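(* Let $A$ be a finite-dimensional $k$-algebra over a field $k$ and let $e\in A$ be an idempotent. (1) If $A$ is a laura algebra, then so is $A/AeA$. (2) If $A$ is a right (resp. left) glued algebra, then so is $A/AeA$. (3) If $A$ is a weakly shod algebra, then so is $A/AeA$. (4) If $A$ is a shod algebra, then so is $A/AeA$.
   Context: Modules are finitely generated right modules; $\operatorname{ind}A$ is the set of isomorphism classes of indecomposable $A$-modules. $\operatorname{pd}_A$ and $\operatorname{id}_A$ denote projective and injective dimension. A path from $M$ to $N$ (with $M,N\in\operatorname{ind}A$) is a sequence $M=X_0\xrightarrow{f_1}X_1\to\cdots\xrightarrow{f_s}X_s=N$ ($s\ge 0$) with all $X_i\in\operatorname{ind}A$ and each $f_i$ a nonzero non-isomorphism; $s$ is its length. Define $$\mathcal{L}_A=\{X\in\operatorname{ind}A\mid \text{for any path from } W \text{ to } X,\ \operatorname{pd}_AW\le 1\},$$ $$\mathcal{R}_A=\{Y\in\operatorname{ind}A\mid \text{for any path from } Y \text{ to } W,\ \operatorname{id}_AW\le 1\}.$$ A subset of $\operatorname{ind}A$ is cofinite if its complement in $\operatorname{ind}A$ is finite. The algebra $A$ is: laura if $\mathcal{L}_A\cup\mathcal{R}_A$ is cofinite in $\operatorname{ind}A$; right glued if $\mathcal{L}_A$ is cofinite in $\operatorname{ind}A$; left glued if $\mathcal{R}_A$ is cofinite in $\operatorname{ind}A$; weakly shod if there is a uniform bound on the lengths of paths from an indecomposable injective module to an indecomposable projective module; shod if every indecomposable $A$-module $M$ satisfies $\operatorname{pd}_AM\le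 1$ or $\operatorname{id}_AM\le 1$. *)

theory Defs
  imports "HOL-Algebra.Module" "HOL-Algebra.QuotRing" "HOL-Algebra.Generated_Groups"
    "HOL-Library.Extended_Nat" "HOL-Library.Nat_Bijection"
begin

section \<open>Finite-dimensional algebras and the quotient by the ideal of an idempotent\<close>

text \<open>
  The locale \<^locale>\<open>algebra\<close> of the library is restricted to commutative algebras.  As there, an
  algebra is a \<^type>\<open>module_scheme\<close> record, whose ring part is now only required to be a ring
  (possibly the zero ring, which does occur as a quotient).
\<close>

locale fd_algebra = K: field K + A: ring A + Module.module K A
  for K :: "('k, 'u) ring_scheme" and A :: "('k, 'a, 'v) module_scheme" +
  assumes smult_mult_left:
      "\<lbrakk>c \<in> carrier K; x \<in> carrier A; y \<in> carrier A\<rbrakk>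
        \<Longrightarrow> (c \<odot>\<^bsub>A\<^esub> x) \<otimes>\<^bsub>A\<^esub> y = c \<odot>\<^bsub>A\<^esub> (x \<otimes>\<^bsub>A\<^esub> y)"
    and smult_mult_right:
      "\<lbrakk>c \<in> carrier K; x \<in> carrier A; y \<in> carrier A\<rbrakk>
        \<Longrightarrow> x \<otimes>\<^bsub>A\<^esub> (c \<odot>\<^bsub>A\<^esub> y) = c \<odot>\<^bsub>A\<^esub> (x \<otimes>\<^bsub>A\<^esub> y)"
    and finite_dim:
      "\<exists>(n::nat) b. b \<in> {..<n} \<rightarrow> carrier A \<and>
        (\<forall>x\<in>carrier A. \<exists>c\<in>{..<n} \<rightarrow> carrier K. x = (\<Oplus>\<^bsub>A\<^esub>i\<in>{..<n}. c i \<odot>\<^bsub>A\<^esub> b i))"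

definition AeA :: "('a, 'v) ring_scheme \<Rightarrow> 'a \<Rightarrow> 'a set" where
  "AeA A e = generate (add_monoid A)
     {a \<otimes>\<^bsub>A\<^esub> e \<otimes>\<^bsub>A\<^esub> b | a b. a \<in> carrier A \<and> b \<in> carrier A}"

text \<open>The quotient ring of the library, with the induced scalar multiplication.\<close>

definition quot_algebra :: "('k, 'a, 'v) module_scheme \<Rightarrow> 'a set \<Rightarrow> ('k, 'a set) module" where
  "quot_algebra A I =
     \<lparr>carrier = carrier (A Quot I), mult = mult (A Quot I), one = one (A Quot I),
      zero = zero (A Quot I), add = add (A Quot I),
      smult = (\<lambda>c X. \<Union>x\<in>X. I +>\<^bsub>A\<^esub> (c \<odot>\<^bsub>A\<^esub> x))\<rparr>"


section \<open>Finitely generated right modules\<close>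

text \<open>The fields \<^const>\<open>mult\<close> and \<^const>\<open>one\<close> inherited from \<^type>\<open>ring\<close> play no role.\<close>

record ('a, 'm) rmodule = "'m ring" +
  ract :: "'m \<Rightarrow> 'a \<Rightarrow> 'm" (infixl \<open>\<triangleleft>\<index>\<close> 70)

locale right_module = A: ring A + M: abelian_group M
  for A :: "('a, 'v) ring_scheme" and M :: "('a, 'm, 'w) rmodule_scheme" +
  assumes ract_closed: "\<lbrakk>x \<in> carrier M; a \<in> carrier A\<rbrakk> \<Longrightarrow> x \<triangleleft>\<^bsub>M\<^esub> a \<in> carrier M"
    and ract_add: "\<lbrakk>x \<in> carrier M; y \<in> carrier M; a \<in> carrier A\<rbrakk>
        \<Longrightarrow> (x \<oplus>\<^bsub>M\<^esub> y) \<triangleleft>\<^bsub>M\<^esub> a = x \<triangleleft>\<^bsub>M\<^esub> a \<oplus>\<^bsub>M\<^esub> y \<triangleleft>\<^bsub>M\<^esub> a"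
    and add_ract: "\<lbrakk>x \<in> carrier M; a \<in> carrier A; b \<in> carrier A\<rbrakk>
        \<Longrightarrow> x \<triangleleft>\<^bsub>M\<^esub> (a \<oplus>\<^bsub>A\<^esub> b) = x \<triangleleft>\<^bsub>M\<^esub> a \<oplus>\<^bsub>M\<^esub> x \<triangleleft>\<^bsub>M\<^esub> b"
    and ract_mult: "\<lbrakk>x \<in> carrier M; a \<in> carrier A; b \<in> carrier A\<rbrakk>
        \<Longrightarrow> x \<triangleleft>\<^bsub>M\<^esub> (a \<otimes>\<^bsub>A\<^esub> b) = (x \<triangleleft>\<^bsub>M\<^esub> a) \<triangleleft>\<^bsub>M\<^esub> b"
    and ract_one: "x \<in> carrier M \<Longrightarrow> x \<triangleleft>\<^bsub>M\<^esub> \<one>\<^bsub>A\<^esub> = x"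

definition fin_gen :: "('a, 'v) ring_scheme \<Rightarrow> ('a, 'm, 'w) rmodule_scheme \<Rightarrow> bool" where
  "fin_gen A M \<longleftrightarrow> (\<exists>(n::nat) x. x \<in> {..<n} \<rightarrow> carrier M \<and>
     (\<forall>m\<in>carrier M. \<exists>a\<in>{..<n} \<rightarrow> carrier A. m = (\<Oplus>\<^bsub>M\<^esub>i\<in>{..<n}. x i \<triangleleft>\<^bsub>M\<^esub> a i)))"

definition rmod_hom ::
    "('a, 'v) ring_scheme \<Rightarrow> ('a, 'm) rmodule \<Rightarrow> ('a, 'n) rmodule \<Rightarrow> ('m \<Rightarrow> 'n) set" where
  "rmod_hom A M N = {f \<in> carrier M \<rightarrow> carrier N.
     (\<forall>x\<in>carrier M. \<forall>y\<in>carrier M. f (x \<oplus>\<^bsub>M\<^esub> y) = f x \<oplus>\<^bsub>N\<^esub> f y) \<and>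
     (\<forall>x\<in>carrier M. \<forall>a\<in>carrier A. f (x \<triangleleft>\<^bsub>M\<^esub> a) = f x \<triangleleft>\<^bsub>N\<^esub> a)}"

definition rmod_iso ::
    "('a, 'v) ring_scheme \<Rightarrow> ('a, 'm) rmodule \<Rightarrow> ('a, 'n) rmodule \<Rightarrow> ('m \<Rightarrow> 'n) set" where
  "rmod_iso A M N = {f \<in> rmod_hom A M N. bij_betw f (carrier M) (carrier N)}"

text \<open>
  The category \<open>mod A\<close>.  HOL cannot quantify over all types of carriers, so the modules are taken with
  carrier in the type \<open>nat \<Rightarrow> 'k\<close>, where \<open>'k\<close> is the type of scalars.  This loses nothing: every finitely
  generated right module over a finite-dimensional algebra is isomorphic to one of these, see
  \<open>fgmod_universal\<close> below.
\<close>

definition fgmod :: "('k, 'a) module \<Rightarrow> ('a, nat \<Rightarrow> 'k) rmodule set" where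
  "fgmod A = {M. right_module A M \<and> fin_gen A M}"

definition submod :: "('a, 'v) ring_scheme \<Rightarrow> 'm set \<Rightarrow> ('a, 'm) rmodule \<Rightarrow> bool" where
  "submod A U M \<longleftrightarrow> additive_subgroup U M \<and> (\<forall>u\<in>U. \<forall>a\<in>carrier A. u \<triangleleft>\<^bsub>M\<^esub> a \<in> U)"

definition indecomposable :: "('a, 'v) ring_scheme \<Rightarrow> ('a, 'm) rmodule \<Rightarrow> bool" where
  "indecomposable A M \<longleftrightarrow> carrier M \<noteq> {\<zero>\<^bsub>M\<^esub>} \<and>
     (\<forall>U V. submod A U M \<and> submod A V M \<and> U <+>\<^bsub>M\<^esub> V = carrier M \<and> U \<inter> V = {\<zero>\<^bsub>M\<^esub>}
        \<longrightarrow> U = {\<zero>\<^bsub>M\<^esub>} \<or> V = {\<zero>\<^bsub>M\<^esub>})"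

text \<open>
  \<open>ind A\<close> collects the modules themselves; passing to isomorphism classes matters only for
  counting and is done in \<open>cofinite_in_ind\<close>.
\<close>

definition ind :: "('k, 'a) module \<Rightarrow> ('a, nat \<Rightarrow> 'k) rmodule set" where
  "ind A = {M \<in> fgmod A. indecomposable A M}"

definition iso_rel :: "('k, 'a) module \<Rightarrow> ('a, nat \<Rightarrow> 'k) rmodule rel" where
  "iso_rel A = {(M, N). M \<in> ind A \<and> N \<in> ind A \<and> rmod_iso A M N \<noteq> {}}"

definition cofinite_in_ind :: "('k, 'a) module \<Rightarrow> ('a, nat \<Rightarrow> 'k) rmodule set \<Rightarrow> bool" where
  "cofinite_in_ind A S \<longleftrightarrow> finite ((ind A - S) // iso_rel A)"


section \<open>Projective and injective dimension\<close>

definition projective :: "('k, 'a) module \<Rightarrow> ('a, nat \<Rightarrow> 'k) rmodule \<Rightarrow> bool" where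
  "projective A P \<longleftrightarrow> P \<in> fgmod A \<and>
     (\<forall>M\<in>fgmod A. \<forall>N\<in>fgmod A. \<forall>g\<in>rmod_hom A M N. \<forall>f\<in>rmod_hom A P N.
        g ` carrier M = carrier N \<longrightarrow> (\<exists>h\<in>rmod_hom A P M. \<forall>x\<in>carrier P. g (h x) = f x))"

definition injective :: "('k, 'a) module \<Rightarrow> ('a, nat \<Rightarrow> 'k) rmodule \<Rightarrow> bool" where
  "injective A I \<longleftrightarrow> I \<in> fgmod A \<and>
     (\<forall>M\<in>fgmod A. \<forall>N\<in>fgmod A. \<forall>g\<in>rmod_hom A M N. \<forall>f\<in>rmod_hom A M I.
        inj_on g (carrier M) \<longrightarrow> (\<exists>h\<in>rmod_hom A N I. \<forall>x\<in>carrier M. h (g x) = f x))"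

text \<open>
  \<open>0 \<rightarrow> P n \<rightarrow> \<dots> \<rightarrow> P 0 \<rightarrow> M \<rightarrow> 0\<close> is exact with all \<open>P i\<close> projective, where \<open>d 0 : P 0 \<rightarrow> M\<close> and
  \<open>d (Suc i) : P (Suc i) \<rightarrow> P i\<close>; values of \<open>P\<close> and \<open>d\<close> beyond \<open>n\<close> are irrelevant.
\<close>

definition projective_resolution ::
    "('k, 'a) module \<Rightarrow> ('a, nat \<Rightarrow> 'k) rmodule \<Rightarrow> nat \<Rightarrow> (nat \<Rightarrow> ('a, nat \<Rightarrow> 'k) rmodule)
       \<Rightarrow> (nat \<Rightarrow> (nat \<Rightarrow> 'k) \<Rightarrow> (nat \<Rightarrow> 'k)) \<Rightarrow> bool" where
  "projective_resolution A M n P d \<longleftrightarrow>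
     (\<forall>i\<le>n. projective A (P i)) \<and>
     d 0 \<in> rmod_hom A (P 0) M \<and> (\<forall>i<n. d (Suc i) \<in> rmod_hom A (P (Suc i)) (P i)) \<and>
     d 0 ` carrier (P 0) = carrier M \<and>
     (\<forall>i<n. d (Suc i) ` carrier (P (Suc i)) = a_kernel (P i) (case i of 0 \<Rightarrow> M | Suc j \<Rightarrow> P j) (d i)) \<and>
     inj_on (d n) (carrier (P n))"

text \<open>
  Dually, \<open>0 \<rightarrow> M \<rightarrow> J 0 \<rightarrow> \<dots> \<rightarrow> J n \<rightarrow> 0\<close> is exact with all \<open>J i\<close> injective, where \<open>d 0 : M \<rightarrow> J 0\<close> and
  \<open>d (Suc i) : J i \<rightarrow> J (Suc i)\<close>.
\<close>

definition injective_resolution ::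
    "('k, 'a) module \<Rightarrow> ('a, nat \<Rightarrow> 'k) rmodule \<Rightarrow> nat \<Rightarrow> (nat \<Rightarrow> ('a, nat \<Rightarrow> 'k) rmodule)
       \<Rightarrow> (nat \<Rightarrow> (nat \<Rightarrow> 'k) \<Rightarrow> (nat \<Rightarrow> 'k)) \<Rightarrow> bool" where
  "injective_resolution A M n J d \<longleftrightarrow>
     (\<forall>i\<le>n. injective A (J i)) \<and>
     d 0 \<in> rmod_hom A M (J 0) \<and> (\<forall>i<n. d (Suc i) \<in> rmod_hom A (J i) (J (Suc i))) \<and>
     inj_on (d 0) (carrier M) \<and>
     (\<forall>i<n. a_kernel (J i) (J (Suc i)) (d (Suc i)) = d i ` carrier (case i of 0 \<Rightarrow> M | Suc j \<Rightarrow> J j)) \<and>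
     d n ` carrier (case n of 0 \<Rightarrow> M | Suc j \<Rightarrow> J j) = carrier (J n)"

text \<open>In \<^typ>\<open>enat\<close> the infimum of the empty set is \<open>\<infinity>\<close>.\<close>

definition pd :: "('k, 'a) module \<Rightarrow> ('a, nat \<Rightarrow> 'k) rmodule \<Rightarrow> enat" where
  "pd A M = Inf {enat n | n. \<exists>P d. projective_resolution A M n P d}"

definition inj_dim :: "('k, 'a) module \<Rightarrow> ('a, nat \<Rightarrow> 'k) rmodule \<Rightarrow> enat" where
  "inj_dim A M = Inf {enat n | n. \<exists>J d. injective_resolution A M n J d}"


section \<open>Paths and the classes of algebras\<close>

definition ind_path ::
    "('k, 'a) module \<Rightarrow> ('a, nat \<Rightarrow> 'k) rmodule \<Rightarrow> ('a, nat \<Rightarrow> 'k) rmodule \<Rightarrow> nat \<Rightarrow> bool" where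
  "ind_path A M N s \<longleftrightarrow> (\<exists>X f. X 0 = M \<and> X s = N \<and> (\<forall>i\<le>s. X i \<in> ind A) \<and>
     (\<forall>i<s. f i \<in> rmod_hom A (X i) (X (Suc i)) \<and>
        (\<exists>x\<in>carrier (X i). f i x \<noteq> \<zero>\<^bsub>X (Suc i)\<^esub>) \<and> f i \<notin> rmod_iso A (X i) (X (Suc i))))"

definition L_part :: "('k, 'a) module \<Rightarrow> ('a, nat \<Rightarrow> 'k) rmodule set" where
  "L_part A = {X \<in> ind A. \<forall>W s. ind_path A W X s \<longrightarrow> pd A W \<le> 1}"

definition R_part :: "('k, 'a) module \<Rightarrow> ('a, nat \<Rightarrow> 'k) rmodule set" where
  "R_part A = {Y \<in> ind A. \<forall>W s. ind_path A Y W s \<longrightarrow> inj_dim A W \<le> 1}"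

definition laura :: "('k, 'a) module \<Rightarrow> bool" where
  "laura A \<longleftrightarrow> cofinite_in_ind A (L_part A \<union> R_part A)"

definition right_glued :: "('k, 'a) module \<Rightarrow> bool" where
  "right_glued A \<longleftrightarrow> cofinite_in_ind A (L_part A)"

definition left_glued :: "('k, 'a) module \<Rightarrow> bool" where
  "left_glued A \<longleftrightarrow> cofinite_in_ind A (R_part A)"

definition weakly_shod :: "('k, 'a) module \<Rightarrow> bool" where
  "weakly_shod A \<longleftrightarrow> (\<exists>b::nat. \<forall>I\<in>ind A. \<forall>P\<in>ind A. \<forall>s.
     injective A I \<and> projective A P \<and> ind_path A I P s \<longrightarrow> s \<le> b)"

definition shod :: "('k, 'a) module \<Rightarrow> bool" where
  "shod A \<longleftrightarrow> (\<forall>M\<in>ind A. pd A M \<le> 1 \<or> inj_dim A M \<le> 1)"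


section \<open>The encoding is adequate\<close>

lemma (in ring) AeA_ideal:
  assumes e: "e \<in> carrier R"
  shows "ideal (AeA R e) R"
proof -
  let ?H = "{a \<otimes> e \<otimes> b | a b. a \<in> carrier R \<and> b \<in> carrier R}"
  have H: "?H \<subseteq> carrier (add_monoid R)" using e by auto
  have sg: "subgroup (AeA R e) (add_monoid R)"
    unfolding AeA_def by (rule add.generate_is_subgroup[OF H[simplified]])
  interpret additive_subgroup "AeA R e" R by (rule additive_subgroup.intro[OF sg])
  have gen: "h \<in> AeA R e" if "h \<in> ?H" for h
    unfolding AeA_def using that by (rule generate.incl)
  have hl: "x \<otimes> h \<in> ?H" if x: "x \<in> carrier R" and h: "h \<in> ?H" for x h
  proof -
    from h obtain a b where ab: "h = a \<otimes> e \<otimes> b" "a \<in> carrier R" "b \<in> carrier R" by blast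
    then have "x \<otimes> h = (x \<otimes> a) \<otimes> e \<otimes> b" using x e by (simp add: m_assoc)
    then show ?thesis using x ab by blast
  qed
  have hr: "h \<otimes> x \<in> ?H" if x: "x \<in> carrier R" and h: "h \<in> ?H" for x h
  proof -
    from h obtain a b where ab: "h = a \<otimes> e \<otimes> b" "a \<in> carrier R" "b \<in> carrier R" by blast
    then have "h \<otimes> x = a \<otimes> e \<otimes> (b \<otimes> x)" using x e by (simp add: m_assoc)
    then show ?thesis using x ab by blast
  qed
  have "x \<otimes> z \<in> AeA R e \<and> z \<otimes> x \<in> AeA R e"
    if z: "z \<in> AeA R e" and x: "x \<in> carrier R" for z x
    using z[unfolded AeA_def]
  proof (induction rule: generate.induct)
    case one
    have o: "\<one>\<^bsub>add_monoid R\<^esub> = \<zero>" by simp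
    show ?case unfolding o by (simp only: r_null[OF x] l_null[OF x] zero_closed simp_thms)
  next
    case (incl h)
    show ?case by (rule conjI[OF gen[OF hl[OF x incl]] gen[OF hr[OF x incl]]])
  next
    case (inv h)
    then have h: "h \<in> carrier R" using H by auto
    have i: "inv\<^bsub>add_monoid R\<^esub> h = \<ominus> h" by (simp add: a_inv_def)
    have "\<ominus> (x \<otimes> h) \<in> AeA R e" by (rule a_inv_closed[OF gen[OF hl[OF x inv]]])
    moreover have "\<ominus> (h \<otimes> x) \<in> AeA R e" by (rule a_inv_closed[OF gen[OF hr[OF x inv]]])
    ultimately show ?case unfolding i by (simp only: r_minus[OF x h] l_minus[OF h x] simp_thms)
  next
    case (eng h1 h2)
    have "h1 \<in> carrier R" "h2 \<in> carrier R"
      using eng(1,2) a_subset unfolding AeA_def by auto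
    then show ?case using eng(3,4) x a_closed by (simp add: r_distr l_distr)
  qed
  then show ?thesis
    by unfold_locales auto
qed

lemma (in ring) AeA_eq_genideal:
  assumes e: "e \<in> carrier R"
  shows "AeA R e = Idl {e}"
proof
  interpret I: ideal "Idl {e}" R using e by (intro genideal_ideal) auto
  have eI: "e \<in> Idl {e}" using e by (intro genideal_self')
  show "AeA R e \<subseteq> Idl {e}" unfolding AeA_def
    by (rule add.generate_subgroup_incl[OF _ I.a_subgroup])
      (use eI in \<open>auto intro: I.I_l_closed I.I_r_closed\<close>)
  have "\<one> \<otimes> e \<otimes> \<one> \<in> AeA R e" unfolding AeA_def by (rule generate.incl) blast
  then show "Idl {e} \<subseteq> AeA R e"
    using e by (intro genideal_minimal AeA_ideal) auto
qed

lemma quot_algebra_simps [simp]: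
  "carrier (quot_algebra A I) = carrier (A Quot I)"
  "mult (quot_algebra A I) = mult (A Quot I)"
  "one (quot_algebra A I) = one (A Quot I)"
  "zero (quot_algebra A I) = zero (A Quot I)"
  "add (quot_algebra A I) = add (A Quot I)"
  by (simp_all add: quot_algebra_def)

lemma ring_cong:
  assumes eqs: "carrier R = carrier S" "mult R = mult S" "one R = one S" "zero R = zero S"
    "add R = add S" and R: "ring R"
  shows "ring S"
proof -
  interpret R: ring R by (rule R)
  note eqs' = eqs[symmetric]
  show ?thesis
  proof (rule ringI)
    show "abelian_group S"
    proof (rule abelian_groupI)
      fix x assume "x \<in> carrier S"
      then have "x \<in> carrier R" by (simp add: eqs')
      then have "\<ominus>\<^bsub>R\<^esub> x \<in> carrier R" "\<ominus>\<^bsub>R\<^esub> x \<oplus>\<^bsub>R\<^esub> x = \<zero>\<^bsub>R\<^esub>"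
        by (auto simp: R.l_neg)
      then show "\<exists>y\<in>carrier S. y \<oplus>\<^bsub>S\<^esub> x = \<zero>\<^bsub>S\<^esub>" unfolding eqs' by blast
    qed (simp_all add: eqs' R.a_ac)
    show "Group.monoid S"
      by (rule monoidI) (simp_all add: eqs' R.m_assoc)
  qed (simp_all add: eqs' R.l_distr R.r_distr)
qed

context fd_algebra
begin

lemma smult_ideal:
  assumes "ideal I A" "c \<in> carrier K" "x \<in> I"
  shows "c \<odot>\<^bsub>A\<^esub> x \<in> I"
proof -
  interpret I: ideal I A by fact
  have x: "x \<in> carrier A" using assms by auto
  have "c \<odot>\<^bsub>A\<^esub> x = (c \<odot>\<^bsub>A\<^esub> \<one>\<^bsub>A\<^esub>) \<otimes>\<^bsub>A\<^esub> x"
    using assms x by (simp add: smult_mult_left)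
  then show ?thesis using assms by (simp add: I.I_l_closed)
qed

lemma quot_smult:
  assumes I: "ideal I A" and c: "c \<in> carrier K" and x: "x \<in> carrier A"
  shows "c \<odot>\<^bsub>quot_algebra A I\<^esub> (I +>\<^bsub>A\<^esub> x) = I +>\<^bsub>A\<^esub> (c \<odot>\<^bsub>A\<^esub> x)"
proof -
  interpret I: ideal I A by fact
  have const: "I +>\<^bsub>A\<^esub> (c \<odot>\<^bsub>A\<^esub> y) = I +>\<^bsub>A\<^esub> (c \<odot>\<^bsub>A\<^esub> x)" if y: "y \<in> I +>\<^bsub>A\<^esub> x" for y
  proof -
    from y obtain h where h: "h \<in> I" "y = h \<oplus>\<^bsub>A\<^esub> x" by (auto simp: a_r_coset_def r_coset_def)
    have "c \<odot>\<^bsub>A\<^esub> y = c \<odot>\<^bsub>A\<^esub> h \<oplus>\<^bsub>A\<^esub> c \<odot>\<^bsub>A\<^esub> x"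
      using h x c by (simp add: smult_r_distr)
    then have "c \<odot>\<^bsub>A\<^esub> y \<in> I +>\<^bsub>A\<^esub> (c \<odot>\<^bsub>A\<^esub> x)"
      using smult_ideal[OF I c h(1)] by (auto simp: a_r_coset_def r_coset_def)
    then show ?thesis using c x by (simp add: I.a_repr_independence')
  qed
  have ne: "I +>\<^bsub>A\<^esub> x \<noteq> {}" using I.a_rcos_self[OF x] by blast
  have "c \<odot>\<^bsub>quot_algebra A I\<^esub> (I +>\<^bsub>A\<^esub> x) = (\<Union>y\<in>I +>\<^bsub>A\<^esub> x. I +>\<^bsub>A\<^esub> (c \<odot>\<^bsub>A\<^esub> y))"
    by (simp add: quot_algebra_def)
  also have "\<dots> = (\<Union>y\<in>I +>\<^bsub>A\<^esub> x. I +>\<^bsub>A\<^esub> (c \<odot>\<^bsub>A\<^esub> x))"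
    by (rule SUP_cong[OF refl const])
  also have "\<dots> = I +>\<^bsub>A\<^esub> (c \<odot>\<^bsub>A\<^esub> x)" using ne by (simp only: UN_constant if_False)
  finally show ?thesis .
qed

lemma quot_fd_algebra:
  assumes I: "ideal I A"
  shows "fd_algebra K (quot_algebra A I)"
proof -
  interpret I: ideal I A by fact
  let ?Q = "quot_algebra A I"
  have Q: "ring ?Q" by (rule ring_cong[OF _ _ _ _ _ I.quotient_is_ring]) simp_all
  interpret Q: ring ?Q by (rule Q)
  have carr: "carrier ?Q = (\<lambda>x. I +>\<^bsub>A\<^esub> x) ` carrier A"
    by (auto simp: FactRing_def A_RCOSETS_def' )
  have add: "(I +>\<^bsub>A\<^esub> x) \<oplus>\<^bsub>?Q\<^esub> (I +>\<^bsub>A\<^esub> y) = I +>\<^bsub>A\<^esub> (x \<oplus>\<^bsub>A\<^esub> y)"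
    if "x \<in> carrier A" "y \<in> carrier A" for x y
    using that by (simp add: FactRing_def I.a_rcos_sum)
  have mult: "(I +>\<^bsub>A\<^esub> x) \<otimes>\<^bsub>?Q\<^esub> (I +>\<^bsub>A\<^esub> y) = I +>\<^bsub>A\<^esub> (x \<otimes>\<^bsub>A\<^esub> y)"
    if "x \<in> carrier A" "y \<in> carrier A" for x y
    using that by (simp add: FactRing_def I.rcoset_mult_add)
  note sm = quot_smult[OF I]
  have modl: "Module.module K ?Q"
    by (rule Module.moduleI[OF K.is_cring Q.is_abelian_group])
      (auto simp: carr sm add smult_l_distr smult_r_distr smult_assoc1 simp del: quot_algebra_simps)
  have fsum: "(\<Oplus>\<^bsub>?Q\<^esub>i\<in>{..<n}. I +>\<^bsub>A\<^esub> f i) = I +>\<^bsub>A\<^esub> (\<Oplus>\<^bsub>A\<^esub>i\<in>{..<n}. f i)"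
    if "f \<in> {..<n} \<rightarrow> carrier A" for f and n :: nat
    using that
  proof (induction n)
    case 0
    then show ?case by (simp add: FactRing_def A.a_coset_add_zero[OF I.a_subset])
  next
    case (Suc n)
    have f: "f \<in> {..<n} \<rightarrow> carrier A" "f n \<in> carrier A" using Suc.prems by auto
    have g: "(\<lambda>i. I +>\<^bsub>A\<^esub> f i) \<in> {..<n} \<rightarrow> carrier ?Q" "I +>\<^bsub>A\<^esub> f n \<in> carrier ?Q"
      unfolding carr using f by auto
    show ?case using f g Suc.IH[OF f(1)]
      by (simp add: lessThan_Suc A.finsum_closed add del: quot_algebra_simps)
  qed
  obtain n :: nat and b where b: "b \<in> {..<n} \<rightarrow> carrier A"
    and sp: "\<And>x. x \<in> carrier A \<Longrightarrow> \<exists>c\<in>{..<n} \<rightarrow> carrier K. x = (\<Oplus>\<^bsub>A\<^esub>i\<in>{..<n}. c i \<odot>\<^bsub>A\<^esub> b i)"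
    using finite_dim by auto
  have fin: "\<exists>c\<in>{..<n} \<rightarrow> carrier K. X = (\<Oplus>\<^bsub>?Q\<^esub>i\<in>{..<n}. c i \<odot>\<^bsub>?Q\<^esub> (I +>\<^bsub>A\<^esub> b i))"
    if "X \<in> carrier ?Q" for X
  proof -
    from that obtain x where x: "x \<in> carrier A" "X = I +>\<^bsub>A\<^esub> x" unfolding carr by auto
    obtain c where c: "c \<in> {..<n} \<rightarrow> carrier K" "x = (\<Oplus>\<^bsub>A\<^esub>i\<in>{..<n}. c i \<odot>\<^bsub>A\<^esub> b i)"
      using sp[OF x(1)] by auto
    have "(\<Oplus>\<^bsub>?Q\<^esub>i\<in>{..<n}. c i \<odot>\<^bsub>?Q\<^esub> (I +>\<^bsub>A\<^esub> b i)) = (\<Oplus>\<^bsub>?Q\<^esub>i\<in>{..<n}. I +>\<^bsub>A\<^esub> (c i \<odot>\<^bsub>A\<^esub> b i))"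
      by (rule Q.finsum_cong')
        (use b c in \<open>auto simp: carr sm Pi_iff simp del: quot_algebra_simps\<close>)
    also have "\<dots> = X" using b c x by (subst fsum) (auto simp: Pi_iff)
    finally show ?thesis using c by auto
  qed
  have b': "(\<lambda>i. I +>\<^bsub>A\<^esub> b i) \<in> {..<n} \<rightarrow> carrier ?Q" unfolding carr using b by auto
  show ?thesis
  proof (intro fd_algebra.intro fd_algebra_axioms.intro)
    show "field K" by (rule K.field_axioms)
    show "ring ?Q" by fact
    show "Module.module K ?Q" by fact
    show "\<exists>(n::nat) b. b \<in> {..<n} \<rightarrow> carrier ?Q \<and> (\<forall>x\<in>carrier ?Q. \<exists>c\<in>{..<n} \<rightarrow> carrier K.
        x = (\<Oplus>\<^bsub>?Q\<^esub>i\<in>{..<n}. c i \<odot>\<^bsub>?Q\<^esub> b i))"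
      using b' fin by blast
  qed (auto simp: carr sm mult smult_mult_left smult_mult_right simp del: quot_algebra_simps)
qed

corollary AeA_quot_fd_algebra:
  assumes "e \<in> carrier A"
  shows "fd_algebra K (quot_algebra A (AeA A e))"
  using assms by (intro quot_fd_algebra A.AeA_ideal)

end

lemma transport_rmodule:
  fixes A :: "('k, 'a) module" and M :: "('a, 'm) rmodule" and g :: "'m \<Rightarrow> (nat \<Rightarrow> 'k)"
  assumes M: "right_module A M" "fin_gen A M" and g: "inj_on g (carrier M)"
  shows "\<exists>N\<in>fgmod A. rmod_iso A M N \<noteq> {}"
proof -
  interpret M: right_module A M by fact
  define h where "h = inv_into (carrier M) g"
  have hg: "h (g x) = x" if "x \<in> carrier M" for x using that g by (simp add: h_def)
  define N :: "('a, nat \<Rightarrow> 'k) rmodule" where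
    "N = \<lparr>carrier = g ` carrier M, mult = undefined, one = undefined, zero = g \<zero>\<^bsub>M\<^esub>,
          add = (\<lambda>x y. g (h x \<oplus>\<^bsub>M\<^esub> h y)), ract = (\<lambda>x a. g (h x \<triangleleft>\<^bsub>M\<^esub> a))\<rparr>"
  have N [simp]: "carrier N = g ` carrier M" "\<zero>\<^bsub>N\<^esub> = g \<zero>\<^bsub>M\<^esub>"
    "x \<oplus>\<^bsub>N\<^esub> y = g (h x \<oplus>\<^bsub>M\<^esub> h y)" "x \<triangleleft>\<^bsub>N\<^esub> a = g (h x \<triangleleft>\<^bsub>M\<^esub> a)" for x y a
    by (simp_all add: N_def)
  have abN: "abelian_group N"
  proof (rule abelian_groupI)
    fix x assume "x \<in> carrier N"
    then obtain m where m: "m \<in> carrier M" "x = g m" by auto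
    then show "\<exists>y\<in>carrier N. y \<oplus>\<^bsub>N\<^esub> x = \<zero>\<^bsub>N\<^esub>"
      by (intro bexI[of _ "g (\<ominus>\<^bsub>M\<^esub> m)"]) (auto simp: hg M.M.l_neg)
  qed (auto simp: hg M.M.a_ac)
  interpret N: abelian_group N by (rule abN)
  have rm: "right_module A N"
    by unfold_locales
      (auto simp: hg M.ract_closed M.ract_add M.add_ract M.ract_mult M.ract_one)
  have fsum: "(\<Oplus>\<^bsub>N\<^esub>i\<in>{..<n}. g (f i)) = g (\<Oplus>\<^bsub>M\<^esub>i\<in>{..<n}. f i)"
    if "f \<in> {..<n} \<rightarrow> carrier M" for f and n :: nat
    using that
  proof (induction n)
    case (Suc n)
    have f: "f \<in> {..<n} \<rightarrow> carrier M" "f n \<in> carrier M" using Suc.prems by auto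
    have g: "(\<lambda>i. g (f i)) \<in> {..<n} \<rightarrow> carrier N" using f by auto
    show ?case using f g Suc.IH[OF f(1)]
      by (simp add: lessThan_Suc hg M.M.finsum_closed)
  qed simp
  obtain n :: nat and x where x: "x \<in> {..<n} \<rightarrow> carrier M"
    and sp: "\<And>m. m \<in> carrier M \<Longrightarrow> \<exists>a\<in>{..<n} \<rightarrow> carrier A. m = (\<Oplus>\<^bsub>M\<^esub>i\<in>{..<n}. x i \<triangleleft>\<^bsub>M\<^esub> a i)"
    using M(2) unfolding fin_gen_def by auto
  have "fin_gen A N" unfolding fin_gen_def
  proof (intro exI conjI ballI)
    show "(\<lambda>i. g (x i)) \<in> {..<n} \<rightarrow> carrier N" using x by auto
    fix y assume "y \<in> carrier N"
    then obtain m where m: "m \<in> carrier M" "y = g m" by auto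
    obtain a where a: "a \<in> {..<n} \<rightarrow> carrier A" "m = (\<Oplus>\<^bsub>M\<^esub>i\<in>{..<n}. x i \<triangleleft>\<^bsub>M\<^esub> a i)"
      using sp[OF m(1)] by auto
    have xa: "(\<lambda>i. x i \<triangleleft>\<^bsub>M\<^esub> a i) \<in> {..<n} \<rightarrow> carrier M" using x a M.ract_closed by (auto simp: Pi_iff)
    have "(\<Oplus>\<^bsub>N\<^esub>i\<in>{..<n}. g (x i) \<triangleleft>\<^bsub>N\<^esub> a i) = (\<Oplus>\<^bsub>N\<^esub>i\<in>{..<n}. g (x i \<triangleleft>\<^bsub>M\<^esub> a i))"
      by (rule N.finsum_cong') (use x xa in \<open>auto simp: hg Pi_iff\<close>)
    also have "\<dots> = y" using fsum[OF xa] a m by simp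
    finally show "\<exists>a\<in>{..<n} \<rightarrow> carrier A. y = (\<Oplus>\<^bsub>N\<^esub>i\<in>{..<n}. g (x i) \<triangleleft>\<^bsub>N\<^esub> a i)"
      using a by blast
  qed
  moreover have "g \<in> rmod_iso A M N"
    using g by (auto simp: rmod_iso_def rmod_hom_def bij_betw_def hg)
  ultimately show ?thesis using rm unfolding fgmod_def by blast
qed

theorem fgmod_universal:
  fixes A :: "('k, 'a) module" and M :: "('a, 'm) rmodule"
  assumes A: "fd_algebra K A" and M: "right_module A M" "fin_gen A M"
  shows "\<exists>N\<in>fgmod A. rmod_iso A M N \<noteq> {}"
proof -
  interpret fd_algebra K A by fact
  interpret M: right_module A M by fact
  obtain n :: nat and x where x: "x \<in> {..<n} \<rightarrow> carrier M"
    and spM: "\<forall>m\<in>carrier M. \<exists>a. a \<in> {..<n} \<rightarrow> carrier A \<and> m = (\<Oplus>\<^bsub>M\<^esub>i\<in>{..<n}. x i \<triangleleft>\<^bsub>M\<^esub> a i)"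
    using M(2) unfolding fin_gen_def Bex_def by blast
  obtain r :: nat and b where b: "b \<in> {..<r} \<rightarrow> carrier A"
    and spA: "\<forall>y\<in>carrier A. \<exists>c. c \<in> {..<r} \<rightarrow> carrier K \<and> y = (\<Oplus>\<^bsub>A\<^esub>i\<in>{..<r}. c i \<odot>\<^bsub>A\<^esub> b i)"
    using finite_dim unfolding Bex_def by blast
  obtain \<alpha> where \<alpha>: "\<And>m. m \<in> carrier M \<Longrightarrow> \<alpha> m \<in> {..<n} \<rightarrow> carrier A"
    "\<And>m. m \<in> carrier M \<Longrightarrow> m = (\<Oplus>\<^bsub>M\<^esub>i\<in>{..<n}. x i \<triangleleft>\<^bsub>M\<^esub> \<alpha> m i)"
    using bchoice[OF spM] by blast
  obtain \<gamma> where \<gamma>: "\<And>y. y \<in> carrier A \<Longrightarrow> \<gamma> y \<in> {..<r} \<rightarrow> carrier K"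
    "\<And>y. y \<in> carrier A \<Longrightarrow> y = (\<Oplus>\<^bsub>A\<^esub>i\<in>{..<r}. \<gamma> y i \<odot>\<^bsub>A\<^esub> b i)"
    using bchoice[OF spA] by blast
  define g where "g m = (\<lambda>k. \<gamma> (\<alpha> m (fst (prod_decode k))) (snd (prod_decode k)))" for m
  have "inj_on g (carrier M)"
  proof (rule inj_onI)
    fix m m' assume m: "m \<in> carrier M" "m' \<in> carrier M" and eq: "g m = g m'"
    have \<gamma>\<alpha>: "\<gamma> (\<alpha> m i) = \<gamma> (\<alpha> m' i)" for i
    proof
      fix j show "\<gamma> (\<alpha> m i) j = \<gamma> (\<alpha> m' i) j"
        using fun_cong[OF eq, of "prod_encode (i, j)"] by (simp add: g_def)
    qed
    have \<alpha>eq: "\<alpha> m i = \<alpha> m' i" if i: "i < n" for i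
    proof -
      have c: "\<alpha> m i \<in> carrier A" "\<alpha> m' i \<in> carrier A" using \<alpha>(1) m i by blast+
      have "\<alpha> m i = (\<Oplus>\<^bsub>A\<^esub>j\<in>{..<r}. \<gamma> (\<alpha> m i) j \<odot>\<^bsub>A\<^esub> b j)" by (rule \<gamma>(2)[OF c(1)])
      also have "\<dots> = (\<Oplus>\<^bsub>A\<^esub>j\<in>{..<r}. \<gamma> (\<alpha> m' i) j \<odot>\<^bsub>A\<^esub> b j)" by (simp only: \<gamma>\<alpha>)
      also have "\<dots> = \<alpha> m' i" by (rule \<gamma>(2)[OF c(2), symmetric])
      finally show ?thesis .
    qed
    have "(\<Oplus>\<^bsub>M\<^esub>i\<in>{..<n}. x i \<triangleleft>\<^bsub>M\<^esub> \<alpha> m i) = (\<Oplus>\<^bsub>M\<^esub>i\<in>{..<n}. x i \<triangleleft>\<^bsub>M\<^esub> \<alpha> m' i)"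
      using \<alpha>(1)[OF m(2)] x
      by (intro M.M.finsum_cong') (auto simp: \<alpha>eq Pi_iff intro!: M.ract_closed)
    then show "m = m'" by (rule trans[OF \<alpha>(2)[OF m(1)] trans[OF _ \<alpha>(2)[OF m(2), symmetric]]])
  qed
  then show ?thesis by (rule transport_rmodule[OF M])
qed

end

theory Submission
  imports Defs
begin

text \<open>
  Write \<open>I = AeA\<close> and \<open>B = A/I\<close>.  The \<open>B\<close>-modules are the \<open>A\<close>-modules that \<open>I\<close> annihilates, and
  homomorphisms, isomorphisms and direct decompositions of such modules are the same over both algebras.
  Hence \<open>ind B\<close> is a part of \<open>ind A\<close>, and a path in \<open>ind B\<close> is a path in \<open>ind A\<close>.

  The idempotency of \<open>e\<close> enters through \<open>I = I I\<close>.  Let \<open>0 \<rightarrow> P1 \<rightarrow> P0 \<rightarrow> X \<rightarrow> 0\<close> be a projective resolution over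
  \<open>A\<close> of a module with \<open>X I = 0\<close>.  Then \<open>P0 I \<subseteq> P1\<close>, so \<open>P0 I = P0 I I \<subseteq> P1 I\<close>, and therefore
  \<open>0 \<rightarrow> P1/P1 I \<rightarrow> P0/P0 I \<rightarrow> X \<rightarrow> 0\<close> is still exact; it is a projective resolution over \<open>B\<close>.  Dually, the
  submodules annihilated by \<open>I\<close> turn an injective resolution of length one over \<open>A\<close> into one over \<open>B\<close>.  So
  dimensions at most one descend (\<open>pd1_descends\<close>, \<open>id1_descends\<close>), and a module of \<open>ind B\<close> that lies in the left
  or right part of \<open>A\<close> lies in the left or right part of \<open>B\<close>.  This settles the laura, glued and shod cases.

  For weakly shod algebras this is not enough, because injective or projective \<open>B\<close>-modules need not be
  injective or projective over \<open>A\<close>.  Two facts about modules over a finite-dimensional algebra help.  First, an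
  indecomposable module outside the left part is reached by a path from an indecomposable injective module
  (\<open>not_left_path_from_injective\<close>).  Secondly, a path from an injective module to a module in the left part has
  fewer than \<open>n\<close> arrows, where \<open>n\<close> bounds the rank of the Grothendieck group (\<open>left_part_path_bound\<close>).  Both have
  duals.  Take a path \<open>X 0 \<rightarrow> \<dots> \<rightarrow> X s\<close> in \<open>ind B\<close> from an injective to a projective module, with \<open>2 n \<le> s\<close>.  By
  the second fact for \<open>B\<close>, \<open>X n\<close> is not in the left part of \<open>B\<close>, hence not in that of \<open>A\<close>, and by the first fact
  for \<open>A\<close> it is reached from an injective \<open>A\<close>-module.  Dually a projective \<open>A\<close>-module is reached from
  \<open>X (s - n)\<close>.  If \<open>b\<close> bounds the paths over \<open>A\<close>, then \<open>s - 2 n \<le> b\<close>, so \<open>2 n + b\<close> is a bound for \<open>B\<close>.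

  To prove the second fact, call a module torsion free if every indecomposable module with a nonzero map to it
  is in the left part, and call \<open>E\<close> Ext-injective if \<open>Ext (Z, E) = 0\<close> for all torsion free \<open>Z\<close>.  Torsion free
  modules have projective dimension at most one, so quotients of Ext-injective modules are Ext-injective.  One
  finds that Ext-injectivity propagates along a path in the left part and that composites of its maps do not
  vanish (\<open>ext_inj_successor\<close>).  Then there are no nonzero maps backwards along the path, and since the
  extension groups vanish, the Euler form has a triangular matrix with nonzero diagonal on the modules of the
  path (\<open>path_bound\<close>).  Their classes in the Grothendieck group are therefore linearly independent.

  Both facts are proved in an axiomatically given category with a length function and with dimensions of its
  spaces of morphisms.  The axioms are self-dual, which yields the dual facts at no cost.
\<close>


section \<open>Preadditive categories\<close>

text \<open>
  Only the additive structure is axiomatised here; kernels and cokernels come with image factorisations in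
  \<open>length_abelian_cat\<close> below.  Associativity and distributivity carry no typing conditions, so that they are
  unrestricted rewrite rules.  A model can achieve this with an undefined arrow as the result of every
  ill-typed operation.
\<close>

locale preadditive_cat =
  fixes Ob :: "'o set" and arr :: "'m \<Rightarrow> bool" and dom cod :: "'m \<Rightarrow> 'o"
    and comp :: "'m \<Rightarrow> 'm \<Rightarrow> 'm" (infixl \<open>\<cdot>\<close> 70)
    and add :: "'m \<Rightarrow> 'm \<Rightarrow> 'm" (infixl \<open>\<^bold>+\<close> 65)
    and neg :: "'m \<Rightarrow> 'm" (\<open>\<^bold>-\<close>)
    and zr :: "'o \<Rightarrow> 'o \<Rightarrow> 'm" and idn :: "'o \<Rightarrow> 'm"
  assumes dom_Ob [simp]: "arr f \<Longrightarrow> dom f \<in> Ob" and cod_Ob [simp]: "arr f \<Longrightarrow> cod f \<in> Ob"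
    and comp_arr [simp]: "arr f \<Longrightarrow> arr g \<Longrightarrow> cod f = dom g \<Longrightarrow> arr (g \<cdot> f)"
    and comp_dom [simp]: "arr f \<Longrightarrow> arr g \<Longrightarrow> cod f = dom g \<Longrightarrow> dom (g \<cdot> f) = dom f"
    and comp_cod [simp]: "arr f \<Longrightarrow> arr g \<Longrightarrow> cod f = dom g \<Longrightarrow> cod (g \<cdot> f) = cod g"
    and comp_assoc: "h \<cdot> g \<cdot> f = h \<cdot> (g \<cdot> f)"
    and idn_arr [simp]: "X \<in> Ob \<Longrightarrow> arr (idn X)"
    and idn_dom [simp]: "X \<in> Ob \<Longrightarrow> dom (idn X) = X" and idn_cod [simp]: "X \<in> Ob \<Longrightarrow> cod (idn X) = X"
    and idn_left: "arr f \<Longrightarrow> cod f = X \<Longrightarrow> idn X \<cdot> f = f"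
    and idn_right: "arr f \<Longrightarrow> dom f = X \<Longrightarrow> f \<cdot> idn X = f"
    and add_arr [simp]: "arr f \<Longrightarrow> arr g \<Longrightarrow> dom f = dom g \<Longrightarrow> cod f = cod g \<Longrightarrow> arr (f \<^bold>+ g)"
    and add_dom [simp]: "arr f \<Longrightarrow> arr g \<Longrightarrow> dom f = dom g \<Longrightarrow> cod f = cod g \<Longrightarrow> dom (f \<^bold>+ g) = dom f"
    and add_cod [simp]: "arr f \<Longrightarrow> arr g \<Longrightarrow> dom f = dom g \<Longrightarrow> cod f = cod g \<Longrightarrow> cod (f \<^bold>+ g) = cod f"
    and add_assoc: "f \<^bold>+ g \<^bold>+ h = f \<^bold>+ (g \<^bold>+ h)" and add_comm: "f \<^bold>+ g = g \<^bold>+ f"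
    and distl: "h \<cdot> (f \<^bold>+ g) = h \<cdot> f \<^bold>+ h \<cdot> g" and distr: "(f \<^bold>+ g) \<cdot> h = f \<cdot> h \<^bold>+ g \<cdot> h"
    and zr_arr [simp]: "X \<in> Ob \<Longrightarrow> Y \<in> Ob \<Longrightarrow> arr (zr X Y)"
    and zr_dom [simp]: "X \<in> Ob \<Longrightarrow> Y \<in> Ob \<Longrightarrow> dom (zr X Y) = X"
    and zr_cod [simp]: "X \<in> Ob \<Longrightarrow> Y \<in> Ob \<Longrightarrow> cod (zr X Y) = Y"
    and add_zr: "arr f \<Longrightarrow> dom f = X \<Longrightarrow> cod f = Y \<Longrightarrow> f \<^bold>+ zr X Y = f"
    and neg_arr [simp]: "arr f \<Longrightarrow> arr (\<^bold>- f)"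
    and neg_dom [simp]: "arr f \<Longrightarrow> dom (\<^bold>- f) = dom f" and neg_cod [simp]: "arr f \<Longrightarrow> cod (\<^bold>- f) = cod f"
    and add_neg: "arr f \<Longrightarrow> f \<^bold>+ \<^bold>- f = zr (dom f) (cod f)"
begin

definition hom :: "'o \<Rightarrow> 'o \<Rightarrow> 'm set" where
  "hom X Y = {f. arr f \<and> dom f = X \<and> cod f = Y}"

lemma mem_hom [simp]: "f \<in> hom X Y \<longleftrightarrow> arr f \<and> dom f = X \<and> cod f = Y"
  by (simp add: hom_def)

text \<open>
  An equation that holds at the head of a composite applies inside a right-nested one in this form.
\<close>

lemma reassoc: "a \<cdot> b = c \<Longrightarrow> a \<cdot> (b \<cdot> x) = c \<cdot> x"
  by (simp add: comp_assoc[symmetric])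

lemma zr_add: "arr f \<Longrightarrow> dom f = X \<Longrightarrow> cod f = Y \<Longrightarrow> zr X Y \<^bold>+ f = f"
  using add_zr[of f X Y] add_comm by simp

lemma add_lcomm: "f \<^bold>+ (g \<^bold>+ h) = g \<^bold>+ (f \<^bold>+ h)"
  by (metis add_assoc add_comm)

lemma neg_add: "arr f \<Longrightarrow> \<^bold>- f \<^bold>+ f = zr (dom f) (cod f)"
  using add_neg add_comm by simp

lemma add_cancel:
  assumes "arr f" "arr g" "arr h" "dom g = dom f" "cod g = cod f" "dom h = dom f" "cod h = cod f"
  shows "f \<^bold>+ g = f \<^bold>+ h \<longleftrightarrow> g = h"
proof
  assume "f \<^bold>+ g = f \<^bold>+ h"
  then have "\<^bold>- f \<^bold>+ f \<^bold>+ g = \<^bold>- f \<^bold>+ f \<^bold>+ h" by (simp add: add_assoc)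
  then show "g = h" using assms by (simp add: neg_add zr_add)
qed simp

lemma add_self_zr:
  assumes "arr f" "f \<^bold>+ f = f" shows "f = zr (dom f) (cod f)"
  using add_cancel[of f f "zr (dom f) (cod f)"] assms by (simp add: add_zr)

lemma zr_comp [simp]:
  assumes "arr f" "cod f = X" "Y \<in> Ob" shows "zr X Y \<cdot> f = zr (dom f) Y"
proof -
  have X: "X \<in> Ob" using assms by auto
  have "zr X Y \<cdot> f \<^bold>+ zr X Y \<cdot> f = (zr X Y \<^bold>+ zr X Y) \<cdot> f" by (simp add: distr)
  also have "\<dots> = zr X Y \<cdot> f" using X assms by (simp add: add_zr)
  finally show ?thesis using add_self_zr[of "zr X Y \<cdot> f"] X assms by simp
qed

lemma comp_zr [simp]:
  assumes "arr f" "dom f = Y" "X \<in> Ob" shows "f \<cdot> zr X Y = zr X (cod f)"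
proof -
  have Y: "Y \<in> Ob" using assms by auto
  have "f \<cdot> zr X Y \<^bold>+ f \<cdot> zr X Y = f \<cdot> (zr X Y \<^bold>+ zr X Y)" by (simp add: distl)
  also have "\<dots> = f \<cdot> zr X Y" using Y assms by (simp add: add_zr)
  finally show ?thesis using add_self_zr[of "f \<cdot> zr X Y"] Y assms by simp
qed

lemma neg_unique:
  assumes "arr f" "arr g" "dom g = dom f" "cod g = cod f" "f \<^bold>+ g = zr (dom f) (cod f)"
  shows "g = \<^bold>- f"
  using add_cancel[of f g "\<^bold>- f"] assms by (simp add: add_neg)

lemma neg_neg [simp]: "arr f \<Longrightarrow> \<^bold>- (\<^bold>- f) = f"
  using neg_unique[of "\<^bold>- f" f] by (simp add: neg_add)

lemma neg_zr [simp]: "X \<in> Ob \<Longrightarrow> Y \<in> Ob \<Longrightarrow> \<^bold>- (zr X Y) = zr X Y"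
  using neg_unique[of "zr X Y" "zr X Y"] by (simp add: add_zr)

lemma neg_comp: "arr f \<Longrightarrow> arr g \<Longrightarrow> cod f = dom g \<Longrightarrow> \<^bold>- g \<cdot> f = \<^bold>- (g \<cdot> f)"
  by (rule neg_unique) (simp_all add: distr[symmetric] add_neg)

lemma comp_neg: "arr f \<Longrightarrow> arr g \<Longrightarrow> cod f = dom g \<Longrightarrow> g \<cdot> \<^bold>- f = \<^bold>- (g \<cdot> f)"
  by (rule neg_unique) (simp_all add: distl[symmetric] add_neg)

lemma add_neg_cancel: "arr f \<Longrightarrow> arr g \<Longrightarrow> dom f = dom g \<Longrightarrow> cod f = cod g \<Longrightarrow> f \<^bold>+ (\<^bold>- f \<^bold>+ g) = g"
  by (simp add: add_assoc[symmetric] add_neg zr_add)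

lemma neg_add_cancel: "arr f \<Longrightarrow> arr g \<Longrightarrow> dom f = dom g \<Longrightarrow> cod f = cod g \<Longrightarrow> \<^bold>- f \<^bold>+ (f \<^bold>+ g) = g"
  by (simp add: add_assoc[symmetric] neg_add zr_add)

lemma neg_sum: "arr f \<Longrightarrow> arr g \<Longrightarrow> dom f = dom g \<Longrightarrow> cod f = cod g \<Longrightarrow> \<^bold>- (f \<^bold>+ g) = \<^bold>- f \<^bold>+ \<^bold>- g"
  by (rule neg_unique[symmetric])
    (simp_all add: add_assoc add_lcomm[of g] add_neg add_neg_cancel add_zr)

lemma diff_eq_zrD:
  assumes f: "arr f" "dom f = X" "cod f = Y" and g: "arr g" "dom g = X" "cod g = Y"
    and eq: "f \<^bold>+ \<^bold>- g = zr X Y"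
  shows "f = g"
proof -
  have "f \<^bold>+ \<^bold>- g \<^bold>+ g = f" using f g unfolding add_assoc by (simp add: neg_add add_zr)
  moreover have "f \<^bold>+ \<^bold>- g \<^bold>+ g = g" unfolding eq using g by (simp add: zr_add)
  ultimately show ?thesis by simp
qed

definition mono :: "'m \<Rightarrow> bool" where
  "mono m \<longleftrightarrow> arr m \<and> (\<forall>g. arr g \<and> cod g = dom m \<and> m \<cdot> g = zr (dom g) (cod m) \<longrightarrow> g = zr (dom g) (dom m))"

definition epi :: "'m \<Rightarrow> bool" where
  "epi e \<longleftrightarrow> arr e \<and> (\<forall>g. arr g \<and> dom g = cod e \<and> g \<cdot> e = zr (dom e) (cod g) \<longrightarrow> g = zr (cod e) (cod g))"

definition iso :: "'m \<Rightarrow> bool" where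
  "iso f \<longleftrightarrow> arr f \<and> (\<exists>g\<in>hom (cod f) (dom f). g \<cdot> f = idn (dom f) \<and> f \<cdot> g = idn (cod f))"

definition ses :: "'o \<Rightarrow> 'm \<Rightarrow> 'o \<Rightarrow> 'm \<Rightarrow> 'o \<Rightarrow> bool" where
  "ses N i M p Z \<longleftrightarrow> i \<in> hom N M \<and> p \<in> hom M Z \<and> mono i \<and> epi p \<and> p \<cdot> i = zr N Z \<and>
     (\<forall>g. arr g \<and> cod g = M \<and> p \<cdot> g = zr (dom g) Z \<longrightarrow> (\<exists>h\<in>hom (dom g) N. i \<cdot> h = g)) \<and>
     (\<forall>g. arr g \<and> dom g = M \<and> g \<cdot> i = zr N (cod g) \<longrightarrow> (\<exists>h\<in>hom Z (cod g). h \<cdot> p = g))"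

definition nonzero :: "'o \<Rightarrow> bool" where
  "nonzero X \<longleftrightarrow> X \<in> Ob \<and> idn X \<noteq> zr X X"

definition biprod :: "'o \<Rightarrow> 'o \<Rightarrow> 'o \<Rightarrow> 'm \<Rightarrow> 'm \<Rightarrow> 'm \<Rightarrow> 'm \<Rightarrow> bool" where
  "biprod M A B i j p q \<longleftrightarrow> i \<in> hom A M \<and> j \<in> hom B M \<and> p \<in> hom M A \<and> q \<in> hom M B \<and>
     p \<cdot> i = idn A \<and> q \<cdot> j = idn B \<and> q \<cdot> i = zr A B \<and> p \<cdot> j = zr B A \<and> i \<cdot> p \<^bold>+ j \<cdot> q = idn M"

definition indec :: "'o \<Rightarrow> bool" where
  "indec X \<longleftrightarrow> nonzero X \<and> (\<forall>t\<in>hom X X. t \<cdot> t = t \<longrightarrow> t = zr X X \<or> t = idn X)"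

definition projective :: "'o \<Rightarrow> bool" where
  "projective P \<longleftrightarrow> P \<in> Ob \<and> (\<forall>g f. epi g \<and> arr f \<and> dom f = P \<and> cod f = cod g \<longrightarrow> (\<exists>h\<in>hom P (dom g). g \<cdot> h = f))"

definition injective :: "'o \<Rightarrow> bool" where
  "injective Q \<longleftrightarrow> Q \<in> Ob \<and> (\<forall>g f. mono g \<and> arr f \<and> cod f = Q \<and> dom f = dom g \<longrightarrow> (\<exists>h\<in>hom (cod g) Q. h \<cdot> g = f))"

text \<open>
  The two dimension predicates state the existence of resolutions of length one; resolutions of length zero are
  the special case with a zero end term.
\<close>

definition pd1 :: "'o \<Rightarrow> bool" where
  "pd1 X \<longleftrightarrow> (\<exists>P1 i P0 p. ses P1 i P0 p X \<and> projective P1 \<and> projective P0)"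

definition id1 :: "'o \<Rightarrow> bool" where
  "id1 X \<longleftrightarrow> (\<exists>Q0 i Q1 p. ses X i Q0 p Q1 \<and> injective Q0 \<and> injective Q1)"

definition step :: "('o \<times> 'o) set" where
  "step = {(X, Y). indec X \<and> indec Y \<and> (\<exists>f\<in>hom X Y. f \<noteq> zr X Y \<and> \<not> iso f)}"

text \<open>
  Additive functions on objects are the homomorphisms out of the Grothendieck group.
\<close>

definition additive :: "('o \<Rightarrow> int) \<Rightarrow> bool" where
  "additive \<phi> \<longleftrightarrow> (\<forall>N i M p Z. ses N i M p Z \<longrightarrow> \<phi> M = \<phi> N + \<phi> Z)"

lemma monoD: "mono m \<Longrightarrow> arr g \<Longrightarrow> cod g = dom m \<Longrightarrow> m \<cdot> g = zr (dom g) (cod m) \<Longrightarrow> g = zr (dom g) (dom m)"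
  and mono_arr: "mono m \<Longrightarrow> arr m"
  by (auto simp: mono_def)

lemma epiD: "epi e \<Longrightarrow> arr g \<Longrightarrow> dom g = cod e \<Longrightarrow> g \<cdot> e = zr (dom e) (cod g) \<Longrightarrow> g = zr (cod e) (cod g)"
  and epi_arr: "epi e \<Longrightarrow> arr e"
  by (auto simp: epi_def)

lemma mono_cancel:
  assumes m: "mono m" and fg: "arr f" "arr g" "dom f = dom g" "cod f = dom m" "cod g = dom m"
    and eq: "m \<cdot> f = m \<cdot> g"
  shows "f = g"
proof -
  have "m \<cdot> (f \<^bold>+ \<^bold>- g) = zr (dom g) (cod m)"
    using fg eq mono_arr[OF m] by (simp add: distl comp_neg add_neg)
  then have "f \<^bold>+ \<^bold>- g = zr (dom g) (dom m)" using monoD[OF m, of "f \<^bold>+ \<^bold>- g"] fg by simp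
  then show ?thesis using diff_eq_zrD[of f _ _ g] fg by simp
qed

lemma epi_cancel:
  assumes e: "epi e" and fg: "arr f" "arr g" "cod f = cod g" "dom f = cod e" "dom g = cod e"
    and eq: "f \<cdot> e = g \<cdot> e"
  shows "f = g"
proof -
  have "(f \<^bold>+ \<^bold>- g) \<cdot> e = zr (dom e) (cod g)"
    using fg eq epi_arr[OF e] by (simp add: distr neg_comp add_neg)
  then have "f \<^bold>+ \<^bold>- g = zr (cod e) (cod g)" using epiD[OF e, of "f \<^bold>+ \<^bold>- g"] fg by simp
  then show ?thesis using diff_eq_zrD[of f _ _ g] fg by simp
qed

lemma mono_comp:
  assumes "mono f" "mono g" "cod f = dom g" shows "mono (g \<cdot> f)"
proof -
  have a: "arr f" "arr g" using assms mono_arr by auto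
  have "h = zr (dom h) (dom f)" if h: "arr h" "cod h = dom f" "g \<cdot> f \<cdot> h = zr (dom h) (cod g)" for h
  proof -
    have "f \<cdot> h = zr (dom h) (dom g)"
      using monoD[OF assms(2), of "f \<cdot> h"] h a assms(3) by (simp add: comp_assoc)
    then show ?thesis using monoD[OF assms(1), of h] h a assms(3) by simp
  qed
  then show ?thesis unfolding mono_def using a assms(3) by simp
qed

lemma epi_comp:
  assumes "epi f" "epi g" "cod f = dom g" shows "epi (g \<cdot> f)"
proof -
  have a: "arr f" "arr g" using assms epi_arr by auto
  have "h = zr (cod g) (cod h)" if h: "arr h" "dom h = cod g" "h \<cdot> (g \<cdot> f) = zr (dom f) (cod h)" for h
  proof -
    have "h \<cdot> g = zr (cod f) (cod h)"
      using epiD[OF assms(1), of "h \<cdot> g"] h a assms(3) by (simp add: comp_assoc)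
    then show ?thesis using epiD[OF assms(2), of h] h a assms(3) by simp
  qed
  then show ?thesis unfolding epi_def using a assms(3) by simp
qed

lemma mono_right:
  assumes "arr f" "arr g" "cod f = dom g" "mono (g \<cdot> f)" shows "mono f"
proof -
  have "h = zr (dom h) (dom f)" if h: "arr h" "cod h = dom f" "f \<cdot> h = zr (dom h) (cod f)" for h
    using monoD[OF assms(4), of h] h assms(1-3) by (simp add: comp_assoc)
  then show ?thesis unfolding mono_def using assms(1) by blast
qed

lemma epi_left:
  assumes "arr f" "arr g" "cod f = dom g" "epi (g \<cdot> f)" shows "epi g"
proof -
  have "h = zr (cod g) (cod h)" if h: "arr h" "dom h = cod g" "h \<cdot> g = zr (dom g) (cod h)" for h
    using epiD[OF assms(4), of h] h assms(1-3) by (simp add: reassoc[OF h(3)])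
  then show ?thesis unfolding epi_def using assms(2) by blast
qed

lemma idn_mono: "X \<in> Ob \<Longrightarrow> mono (idn X)" and idn_epi: "X \<in> Ob \<Longrightarrow> epi (idn X)"
  unfolding mono_def epi_def by (auto simp: idn_left idn_right)

lemma split_mono: "s \<in> hom Y X \<Longrightarrow> f \<in> hom X Y \<Longrightarrow> s \<cdot> f = idn X \<Longrightarrow> mono f"
  using mono_right[of f s] idn_mono[of X] by auto

lemma split_epi: "s \<in> hom Y X \<Longrightarrow> f \<in> hom X Y \<Longrightarrow> f \<cdot> s = idn Y \<Longrightarrow> epi f"
  using epi_left[of s f] idn_epi[of Y] by auto

lemma sesD:
  assumes "ses N i M p Z"
  shows "arr i" "dom i = N" "cod i = M" "arr p" "dom p = M" "cod p = Z" "mono i" "epi p" "p \<cdot> i = zr N Z"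
    "N \<in> Ob" "M \<in> Ob" "Z \<in> Ob"
  using assms unfolding ses_def by auto

lemma ses_ker:
  assumes "ses N i M p Z" "arr g" "cod g = M" "p \<cdot> g = zr (dom g) Z"
  shows "\<exists>h. arr h \<and> dom h = dom g \<and> cod h = N \<and> i \<cdot> h = g"
proof -
  have "\<exists>h\<in>hom (dom g) N. i \<cdot> h = g" using assms unfolding ses_def by blast
  then show ?thesis by auto
qed

lemma ses_coker:
  assumes "ses N i M p Z" "arr g" "dom g = M" "g \<cdot> i = zr N (cod g)"
  shows "\<exists>h. arr h \<and> dom h = Z \<and> cod h = cod g \<and> h \<cdot> p = g"
proof -
  have "\<exists>h\<in>hom Z (cod g). h \<cdot> p = g" using assms unfolding ses_def by blast
  then show ?thesis by auto
qed

lemma isoE: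
  assumes "iso f"
  obtains g where "arr g" "dom g = cod f" "cod g = dom f" "g \<cdot> f = idn (dom f)" "f \<cdot> g = idn (cod f)"
  using assms unfolding iso_def by auto

lemma iso_arr: "iso f \<Longrightarrow> arr f" by (simp add: iso_def)

lemma iso_comp:
  assumes "iso f" "iso g" "cod f = dom g" shows "iso (g \<cdot> f)"
proof -
  obtain f' where f': "arr f'" "dom f' = cod f" "cod f' = dom f" "f' \<cdot> f = idn (dom f)" "f \<cdot> f' = idn (cod f)"
    using assms(1) by (rule isoE)
  obtain g' where g': "arr g'" "dom g' = cod g" "cod g' = dom g" "g' \<cdot> g = idn (dom g)" "g \<cdot> g' = idn (cod g)"
    using assms(2) by (rule isoE)
  have a: "arr f" "arr g" using assms iso_arr by auto
  have "(f' \<cdot> g') \<cdot> (g \<cdot> f) = idn (dom f)" "(g \<cdot> f) \<cdot> (f' \<cdot> g') = idn (cod g)"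
    using a f' g' assms(3)
    by (simp_all add: comp_assoc reassoc[OF g'(4)] reassoc[OF f'(5)] idn_left idn_right)
  then show ?thesis unfolding iso_def using a f' g' assms(3) by (auto intro!: bexI[of _ "f' \<cdot> g'"])
qed

lemma split_mono_epi_iso:
  assumes "s \<in> hom Y X" "f \<in> hom X Y" "s \<cdot> f = idn X" "epi f" shows "iso f"
proof -
  have "(f \<cdot> s) \<cdot> f = idn Y \<cdot> f" using assms by (simp add: comp_assoc idn_left idn_right)
  then have "f \<cdot> s = idn Y" using epi_cancel[OF assms(4), of "f \<cdot> s" "idn Y"] assms(1,2) by auto
  then show ?thesis using assms unfolding iso_def by auto
qed

lemma split_epi_mono_iso:
  assumes "s \<in> hom Y X" "f \<in> hom X Y" "f \<cdot> s = idn Y" "mono f" shows "iso f"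
proof -
  have "f \<cdot> (s \<cdot> f) = f \<cdot> idn X" using assms by (simp add: comp_assoc[symmetric] idn_left idn_right)
  then have "s \<cdot> f = idn X" using mono_cancel[OF assms(4), of "s \<cdot> f" "idn X"] assms(1,2) by auto
  then show ?thesis using assms unfolding iso_def by auto
qed

lemma iso_mono:
  assumes "iso f" shows "mono f"
proof -
  obtain g where "arr g" "dom g = cod f" "cod g = dom f" "g \<cdot> f = idn (dom f)" using assms by (rule isoE)
  then show ?thesis using split_mono[of g "cod f" "dom f" f] iso_arr[OF assms] by simp
qed

lemma iso_epi:
  assumes "iso f" shows "epi f"
proof -
  obtain g where "arr g" "dom g = cod f" "cod g = dom f" "f \<cdot> g = idn (cod f)" using assms by (rule isoE)
  then show ?thesis using split_epi[of g "cod f" "dom f" f] iso_arr[OF assms] by simp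
qed

lemma biprodD:
  assumes "biprod M A B i j p q"
  shows "arr i" "dom i = A" "cod i = M" "arr j" "dom j = B" "cod j = M"
    "arr p" "dom p = M" "cod p = A" "arr q" "dom q = M" "cod q = B"
    "p \<cdot> i = idn A" "q \<cdot> j = idn B" "q \<cdot> i = zr A B" "p \<cdot> j = zr B A" "i \<cdot> p \<^bold>+ j \<cdot> q = idn M"
    "M \<in> Ob" "A \<in> Ob" "B \<in> Ob"
  using assms unfolding biprod_def by auto

lemma biprod_decomp_left:
  assumes b: "biprod M A B i j p q" and f: "arr f" "dom f = M"
  shows "f = f \<cdot> i \<cdot> p \<^bold>+ f \<cdot> j \<cdot> q"
  using biprodD(17)[OF b] f by (simp add: comp_assoc distl[symmetric] idn_right)

lemma biprod_decomp_right:
  assumes b: "biprod M A B i j p q" and f: "arr f" "cod f = M"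
  shows "f = i \<cdot> (p \<cdot> f) \<^bold>+ j \<cdot> (q \<cdot> f)"
  using biprodD(17)[OF b] f by (simp add: comp_assoc[symmetric] distr[symmetric] idn_left)

lemma biprod_ses:
  assumes b: "biprod M A B i j p q" shows "ses A i M q B"
proof -
  note b' = biprodD[OF b]
  have "\<exists>h\<in>hom (dom g) A. i \<cdot> h = g" if "arr g" "cod g = M" "q \<cdot> g = zr (dom g) B" for g
    using that b' biprod_decomp_right[OF b that(1,2)] by (intro bexI[of _ "p \<cdot> g"]) (auto simp: add_zr)
  moreover have "\<exists>h\<in>hom B (cod g). h \<cdot> q = g" if "arr g" "dom g = M" "g \<cdot> i = zr A (cod g)" for g
    using that b' biprod_decomp_left[OF b that(1,2)] by (intro bexI[of _ "g \<cdot> j"]) (auto simp: zr_add)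
  moreover have "mono i" using split_mono[of p M A i] b' by auto
  moreover have "epi q" using split_epi[of j B M q] b' by auto
  ultimately show ?thesis unfolding ses_def using b' by auto
qed

lemma nonzeroI:
  assumes "arr f" "dom f = X" "f \<noteq> zr X (cod f)" shows "nonzero X"
proof -
  have "f = f \<cdot> idn X" "X \<in> Ob" using assms by (auto simp: idn_right)
  then show ?thesis unfolding nonzero_def using assms by auto
qed

lemma nonzeroI':
  assumes "arr f" "cod f = X" "f \<noteq> zr (dom f) X" shows "nonzero X"
proof -
  have "f = idn X \<cdot> f" "X \<in> Ob" using assms by (auto simp: idn_left)
  then show ?thesis unfolding nonzero_def using assms by auto
qed

lemma zero_objD: "\<not> nonzero X \<Longrightarrow> arr f \<Longrightarrow> dom f = X \<Longrightarrow> f = zr X (cod f)"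
  "\<not> nonzero X \<Longrightarrow> arr f \<Longrightarrow> cod f = X \<Longrightarrow> f = zr (dom f) X"
  using nonzeroI nonzeroI' by blast+

lemma indecD: "indec X \<Longrightarrow> X \<in> Ob" "indec X \<Longrightarrow> idn X \<noteq> zr X X" "indec X \<Longrightarrow> nonzero X"
  "indec X \<Longrightarrow> t \<in> hom X X \<Longrightarrow> t \<cdot> t = t \<Longrightarrow> t = zr X X \<or> t = idn X"
  by (auto simp: indec_def nonzero_def)

lemma projectiveD:
  assumes "projective P" "epi g" "arr f" "dom f = P" "cod f = cod g"
  shows "\<exists>h. arr h \<and> dom h = P \<and> cod h = dom g \<and> g \<cdot> h = f"
proof -
  have "\<exists>h\<in>hom P (dom g). g \<cdot> h = f" using assms unfolding projective_def by blast
  then show ?thesis by auto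
qed

lemma injectiveD:
  assumes "injective Q" "mono g" "arr f" "cod f = Q" "dom f = dom g"
  shows "\<exists>h. arr h \<and> dom h = cod g \<and> cod h = Q \<and> h \<cdot> g = f"
proof -
  have "\<exists>h\<in>hom (cod g) Q. h \<cdot> g = f" using assms unfolding injective_def by blast
  then show ?thesis by auto
qed

text \<open>
  Swapping domains with codomains and reversing composition preserves the axioms; every later statement about
  projectives, kernels or predecessors gives one about injectives, cokernels or successors.
\<close>

lemma dual: "preadditive_cat Ob arr cod dom (\<lambda>f g. g \<cdot> f) (\<^bold>+) neg (\<lambda>X Y. zr Y X) idn"
  by unfold_locales (auto simp: comp_assoc add_assoc distl distr add_zr add_neg idn_left idn_right intro: add_comm)

end

context preadditive_cat
begin

interpretation D: preadditive_cat Ob arr cod dom "\<lambda>f g. g \<cdot> f" "(\<^bold>+)" neg "\<lambda>X Y. zr Y X" idn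
  by (rule dual)

lemma dual_hom: "D.hom X Y = hom Y X"
  unfolding D.hom_def hom_def by blast

lemma dual_mono: "D.mono = epi"
  unfolding D.mono_def epi_def by (intro ext) blast

lemma dual_epi: "D.epi = mono"
  unfolding D.epi_def mono_def by (intro ext) blast

lemma dual_iso: "D.iso = iso"
  unfolding D.iso_def iso_def dual_hom by (intro ext) blast

lemma dual_ses: "D.ses N i M p Z = ses Z p M i N"
  unfolding D.ses_def ses_def dual_hom dual_mono dual_epi by blast

lemma dual_nonzero: "D.nonzero = nonzero"
  unfolding D.nonzero_def nonzero_def by (intro ext) blast

lemma dual_biprod: "D.biprod M A B i j p q = biprod M A B p q i j"
  unfolding D.biprod_def biprod_def dual_hom by blast

lemma dual_indec: "D.indec = indec"
  unfolding D.indec_def indec_def dual_hom dual_nonzero by (intro ext) blast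

lemma dual_projective: "D.projective = injective"
  unfolding D.projective_def injective_def dual_hom dual_epi by (intro ext) blast

lemma dual_injective: "D.injective = projective"
  unfolding D.injective_def projective_def dual_hom dual_mono by (intro ext) blast

lemma dual_pd1: "D.pd1 = id1"
  unfolding D.pd1_def id1_def dual_ses dual_projective by (intro ext) blast

lemma dual_id1: "D.id1 = pd1"
  unfolding D.id1_def pd1_def dual_ses dual_injective by (intro ext) blast

lemma dual_step: "D.step = step\<inverse>"
  unfolding D.step_def step_def dual_indec dual_hom dual_iso by blast

lemma dual_additive: "D.additive = additive"
  unfolding D.additive_def additive_def dual_ses by (intro ext iffI) (metis add.commute)+

lemmas dual_simps = dual_hom dual_mono dual_epi dual_iso dual_ses dual_nonzero dual_biprod dual_indec
  dual_projective dual_injective dual_pd1 dual_id1 dual_step dual_additive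

end

text \<open>
  The axioms that a category of finite-dimensional modules satisfies and that the arguments below use: \<open>d\<close> is
  additive and positive, like the dimension of a module, and \<open>h X Y\<close> is the dimension of \<open>hom X Y\<close>.  Exactness of
  the hom functors is needed only where the induced map happens to be surjective, so \<open>h_left\<close> and \<open>h_right\<close>
  take this surjectivity as a premise.  The factorisation axiom provides a kernel, an image and a cokernel of
  every arrow.
\<close>

locale length_abelian_cat = preadditive_cat +
  fixes d :: "'a \<Rightarrow> nat" and h :: "'a \<Rightarrow> 'a \<Rightarrow> nat"
  assumes factor: "arr f \<Longrightarrow> \<exists>K k e J m C c. ses K k (dom f) e J \<and> ses J m (cod f) c C \<and> m \<cdot> e = f"
    and biprod_ex: "X \<in> Ob \<Longrightarrow> Y \<in> Ob \<Longrightarrow> \<exists>S i j p q. biprod S X Y i j p q"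
    and d_add: "ses N i M p Z \<Longrightarrow> d M = d N + d Z"
    and d_pos: "nonzero X \<Longrightarrow> 0 < d X"
    and h_zero: "X \<in> Ob \<Longrightarrow> Y \<in> Ob \<Longrightarrow> h X Y = 0 \<longleftrightarrow> hom X Y = {zr X Y}"
    and h_left: "ses N i M p Z \<Longrightarrow> Y \<in> Ob \<Longrightarrow> (\<And>f. f \<in> hom N Y \<Longrightarrow> \<exists>g\<in>hom M Y. g \<cdot> i = f) \<Longrightarrow>
      h M Y = h N Y + h Z Y"
    and h_right: "ses N i M p Z \<Longrightarrow> Y \<in> Ob \<Longrightarrow> (\<And>f. f \<in> hom Y Z \<Longrightarrow> \<exists>g\<in>hom Y M. p \<cdot> g = f) \<Longrightarrow>
      h Y M = h Y N + h Y Z"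
    and enough_proj: "X \<in> Ob \<Longrightarrow> \<exists>P p. projective P \<and> p \<in> hom P X \<and> epi p"
    and enough_inj: "X \<in> Ob \<Longrightarrow> \<exists>Q i. injective Q \<and> i \<in> hom X Q \<and> mono i"
begin

lemma dual_length: "length_abelian_cat Ob arr cod dom (\<lambda>f g. g \<cdot> f) (\<^bold>+) neg (\<lambda>X Y. zr Y X) idn d (\<lambda>X Y. h Y X)"
proof -
  interpret D: preadditive_cat Ob arr cod dom "\<lambda>f g. g \<cdot> f" "(\<^bold>+)" neg "\<lambda>X Y. zr Y X" idn
    by (rule dual)
  show ?thesis
  proof (unfold_locales, unfold dual_simps)
    show "\<exists>K k e J m C c. ses J e (cod f) k K \<and> ses C c (dom f) m J \<and> e \<cdot> m = f" if "arr f" for f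
      using factor[OF that] by blast
    show "\<exists>S i j p q. biprod S X Y p q i j" if "X \<in> Ob" "Y \<in> Ob" for X Y
      using biprod_ex[OF that] by blast
    show "d M = d N + d Z" if "ses Z p M i N" for N i M p Z
      using d_add[OF that] by simp
    show "h Y M = h Y N + h Y Z" if "ses Z p M i N" "Y \<in> Ob" "\<And>f. f \<in> hom Y N \<Longrightarrow> \<exists>g\<in>hom Y M. i \<cdot> g = f"
      for N i M p Z Y using h_right[OF that(1,2)] that(3) by simp
    show "h M Y = h N Y + h Z Y" if "ses Z p M i N" "Y \<in> Ob" "\<And>f. f \<in> hom Z Y \<Longrightarrow> \<exists>g\<in>hom M Y. g \<cdot> p = f"
      for N i M p Z Y using h_left[OF that(1,2)] that(3) by simp
    show "\<exists>P p. injective P \<and> p \<in> hom X P \<and> mono p" if "X \<in> Ob" for X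
      using enough_inj[OF that] .
    show "\<exists>P p. projective P \<and> p \<in> hom P X \<and> epi p" if "X \<in> Ob" for X
      using enough_proj[OF that] .
    show "0 < d X" if "nonzero X" for X using d_pos[OF that] .
    show "(h Y X = 0) = (hom Y X = {zr Y X})" if "X \<in> Ob" "Y \<in> Ob" for X Y
      using h_zero that by simp
  qed
qed

lemma ses_iso_left:
  assumes s: "ses J m M c C" and e: "iso e" "dom e = N" "cod e = J"
  shows "ses N (m \<cdot> e) M c C"
proof -
  obtain r where r: "arr r" "dom r = J" "cod r = N" "r \<cdot> e = idn N" "e \<cdot> r = idn J"
    using e by (metis isoE)
  note s' = sesD[OF s] and ea = iso_arr[OF e(1)]
  have "\<exists>h\<in>hom (dom g) N. m \<cdot> e \<cdot> h = g" if g: "arr g" "cod g = M" "c \<cdot> g = zr (dom g) C" for g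
  proof -
    obtain u where u: "arr u" "dom u = dom g" "cod u = J" "m \<cdot> u = g" using ses_ker[OF s g] by blast
    have "m \<cdot> e \<cdot> (r \<cdot> u) = g" using u s' ea e r by (simp add: comp_assoc reassoc[OF r(5)] idn_left)
    then show ?thesis using u r by (intro bexI[of _ "r \<cdot> u"]) auto
  qed
  moreover have "\<exists>h\<in>hom C (cod g). h \<cdot> c = g" if g: "arr g" "dom g = M" "g \<cdot> (m \<cdot> e) = zr N (cod g)" for g
  proof -
    have "g \<cdot> m = g \<cdot> (m \<cdot> e) \<cdot> r" using g(1,2) s' ea e r by (simp add: comp_assoc idn_right)
    also have "\<dots> = zr J (cod g)" unfolding g(3) using g r by simp
    finally show ?thesis using ses_coker[OF s g(1,2)] by auto
  qed
  moreover have "mono (m \<cdot> e)" using mono_comp[OF iso_mono[OF e(1)] s'(7)] e s' by simp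
  moreover have "c \<cdot> (m \<cdot> e) = zr N C" using s' ea e by (simp add: reassoc[OF s'(9)])
  ultimately show ?thesis unfolding ses_def using s' ea e by auto
qed

text \<open>
  In the image factorisation of a mono the kernel is zero, so the epi has a left inverse and is an isomorphism;
  the cokernel in the factorisation is therefore a cokernel of the mono itself.
\<close>

lemma mono_ses:
  assumes m: "mono m" shows "\<exists>C c. ses (dom m) m (cod m) c C"
proof -
  have ma: "arr m" using m by (rule mono_arr)
  obtain K k e J m' C c where s: "ses K k (dom m) e J" "ses J m' (cod m) c C" "m' \<cdot> e = m"
    using factor[OF ma] by blast
  note s1 = sesD[OF s(1)] and s2 = sesD[OF s(2)]
  have "m \<cdot> k = zr K (cod m)" unfolding s(3)[symmetric] using s1 s2 by (simp add: comp_assoc)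
  then have "k = zr K (dom m)" using monoD[OF m, of k] s1 by simp
  then have "idn (dom m) \<cdot> k = zr K (dom m)" using s1 ma by simp
  then obtain r where r: "arr r" "dom r = J" "cod r = dom m" "r \<cdot> e = idn (dom m)"
    using ses_coker[OF s(1), of "idn (dom m)"] ma by auto
  have "iso e" using split_mono_epi_iso[of r J "dom m" e] r s1 by auto
  then show ?thesis using ses_iso_left[OF s(2), of e] s1 s(3) by auto
qed

end

context length_abelian_cat
begin

interpretation D: length_abelian_cat Ob arr cod dom "\<lambda>f g. g \<cdot> f" "(\<^bold>+)" neg "\<lambda>X Y. zr Y X" idn d "\<lambda>X Y. h Y X"
  by (rule dual_length)

lemma epi_ses: "epi e \<Longrightarrow> \<exists>K k. ses K k (dom e) e (cod e)"
  using D.mono_ses[of e] unfolding dual_simps by blast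

lemma ses_iso_right: "ses N i M p J \<Longrightarrow> iso e \<Longrightarrow> cod e = Z \<Longrightarrow> dom e = J \<Longrightarrow> ses N i M (e \<cdot> p) Z"
  using D.ses_iso_left[of J p M i N e Z] unfolding dual_simps by blast

end

context length_abelian_cat
begin

text \<open>
  A mono and an epi already form a short exact sequence if one of the two universal properties holds.
\<close>

lemma mono_coker_ses:
  assumes i: "mono i" "dom i = N" "cod i = M" and p: "epi p" "dom p = M" "cod p = Z"
    and pi: "p \<cdot> i = zr N Z"
    and u: "\<And>g. arr g \<Longrightarrow> dom g = M \<Longrightarrow> g \<cdot> i = zr N (cod g) \<Longrightarrow> \<exists>h\<in>hom Z (cod g). h \<cdot> p = g"
  shows "ses N i M p Z"
proof -
  obtain C c where s: "ses N i M c C" using mono_ses[OF i(1)] i by auto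
  note s' = sesD[OF s]
  have pa: "arr p" using p epi_arr by auto
  obtain v where v: "arr v" "dom v = Z" "cod v = C" "v \<cdot> p = c" using u[of c] s' by auto
  have "\<exists>h\<in>hom (dom g) N. i \<cdot> h = g" if g: "arr g" "cod g = M" "p \<cdot> g = zr (dom g) Z" for g
  proof -
    have "c \<cdot> g = zr (dom g) C" unfolding v(4)[symmetric] using g v(1-3) pa p by (simp add: comp_assoc)
    then show ?thesis using ses_ker[OF s g(1,2)] by auto
  qed
  then show ?thesis unfolding ses_def using i p pa pi u s' by auto
qed

end

context length_abelian_cat
begin

interpretation D: length_abelian_cat Ob arr cod dom "\<lambda>f g. g \<cdot> f" "(\<^bold>+)" neg "\<lambda>X Y. zr Y X" idn d "\<lambda>X Y. h Y X"
  by (rule dual_length)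

lemma epi_ker_ses:
  assumes "mono i" "dom i = N" "cod i = M" "epi p" "dom p = M" "cod p = Z" "p \<cdot> i = zr N Z"
    "\<And>g. arr g \<Longrightarrow> cod g = M \<Longrightarrow> p \<cdot> g = zr (dom g) Z \<Longrightarrow> \<exists>h\<in>hom (dom g) N. i \<cdot> h = g"
  shows "ses N i M p Z"
  using D.mono_coker_ses[of p Z M i N] assms unfolding dual_simps by blast

end


section \<open>Decompositions, syzygies and pushouts\<close>

context length_abelian_cat
begin

lemma d_mono: assumes "mono m" shows "d (dom m) \<le> d (cod m)"
proof -
  obtain C c where "ses (dom m) m (cod m) c C" using mono_ses[OF assms] by blast
  then show ?thesis using d_add by fastforce
qed

lemma d_zero: assumes "X \<in> Ob" shows "d X = 0 \<longleftrightarrow> \<not> nonzero X"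
proof
  assume n: "\<not> nonzero X"
  have z: "idn X = zr X X" using n assms by (simp add: nonzero_def)
  have 1: "\<exists>h\<in>hom (dom g) X. idn X \<cdot> h = g" if "arr g \<and> cod g = X \<and> idn X \<cdot> g = zr (dom g) X" for g
    using that by (intro bexI[of _ g] idn_left) simp_all
  have 2: "\<exists>h\<in>hom X (cod g). h \<cdot> idn X = g" if "arr g \<and> dom g = X \<and> g \<cdot> idn X = zr X (cod g)" for g
    using that by (intro bexI[of _ g] idn_right) simp_all
  have 3: "idn X \<cdot> idn X = zr X X" "idn X \<in> hom X X" using assms z by (simp_all add: idn_left)
  have "ses X (idn X) X (idn X) X"
    unfolding ses_def using 1 2 3 idn_mono[OF assms] idn_epi[OF assms] by blast
  from d_add[OF this] show "d X = 0" by simp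
qed (use d_pos in force)

lemma ses_left_zero_iso:
  assumes s: "ses N i M p Z" and z: "\<not> nonzero N" shows "iso p"
proof -
  note s' = sesD[OF s]
  have "idn M \<cdot> i = zr N (cod (idn M))" using zero_objD(1)[OF z, of i] s' by (simp add: idn_left)
  then obtain r where r: "arr r" "dom r = Z" "cod r = M" "r \<cdot> p = idn M"
    using ses_coker[OF s, of "idn M"] s' by auto
  show ?thesis using split_mono_epi_iso[of r Z M p] r s' by simp
qed

lemma ses_right_zero_iso:
  assumes s: "ses N i M p Z" and z: "\<not> nonzero Z" shows "iso i"
proof -
  note s' = sesD[OF s]
  have "p \<cdot> idn M = zr (dom (idn M)) Z" using zero_objD(2)[OF z, of p] s' by (simp add: idn_right)
  then obtain r where r: "arr r" "dom r = M" "cod r = N" "i \<cdot> r = idn M"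
    using ses_ker[OF s, of "idn M"] s' by auto
  show ?thesis using split_epi_mono_iso[of r M N i] r s' by simp
qed

lemma mono_d_eq_iso: assumes "mono m" "d (dom m) = d (cod m)" shows "iso m"
proof -
  obtain C c where s: "ses (dom m) m (cod m) c C" using mono_ses[OF assms(1)] by blast
  then have "d C = 0" using d_add[OF s] assms(2) by simp
  then show ?thesis using ses_right_zero_iso[OF s] d_zero sesD(12)[OF s] by blast
qed

lemma epi_d_eq_iso: assumes "epi m" "d (dom m) = d (cod m)" shows "iso m"
proof -
  obtain C c where s: "ses C c (dom m) m (cod m)" using epi_ses[OF assms(1)] by blast
  then have "d C = 0" using d_add[OF s] assms(2) by simp
  then show ?thesis using ses_left_zero_iso[OF s] d_zero sesD(10)[OF s] by blast
qed

lemma image_factor: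
  assumes "arr f"
  obtains J e m where "epi e" "mono m" "dom e = dom f" "cod e = J" "dom m = J" "cod m = cod f" "m \<cdot> e = f" "arr e" "arr m"
  using factor[OF assms] sesD by metis

text \<open>
  An idempotent is an epi followed by a mono, and cancelling both in \<open>t t = t\<close> leaves an identity.
\<close>

lemma idempotent_split:
  assumes t: "t \<in> hom M M" "t \<cdot> t = t"
  obtains J e m where "arr e" "arr m" "dom e = M" "cod e = J" "dom m = J" "cod m = M" "m \<cdot> e = t" "e \<cdot> m = idn J"
    "epi e" "mono m" "J \<in> Ob"
proof -
  have ta: "arr t" "dom t = M" "cod t = M" using t by auto
  obtain J e m where em: "epi e" "mono m" "dom e = M" "cod e = J" "dom m = J" "cod m = M" "m \<cdot> e = t" "arr e" "arr m"
    using image_factor[OF ta(1)] ta by metis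
  have J: "J \<in> Ob" using em by auto
  have "(m \<cdot> (e \<cdot> m)) \<cdot> e = (m \<cdot> idn J) \<cdot> e" using em t by (simp add: comp_assoc idn_right reassoc[OF em(7)])
  then have "m \<cdot> (e \<cdot> m) = m \<cdot> idn J" using epi_cancel[OF em(1), of "m \<cdot> (e \<cdot> m)" "m \<cdot> idn J"] em J by simp
  then have "e \<cdot> m = idn J" using mono_cancel[OF em(2), of "e \<cdot> m" "idn J"] em J by simp
  then show ?thesis using that em J by blast
qed

lemma complement_idempotent:
  assumes t: "t \<in> hom M M" "t \<cdot> t = t"
  shows "idn M \<^bold>+ \<^bold>- t \<in> hom M M" "(idn M \<^bold>+ \<^bold>- t) \<cdot> (idn M \<^bold>+ \<^bold>- t) = idn M \<^bold>+ \<^bold>- t"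
    "(idn M \<^bold>+ \<^bold>- t) \<cdot> t = zr M M" "t \<cdot> (idn M \<^bold>+ \<^bold>- t) = zr M M"
proof -
  have ta: "arr t" "dom t = M" "cod t = M" and M: "M \<in> Ob" using t by auto
  show "idn M \<^bold>+ \<^bold>- t \<in> hom M M" using ta M by simp
  show a: "(idn M \<^bold>+ \<^bold>- t) \<cdot> t = zr M M"
    using ta M t(2) by (simp add: distr neg_comp idn_left add_neg)
  show "t \<cdot> (idn M \<^bold>+ \<^bold>- t) = zr M M"
    using ta M t(2) by (simp add: distl comp_neg idn_right add_neg)
  have "(idn M \<^bold>+ \<^bold>- t) \<cdot> (idn M \<^bold>+ \<^bold>- t) = (idn M \<^bold>+ \<^bold>- t) \<cdot> idn M \<^bold>+ \<^bold>- ((idn M \<^bold>+ \<^bold>- t) \<cdot> t)"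
    using ta M by (simp only: distl comp_neg add_arr add_dom add_cod neg_arr neg_dom neg_cod idn_arr idn_dom idn_cod)
  also have "\<dots> = idn M \<^bold>+ \<^bold>- t" unfolding a using ta M by (simp add: idn_right add_zr)
  finally show "(idn M \<^bold>+ \<^bold>- t) \<cdot> (idn M \<^bold>+ \<^bold>- t) = idn M \<^bold>+ \<^bold>- t" .
qed

text \<open>
  The pieces cut out by an idempotent and by its complement form a biproduct, so an object with a nontrivial
  idempotent decomposes.
\<close>

lemma idempotent_biprod:
  assumes t: "t \<in> hom X X" "t \<cdot> t = t"
  obtains A B i j p q where "biprod X A B i j p q" "i \<cdot> p = t"
proof -
  have ta: "arr t" "dom t = X" "cod t = X" and XO: "X \<in> Ob" using t by auto
  let ?s = "idn X \<^bold>+ \<^bold>- t"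
  note s = complement_idempotent[OF t]
  obtain A p i where A: "arr p" "arr i" "dom p = X" "cod p = A" "dom i = A" "cod i = X" "i \<cdot> p = t" "p \<cdot> i = idn A"
    "epi p" "mono i" "A \<in> Ob" using idempotent_split[OF t] by metis
  obtain B q j where B: "arr q" "arr j" "dom q = X" "cod q = B" "dom j = B" "cod j = X" "j \<cdot> q = ?s" "q \<cdot> j = idn B"
    "epi q" "mono j" "B \<in> Ob" using idempotent_split[OF s(1,2)] by metis
  have "j \<cdot> (q \<cdot> i \<cdot> p) = (j \<cdot> q) \<cdot> (i \<cdot> p)" by (simp only: comp_assoc)
  also have "\<dots> = zr X X" unfolding A(7) B(7) by (rule s(3))
  finally have "q \<cdot> i \<cdot> p = zr X B" using monoD[OF B(10), of "q \<cdot> i \<cdot> p"] A(1-6) B(1-6) by simp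
  then have qi: "q \<cdot> i = zr A B" using epiD[OF A(9), of "q \<cdot> i"] A(1-6) B(1-6) by simp
  have "i \<cdot> (p \<cdot> j \<cdot> q) = (i \<cdot> p) \<cdot> (j \<cdot> q)" by (simp only: comp_assoc)
  also have "\<dots> = zr X X" unfolding A(7) B(7) by (rule s(4))
  finally have "p \<cdot> j \<cdot> q = zr X A" using monoD[OF A(10), of "p \<cdot> j \<cdot> q"] A(1-6) B(1-6) by simp
  then have pj: "p \<cdot> j = zr B A" using epiD[OF B(9), of "p \<cdot> j"] A(1-6) B(1-6) by simp
  have sum: "i \<cdot> p \<^bold>+ j \<cdot> q = idn X" unfolding A(7) B(7) using ta XO
    by (simp add: add_lcomm[of t] add_neg add_zr)
  have "biprod X A B i j p q" unfolding biprod_def using A B qi pj sum by simp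
  then show ?thesis using that A(7) by blast
qed

lemma decomposable_biprod:
  assumes X: "nonzero X" "\<not> indec X"
  obtains A B i j p q where "biprod X A B i j p q" "d A < d X" "d B < d X"
proof -
  obtain t where t: "t \<in> hom X X" "t \<cdot> t = t" "t \<noteq> zr X X" "t \<noteq> idn X"
    using X unfolding indec_def by auto
  obtain A B i j p q where b: "biprod X A B i j p q" "i \<cdot> p = t" using idempotent_biprod[OF t(1,2)] by metis
  note b' = biprodD[OF b(1)]
  have "d X = d A + d B" using d_add[OF biprod_ses[OF b(1)]] .
  moreover have "nonzero A"
  proof (rule ccontr)
    assume "\<not> nonzero A"
    then have "i = zr A X" using zero_objD(1)[of A i] b'(1-3) by simp
    then have "i \<cdot> p = zr X X" using b'(1-12,18-20) by simp
    then show False using b(2) t by simp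
  qed
  moreover have "nonzero B"
  proof (rule ccontr)
    assume "\<not> nonzero B"
    then have "q = zr X B" using zero_objD(2)[of B q] b'(1-12) by simp
    then have "j \<cdot> q = zr X X" using b'(1-12,18-20) by simp
    then have "i \<cdot> p = idn X" using b'(1-12,17) by (simp add: add_zr)
    then show False using b(2) t by simp
  qed
  ultimately show ?thesis using that[OF b(1)] d_pos by fastforce
qed

text \<open>Additivity of \<open>d\<close> makes both summands of a proper decomposition smaller, so decomposing terminates.\<close>

lemma decomposition_induct [consumes 1, case_names zero indec biprod]:
  assumes "X \<in> Ob"
    and "\<And>X. X \<in> Ob \<Longrightarrow> \<not> nonzero X \<Longrightarrow> P X"
    and "\<And>X. indec X \<Longrightarrow> P X"
    and "\<And>X A B i j p q. biprod X A B i j p q \<Longrightarrow> P A \<Longrightarrow> P B \<Longrightarrow> P X"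
  shows "P X"
  using assms(1)
proof (induction "d X" arbitrary: X rule: less_induct)
  case less
  show ?case
  proof (cases "nonzero X \<and> \<not> indec X")
    case True
    then obtain A B i j p q where b: "biprod X A B i j p q" "d A < d X" "d B < d X"
      using decomposable_biprod by metis
    show ?thesis using assms(4)[OF b(1) less(1)[OF b(2)] less(1)[OF b(3)]] biprodD[OF b(1)] by blast
  qed (use assms(2,3) less in blast)
qed

text \<open>
  Every object is the sum of a part all of whose indecomposable summands avoid \<open>S\<close> and a part all of whose
  indecomposable summands lie in \<open>S\<close>; \<open>t\<close> is the projector onto the former.  The two properties of \<open>t\<close> avoid
  any mention of a decomposition, which keeps them easy to carry through the induction.
\<close>

lemma splitting:
  assumes "M \<in> Ob"
  shows "\<exists>t\<in>hom M M. t \<cdot> t = t \<and>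
    (\<forall>f. arr f \<longrightarrow> dom f = M \<longrightarrow> (\<forall>X g. indec X \<and> \<not> S X \<and> g \<in> hom X M \<longrightarrow> f \<cdot> g = zr X (cod f)) \<longrightarrow> f \<cdot> t = zr M (cod f)) \<and>
    (\<forall>f. arr f \<longrightarrow> cod f = M \<longrightarrow> (\<forall>X g. indec X \<and> S X \<and> g \<in> hom M X \<longrightarrow> g \<cdot> f = zr (dom f) X) \<longrightarrow> t \<cdot> f = f)"
    (is "\<exists>t\<in>hom M M. ?Q M t")
  using assms
proof (induction M rule: decomposition_induct)
  case (zero M)
  have "zr M M \<cdot> f = f" if "arr f" "cod f = M" for f
    using zero_objD(2)[of M f] zero that by simp
  then show ?case using zero by (intro bexI[of _ "zr M M"]) auto
next
  case (indec M)
  note M = indecD(1)[OF indec]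
  show ?case
  proof (cases "S M")
    case True
    have "zr M M \<cdot> f = f" if f: "arr f" "cod f = M"
      "\<forall>X g. indec X \<and> S X \<and> g \<in> hom M X \<longrightarrow> g \<cdot> f = zr (dom f) X" for f
      using f(3)[rule_format, of M "idn M"] f(1,2) indec True M by (simp add: idn_left)
    then show ?thesis using M by (intro bexI[of _ "zr M M"]) auto
  next
    case False
    have "f \<cdot> idn M = zr M (cod f)" if f: "arr f" "dom f = M"
      "\<forall>X g. indec X \<and> \<not> S X \<and> g \<in> hom X M \<longrightarrow> f \<cdot> g = zr X (cod f)" for f
      using f(3)[rule_format, of M "idn M"] f(1,2) indec False M by (simp add: idn_right)
    then show ?thesis using M by (intro bexI[of _ "idn M"]) (auto simp: idn_left)
  qed
next
  case (biprod M A B i j p q)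
  note b = biprodD[OF biprod(1)]
  obtain u where u: "u \<in> hom A A" "?Q A u" using biprod(2) by blast
  obtain v where v: "v \<in> hom B B" "?Q B v" using biprod(3) by blast
  have uv: "arr u" "dom u = A" "cod u = A" "arr v" "dom v = B" "cod v = B" using u(1) v(1) by auto
  have uu: "u \<cdot> u = u" and vv: "v \<cdot> v = v" using u(2) v(2) by auto
  let ?t = "i \<cdot> u \<cdot> p \<^bold>+ j \<cdot> v \<cdot> q"
  have t: "?t \<in> hom M M" using b uv by simp
  have tt: "?t \<cdot> ?t = ?t"
    using b(1-12) b(18-20) uv by (simp add: distl distr comp_assoc reassoc[OF b(13)] reassoc[OF b(14)] reassoc[OF b(15)]
        reassoc[OF b(16)] add_zr zr_add idn_left reassoc[OF uu] reassoc[OF vv])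
  have 1: "f \<cdot> ?t = zr M (cod f)" if f: "arr f" "dom f = M"
    and z: "\<And>X g. indec X \<Longrightarrow> \<not> S X \<Longrightarrow> g \<in> hom X M \<Longrightarrow> f \<cdot> g = zr X (cod f)" for f
  proof -
    have "f \<cdot> i \<cdot> u = zr A (cod (f \<cdot> i))"
    proof (rule u(2)[THEN conjunct2, THEN conjunct1, rule_format])
      show "f \<cdot> i \<cdot> g = zr X (cod (f \<cdot> i))" if "indec X \<and> \<not> S X \<and> g \<in> hom X A" for X g
        using z[of X "i \<cdot> g"] that f b by (simp add: comp_assoc)
    qed (use f b in auto)
    moreover have "f \<cdot> j \<cdot> v = zr B (cod (f \<cdot> j))"
    proof (rule v(2)[THEN conjunct2, THEN conjunct1, rule_format])
      show "f \<cdot> j \<cdot> g = zr X (cod (f \<cdot> j))" if "indec X \<and> \<not> S X \<and> g \<in> hom X B" for X g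
        using z[of X "j \<cdot> g"] that f b by (simp add: comp_assoc)
    qed (use f b in auto)
    moreover have "f \<cdot> ?t = f \<cdot> i \<cdot> u \<cdot> p \<^bold>+ f \<cdot> j \<cdot> v \<cdot> q" by (simp add: distl comp_assoc)
    ultimately show ?thesis using f b by (simp add: add_zr)
  qed
  have 2: "?t \<cdot> f = f" if f: "arr f" "cod f = M"
    and z: "\<And>X g. indec X \<Longrightarrow> S X \<Longrightarrow> g \<in> hom M X \<Longrightarrow> g \<cdot> f = zr (dom f) X" for f
  proof -
    have "u \<cdot> (p \<cdot> f) = p \<cdot> f"
    proof (rule u(2)[THEN conjunct2, THEN conjunct2, rule_format])
      show "g \<cdot> (p \<cdot> f) = zr (dom (p \<cdot> f)) X" if "indec X \<and> S X \<and> g \<in> hom A X" for X g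
        using z[of X "g \<cdot> p"] that f b by (simp add: comp_assoc)
    qed (use f b in auto)
    moreover have "v \<cdot> (q \<cdot> f) = q \<cdot> f"
    proof (rule v(2)[THEN conjunct2, THEN conjunct2, rule_format])
      show "g \<cdot> (q \<cdot> f) = zr (dom (q \<cdot> f)) X" if "indec X \<and> S X \<and> g \<in> hom B X" for X g
        using z[of X "g \<cdot> q"] that f b by (simp add: comp_assoc)
    qed (use f b in auto)
    ultimately show ?thesis using biprod_decomp_right[OF biprod(1) f] by (simp add: distr comp_assoc)
  qed
  show ?case using t tt 1 2 by blast
qed

lemma projective_retract:
  assumes P: "projective P" and e: "arr e" "dom e = P" "cod e = N" and m: "arr m" "dom m = N" "cod m = P"
    and em: "e \<cdot> m = idn N"
  shows "projective N"
  unfolding projective_def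
proof (intro conjI allI impI)
  show "N \<in> Ob" using e by auto
  fix g f assume f: "epi g \<and> arr f \<and> dom f = N \<and> cod f = cod g"
  then obtain x where x: "arr x" "dom x = P" "cod x = dom g" "g \<cdot> x = f \<cdot> e"
    using projectiveD[OF P, of g "f \<cdot> e"] e by auto
  have "g \<cdot> (x \<cdot> m) = f" using f em by (simp add: comp_assoc[symmetric] x(4)) (simp add: comp_assoc idn_right)
  then show "\<exists>h\<in>hom N (dom g). g \<cdot> h = f" using x m by (intro bexI[of _ "x \<cdot> m"]) auto
qed

text \<open>
  A weak form of Schanuel's lemma: if one presentation of \<open>X\<close> by a projective has a projective kernel, then
  every such presentation has.  The second kernel is exhibited as a retract of a sum of projectives.
\<close>

lemma schanuel:
  assumes s: "ses P1 i P0 p X" "projective P1" "projective P0" and s': "ses N j P q X" "projective P"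
  shows "projective N"
  unfolding projective_def
proof (intro conjI allI impI)
  note sd = sesD[OF s(1)] and sd' = sesD[OF s'(1)]
  show "N \<in> Ob" by (rule sd')
  obtain a where a: "arr a" "dom a = P" "cod a = P0" "p \<cdot> a = q"
    using projectiveD[OF s'(2) sd(8), of q] sd sd' by auto
  obtain b where b: "arr b" "dom b = P0" "cod b = P" "q \<cdot> b = p"
    using projectiveD[OF s(3) sd'(8), of p] sd sd' by auto
  have "p \<cdot> (a \<cdot> j) = zr N X" using sd' by (simp add: reassoc[OF a(4)])
  then obtain \<alpha> where \<alpha>: "arr \<alpha>" "dom \<alpha> = N" "cod \<alpha> = P1" "i \<cdot> \<alpha> = a \<cdot> j"
    using ses_ker[OF s(1), of "a \<cdot> j"] a sd' by auto
  have "q \<cdot> (b \<cdot> i) = zr P1 X" using sd by (simp add: reassoc[OF b(4)])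
  then obtain \<beta> where \<beta>: "arr \<beta>" "dom \<beta> = P1" "cod \<beta> = N" "j \<cdot> \<beta> = b \<cdot> i"
    using ses_ker[OF s'(1), of "b \<cdot> i"] b sd by auto
  have "q \<cdot> (idn P \<^bold>+ \<^bold>- (b \<cdot> a)) = zr P X"
    using a b sd' by (simp add: distl comp_neg reassoc[OF b(4)] idn_right add_neg)
  then obtain \<gamma> where \<gamma>: "arr \<gamma>" "dom \<gamma> = P" "cod \<gamma> = N" "j \<cdot> \<gamma> = idn P \<^bold>+ \<^bold>- (b \<cdot> a)"
    using ses_ker[OF s'(1), of "idn P \<^bold>+ \<^bold>- (b \<cdot> a)"] a b sd' by auto
  have "j \<cdot> (\<beta> \<cdot> \<alpha> \<^bold>+ \<gamma> \<cdot> j) = j \<cdot> idn N"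
    using a(1-3) b(1-3) \<alpha>(1-3) \<beta>(1-3) \<gamma>(1-3) sd' sd(1-3)
    by (simp add: distl distr reassoc[OF \<beta>(4)] reassoc[OF \<gamma>(4)] comp_assoc \<alpha>(4) neg_comp idn_left idn_right
      add_lcomm[of "b \<cdot> (a \<cdot> j)"] add_neg add_zr)
  then have id: "\<beta> \<cdot> \<alpha> \<^bold>+ \<gamma> \<cdot> j = idn N"
    using mono_cancel[OF sd'(7), of "\<beta> \<cdot> \<alpha> \<^bold>+ \<gamma> \<cdot> j" "idn N"] \<alpha>(1-3) \<beta>(1-3) \<gamma>(1-3) sd' by simp
  fix g f assume f: "epi g \<and> arr f \<and> dom f = N \<and> cod f = cod g"
  then have fa: "arr f" "dom f = N" "cod f = cod g" "arr g" using epi_arr by auto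
  obtain u where u: "arr u" "dom u = P1" "cod u = dom g" "g \<cdot> u = f \<cdot> \<beta>"
    using projectiveD[OF s(2), of g "f \<cdot> \<beta>"] f \<beta> by auto
  obtain v where v: "arr v" "dom v = P" "cod v = dom g" "g \<cdot> v = f \<cdot> \<gamma>"
    using projectiveD[OF s'(2), of g "f \<cdot> \<gamma>"] f \<gamma> by auto
  have "g \<cdot> (u \<cdot> \<alpha> \<^bold>+ v \<cdot> j) = f \<cdot> (\<beta> \<cdot> \<alpha> \<^bold>+ \<gamma> \<cdot> j)"
    by (simp add: distl reassoc[OF u(4)] reassoc[OF v(4)] comp_assoc)
  also have "\<dots> = f" unfolding id using fa by (simp add: idn_right)
  finally show "\<exists>h\<in>hom N (dom g). g \<cdot> h = f"
    using u v \<alpha> sd' by (intro bexI[of _ "u \<cdot> \<alpha> \<^bold>+ v \<cdot> j"]) auto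
qed

text \<open>
  A short exact sequence is pushed out along a map out of its first term.  This replaces the group of
  extensions: the extension of \<open>Z\<close> by \<open>T\<close> obtained from \<open>f\<close> splits exactly if \<open>f\<close> extends along \<open>j\<close>.
\<close>

lemma pushout:
  assumes s: "ses N j P q Z" and f: "arr f" "dom f = N" "cod f = T"
  obtains M \<iota> v w where "ses T \<iota> M v Z" "arr w" "dom w = P" "cod w = M" "v \<cdot> w = q" "w \<cdot> j = \<iota> \<cdot> f"
proof -
  note s' = sesD[OF s]
  have T: "T \<in> Ob" using f by auto
  obtain S iP iT pP pT where b0: "biprod S P T iP iT pP pT" using biprod_ex[OF s'(11) T] by blast
  note b = biprodD[OF b0]
  define u where "u = iP \<cdot> j \<^bold>+ \<^bold>- (iT \<cdot> f)"
  have u: "arr u" "dom u = N" "cod u = S" using b f s' unfolding u_def by auto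
  have pu: "pP \<cdot> u = j" unfolding u_def using b(1-12) f s'
    by (simp add: distl comp_neg reassoc[OF b(13)] reassoc[OF b(16)] idn_left add_zr T)
  have "mono u" using mono_right[of u pP] u b pu s'(7) by simp
  then obtain M c where c: "ses N u S c M" using mono_ses u by metis
  note c' = sesD[OF c]
  have "(q \<cdot> pP) \<cdot> u = zr N Z" using s'(9) by (simp add: comp_assoc pu)
  then obtain v where v: "arr v" "dom v = M" "cod v = Z" "v \<cdot> c = q \<cdot> pP"
    using ses_coker[OF c, of "q \<cdot> pP"] b s' by auto
  have wj: "c \<cdot> iP \<cdot> j = c \<cdot> iT \<cdot> f"
  proof -
    have "c \<cdot> iP \<cdot> j \<^bold>+ \<^bold>- (c \<cdot> iT \<cdot> f) = zr N M"
      using c'(9) b c'(1-6) f s' unfolding u_def by (simp add: distl comp_neg comp_assoc)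
    then show ?thesis using diff_eq_zrD[of "c \<cdot> iP \<cdot> j" N M "c \<cdot> iT \<cdot> f"] b c'(1-6) f s' by simp
  qed
  have epq: "epi (q \<cdot> pP)"
    using epi_comp[OF split_epi[of iP P S pP]] s' b by simp
  have epv: "epi v" using epi_left[of c v] v c' epq by simp
  have "g = zr (dom g) T" if g: "arr g" "cod g = T" "c \<cdot> iT \<cdot> g = zr (dom g) M" for g
  proof -
    obtain x where x: "arr x" "dom x = dom g" "cod x = N" "u \<cdot> x = iT \<cdot> g"
      using ses_ker[OF c, of "iT \<cdot> g"] g b by (auto simp: comp_assoc)
    have "j \<cdot> x = pP \<cdot> (u \<cdot> x)" by (simp add: reassoc[OF pu])
    also have "\<dots> = zr (dom g) P" unfolding x(4) using b g by (simp add: reassoc[OF b(16)])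
    finally have "x = zr (dom g) N" using monoD[OF s'(7), of x] x(1-3) s' by simp
    then have "iT \<cdot> g = zr (dom g) S" using x(4) u g by simp
    then have "pT \<cdot> (iT \<cdot> g) = zr (dom g) T" using b(1-12) g(1,2) by simp
    then show ?thesis using g(1,2) by (simp add: reassoc[OF b(14)] idn_left)
  qed
  then have mono: "mono (c \<cdot> iT)" unfolding mono_def using b c' by (auto simp: comp_assoc)
  have "ses T (c \<cdot> iT) M v Z"
  proof (rule mono_coker_ses[OF mono _ _ epv])
    show "v \<cdot> (c \<cdot> iT) = zr T Z" using s' b by (simp add: reassoc[OF v(4)] comp_assoc)
    fix g assume g: "arr g" "dom g = M" "g \<cdot> (c \<cdot> iT) = zr T (cod g)"
    have "g \<cdot> (c \<cdot> iP \<cdot> j) = zr N (cod g)" unfolding wj using f g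
      by (simp add: comp_assoc) (metis comp_assoc zr_comp cod_Ob)
    then obtain x where x: "arr x" "dom x = Z" "cod x = cod g" "x \<cdot> q = g \<cdot> c \<cdot> iP"
      using ses_coker[OF s, of "g \<cdot> c \<cdot> iP"] g c'(1-6) b by (auto simp: comp_assoc)
    have "x \<cdot> v \<cdot> c = g \<cdot> c"
    proof -
      have "g \<cdot> c = g \<cdot> c \<cdot> iP \<cdot> pP \<^bold>+ g \<cdot> c \<cdot> iT \<cdot> pT"
        using biprod_decomp_left[OF b0, of "g \<cdot> c"] g(1,2) c' by simp
      also have "g \<cdot> c \<cdot> iT = zr T (cod g)" using g(3) by (simp add: comp_assoc)
      also have "g \<cdot> c \<cdot> iP \<cdot> pP \<^bold>+ zr T (cod g) \<cdot> pT = g \<cdot> c \<cdot> iP \<cdot> pP" using g(1,2) b c' by (simp add: add_zr)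
      also have "\<dots> = x \<cdot> v \<cdot> c" unfolding x(4)[symmetric] by (simp add: comp_assoc v(4))
      finally show ?thesis by simp
    qed
    then have "x \<cdot> v = g" using epi_cancel[OF c'(8), of "x \<cdot> v" g] x(1-3) v(1-3) g(1,2) c' by simp
    then show "\<exists>h\<in>hom Z (cod g). h \<cdot> v = g" using x by (intro bexI[of _ x]) auto
  qed (use b c' v in auto)
  moreover have "v \<cdot> (c \<cdot> iP) = q" using b s' by (simp add: reassoc[OF v(4)] comp_assoc idn_right)
  ultimately show ?thesis using that[of "c \<cdot> iT" M v "c \<cdot> iP"] b c' wj by simp
qed

end


section \<open>Paths from injective objects\<close>

context preadditive_cat
begin

lemma biprod_projective:
  assumes b0: "biprod M A B i j p q" and A: "projective A" and B: "projective B" shows "projective M"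
  unfolding projective_def
proof (intro conjI allI impI)
  note b = biprodD[OF b0]
  show "M \<in> Ob" by (rule b)
  fix g f assume f: "epi g \<and> arr f \<and> dom f = M \<and> cod f = cod g"
  then have f': "epi g" "arr f" "dom f = M" "cod f = cod g" by auto
  obtain x where x: "arr x" "dom x = A" "cod x = dom g" "g \<cdot> x = f \<cdot> i"
    using projectiveD[OF A f'(1), of "f \<cdot> i"] f' b by auto
  obtain y where y: "arr y" "dom y = B" "cod y = dom g" "g \<cdot> y = f \<cdot> j"
    using projectiveD[OF B f'(1), of "f \<cdot> j"] f' b by auto
  have "g \<cdot> (x \<cdot> p \<^bold>+ y \<cdot> q) = f \<cdot> i \<cdot> p \<^bold>+ f \<cdot> j \<cdot> q"
    by (simp only: distl comp_assoc[symmetric] x(4) y(4))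
  also have "\<dots> = f" using biprod_decomp_left[OF b0 f'(2,3)] by simp
  finally show "\<exists>h\<in>hom M (dom g). g \<cdot> h = f" using x y b by (intro bexI[of _ "x \<cdot> p \<^bold>+ y \<cdot> q"]) auto
qed

end

context length_abelian_cat
begin

text \<open>
  The Grothendieck group has rank at most \<open>n\<close>: the classes of any \<open>n + 1\<close> objects are linearly dependent, tested
  on additive functions with values in the integers.
\<close>

definition rank_le :: "nat \<Rightarrow> bool" where
  "rank_le n \<longleftrightarrow> (\<forall>X. (\<forall>i\<le>n. X i \<in> Ob) \<longrightarrow>
     (\<exists>c :: nat \<Rightarrow> int. (\<exists>i\<le>n. c i \<noteq> 0) \<and> (\<forall>\<phi>. additive \<phi> \<longrightarrow> (\<Sum>i\<le>n. c i * \<phi> (X i)) = 0)))"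

text \<open>This is the power with exponent \<open>n + 1\<close>; the zeroth power would depend on the object.\<close>

primrec pow :: "'b \<Rightarrow> nat \<Rightarrow> 'b" where
  "pow f 0 = f" | "pow f (Suc n) = pow f n \<cdot> f"

lemma pow_arr: "f \<in> hom X X \<Longrightarrow> arr (pow f n) \<and> dom (pow f n) = X \<and> cod (pow f n) = X"
  by (induction n) auto

lemma pow_add: "pow f m \<cdot> pow f n = pow f (Suc (m + n))"
  by (induction n) (simp_all add: comp_assoc[symmetric])

text \<open>
  Fitting's lemma.  Choose a power \<open>f\<^sup>n = m e\<close> whose image \<open>J\<close> is as small as possible.  Then \<open>e m\<close> is an
  automorphism of \<open>J\<close>, so \<open>m v e\<close> with the inverse \<open>v\<close> of \<open>e m\<close> is an idempotent, which is \<open>0\<close> or \<open>1\<close>.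
\<close>

lemma fitting:
  assumes X: "indec X" and f: "f \<in> hom X X" and nz: "\<And>n. pow f n \<noteq> zr X X"
  shows "iso f"
proof -
  let ?im = "\<lambda>n k. \<exists>J e m. epi e \<and> mono m \<and> dom e = X \<and> cod e = J \<and> dom m = J \<and> cod m = X \<and> m \<cdot> e = pow f n \<and> d J = k"
  define k where "k = (LEAST k. \<exists>n. ?im n k)"
  have pa: "arr (pow f 0)" "dom (pow f 0) = X" "cod (pow f 0) = X" using f by auto
  obtain J0 e0 m0 where "epi e0" "mono m0" "dom e0 = X" "cod e0 = J0" "dom m0 = J0" "cod m0 = X" "m0 \<cdot> e0 = pow f 0"
    using image_factor[OF pa(1)] unfolding pa by blast
  then have "?im 0 (d J0)" by (intro exI conjI) (assumption | rule refl)+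
  then have ex: "\<exists>k n. ?im n k" by blast
  have k: "\<exists>n. ?im n k" unfolding k_def by (rule LeastI_ex[OF ex])
  have kle: "k \<le> k'" if "\<exists>n. ?im n k'" for k' using that unfolding k_def by (rule Least_le)
  obtain n J e m where em: "epi e" "mono m" "dom e = X" "cod e = J" "dom m = J" "cod m = X" "m \<cdot> e = pow f n" "d J = k"
    using k by blast
  have a: "arr e" "arr m" using em epi_arr mono_arr by auto
  have J: "J \<in> Ob" using a em by auto
  obtain J' e' m' where em': "epi e'" "mono m'" "dom e' = J" "cod e' = J'" "dom m' = J'" "cod m' = J" "m' \<cdot> e' = e \<cdot> m"
    "arr e'" "arr m'"
    using image_factor[of "e \<cdot> m"] a em by (metis comp_arr comp_dom comp_cod)
  have "?im (Suc (n + n)) (d J')"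
  proof (intro exI conjI)
    show "epi (e' \<cdot> e)" "mono (m \<cdot> m')" using em em' epi_comp mono_comp by auto
    have "m \<cdot> m' \<cdot> (e' \<cdot> e) = pow f n \<cdot> pow f n" unfolding em(7)[symmetric]
      by (simp add: comp_assoc reassoc[OF em'(7)])
    then show "m \<cdot> m' \<cdot> (e' \<cdot> e) = pow f (Suc (n + n))" by (simp only: pow_add)
  qed (use em em' a in auto)
  then have "k \<le> d J'" by (rule kle[OF exI])
  moreover have "d J' \<le> d J" using d_mono[OF em'(2)] em' by simp
  ultimately have dJ: "d J' = d J" using em(8) by simp
  have "iso e'" using epi_d_eq_iso[OF em'(1)] em' dJ by simp
  moreover have "iso m'" using mono_d_eq_iso[OF em'(2)] em' dJ by simp
  ultimately have "iso (m' \<cdot> e')" using iso_comp em' by metis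
  then obtain v where v: "arr v" "dom v = J" "cod v = J" "v \<cdot> (e \<cdot> m) = idn J" "(e \<cdot> m) \<cdot> v = idn J"
    unfolding em'(7) using a em by (metis isoE comp_dom comp_cod)
  define t where "t = m \<cdot> (v \<cdot> e)"
  have t: "t \<in> hom X X" unfolding t_def using a em v by auto
  have "t \<cdot> t = m \<cdot> (v \<cdot> (e \<cdot> m) \<cdot> (v \<cdot> e))" unfolding t_def by (simp only: comp_assoc)
  also have "\<dots> = t" unfolding v(4) t_def using a em(3-6) v(1-3) by (simp add: idn_left)
  finally have "t = zr X X \<or> t = idn X" using indecD(4)[OF X t] by blast
  then show ?thesis
  proof
    assume "t = zr X X"
    then have "e \<cdot> (m \<cdot> (v \<cdot> e)) = zr X J" unfolding t_def using a em(3-6) indecD(1)[OF X] by simp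
    moreover have "e \<cdot> (m \<cdot> (v \<cdot> e)) = (e \<cdot> m) \<cdot> v \<cdot> e" by (simp only: comp_assoc)
    ultimately have "e = zr X J" unfolding v(5) using a em(3-6) by (simp add: idn_left)
    then have "m \<cdot> e = zr X X" using a em(3-6) indecD(1)[OF X] by simp
    then show ?thesis using em(7) nz by simp
  next
    assume t1: "t = idn X"
    have fa: "arr f" "dom f = X" "cod f = X" using f by auto
    have s: "v \<cdot> e \<in> hom X J" "m \<in> hom J X" "e \<in> hom X J" "m \<cdot> v \<in> hom J X"
      using a em v by auto
    have ime: "iso m" using split_epi_mono_iso[OF s(1,2) _ em(2)] t1 unfolding t_def by blast
    have mve: "(m \<cdot> v) \<cdot> e = idn X" using t1 unfolding t_def by (simp add: comp_assoc)
    have ie: "iso e" using split_mono_epi_iso[OF s(4,3) mve em(1)] .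
    have ip: "iso (pow f n)" using iso_comp[OF ie ime] em by simp
    show ?thesis
    proof (cases n)
      case (Suc n')
      obtain g where g: "arr g" "dom g = X" "cod g = X" "g \<cdot> pow f n = idn X" "pow f n \<cdot> g = idn X"
        using ip pow_arr[OF f, of n] by (metis isoE)
      have p: "arr (pow f n')" "dom (pow f n') = X" "cod (pow f n') = X" using pow_arr[OF f, of n'] by auto
      have "(g \<cdot> pow f n') \<cdot> f = idn X" using g(4) Suc by (simp add: comp_assoc)
      moreover have "pow f (Suc n') = f \<cdot> pow f n'"
        using pow_add[of f 0 n'] by simp
      then have "f \<cdot> (pow f n' \<cdot> g) = idn X" using g(5) Suc by (simp add: comp_assoc)
      then have "epi f" using split_epi[of "pow f n' \<cdot> g" X X f] fa g p by simp
      ultimately show ?thesis using split_mono_epi_iso[of "g \<cdot> pow f n'" X X f] fa g p by simp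
    qed (use ip in simp)
  qed
qed

lemma zero_projective: assumes "X \<in> Ob" "\<not> nonzero X" shows "projective X"
  unfolding projective_def
proof (intro conjI allI impI)
  fix g f assume f: "epi g \<and> arr f \<and> dom f = X \<and> cod f = cod g"
  then have "f = zr X (cod g)" using zero_objD(1)[OF assms(2), of f] by simp
  then show "\<exists>h\<in>hom X (dom g). g \<cdot> h = f" using f assms(1) epi_arr[of g] by (intro bexI[of _ "zr X (dom g)"]) auto
qed (rule assms(1))

lemma zero_injective: assumes "X \<in> Ob" "\<not> nonzero X" shows "injective X"
  unfolding injective_def
proof (intro conjI allI impI)
  fix g f assume f: "mono g \<and> arr f \<and> cod f = X \<and> dom f = dom g"
  then have "f = zr (dom g) X" using zero_objD(2)[OF assms(2), of f] by simp
  then show "\<exists>h\<in>hom (cod g) X. h \<cdot> g = f" using f assms(1) mono_arr[of g] by (intro bexI[of _ "zr (cod g) X"]) auto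
qed (rule assms(1))

lemma projective_pd1: assumes "projective X" shows "pd1 X"
proof -
  have X: "X \<in> Ob" using assms by (simp add: projective_def)
  obtain K k where s: "ses K k X (idn X) X" using epi_ses[OF idn_epi[OF X]] X by auto
  have "d K = 0" using d_add[OF s] by simp
  then have "projective K" using zero_projective d_zero sesD(10)[OF s] by blast
  then show ?thesis unfolding pd1_def using s assms by blast
qed

lemma injective_id1: assumes "injective X" shows "id1 X"
proof -
  have X: "X \<in> Ob" using assms by (simp add: injective_def)
  obtain K k where s: "ses X (idn X) X k K" using mono_ses[OF idn_mono[OF X]] X by auto
  have "d K = 0" using d_add[OF s] by simp
  then have "injective K" using zero_injective d_zero sesD(12)[OF s] by blast
  then show ?thesis unfolding id1_def using s assms by blast
qed

lemma injective_retract: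
  assumes Q: "injective Q" and e: "arr e" "dom e = Q" "cod e = N" and m: "arr m" "dom m = N" "cod m = Q"
    and em: "e \<cdot> m = idn N"
  shows "injective N"
  unfolding injective_def
proof (intro conjI allI impI)
  show "N \<in> Ob" using e by auto
  fix g f assume f: "mono g \<and> arr f \<and> cod f = N \<and> dom f = dom g"
  then obtain x where x: "arr x" "dom x = cod g" "cod x = Q" "x \<cdot> g = m \<cdot> f"
    using injectiveD[OF Q, of g "m \<cdot> f"] m by auto
  have "e \<cdot> x \<cdot> g = f" using f by (simp add: comp_assoc x(4) reassoc[OF em] idn_left)
  then show "\<exists>h\<in>hom (cod g) N. h \<cdot> g = f" using x e by (intro bexI[of _ "e \<cdot> x"]) auto
qed

text \<open>
  A nonzero map on a biproduct is nonzero on one of the summands, and summands of injectives are injective.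
\<close>

lemma indec_injective_map:
  assumes "injective Q" "f \<in> hom Q X" "f \<noteq> zr Q X"
  shows "\<exists>I g. indec I \<and> injective I \<and> g \<in> hom I X \<and> g \<noteq> zr I X"
proof -
  have "Q \<in> Ob" using assms by auto
  then show ?thesis using assms
  proof (induction Q arbitrary: f rule: decomposition_induct)
    case (zero Q)
    then show ?case using zero_objD(1)[of Q f] by auto
  next
    case (biprod Q A B i j p q)
    note b = biprodD[OF biprod(1)]
    have f: "arr f" "dom f = Q" "cod f = X" using biprod by auto
    have A: "injective A" using injective_retract[OF biprod(4), of p A i] b by simp
    have B: "injective B" using injective_retract[OF biprod(4), of q B j] b by simp
    show ?case
    proof (cases "f \<cdot> i = zr A X")
      case True
      have "f \<cdot> j \<noteq> zr B X"
      proof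
        assume "f \<cdot> j = zr B X"
        then have "f = zr A X \<cdot> p \<^bold>+ zr B X \<cdot> q"
          using biprod_decomp_left[OF biprod(1) f(1,2)] True by (simp only:)
        also have "\<dots> = zr Q X" using b(1-12) b(18-20) f cod_Ob[OF f(1)] by (simp add: add_zr)
        finally have "f = zr Q X" .
        then show False using biprod by simp
      qed
      then show ?thesis using biprod(3)[OF B, of "f \<cdot> j"] b f by auto
    next
      case False
      then show ?thesis using biprod(2)[OF A, of "f \<cdot> i"] b f by auto
    qed
  qed blast
qed

text \<open>
  Let \<open>0 \<rightarrow> N \<rightarrow> P \<rightarrow> W \<rightarrow> 0\<close> be exact with \<open>P\<close> projective.  As \<open>N\<close> is not projective, some \<open>b : N \<rightarrow> Y'\<close> does not
  lift along an epi \<open>a : Y \<rightarrow> Y'\<close>.  Embedding the kernel of \<open>a\<close> into an injective \<open>Q\<close> with cokernel \<open>C\<close> turns this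
  obstruction into a nonsplit extension of \<open>W\<close> by \<open>C\<close>, a quotient of an injective.  If no indecomposable with a
  nonzero map to \<open>W\<close> received a nonzero map from an injective, the middle term would split into a part without
  maps to \<open>W\<close> and a part that \<open>Q\<close>, hence \<open>C\<close>, does not map to; this splits the extension.  The argument replaces
  the familiar criterion by the Auslander--Reiten translate.
\<close>

lemma not_pd1_injective_predecessor:
  assumes W: "indec W" "\<not> pd1 W"
  shows "\<exists>I X g v. indec I \<and> injective I \<and> indec X \<and> g \<in> hom I X \<and> g \<noteq> zr I X \<and> v \<in> hom X W \<and> v \<noteq> zr X W"
proof (rule ccontr)
  assume no: "\<not> ?thesis"
  have WO: "W \<in> Ob" using indecD(1)[OF W(1)] .
  obtain P q where P: "projective P" "arr q" "dom q = P" "cod q = W" "epi q"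
    using enough_proj[OF WO] by auto
  obtain N j where s: "ses N j P q W" using epi_ses[OF P(5)] P by metis
  note s' = sesD[OF s]
  have nP: "\<not> projective N" using W(2) s P(1) unfolding pd1_def by blast
  then obtain a b where ab: "epi a" "arr b" "dom b = N" "cod b = cod a"
    and nl: "\<And>h. h \<in> hom N (dom a) \<Longrightarrow> a \<cdot> h \<noteq> b"
    unfolding projective_def using s' by blast
  have aa: "arr a" using ab epi_arr by auto
  \<comment> \<open>\<open>b : N \<rightarrow> Y'\<close> does not lift along \<open>a : Y \<rightarrow> Y'\<close>\<close>
  define Y where "Y = dom a"
  define Y' where "Y' = cod a"
  have aY: "arr a" "dom a = Y" "cod a = Y'" "dom b = N" "cod b = Y'" and YO: "Y \<in> Ob" "Y' \<in> Ob"
    using aa ab unfolding Y_def Y'_def by auto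
  obtain R k where k: "ses R k Y a Y'" using epi_ses[OF ab(1)] aY by metis
  note k' = sesD[OF k]
  obtain Q \<kappa> where Q: "injective Q" "arr \<kappa>" "dom \<kappa> = R" "cod \<kappa> = Q" "mono \<kappa>"
    using enough_inj[OF k'(10)] by auto
  obtain C c where c: "ses R \<kappa> Q c C" using mono_ses[OF Q(5)] Q by metis
  note c' = sesD[OF c]
  obtain l where l: "arr l" "dom l = Y" "cod l = Q" "l \<cdot> k = \<kappa>"
    using injectiveD[OF Q(1) k'(7), of \<kappa>] Q k' by auto
  have "c \<cdot> l \<cdot> k = zr R C" using c' by (simp add: comp_assoc l(4))
  then obtain \<mu> where \<mu>: "arr \<mu>" "dom \<mu> = Y'" "cod \<mu> = C" "\<mu> \<cdot> a = c \<cdot> l"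
    using ses_coker[OF k, of "c \<cdot> l"] l c' by auto
  define g where "g = \<mu> \<cdot> b"
  have g: "arr g" "dom g = N" "cod g = C" unfolding g_def using \<mu> ab aY by auto
  have noext: "x \<cdot> j \<noteq> g" if x: "arr x" "dom x = P" "cod x = C" for x
  proof
    assume xj: "x \<cdot> j = g"
    obtain y where y: "arr y" "dom y = P" "cod y = Q" "c \<cdot> y = x"
      using projectiveD[OF P(1) c'(8), of x] x c' by auto
    \<comment> \<open>\<open>Y\<close> is the pullback of \<open>\<mu>\<close> and \<open>c\<close>: it is a kernel of \<open>(\<mu>, -c)\<close>\<close>
    obtain S i1 i2 p1 p2 where b0: "biprod S Y' Q i1 i2 p1 p2" using biprod_ex[OF YO(2) c'(11)] by blast
    note b' = biprodD[OF b0]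
    define \<alpha> where "\<alpha> = i1 \<cdot> a \<^bold>+ i2 \<cdot> l"
    have \<alpha>: "arr \<alpha>" "dom \<alpha> = Y" "cod \<alpha> = S" unfolding \<alpha>_def using b' aY l by auto
    have p1\<alpha>: "p1 \<cdot> \<alpha> = a"
      unfolding \<alpha>_def using b'(1-12) b'(18-20) aY l YO by (simp add: distl reassoc[OF b'(13)] reassoc[OF b'(16)] idn_left add_zr)
    have p2\<alpha>: "p2 \<cdot> \<alpha> = l"
      unfolding \<alpha>_def using b'(1-12) b'(18-20) aY l YO by (simp add: distl reassoc[OF b'(14)] reassoc[OF b'(15)] idn_left zr_add)
    define \<delta> where "\<delta> = \<mu> \<cdot> p1 \<^bold>+ \<^bold>- (c \<cdot> p2)"
    have \<delta>: "arr \<delta>" "dom \<delta> = S" "cod \<delta> = C" unfolding \<delta>_def using b' \<mu> c' by auto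
    have \<delta>i2: "\<delta> \<cdot> i2 = \<^bold>- c"
      unfolding \<delta>_def using b'(1-12) b'(18-20) \<mu>(1-3) c'
      by (simp add: distr neg_comp comp_assoc b'(14) b'(16) zr_add idn_right)
    have m\<alpha>: "mono \<alpha>"
      unfolding mono_def
    proof (intro conjI allI impI)
      fix z assume z: "arr z \<and> cod z = dom \<alpha> \<and> \<alpha> \<cdot> z = zr (dom z) (cod \<alpha>)"
      have "a \<cdot> z = p1 \<cdot> (\<alpha> \<cdot> z)" by (simp add: reassoc[OF p1\<alpha>])
      also have "\<dots> = zr (dom z) Y'" using z \<alpha> b' by simp
      finally have az: "a \<cdot> z = zr (dom z) Y'" .
      have "l \<cdot> z = p2 \<cdot> (\<alpha> \<cdot> z)" by (simp add: reassoc[OF p2\<alpha>])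
      also have "\<dots> = zr (dom z) Q" using z \<alpha> b' by simp
      finally have lz: "l \<cdot> z = zr (dom z) Q" .
      obtain r where r: "arr r" "dom r = dom z" "cod r = R" "k \<cdot> r = z"
        using ses_ker[OF k, of z] z \<alpha> az by auto
      have "\<kappa> \<cdot> r = zr (dom r) Q" using lz unfolding r(4)[symmetric] l(4)[symmetric] using r(1-3) k' by (simp add: comp_assoc)
      then have "r = zr (dom z) R" using monoD[OF Q(5), of r] r Q by simp
      then show "z = zr (dom z) (dom \<alpha>)" using r(4) z k' \<alpha> by (metis comp_zr dom_Ob)
    qed (use \<alpha> in simp)
    have e\<delta>: "epi \<delta>"
      unfolding epi_def
    proof (intro conjI allI impI)
      fix z assume z: "arr z \<and> dom z = cod \<delta> \<and> z \<cdot> \<delta> = zr (dom \<delta>) (cod z)"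
      have "z \<cdot> \<^bold>- c = (z \<cdot> \<delta>) \<cdot> i2" by (simp add: comp_assoc \<delta>i2)
      also have "\<dots> = zr Q (cod z)" using z \<delta> b' by simp
      finally have "\<^bold>- (\<^bold>- (z \<cdot> c)) = zr Q (cod z)" using z c' \<delta> by (simp add: comp_neg)
      then have "z \<cdot> c = zr Q (cod z)" using z c' \<delta> by simp
      then show "z = zr (cod \<delta>) (cod z)" using epiD[OF c'(8), of z] z c' \<delta> by simp
    qed (use \<delta> in simp)
    have \<delta>\<alpha>: "\<delta> \<cdot> \<alpha> = zr Y C"
      unfolding \<delta>_def using \<mu> c'(1-6) l(1-3) b'(1-12) aY \<alpha>
      by (simp add: distr neg_comp comp_assoc p1\<alpha> p2\<alpha> add_neg)
    have "ses Y \<alpha> S \<delta> C"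
    proof (rule mono_coker_ses[OF m\<alpha> \<alpha>(2,3) e\<delta> \<delta>(2,3) \<delta>\<alpha>])
      fix z assume z: "arr z" "dom z = S" "z \<cdot> \<alpha> = zr Y (cod z)"
      have z\<alpha>: "z \<cdot> i1 \<cdot> a \<^bold>+ z \<cdot> i2 \<cdot> l = zr Y (cod z)"
        using z(3) unfolding \<alpha>_def by (simp add: distl comp_assoc)
      have "z \<cdot> i2 \<cdot> \<kappa> = (z \<cdot> i1 \<cdot> a \<^bold>+ z \<cdot> i2 \<cdot> l) \<cdot> k"
        using z(1,2) b'(1-12) k'(1-6) l(1-3) aY Q(2-4) k'(9-12) c'(11)
        by (simp add: distr comp_assoc l(4) k'(9) zr_add)
      also have "\<dots> = zr R (cod z)" unfolding z\<alpha> using k' z by simp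
      finally obtain x where x: "arr x" "dom x = C" "cod x = cod z" "x \<cdot> c = z \<cdot> i2"
        using ses_coker[OF c, of "z \<cdot> i2"] z(1,2) b' by auto
      have "(z \<cdot> i1 \<^bold>+ x \<cdot> \<mu>) \<cdot> a = zr Y (cod z)"
        using z\<alpha> x(4)[symmetric] by (simp add: distr comp_assoc \<mu>(4))
      then have "z \<cdot> i1 \<^bold>+ x \<cdot> \<mu> = zr Y' (cod z)"
        using epiD[OF ab(1), of "z \<cdot> i1 \<^bold>+ x \<cdot> \<mu>"] z(1,2) x(1-3) b'(1-12) \<mu>(1-3) aY by simp
      then have xi: "z \<cdot> i1 = \<^bold>- (x \<cdot> \<mu>)"
        using neg_unique[of "x \<cdot> \<mu>" "z \<cdot> i1"] z(1,2) x(1-3) b'(1-12) \<mu>(1-3) by (simp add: add_comm)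
      have "\<^bold>- x \<cdot> \<delta> = \<^bold>- (x \<cdot> \<mu>) \<cdot> p1 \<^bold>+ (x \<cdot> c) \<cdot> p2"
        unfolding \<delta>_def using x(1-3) b'(1-12) \<mu>(1-3) c'(1-6)
        by (simp add: distl comp_neg neg_comp neg_sum comp_assoc)
      also have "\<dots> = z" unfolding xi[symmetric] x(4) using biprod_decomp_left[OF b0 z(1,2)] by simp
      finally show "\<exists>h\<in>hom C (cod z). h \<cdot> \<delta> = z" using x by (intro bexI[of _ "\<^bold>- x"]) auto
    qed
    note ker = ses_ker[OF this]
    have "\<delta> \<cdot> (i1 \<cdot> b \<^bold>+ i2 \<cdot> (y \<cdot> j)) = \<mu> \<cdot> b \<^bold>+ \<^bold>- (c \<cdot> (y \<cdot> j))"
      unfolding \<delta>_def using b'(1-12) b'(18-20) ab aY y(1-3) s'(1-6) \<mu>(1-3) c'(1-6) YO s'(10) c'(12)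
      by (simp add: distl distr neg_comp comp_assoc reassoc[OF b'(13)] reassoc[OF b'(14)] reassoc[OF b'(15)]
          reassoc[OF b'(16)] idn_left add_zr zr_add)
    also have "\<mu> \<cdot> b = c \<cdot> (y \<cdot> j)" using xj unfolding g_def y(4)[symmetric] by (simp add: comp_assoc)
    finally have "\<delta> \<cdot> (i1 \<cdot> b \<^bold>+ i2 \<cdot> (y \<cdot> j)) = zr N C"
      using c'(1-6) y(1-3) s'(1-6) by (simp add: add_neg)
    then obtain h where h: "arr h" "dom h = N" "cod h = Y" "\<alpha> \<cdot> h = i1 \<cdot> b \<^bold>+ i2 \<cdot> (y \<cdot> j)"
      using ker[of "i1 \<cdot> b \<^bold>+ i2 \<cdot> (y \<cdot> j)"] b'(1-12) ab aY y(1-3) s'(1-6) by auto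
    have "a \<cdot> h = p1 \<cdot> (i1 \<cdot> b \<^bold>+ i2 \<cdot> (y \<cdot> j))" unfolding h(4)[symmetric] by (simp add: reassoc[OF p1\<alpha>])
    also have "\<dots> = b" using b'(1-12) b'(18-20) ab aY y(1-3) s'(1-6) YO s'(10)
      by (simp add: distl reassoc[OF b'(13)] reassoc[OF b'(16)] idn_left add_zr)
    finally show False using nl[of h] h aY by simp
  qed
  \<comment> \<open>the extension of \<open>W\<close> by \<open>C\<close> that corresponds to \<open>g\<close> does not split, but its middle term does\<close>
  obtain E \<iota> v w where E: "ses C \<iota> E v W" "arr w" "dom w = P" "cod w = E" "v \<cdot> w = q" "w \<cdot> j = \<iota> \<cdot> g"
    using pushout[OF s g] by metis
  note E' = sesD[OF E(1)]
  obtain t where t: "arr t" "dom t = E" "cod t = E" "t \<cdot> t = t"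
    and t1: "\<And>f. arr f \<Longrightarrow> dom f = E \<Longrightarrow> (\<And>X g. indec X \<Longrightarrow> \<not> (\<exists>v\<in>hom X W. v \<noteq> zr X W) \<Longrightarrow> g \<in> hom X E \<Longrightarrow> f \<cdot> g = zr X (cod f)) \<Longrightarrow> f \<cdot> t = zr E (cod f)"
    and t2: "\<And>f. arr f \<Longrightarrow> cod f = E \<Longrightarrow> (\<And>X g. indec X \<Longrightarrow> (\<exists>v\<in>hom X W. v \<noteq> zr X W) \<Longrightarrow> g \<in> hom E X \<Longrightarrow> g \<cdot> f = zr (dom f) X) \<Longrightarrow> t \<cdot> f = f"
    using splitting[OF E'(11), of "\<lambda>X. \<exists>v\<in>hom X W. v \<noteq> zr X W"] by (auto simp del: bex_simps)
  have "v \<cdot> t = zr E W"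
    using t1[of v] E' by (metis comp_arr comp_cod comp_dom mem_hom)
  then obtain r where r: "arr r" "dom r = E" "cod r = C" "\<iota> \<cdot> r = t"
    using ses_ker[OF E(1), of t] t by auto
  have "t \<cdot> (\<iota> \<cdot> c) = \<iota> \<cdot> c"
  proof (rule t2)
    fix X y assume X: "indec X" "\<exists>v\<in>hom X W. v \<noteq> zr X W" "y \<in> hom E X"
    show "y \<cdot> (\<iota> \<cdot> c) = zr (dom (\<iota> \<cdot> c)) X"
    proof (rule ccontr)
      assume "y \<cdot> (\<iota> \<cdot> c) \<noteq> zr (dom (\<iota> \<cdot> c)) X"
      then have "\<exists>I g. indec I \<and> injective I \<and> g \<in> hom I X \<and> g \<noteq> zr I X"
        using indec_injective_map[OF Q(1), of "y \<cdot> (\<iota> \<cdot> c)" X] X c' E' by simp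
      then show False using no X by blast
    qed
  qed (use c' E' in auto)
  then have "(t \<cdot> \<iota>) \<cdot> c = \<iota> \<cdot> c" by (simp only: comp_assoc)
  then have "t \<cdot> \<iota> = \<iota>" using epi_cancel[OF c'(8), of "t \<cdot> \<iota>" \<iota>] t E' c' by simp
  then have "\<iota> \<cdot> (r \<cdot> \<iota>) = \<iota> \<cdot> idn C" using E' by (simp add: reassoc[OF r(4)] idn_right)
  then have ri: "r \<cdot> \<iota> = idn C" using mono_cancel[OF E'(7), of "r \<cdot> \<iota>" "idn C"] r E' by simp
  have "r \<cdot> w \<cdot> j = g" using g by (simp add: comp_assoc E(6) reassoc[OF ri] idn_left)
  then show False using noext[of "r \<cdot> w"] r E by simp
qed

end


section \<open>Ext-injective objects relative to the left part\<close>

text \<open>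
  \<open>S\<close> plays the role of the left part: a set of indecomposables of projective dimension at most one that is
  closed under predecessors.
\<close>

locale left_part = length_abelian_cat +
  fixes S :: "'a \<Rightarrow> bool"
  assumes S_indec: "S X \<Longrightarrow> indec X"
    and S_closed: "S Y \<Longrightarrow> indec X \<Longrightarrow> f \<in> hom X Y \<Longrightarrow> f \<noteq> zr X Y \<Longrightarrow> S X"
    and S_pd1: "S X \<Longrightarrow> pd1 X"
begin

text \<open>
  \<open>(torsion, free_part)\<close> is the split torsion pair whose torsion free indecomposables are those in \<open>S\<close>.
\<close>

definition free_part :: "'a \<Rightarrow> bool" where
  "free_part M \<longleftrightarrow> M \<in> Ob \<and> (\<forall>X f. indec X \<and> f \<in> hom X M \<and> f \<noteq> zr X M \<longrightarrow> S X)"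

definition torsion :: "'a \<Rightarrow> bool" where
  "torsion T \<longleftrightarrow> T \<in> Ob \<and> (\<forall>Z f. free_part Z \<and> f \<in> hom T Z \<longrightarrow> f = zr T Z)"

lemma free_partD:
  assumes "free_part M" "indec X" "arr f" "dom f = X" "cod f = M" "\<not> S X" shows "f = zr X M"
proof (rule ccontr)
  assume n: "f \<noteq> zr X M"
  have "f \<in> hom X M" using assms by simp
  then show False using assms(1,2,6) n unfolding free_part_def by blast
qed

lemma torsionD:
  assumes "torsion T" "free_part Z" "arr f" "dom f = T" "cod f = Z" shows "f = zr T Z"
proof -
  have "f \<in> hom T Z" using assms by simp
  then show ?thesis using assms(1,2) unfolding torsion_def by blast
qed

lemma S_free: "S X \<Longrightarrow> free_part X"
  unfolding free_part_def using S_closed indecD(1)[OF S_indec] by blast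

lemma free_sub: assumes m: "mono m" and c: "free_part (cod m)" shows "free_part (dom m)"
proof -
  have a: "arr m" using m mono_arr by auto
  have "S X" if X: "indec X" "arr f" "dom f = X" "cod f = dom m" "f \<noteq> zr X (dom m)" for X f
  proof -
    have "m \<cdot> f \<noteq> zr X (cod m)" using monoD[OF m, of f] X by auto
    moreover have "m \<cdot> f \<in> hom X (cod m)" using a X by simp
    ultimately show ?thesis using c X(1) unfolding free_part_def by blast
  qed
  then show ?thesis unfolding free_part_def using a by auto
qed

text \<open>
  The pair splits because \<open>S\<close> is closed under predecessors: there is no nonzero map from an indecomposable
  outside \<open>S\<close> to one in \<open>S\<close>.
\<close>

lemma torsion_split:
  assumes M: "M \<in> Ob"
  obtains T L i j p q where "biprod M T L i j p q" "torsion T" "free_part L"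
proof -
  obtain t where t: "t \<in> hom M M" "t \<cdot> t = t"
    and t1: "\<And>f. arr f \<Longrightarrow> dom f = M \<Longrightarrow> (\<And>X g. indec X \<Longrightarrow> \<not> S X \<Longrightarrow> g \<in> hom X M \<Longrightarrow> f \<cdot> g = zr X (cod f)) \<Longrightarrow> f \<cdot> t = zr M (cod f)"
    and t2: "\<And>f. arr f \<Longrightarrow> cod f = M \<Longrightarrow> (\<And>X g. indec X \<Longrightarrow> S X \<Longrightarrow> g \<in> hom M X \<Longrightarrow> g \<cdot> f = zr (dom f) X) \<Longrightarrow> t \<cdot> f = f"
    using splitting[OF M, of S] by auto
  obtain T L i j p q where b0: "biprod M T L i j p q" "i \<cdot> p = t" using idempotent_biprod[OF t] by metis
  note b = biprodD[OF b0(1)]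
  have "f = zr T Z" if f: "free_part Z" "arr f" "dom f = T" "cod f = Z" for f Z
  proof -
    have "f \<cdot> p \<cdot> t = zr M (cod (f \<cdot> p))"
    proof (rule t1)
      fix X g assume X: "indec X" "\<not> S X" "g \<in> hom X M"
      then have "f \<cdot> p \<cdot> g = zr X Z" using free_partD[OF f(1) X(1), of "f \<cdot> p \<cdot> g"] f b by simp
      then show "f \<cdot> p \<cdot> g = zr X (cod (f \<cdot> p))" using f b by simp
    qed (use f b in auto)
    then have "f \<cdot> p = zr M Z" unfolding b0(2)[symmetric] using f b(1-12)
      by (simp add: comp_assoc reassoc[OF b(13)] idn_left)
    then have "f \<cdot> p \<cdot> i = zr T Z" using f b(1-12) cod_Ob[OF f(2)] by simp
    then show ?thesis using f by (simp add: comp_assoc b(13) idn_right)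
  qed
  then have T: "torsion T" unfolding torsion_def using b by auto
  have "S X" if X: "indec X" "arr f" "dom f = X" "cod f = L" "f \<noteq> zr X L" for X f
  proof (rule ccontr)
    assume nS: "\<not> S X"
    have jf: "arr (j \<cdot> f)" "dom (j \<cdot> f) = X" "cod (j \<cdot> f) = M" using X b by auto
    have "t \<cdot> (j \<cdot> f) = j \<cdot> f"
    proof (rule t2)
      fix Y g assume Y: "indec Y" "S Y" "g \<in> hom M Y"
      have "g \<cdot> (j \<cdot> f) \<in> hom X Y" using jf Y by simp
      then show "g \<cdot> (j \<cdot> f) = zr (dom (j \<cdot> f)) Y" using S_closed[OF Y(2) X(1)] nS jf by auto
    qed (use jf in auto)
    moreover have "t \<cdot> (j \<cdot> f) = zr X M" unfolding b0(2)[symmetric] using X b(1-12) b(18-20) indecD(1)[OF X(1)]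
      by (simp add: comp_assoc reassoc[OF b(16)])
    ultimately have "j \<cdot> f = zr X M" by simp
    then have "q \<cdot> (j \<cdot> f) = zr X L" using b(1-12) indecD(1)[OF X(1)] by simp
    then show False using X by (simp add: reassoc[OF b(14)] idn_left)
  qed
  then have "free_part L" unfolding free_part_def using b by auto
  then show ?thesis using that[OF b0(1) T] by blast
qed

text \<open>
  Torsion free objects are sums of members of \<open>S\<close>, so they have projective dimension at most one; by Schanuel's
  lemma every syzygy witnesses this.
\<close>

lemma free_part_syzygy:
  assumes Z: "free_part Z"
  shows "ses N j P q Z \<Longrightarrow> projective P \<Longrightarrow> projective N"
proof -
  have "Z \<in> Ob" using Z by (simp add: free_part_def)
  then show "ses N j P q Z \<Longrightarrow> projective P \<Longrightarrow> projective N" using Z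
  proof (induction Z arbitrary: N j P q rule: decomposition_induct)
    case (zero Z)
    have i: "iso j" using ses_right_zero_iso[OF zero(3,2)] .
    note s = sesD[OF zero(3)]
    obtain g where "arr g" "dom g = P" "cod g = N" "g \<cdot> j = idn N" using i s by (metis isoE)
    then show ?case using projective_retract[OF zero(4), of g N j] s by simp
  next
    case (indec Z)
    have "idn Z \<in> hom Z Z" "idn Z \<noteq> zr Z Z" using indecD[OF indec(1)] by auto
    then have "S Z" using indec(1,4) unfolding free_part_def by blast
    then obtain P1 i P0 p where "ses P1 i P0 p Z" "projective P1" "projective P0" using S_pd1 unfolding pd1_def by blast
    then show ?case using schanuel indec by blast
  next
    case (biprod Z A B i1 i2 p1 p2)
    note b = biprodD[OF biprod(1)] and s = sesD[OF biprod(4)]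
    have "mono i1" "mono i2" using split_mono[of p1 Z A i1] split_mono[of p2 Z B i2] b by auto
    then have AB: "free_part A" "free_part B" using free_sub[of i1] free_sub[of i2] b biprod(6) by auto
    have ep: "epi p1" "epi p2" using split_epi[of i1 A Z p1] split_epi[of i2 B Z p2] b by auto
    have "epi (p1 \<cdot> q)" using epi_comp[OF s(8) ep(1)] s b by simp
    then obtain N1 j1 where s1: "ses N1 j1 P (p1 \<cdot> q) A" using epi_ses[of "p1 \<cdot> q"] s b by auto
    note s1' = sesD[OF s1]
    have P1: "projective N1" using biprod(2)[OF s1 biprod(5) AB(1)] .
    have "p1 \<cdot> q \<cdot> j = zr N A" using s b by (simp add: comp_assoc)
    then obtain j' where j': "arr j'" "dom j' = N" "cod j' = N1" "j1 \<cdot> j' = j"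
      using ses_ker[OF s1, of j] s by auto
    let ?q = "p2 \<cdot> q \<cdot> j1"
    have qa: "arr ?q" "dom ?q = N1" "cod ?q = B" using s b s1' by auto
    have eq: "epi ?q"
      unfolding epi_def
    proof (intro conjI allI impI)
      fix w assume w: "arr w \<and> dom w = cod ?q \<and> w \<cdot> ?q = zr (dom ?q) (cod w)"
      then have w': "arr w" "dom w = B" "w \<cdot> p2 \<cdot> q \<cdot> j1 = zr N1 (cod w)" using qa by (auto simp: comp_assoc)
      obtain x where x: "arr x" "dom x = A" "cod x = cod w" "x \<cdot> (p1 \<cdot> q) = w \<cdot> p2 \<cdot> q"
        using ses_coker[OF s1, of "w \<cdot> p2 \<cdot> q"] w' s b by auto
      have "x \<cdot> p1 \<cdot> q = w \<cdot> p2 \<cdot> q" using x(4) by (simp add: comp_assoc)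
      then have "x \<cdot> p1 = w \<cdot> p2" using epi_cancel[OF s(8), of "x \<cdot> p1" "w \<cdot> p2"] x(1-3) w'(1,2) b s by simp
      then have "w \<cdot> p2 \<cdot> i2 = x \<cdot> p1 \<cdot> i2" by simp
      then have "w = x \<cdot> (p1 \<cdot> i2)" using b(14) w' by (simp add: comp_assoc idn_right)
      then show "w = zr (cod ?q) (cod w)" unfolding b(16) using x(1-3) qa b by simp
    qed (use qa in simp)
    have "ses N j' N1 ?q B"
    proof (rule epi_ker_ses)
      show "mono j'" using mono_right[of j' j1] j' s1' s by simp
      show "?q \<cdot> j' = zr N B" using s b by (simp add: comp_assoc j'(4))
      fix g assume g: "arr g" "cod g = N1" "?q \<cdot> g = zr (dom g) B"
      have "q \<cdot> j1 \<cdot> g = i1 \<cdot> (p1 \<cdot> (q \<cdot> j1 \<cdot> g)) \<^bold>+ i2 \<cdot> (p2 \<cdot> (q \<cdot> j1 \<cdot> g))"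
        using biprod_decomp_right[OF biprod(1), of "q \<cdot> j1 \<cdot> g"] g(1,2) s s1' by simp
      also have "p2 \<cdot> (q \<cdot> j1 \<cdot> g) = zr (dom g) B" using g(3) by (simp only: comp_assoc)
      also have "p1 \<cdot> (q \<cdot> j1 \<cdot> g) = (p1 \<cdot> q \<cdot> j1) \<cdot> g" by (simp only: comp_assoc)
      also have "\<dots> = zr (dom g) A" using s1' g(1,2) by simp
      also have "i1 \<cdot> zr (dom g) A \<^bold>+ i2 \<cdot> zr (dom g) B = zr (dom g) Z" using b(1-12) b(18-20) g(1) by (simp add: add_zr)
      finally have "q \<cdot> (j1 \<cdot> g) = zr (dom (j1 \<cdot> g)) Z" using g s1' by (simp add: comp_assoc)
      then obtain x where x: "arr x" "dom x = dom g" "cod x = N" "j \<cdot> x = j1 \<cdot> g"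
        using ses_ker[OF biprod(4), of "j1 \<cdot> g"] g s1' by auto
      have "j1 \<cdot> (j' \<cdot> x) = j1 \<cdot> g" using x(4) by (simp add: reassoc[OF j'(4)])
      then have "j' \<cdot> x = g" using mono_cancel[OF s1'(7), of "j' \<cdot> x" g] x(1-3) j'(1-3) g(1,2) s1' by simp
      then show "\<exists>h\<in>hom (dom g) N. j' \<cdot> h = g" using x by (intro bexI[of _ x]) auto
    qed (use j' qa eq in auto)
    then show ?case using biprod(3)[OF _ P1 AB(2)] by blast
  qed
qed

text \<open>
  There is no nonsplit extension of a torsion free object by \<open>E\<close>, phrased with a projective presentation of the
  torsion free object instead of the group of extensions.
\<close>

definition ext_inj :: "'a \<Rightarrow> bool" where
  "ext_inj E \<longleftrightarrow> E \<in> Ob \<and> (\<forall>N j P q Z f. ses N j P q Z \<and> projective P \<and> free_part Z \<and> arr f \<and> dom f = N \<and> cod f = E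
     \<longrightarrow> (\<exists>g\<in>hom P E. g \<cdot> j = f))"

lemma ext_injD:
  assumes "ext_inj E" "ses N j P q Z" "projective P" "free_part Z" "arr f" "dom f = N" "cod f = E"
  shows "\<exists>g. arr g \<and> dom g = P \<and> cod g = E \<and> g \<cdot> j = f"
proof -
  have "\<exists>g\<in>hom P E. g \<cdot> j = f" using assms unfolding ext_inj_def by blast
  then show ?thesis by auto
qed

lemma injective_ext_inj: assumes "injective I" shows "ext_inj I"
  unfolding ext_inj_def
proof (intro conjI allI impI)
  show "I \<in> Ob" using assms by (simp add: injective_def)
  fix N j P q Z f assume "ses N j P q Z \<and> projective P \<and> free_part Z \<and> arr f \<and> dom f = N \<and> cod f = I"
  then show "\<exists>g\<in>hom P I. g \<cdot> j = f" using injectiveD[OF assms, of j f] sesD[of N j P q Z] by auto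
qed

text \<open>
  The functor \<open>Ext (Z, -)\<close> is right exact for torsion free \<open>Z\<close>: a map from the projective syzygy of \<open>Z\<close> to the
  quotient lifts to \<open>E\<close>.
\<close>

lemma quotient_ext_inj:
  assumes E: "ext_inj E" and e: "epi e" "dom e = E" "cod e = J"
  shows "ext_inj J"
  unfolding ext_inj_def
proof (intro conjI allI impI)
  have ea: "arr e" using e epi_arr by auto
  show "J \<in> Ob" using e ea by auto
  fix N j P q Z f assume as: "ses N j P q Z \<and> projective P \<and> free_part Z \<and> arr f \<and> dom f = N \<and> cod f = J"
  then have s: "ses N j P q Z" and P: "projective P" and Z: "free_part Z" and f: "arr f" "dom f = N" "cod f = J" by auto
  have "projective N" using free_part_syzygy[OF Z s P] .
  then obtain x where x: "arr x" "dom x = N" "cod x = E" "e \<cdot> x = f" using projectiveD[of N e f] e f by auto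
  obtain y where y: "arr y" "dom y = P" "cod y = E" "y \<cdot> j = x" using ext_injD[OF E s P Z, of x] x by auto
  show "\<exists>g\<in>hom P J. g \<cdot> j = f" using y e ea x by (intro bexI[of _ "e \<cdot> y"]) (auto simp: comp_assoc)
qed

text \<open>
  In an extension \<open>M\<close> of \<open>Z\<close> by \<open>T\<close>, the inclusion of \<open>T\<close> lands in the torsion summand of \<open>M\<close>, and this summand
  vanishes in \<open>Z\<close>, so the two agree and \<open>T\<close> is a direct summand.
\<close>

lemma torsion_ext_inj: assumes T: "torsion T" shows "ext_inj T"
  unfolding ext_inj_def
proof (intro conjI allI impI)
  show TO: "T \<in> Ob" using T by (simp add: torsion_def)
  fix N j P q Z f assume as: "ses N j P q Z \<and> projective P \<and> free_part Z \<and> arr f \<and> dom f = N \<and> cod f = T"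
  then have s: "ses N j P q Z" and Z: "free_part Z" and f: "arr f" "dom f = N" "cod f = T" by auto
  obtain M \<iota> v w where M: "ses T \<iota> M v Z" "arr w" "dom w = P" "cod w = M" "v \<cdot> w = q" "w \<cdot> j = \<iota> \<cdot> f"
    using pushout[OF s f] by metis
  note M' = sesD[OF M(1)]
  obtain T' L i1 i2 p1 p2 where b0: "biprod M T' L i1 i2 p1 p2" "torsion T'" "free_part L"
    using torsion_split[OF M'(11)] by metis
  note b = biprodD[OF b0(1)]
  have "v \<cdot> i1 = zr T' Z" using torsionD[OF b0(2) Z, of "v \<cdot> i1"] M' b by simp
  then obtain r where r: "arr r" "dom r = T'" "cod r = T" "\<iota> \<cdot> r = i1" using ses_ker[OF M(1), of i1] b by auto
  have "p2 \<cdot> \<iota> = zr T L" using torsionD[OF T b0(3), of "p2 \<cdot> \<iota>"] M' b by simp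
  then have "\<iota> = i1 \<cdot> (p1 \<cdot> \<iota>) \<^bold>+ i2 \<cdot> zr T L" using biprod_decomp_right[OF b0(1), of \<iota>] M' by simp
  also have "\<dots> = i1 \<cdot> (p1 \<cdot> \<iota>)" using b(1-12) M' TO b(18-20) by (simp add: add_zr)
  finally have i: "i1 \<cdot> (p1 \<cdot> \<iota>) = \<iota>" by simp
  then have "\<iota> \<cdot> (r \<cdot> (p1 \<cdot> \<iota>)) = \<iota> \<cdot> idn T" using M' by (simp add: reassoc[OF r(4)] idn_right)
  then have ri: "r \<cdot> (p1 \<cdot> \<iota>) = idn T" using mono_cancel[OF M'(7), of "r \<cdot> (p1 \<cdot> \<iota>)" "idn T"] r(1-3) b M' TO by simp
  have "r \<cdot> p1 \<cdot> w \<cdot> j = r \<cdot> (p1 \<cdot> \<iota>) \<cdot> f" by (simp add: comp_assoc M(6))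
  also have "\<dots> = f" unfolding ri using f by (simp add: idn_left)
  finally show "\<exists>g\<in>hom P T. g \<cdot> j = f" using r b M by (intro bexI[of _ "r \<cdot> p1 \<cdot> w"]) auto
qed

lemma extension_ext_inj:
  assumes s: "ses J m X c C" and J: "ext_inj J" and C: "ext_inj C"
  shows "ext_inj X"
  unfolding ext_inj_def
proof (intro conjI allI impI)
  note s' = sesD[OF s]
  show "X \<in> Ob" by (rule s')
  fix N j P q Z f assume as: "ses N j P q Z \<and> projective P \<and> free_part Z \<and> arr f \<and> dom f = N \<and> cod f = X"
  then have t: "ses N j P q Z" and P: "projective P" and Z: "free_part Z" and f: "arr f" "dom f = N" "cod f = X" by auto
  note t' = sesD[OF t]
  obtain x where x: "arr x" "dom x = P" "cod x = C" "x \<cdot> j = c \<cdot> f" using ext_injD[OF C t P Z, of "c \<cdot> f"] f s' by auto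
  obtain y where y: "arr y" "dom y = P" "cod y = X" "c \<cdot> y = x" using projectiveD[OF P s'(8), of x] x s' by auto
  have "c \<cdot> (f \<^bold>+ \<^bold>- (y \<cdot> j)) = zr N C" using f y(1-3) s'(1-6) t'(1-6)
    by (simp add: distl comp_neg reassoc[OF y(4)] x(4) add_neg)
  then obtain g where g: "arr g" "dom g = N" "cod g = J" "m \<cdot> g = f \<^bold>+ \<^bold>- (y \<cdot> j)"
    using ses_ker[OF s, of "f \<^bold>+ \<^bold>- (y \<cdot> j)"] f y t' by auto
  obtain k where k: "arr k" "dom k = P" "cod k = J" "k \<cdot> j = g" using ext_injD[OF J t P Z g(1-3)] by auto
  have "(y \<^bold>+ m \<cdot> k) \<cdot> j = y \<cdot> j \<^bold>+ (f \<^bold>+ \<^bold>- (y \<cdot> j))" by (simp only: distr comp_assoc k(4) g(4))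
  also have "\<dots> = f" using f y t' by (simp add: add_lcomm[of "y \<cdot> j" f] add_neg add_zr)
  finally show "\<exists>g\<in>hom P X. g \<cdot> j = f" using y k s' by (intro bexI[of _ "y \<^bold>+ m \<cdot> k"]) auto
qed

text \<open>
  The key step.  Factor \<open>f\<close> through its image \<open>J\<close> and split its cokernel \<open>C\<close> into a torsion part \<open>T\<close> and a torsion
  free part \<open>L\<close>.  Both \<open>J\<close>, a quotient of \<open>E\<close>, and \<open>T\<close> are Ext-injective, so the kernel of \<open>X \<rightarrow> L\<close>, an
  extension of \<open>T\<close> by \<open>J\<close>, is so too and \<open>X \<rightarrow> L\<close> splits.  As \<open>X\<close> is indecomposable and \<open>f\<close> is nonzero, \<open>L = 0\<close>.
  Hence \<open>C\<close> is torsion: \<open>X\<close> is Ext-injective, and a map from \<open>X\<close> to a torsion free object that vanishes on \<open>J\<close>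
  factors through \<open>C\<close> and is zero.
\<close>

lemma ext_inj_successor:
  assumes E: "ext_inj E" and X: "S X" and f: "f \<in> hom E X" "f \<noteq> zr E X"
  shows "ext_inj X" and "free_part Z \<Longrightarrow> g \<in> hom X Z \<Longrightarrow> g \<cdot> f = zr E Z \<Longrightarrow> g = zr X Z"
proof -
  have fa: "arr f" "dom f = E" "cod f = X" using f by auto
  have Xi: "indec X" using S_indec X .
  obtain K k e J m C c where s0: "ses K k E e J" and s: "ses J m X c C" and me: "m \<cdot> e = f"
    using factor[OF fa(1)] fa by auto
  note s0' = sesD[OF s0] and s' = sesD[OF s]
  have J: "ext_inj J" using quotient_ext_inj[OF E s0'(8)] s0' by simp
  obtain T L iT iL pT pL where b0: "biprod C T L iT iL pT pL" and T: "torsion T" and L: "free_part L"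
    using torsion_split[OF s'(12)] by metis
  note b = biprodD[OF b0]
  have TI: "ext_inj T" using torsion_ext_inj[OF T] .
  have epL: "epi pL" using split_epi[of iL L C pL] b by simp
  let ?r = "pL \<cdot> c"
  have r: "arr ?r" "dom ?r = X" "cod ?r = L" using b s' by auto
  have er: "epi ?r" using epi_comp[OF s'(8) epL] s' b by simp
  \<comment> \<open>a section of \<open>X \<rightarrow> L\<close> is built on a projective \<open>P\<close> over \<open>L\<close>: lift, then correct the lift twice on the syzygy \<open>N\<close>, first by \<open>T\<close>, then by \<open>J\<close>\<close>
  obtain P \<pi> where P: "projective P" "arr \<pi>" "dom \<pi> = P" "cod \<pi> = L" "epi \<pi>"
    using enough_proj[OF b(20)] by auto
  obtain N j where t: "ses N j P \<pi> L" using epi_ses[OF P(5)] P by metis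
  note t' = sesD[OF t]
  obtain x where x: "arr x" "dom x = P" "cod x = X" "?r \<cdot> x = \<pi>" using projectiveD[OF P(1) er, of \<pi>] P r by auto
  obtain y where y: "arr y" "dom y = P" "cod y = T" "y \<cdot> j = pT \<cdot> c \<cdot> x \<cdot> j"
    using ext_injD[OF TI t P(1) L, of "pT \<cdot> c \<cdot> x \<cdot> j"] x b s' t' by auto
  obtain z where z: "arr z" "dom z = P" "cod z = X" "c \<cdot> z = iT \<cdot> y"
    using projectiveD[OF P(1) s'(8), of "iT \<cdot> y"] y b s' by auto
  let ?x = "x \<^bold>+ \<^bold>- z"
  have x': "arr ?x" "dom ?x = P" "cod ?x = X" using x z by auto
  have "pL \<cdot> (c \<cdot> z) = zr P L" unfolding z(4) using b y(1-3) by (simp add: reassoc[OF b(15)])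
  then have rx: "?r \<cdot> ?x = \<pi>" using x z(1-3) b(1-12) s'(1-6) P
    by (simp add: distl comp_neg comp_assoc add_zr t'(10-12))
  have cxj: "c \<cdot> (?x \<cdot> j) = zr N C"
  proof -
    have "c \<cdot> x \<cdot> j = iT \<cdot> (pT \<cdot> (c \<cdot> x \<cdot> j)) \<^bold>+ iL \<cdot> (pL \<cdot> (c \<cdot> x \<cdot> j))"
      using biprod_decomp_right[OF b0, of "c \<cdot> x \<cdot> j"] x s' t' by simp
    also have "pL \<cdot> (c \<cdot> x \<cdot> j) = zr N L" using t'(9) x(4) by (simp add: comp_assoc[symmetric])
    also have "pT \<cdot> (c \<cdot> x \<cdot> j) = y \<cdot> j" unfolding y(4) by (simp only: comp_assoc)
    also have "iT \<cdot> (y \<cdot> j) \<^bold>+ iL \<cdot> zr N L = iT \<cdot> y \<cdot> j"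
      using b(1-12) y(1-3) t' by (simp add: add_zr comp_assoc)
    also have "\<dots> = c \<cdot> z \<cdot> j" by (simp only: z(4))
    finally have "c \<cdot> (x \<cdot> j) = c \<cdot> (z \<cdot> j)" by (simp only: comp_assoc)
    then show ?thesis using x(1-3) z(1-3) s' t'(1-6) by (simp add: distl distr comp_neg neg_comp add_neg)
  qed
  then obtain k0 where k0: "arr k0" "dom k0 = N" "cod k0 = J" "m \<cdot> k0 = ?x \<cdot> j"
    using ses_ker[OF s, of "?x \<cdot> j"] x' t' by auto
  obtain k1 where k1: "arr k1" "dom k1 = P" "cod k1 = J" "k1 \<cdot> j = k0" using ext_injD[OF J t P(1) L k0(1-3)] by auto
  have "(?x \<^bold>+ \<^bold>- (m \<cdot> k1)) \<cdot> j = ?x \<cdot> j \<^bold>+ \<^bold>- (?x \<cdot> j)"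
    using x' k1(1-3) s' t' by (simp only: distr neg_comp comp_arr comp_dom comp_cod comp_assoc k1(4) k0(4))
  also have "\<dots> = zr N X" using add_neg[of "?x \<cdot> j"] x' t' by simp
  finally obtain \<sigma> where \<sigma>: "arr \<sigma>" "dom \<sigma> = L" "cod \<sigma> = X" "\<sigma> \<cdot> \<pi> = ?x \<^bold>+ \<^bold>- (m \<cdot> k1)"
    using ses_coker[OF t, of "?x \<^bold>+ \<^bold>- (m \<cdot> k1)"] x' k1 s' by auto
  have "?r \<cdot> (\<sigma> \<cdot> \<pi>) = ?r \<cdot> ?x \<^bold>+ ?r \<cdot> \<^bold>- (m \<cdot> k1)" unfolding \<sigma>(4) by (rule distl)
  also have "?r \<cdot> \<^bold>- (m \<cdot> k1) = \<^bold>- (?r \<cdot> (m \<cdot> k1))" using r k1(1-3) s' by (intro comp_neg) auto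
  also have "?r \<cdot> (m \<cdot> k1) = pL \<cdot> ((c \<cdot> m) \<cdot> k1)" by (simp only: comp_assoc)
  also have "?r \<cdot> ?x \<^bold>+ \<^bold>- (pL \<cdot> ((c \<cdot> m) \<cdot> k1)) = \<pi>" unfolding s'(9) rx using k1(1-3) s'(10-12) b(1-12) b(20) P t'(10,11) by (simp add: add_zr)
  finally have "(?r \<cdot> \<sigma>) \<cdot> \<pi> = idn L \<cdot> \<pi>" using P by (simp add: comp_assoc idn_left)
  then have rs: "?r \<cdot> \<sigma> = idn L" using epi_cancel[OF P(5), of "?r \<cdot> \<sigma>" "idn L"] r \<sigma>(1-3) P b(20) by simp
  have "\<sigma> \<cdot> ?r \<in> hom X X" using \<sigma> r by simp
  moreover have "\<sigma> \<cdot> ?r \<cdot> (\<sigma> \<cdot> ?r) = \<sigma> \<cdot> (?r \<cdot> \<sigma>) \<cdot> ?r" by (simp only: comp_assoc)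
  then have "\<sigma> \<cdot> ?r \<cdot> (\<sigma> \<cdot> ?r) = \<sigma> \<cdot> ?r" unfolding rs using \<sigma> by (simp add: idn_right)
  ultimately have "\<sigma> \<cdot> ?r = zr X X \<or> \<sigma> \<cdot> ?r = idn X" using indecD(4)[OF Xi] by blast
  moreover have "\<sigma> \<cdot> ?r \<noteq> idn X"
  proof
    assume 1: "\<sigma> \<cdot> ?r = idn X"
    have "f = \<sigma> \<cdot> ?r \<cdot> f" unfolding 1 using fa by (simp add: idn_left)
    also have "\<dots> = \<sigma> \<cdot> (pL \<cdot> (c \<cdot> m \<cdot> e))" unfolding me[symmetric] by (simp only: comp_assoc)
    also have "\<dots> = zr E X" using s' s0' b(1-12) b(20) \<sigma>(1-3) by simp
    finally show False using f by simp
  qed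
  ultimately have "\<sigma> \<cdot> ?r = zr X X" by blast
  then have "?r \<cdot> \<sigma> \<cdot> ?r = ?r \<cdot> zr X X" by (simp only: comp_assoc)
  then have "?r = zr X L" unfolding rs using r indecD(1)[OF Xi] by (simp add: idn_left)
  then have pL: "pL = zr C L" using epiD[OF s'(8), of pL] s' b by simp
  have ip: "iT \<cdot> pT = idn C" using b(17) b(1-12) b(18-20) unfolding pL by (simp add: add_zr)
  have C: "torsion C" unfolding torsion_def
  proof (intro conjI allI impI)
    fix Z g assume g: "free_part Z \<and> g \<in> hom C Z"
    then have g': "arr g" "dom g = C" "cod g = Z" "Z \<in> Ob" by auto
    have "g \<cdot> iT = zr T Z" using torsionD[OF T, of Z "g \<cdot> iT"] g g' b by simp
    then have "g \<cdot> iT \<cdot> pT = zr C Z" using b(1-12) g' by simp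
    then show "g = zr C Z" using g' by (simp add: comp_assoc ip idn_right)
  qed (rule s')
  show "ext_inj X" using extension_ext_inj[OF s J torsion_ext_inj[OF C]] .
  assume Z: "free_part Z" and g: "g \<in> hom X Z" "g \<cdot> f = zr E Z"
  have "g \<cdot> m \<cdot> e = zr E Z" using g(2) me by (simp add: comp_assoc)
  then have "g \<cdot> m = zr J Z" using epiD[OF s0'(8), of "g \<cdot> m"] g(1) s' s0' by simp
  then obtain g' where g': "arr g'" "dom g' = C" "cod g' = Z" "g' \<cdot> c = g" using ses_coker[OF s, of g] g(1) by auto
  have "g' = zr C Z" using torsionD[OF C Z g'(1-3)] .
  then show "g = zr X Z" using g'(4) g(1) s'(1-6) cod_Ob[of g] by auto
qed

end


section \<open>Paths inside the left part are short\<close>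

lemma relpow_converse: fixes r :: "('x \<times> 'x) set" shows "(r\<inverse>) ^^ n = (r ^^ n)\<inverse>"
proof (induction n)
  case (Suc n)
  have "(r ^^ Suc n)\<inverse> = (r O (r ^^ n))\<inverse>" by (simp add: relpow_commute)
  then show ?case using Suc by (simp add: converse_relcomp)
qed simp

context left_part
begin

lemma comp_nonzero:
  assumes "ext_inj E" "S X" "S Y" "arr f" "dom f = E" "cod f = X" "f \<noteq> zr E X"
    "arr g" "dom g = X" "cod g = Y" "g \<noteq> zr X Y"
  shows "g \<cdot> f \<noteq> zr E Y"
  using ext_inj_successor(2)[OF assms(1,2), of f Y g] S_free[OF assms(3)] assms by auto

text \<open>
  By the preceding section, all objects on the path are Ext-injective and no composite of maps between them is
  zero.  A nonzero map backwards would give a non-nilpotent endomorphism, hence by Fitting's lemma an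
  automorphism, that factors through an arrow \<open>f i\<close> of the path; this makes \<open>f i\<close> an isomorphism.  In a linear
  dependency of the classes of \<open>X 0, \<dots>, X n\<close> let \<open>m\<close> be the last index with nonzero coefficient.  The function
  \<open>\<phi>\<close> given by a projective resolution of \<open>X m\<close> is additive, and as the extension groups vanish, it takes the
  value \<open>h (X m) (X j)\<close> at \<open>X j\<close>.  This is zero for \<open>j < m\<close> and nonzero for \<open>j = m\<close>, a contradiction.
\<close>

lemma path_bound:
  assumes rk: "rank_le n"
    and S: "\<And>i. i \<le> s \<Longrightarrow> S (X i)" and E0: "ext_inj (X 0)"
    and f: "\<And>i. i < s \<Longrightarrow> f i \<in> hom (X i) (X (Suc i)) \<and> f i \<noteq> zr (X i) (X (Suc i)) \<and> \<not> iso (f i)"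
  shows "s < n"
proof (rule ccontr)
  assume "\<not> s < n"
  then have ns: "n \<le> s" by simp
  have O: "X i \<in> Ob" if "i \<le> s" for i using indecD(1)[OF S_indec[OF S[OF that]]] .
  have E: "ext_inj (X i)" if "i \<le> s" for i
    using that
  proof (induction i)
    case (Suc i)
    then show ?case using ext_inj_successor(1)[of "X i" "X (Suc i)" "f i"] S[of "Suc i"] f[of i] by simp
  qed (use E0 in simp)
  have A: "\<exists>u. arr u \<and> dom u = X i \<and> cod u = X j \<and> u \<noteq> zr (X i) (X j)" if "i \<le> j" "j \<le> s" for i j
    using that
  proof (induction j rule: dec_induct)
    case base
    then show ?case using indecD(1,2)[OF S_indec[OF S[of i]]] by (intro exI[of _ "idn (X i)"]) auto
  next
    case (step j)
    then obtain u where u: "arr u" "dom u = X i" "cod u = X j" "u \<noteq> zr (X i) (X j)" by auto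
    have j: "j < s" using step by simp
    have "f j \<cdot> u \<noteq> zr (X i) (X (Suc j))"
      using comp_nonzero[of "X i" "X j" "X (Suc j)" u "f j"] E[of i] S[of j] S[of "Suc j"] step(1,2) j u f[OF j] by simp
    then show ?case using u f[OF j] by (intro exI[of _ "f j \<cdot> u"]) auto
  qed
  \<comment> \<open>there are no nonzero maps backwards: they would close up to a non-nilpotent endomorphism factoring through \<open>f i\<close>\<close>
  have B: "g = zr (X j) (X i)" if ij: "i < j" "j \<le> s" and g: "arr g" "dom g = X j" "cod g = X i" for i j g
  proof (rule ccontr)
    assume gn: "g \<noteq> zr (X j) (X i)"
    have i: "i < s" "i \<le> s" "Suc i \<le> s" using ij by auto
    obtain u where u: "arr u" "dom u = X (Suc i)" "cod u = X j" "u \<noteq> zr (X (Suc i)) (X j)"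
      using A[of "Suc i" j] ij by auto
    note fi = f[OF i(1), simplified]
    define w where "w = g \<cdot> u"
    have w: "arr w" "dom w = X (Suc i)" "cod w = X i" unfolding w_def using u g by auto
    have wn: "w \<noteq> zr (X (Suc i)) (X i)" unfolding w_def
      using comp_nonzero[of "X (Suc i)" "X j" "X i" u g] E[OF i(3)] S[of j] S[of i] ij u g gn i by simp
    define v where "v = w \<cdot> f i"
    have v: "v \<in> hom (X i) (X i)" unfolding v_def using w fi by simp
    have vn: "v \<noteq> zr (X i) (X i)" unfolding v_def
      using comp_nonzero[of "X i" "X (Suc i)" "X i" "f i" w] E[OF i(2)] S[OF i(3)] S[OF i(2)] w wn fi by simp
    have "pow v k \<noteq> zr (X i) (X i)" for k
    proof (induction k)
      case (Suc k)
      then show ?case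
        using comp_nonzero[of "X i" "X i" "X i" v "pow v k"] E[OF i(2)] S[OF i(2)] v vn pow_arr[OF v, of k] by simp
    qed (use vn in simp)
    then have "iso v" using fitting[OF S_indec[OF S[OF i(2)]] v] by blast
    then obtain v' where v': "arr v'" "dom v' = X i" "cod v' = X i" "v' \<cdot> v = idn (X i)" using v by (auto elim!: isoE)
    define r where "r = v' \<cdot> w"
    have r: "arr r" "dom r = X (Suc i)" "cod r = X i" unfolding r_def using v' w by auto
    have rf: "r \<cdot> f i = idn (X i)" using v'(4) unfolding v_def r_def by (simp add: comp_assoc)
    have "f i \<cdot> r \<cdot> (f i \<cdot> r) = f i \<cdot> (r \<cdot> f i) \<cdot> r" by (simp only: comp_assoc)
    also have "\<dots> = f i \<cdot> r" unfolding rf using fi by (simp add: idn_right)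
    finally have "f i \<cdot> r = zr (X (Suc i)) (X (Suc i)) \<or> f i \<cdot> r = idn (X (Suc i))"
      using indecD(4)[OF S_indec[OF S[OF i(3)]], of "f i \<cdot> r"] fi r by auto
    then show False
    proof
      assume z: "f i \<cdot> r = zr (X (Suc i)) (X (Suc i))"
      have "f i = f i \<cdot> r \<cdot> f i" using fi by (simp add: comp_assoc rf idn_right)
      also have "\<dots> = zr (X i) (X (Suc i))" unfolding z using fi O[OF i(3)] by simp
      finally show False using fi by simp
    next
      assume "f i \<cdot> r = idn (X (Suc i))"
      then have "iso (f i)" unfolding iso_def using fi r rf by (auto intro!: bexI[of _ r])
      then show False using fi by simp
    qed
  qed
  have "\<forall>i\<le>n. X i \<in> Ob" using O ns by simp
  then obtain c :: "nat \<Rightarrow> int" where c: "\<exists>i\<le>n. c i \<noteq> 0" "\<And>\<phi>. additive \<phi> \<Longrightarrow> (\<Sum>i\<le>n. c i * \<phi> (X i)) = 0"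
    using rk unfolding rank_le_def by blast
  define m where "m = Max {i. i \<le> n \<and> c i \<noteq> 0}"
  have fin: "finite {i. i \<le> n \<and> c i \<noteq> 0}" by simp
  have "m \<in> {i. i \<le> n \<and> c i \<noteq> 0}" unfolding m_def using c(1) by (intro Max_in[OF fin]) auto
  then have m: "m \<le> n" "c m \<noteq> 0" by auto
  have mx: "c j = 0" if "m < j" "j \<le> n" for j
    using Max_ge[OF fin, of j] that unfolding m_def[symmetric] by force
  have ms: "m \<le> s" using m ns by simp
  obtain P1 i P0 p where P: "ses P1 i P0 p (X m)" "projective P1" "projective P0"
    using S_pd1[OF S[OF ms]] unfolding pd1_def by blast
  define \<phi> where "\<phi> Y = int (h P0 Y) - int (h P1 Y)" for Y
  have PO: "P1 \<in> Ob" "P0 \<in> Ob" using sesD[OF P(1)] by auto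
  have hP: "h P' M = h P' N + h P' Z" if s: "ses N j M q Z" and P': "projective P'" "P' \<in> Ob" for P' N j M q Z
  proof (rule h_right[OF s P'(2)])
    fix f assume "f \<in> hom P' Z"
    then have "\<exists>g. arr g \<and> dom g = P' \<and> cod g = dom q \<and> q \<cdot> g = f"
      using sesD(6)[OF s] by (intro projectiveD[OF P'(1) sesD(8)[OF s]]) simp_all
    then obtain g where "arr g" "dom g = P'" "cod g = dom q" "q \<cdot> g = f" by (elim exE conjE)
    then show "\<exists>g\<in>hom P' M. q \<cdot> g = f" using sesD(5)[OF s] by (intro bexI[of _ g]) simp_all
  qed
  have "additive \<phi>" unfolding additive_def
  proof (intro allI impI)
    fix N i M p Z assume s: "ses N i M p Z"
    show "\<phi> M = \<phi> N + \<phi> Z" unfolding \<phi>_def using hP[OF s P(2) PO(1)] hP[OF s P(3) PO(2)] by simp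
  qed
  then have sum0: "(\<Sum>i\<le>n. c i * \<phi> (X i)) = 0" by (rule c(2))
  have \<phi>h: "\<phi> (X j) = int (h (X m) (X j))" if j: "j \<le> n" for j
  proof -
    have js: "j \<le> s" using j ns by simp
    have "h P0 (X j) = h P1 (X j) + h (X m) (X j)"
    proof (rule h_left[OF P(1) O[OF js]])
      fix f assume "f \<in> hom P1 (X j)"
      then have "\<exists>g. arr g \<and> dom g = P0 \<and> cod g = X j \<and> g \<cdot> i = f"
        by (intro ext_injD[OF E[OF js] P(1,3) S_free[OF S[OF ms]]]) simp_all
      then obtain g where "arr g" "dom g = P0" "cod g = X j" "g \<cdot> i = f" by (elim exE conjE)
      then show "\<exists>g\<in>hom P0 (X j). g \<cdot> i = f" by (intro bexI[of _ g]) simp_all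
    qed
    then show ?thesis unfolding \<phi>_def by simp
  qed
  have h0: "h (X m) (X j) = 0" if "j < m" for j
  proof -
    have "hom (X m) (X j) = {zr (X m) (X j)}" using B[OF that ms] O[of j] O[OF ms] that ms by auto
    then show ?thesis using h_zero O[of j] O[OF ms] that ms by simp
  qed
  have "(\<Sum>j\<le>n. c j * \<phi> (X j)) = (\<Sum>j\<le>n. if j = m then c m * int (h (X m) (X m)) else 0)"
  proof (rule sum.cong[OF refl])
    fix j assume "j \<in> {..n}"
    then have j: "j \<le> n" by simp
    consider "j < m" | "j = m" | "m < j" by linarith
    then show "c j * \<phi> (X j) = (if j = m then c m * int (h (X m) (X m)) else 0)"
      using \<phi>h[OF j] h0[of j] mx[of j] j by cases simp_all
  qed
  then have "c m * int (h (X m) (X m)) = 0" using sum0 m(1) by (simp add: sum.delta)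
  moreover have "h (X m) (X m) \<noteq> 0"
  proof
    assume "h (X m) (X m) = 0"
    then have "hom (X m) (X m) = {zr (X m) (X m)}" using h_zero O[OF ms] by blast
    moreover have "idn (X m) \<in> hom (X m) (X m)" using O[OF ms] by simp
    ultimately show False using indecD(2)[OF S_indec[OF S[OF ms]]] by auto
  qed
  ultimately show False using m(2) by simp
qed

end

context length_abelian_cat
begin

lemma left_path_bound:
  assumes "rank_le n" "\<And>X. S X \<Longrightarrow> indec X \<and> pd1 X"
    and cl: "\<And>X Y f. S Y \<Longrightarrow> indec X \<Longrightarrow> f \<in> hom X Y \<Longrightarrow> f \<noteq> zr X Y \<Longrightarrow> S X"
    and p: "injective I" "(I, Y) \<in> step ^^ s" "S Y"
  shows "s < n"
proof -
  interpret left_part Ob arr dom cod comp add neg zr idn d h S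
    using assms by unfold_locales blast+
  obtain X where X: "X 0 = I" "X s = Y" "\<And>i. i < s \<Longrightarrow> (X i, X (Suc i)) \<in> step"
    using p(2) unfolding relpow_fun_conv by blast
  have "\<exists>f. f \<in> hom (X i) (X (Suc i)) \<and> f \<noteq> zr (X i) (X (Suc i)) \<and> \<not> iso f" if "i < s" for i
    using X(3)[OF that] unfolding step_def by blast
  then obtain f where f: "\<And>i. i < s \<Longrightarrow> f i \<in> hom (X i) (X (Suc i)) \<and> f i \<noteq> zr (X i) (X (Suc i)) \<and> \<not> iso (f i)"
    by metis
  have "S (X i)" if "i \<le> s" for i
    using that
  proof (induction rule: inc_induct)
    case (step i)
    then show ?case using cl[of "X (Suc i)" "X i" "f i"] f[of i] X(3)[of i] unfolding step_def by blast
  qed (use X p in simp)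
  moreover have "ext_inj (X 0)" using injective_ext_inj p(1) X(1) by simp
  ultimately show ?thesis using path_bound[of n s X f] assms(1) f by blast
qed

lemma step_or_iso: "indec X \<Longrightarrow> indec Y \<Longrightarrow> f \<in> hom X Y \<Longrightarrow> f \<noteq> zr X Y \<Longrightarrow> (X, Y) \<in> step \<or> iso f"
  unfolding step_def by blast

lemma injective_iso:
  assumes "iso f" "injective (dom f)" shows "injective (cod f)"
proof -
  obtain g where "arr g" "dom g = cod f" "cod g = dom f" "f \<cdot> g = idn (cod f)" using assms(1) by (rule isoE)
  then show ?thesis using injective_retract[OF assms(2), of f "cod f" g] iso_arr[OF assms(1)] by simp
qed

text \<open>
  The two maps of \<open>not_pd1_injective_predecessor\<close> may be isomorphisms; an isomorphism is absorbed into its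
  neighbour, and an injective object that is isomorphic to \<open>W\<close> gives a path of length zero.
\<close>

lemma not_pd1_path_from_injective:
  assumes W: "indec W" "\<not> pd1 W"
  shows "\<exists>I s. indec I \<and> injective I \<and> (I, W) \<in> step ^^ s"
proof -
  obtain I X g v where I: "indec I" "injective I" "indec X" "arr g" "dom g = I" "cod g = X" "g \<noteq> zr I X"
    and v: "arr v" "dom v = X" "cod v = W" "v \<noteq> zr X W"
    using not_pd1_injective_predecessor[OF W] by auto
  have vc: "(X, W) \<in> step \<or> iso v" using step_or_iso[of X W v] I W v by simp
  show ?thesis
  proof (cases "iso g")
    case True
    then have X: "injective X" using injective_iso[of g] I by simp
    from vc show ?thesis
    proof
      assume "(X, W) \<in> step"
      then have "(X, W) \<in> step ^^ 1" by simp
      then show ?thesis using X I by blast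
    next
      assume "iso v"
      then have "injective W" using injective_iso[of v] X v by simp
      moreover have "(W, W) \<in> step ^^ 0" by simp
      ultimately show ?thesis using W by blast
    qed
  next
    case False
    then have IX: "(I, X) \<in> step" using step_or_iso[of I X g] I by simp
    from vc show ?thesis
    proof
      assume "(X, W) \<in> step"
      then have "(I, W) \<in> step ^^ 2" using IX by (auto simp: numeral_2_eq_2)
      then show ?thesis using I by blast
    next
      assume iv: "iso v"
      then obtain v' where v': "arr v'" "dom v' = W" "cod v' = X" "v' \<cdot> v = idn X" "v \<cdot> v' = idn W"
        using v by (metis isoE)
      have g: "v' \<cdot> (v \<cdot> g) = g" using I v' by (simp add: reassoc[OF v'(4)] idn_left)
      have iv': "iso v'" unfolding iso_def using v v' by (auto intro!: bexI[of _ v])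
      have vg: "arr (v \<cdot> g)" "dom (v \<cdot> g) = I" "cod (v \<cdot> g) = W" using v I by auto
      have "\<not> iso (v \<cdot> g)"
        using iso_comp[of "v \<cdot> g" v'] iv' False g vg v' by auto
      moreover have "v \<cdot> g \<noteq> zr I W"
      proof
        assume "v \<cdot> g = zr I W"
        then have "g = v' \<cdot> zr I W" using g by simp
        then show False using I v' indecD(1)[OF I(1)] by simp
      qed
      ultimately have "(I, W) \<in> step" using step_or_iso[of I W "v \<cdot> g"] vg I W by simp
      then have "(I, W) \<in> step ^^ 1" by simp
      then show ?thesis using I by blast
    qed
  qed
qed

end

context length_abelian_cat
begin

interpretation D: length_abelian_cat Ob arr cod dom "\<lambda>f g. g \<cdot> f" "(\<^bold>+)" neg "\<lambda>X Y. zr Y X" idn d "\<lambda>X Y. h Y X"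
  by (rule dual_length)

lemma dual_rank: "D.rank_le n = rank_le n"
  unfolding D.rank_le_def rank_le_def dual_simps by blast

end


section \<open>The rank of the Grothendieck group\<close>

text \<open>
  Elimination over the integers, with cross multiplication in place of division by the pivot.
\<close>

lemma integer_dependency:
  fixes M :: "'i \<Rightarrow> nat \<Rightarrow> int"
  assumes "finite J" "n < card J"
  shows "\<exists>c. (\<exists>j\<in>J. c j \<noteq> 0) \<and> (\<forall>i<n. (\<Sum>j\<in>J. c j * M j i) = 0)"
  using assms
proof (induction n arbitrary: J M)
  case 0
  then obtain j where "j \<in> J" by fastforce
  then show ?case by (intro exI[of _ "\<lambda>_. 1"]) auto
next
  case (Suc n)
  show ?case
  proof (cases "\<exists>p\<in>J. M p n \<noteq> 0")
    case False
    obtain c where c: "\<exists>j\<in>J. c j \<noteq> 0" "\<forall>i<n. (\<Sum>j\<in>J. c j * M j i) = 0"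
      using Suc.IH[of J M] Suc.prems by auto
    moreover have "(\<Sum>j\<in>J. c j * M j n) = 0" using False by (simp add: sum.neutral)
    ultimately show ?thesis using less_Suc_eq by (intro exI[of _ c]) auto
  next
    case True
    then obtain p where p: "p \<in> J" "M p n \<noteq> 0" by blast
    let ?J = "J - {p}"
    have "finite ?J" "n < card ?J" using Suc.prems p by auto
    then obtain c where c: "\<exists>j\<in>?J. c j \<noteq> 0"
      "\<forall>i<n. (\<Sum>j\<in>?J. c j * (M p n * M j i - M j n * M p i)) = 0"
      using Suc.IH[of ?J "\<lambda>j i. M p n * M j i - M j n * M p i"] by auto
    define s where "s = (\<Sum>j\<in>?J. c j * M j n)"
    define c' where "c' j = (if j = p then - s else c j * M p n)" for j
    have sum: "(\<Sum>j\<in>J. c' j * M j i) = (\<Sum>j\<in>?J. c j * (M p n * M j i - M j n * M p i))" for i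
    proof -
      have "(\<Sum>j\<in>J. c' j * M j i) = - s * M p i + (\<Sum>j\<in>?J. c' j * M j i)"
        using sum.remove[OF Suc.prems(1) p(1), of "\<lambda>j. c' j * M j i"] by (simp add: c'_def)
      also have "(\<Sum>j\<in>?J. c' j * M j i) = (\<Sum>j\<in>?J. c j * M p n * M j i)"
        by (rule sum.cong) (auto simp: c'_def)
      also have "- s * M p i = (\<Sum>j\<in>?J. - (c j * M j n * M p i))"
        by (simp add: s_def sum_distrib_right sum_negf)
      finally show ?thesis by (simp add: sum.distrib[symmetric] algebra_simps)
    qed
    have "(\<Sum>j\<in>J. c' j * M j i) = 0" if "i < Suc n" for i
    proof (cases "i = n")
      case True
      then show ?thesis unfolding sum by (simp add: sum.neutral)
    qed (use c(2) that in \<open>simp add: sum\<close>)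
    moreover have "\<exists>j\<in>J. c' j \<noteq> 0" using c(1) p by (auto simp: c'_def)
    ultimately show ?thesis by blast
  qed
qed

context length_abelian_cat
begin

definition simple :: "'a \<Rightarrow> bool" where
  "simple X \<longleftrightarrow> nonzero X \<and> (\<forall>m. mono m \<and> cod m = X \<longrightarrow> \<not> nonzero (dom m) \<or> iso m)"

lemma simple_subobject:
  "nonzero X \<Longrightarrow> \<exists>m. mono m \<and> simple (dom m) \<and> cod m = X"
proof (induction "d X" arbitrary: X rule: less_induct)
  case less
  have XO: "X \<in> Ob" using less(2) by (simp add: nonzero_def)
  show ?case
  proof (cases "simple X")
    case True
    then show ?thesis using idn_mono[OF XO] XO by (intro exI[of _ "idn X"]) simp
  next
    case False
    then obtain m where m: "mono m" "cod m = X" "nonzero (dom m)" "\<not> iso m" using less(2) unfolding simple_def by blast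
    have "d (dom m) \<noteq> d X" using mono_d_eq_iso[OF m(1)] m by auto
    then have "d (dom m) < d X" using d_mono[OF m(1)] m by simp
    then obtain m' where m': "mono m'" "simple (dom m')" "cod m' = dom m" using less(1) m(3) by blast
    have a: "arr m" "arr m'" using m m' mono_arr by auto
    show ?thesis using mono_comp[OF m'(1) m(1) m'(3)] a m m' by (intro exI[of _ "m \<cdot> m'"]) simp
  qed
qed

lemma schur:
  assumes S: "simple (dom f)" "simple (cod f)" and f: "arr f" "f \<noteq> zr (dom f) (cod f)"
  shows "iso f"
proof -
  obtain K k e J m C c where s: "ses K k (dom f) e J" "ses J m (cod f) c C" "m \<cdot> e = f" using factor[OF f(1)] by blast
  note s1 = sesD[OF s(1)] and s2 = sesD[OF s(2)]
  have "nonzero J"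
  proof (rule ccontr)
    assume "\<not> nonzero J"
    then have "e = zr (dom f) J" using zero_objD(2)[of J e] s1 by simp
    then have "m \<cdot> e = zr (dom f) (cod f)" using s2(1-3) dom_Ob[OF f(1)] by simp
    then show False using s(3) f by simp
  qed
  then have im: "iso m" using S(2) s2 unfolding simple_def by blast
  have "\<not> iso k"
  proof
    assume "iso k"
    then have "e = zr (dom f) J" using epiD[OF iso_epi, of k e] s1 by simp
    then have "m \<cdot> e = zr (dom f) (cod f)" using s2(1-3) dom_Ob[OF f(1)] by simp
    then show False using s(3) f by simp
  qed
  then have "\<not> nonzero K" using S(1) s1 unfolding simple_def by blast
  then have "iso e" using ses_left_zero_iso[OF s(1)] by blast
  then show ?thesis using iso_comp[OF _ im, of e] s1 s2 s(3) by simp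
qed

lemma additive_iso:
  assumes \<phi>: "additive \<phi>" and e: "iso e" shows "\<phi> (dom e) = \<phi> (cod e)"
proof -
  have O: "cod e \<in> Ob" using iso_arr[OF e] by simp
  obtain S i j p q where b: "biprod S (cod e) (cod e) i j p q" using biprod_ex[OF O O] by blast
  have s: "ses (cod e) i S q (cod e)" using biprod_ses[OF b] .
  have "ses (dom e) (i \<cdot> e) S q (cod e)" using ses_iso_left[OF s e] by simp
  then have "\<phi> S = \<phi> (dom e) + \<phi> (cod e)" "\<phi> S = \<phi> (cod e) + \<phi> (cod e)"
    using \<phi> s unfolding additive_def by blast+
  then show ?thesis by simp
qed

lemma additive_zero:
  assumes \<phi>: "additive \<phi>" and X: "X \<in> Ob" "\<not> nonzero X" shows "\<phi> X = 0"
proof -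
  obtain S i j p q where b: "biprod S X X i j p q" using biprod_ex[OF X(1) X(1)] by blast
  note s = biprod_ses[OF b]
  have "iso i" using ses_right_zero_iso[OF s X(2)] .
  then have "\<phi> X = \<phi> S" using additive_iso[OF \<phi>, of i] sesD(2,3)[OF s] by simp
  moreover have "\<phi> S = \<phi> X + \<phi> X" using \<phi> s unfolding additive_def by blast
  ultimately show ?thesis by simp
qed

text \<open>
  Simple objects that receive a nonzero map from \<open>M\<close> occur in a composition series of \<open>M\<close>: a nonzero map either
  restricts to an isomorphism of the simple subobject, by Schur's lemma, or factors through the quotient.
\<close>

lemma composition_factors:
  "M \<in> Ob \<Longrightarrow> \<exists>Fs. \<forall>f. arr f \<and> dom f = M \<and> simple (cod f) \<and> f \<noteq> zr M (cod f) \<longrightarrow>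
     (\<exists>e. iso e \<and> cod e = cod f \<and> dom e \<in> set Fs)"
proof (induction "d M" arbitrary: M rule: less_induct)
  case less
  show ?case
  proof (cases "nonzero M")
    case False
    then show ?thesis using zero_objD(1)[OF False] by (intro exI[of _ "[]"]) blast
  next
    case True
    obtain m where m: "mono m" "simple (dom m)" "cod m = M" using simple_subobject[OF True] by blast
    obtain C c where s: "ses (dom m) m M c C" using mono_ses[OF m(1)] m(3) by auto
    note s' = sesD[OF s]
    have "0 < d (dom m)" using m(2) d_pos unfolding simple_def by blast
    then have "d C < d M" using d_add[OF s] by simp
    then obtain Fs where Fs: "\<And>f. arr f \<Longrightarrow> dom f = C \<Longrightarrow> simple (cod f) \<Longrightarrow> f \<noteq> zr C (cod f) \<Longrightarrow>
      \<exists>e. iso e \<and> cod e = cod f \<and> dom e \<in> set Fs" using less(1) s'(12) by blast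
    have "\<exists>e. iso e \<and> cod e = cod f \<and> dom e \<in> set (dom m # Fs)"
      if f: "arr f" "dom f = M" "simple (cod f)" "f \<noteq> zr M (cod f)" for f
    proof (cases "f \<cdot> m = zr (dom m) (cod f)")
      case True
      then obtain g where g: "arr g" "dom g = C" "cod g = cod f" "g \<cdot> c = f" using ses_coker[OF s f(1,2)] by blast
      have "g \<noteq> zr C (cod f)"
      proof
        assume gz: "g = zr C (cod f)"
        have "f = g \<cdot> c" using g(4) by (rule sym)
        also have "\<dots> = zr M (cod f)" unfolding gz using s'(4-6) cod_Ob[OF f(1)] by simp
        finally show False using f(4) by blast
      qed
      then have "\<exists>e. iso e \<and> cod e = cod f \<and> dom e \<in> set Fs" using Fs[of g] g f by simp
      then show ?thesis by (metis list.set_intros(2))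
    next
      case False
      then have "iso (f \<cdot> m)" using schur[of "f \<cdot> m"] m f s' by simp
      then show ?thesis using m f s' by (intro exI[of _ "f \<cdot> m"]) simp
    qed
    then show ?thesis by blast
  qed
qed

lemma additive_via_factors:
  assumes F: "\<And>S. simple S \<Longrightarrow> \<exists>e. iso e \<and> cod e = S \<and> dom e \<in> set Fs"
  shows "X \<in> Ob \<Longrightarrow> \<exists>m :: nat \<Rightarrow> int. \<forall>\<phi>. additive \<phi> \<longrightarrow> \<phi> X = (\<Sum>i<length Fs. m i * \<phi> (Fs ! i))"
proof (induction "d X" arbitrary: X rule: less_induct)
  case less
  show ?case
  proof (cases "nonzero X")
    case False
    then show ?thesis using additive_zero less(2) by (intro exI[of _ "\<lambda>_. 0"]) simp
  next
    case True
    obtain u where u: "mono u" "simple (dom u)" "cod u = X" using simple_subobject[OF True] by blast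
    obtain C c where s: "ses (dom u) u X c C" using mono_ses[OF u(1)] u(3) by auto
    have "0 < d (dom u)" using u(2) d_pos unfolding simple_def by blast
    then have "d C < d X" using d_add[OF s] by simp
    then obtain m :: "nat \<Rightarrow> int" where m: "\<And>\<phi>. additive \<phi> \<Longrightarrow> \<phi> C = (\<Sum>i<length Fs. m i * \<phi> (Fs ! i))"
      using less(1) sesD(12)[OF s] by blast
    obtain e where e: "iso e" "cod e = dom u" "dom e \<in> set Fs" using F[OF u(2)] by blast
    obtain k where k: "k < length Fs" "Fs ! k = dom e" using e(3) by (metis in_set_conv_nth)
    have "\<phi> X = (\<Sum>i<length Fs. (m i + (if i = k then 1 else 0)) * \<phi> (Fs ! i))" if \<phi>: "additive \<phi>" for \<phi>
    proof -
      have "\<phi> X = \<phi> (dom u) + \<phi> C" using \<phi> s unfolding additive_def by blast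
      also have "\<phi> (dom u) = \<phi> (Fs ! k)" using additive_iso[OF \<phi> e(1)] e k by simp
      also have "\<dots> = (\<Sum>i<length Fs. if i = k then \<phi> (Fs ! i) else 0)" using k(1) by (simp add: sum.delta)
      also have "\<dots> + \<phi> C = (\<Sum>i<length Fs. (if i = k then \<phi> (Fs ! i) else 0) + m i * \<phi> (Fs ! i))"
        unfolding m[OF \<phi>] sum.distrib by simp
      also have "\<dots> = (\<Sum>i<length Fs. (m i + (if i = k then 1 else 0)) * \<phi> (Fs ! i))"
        by (rule sum.cong) (auto simp: algebra_simps)
      finally show ?thesis .
    qed
    then show ?thesis by (intro exI allI impI)
  qed
qed

text \<open>
  A generator maps nontrivially to every simple object, so finitely many simple objects represent all of them,
  and their classes generate the Grothendieck group.
\<close>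

lemma generator_rank:
  assumes G: "G \<in> Ob" and gen: "\<And>X. nonzero X \<Longrightarrow> \<exists>f\<in>hom G X. f \<noteq> zr G X"
  shows "\<exists>n. rank_le n"
proof -
  obtain Fs where Fs: "\<forall>f. arr f \<and> dom f = G \<and> simple (cod f) \<and> f \<noteq> zr G (cod f) \<longrightarrow>
      (\<exists>e. iso e \<and> cod e = cod f \<and> dom e \<in> set Fs)" by (rule exE[OF composition_factors[OF G]])
  have F: "\<exists>e. iso e \<and> cod e = S \<and> dom e \<in> set Fs" if "simple S" for S
  proof -
    have "nonzero S" using that by (simp add: simple_def)
    then obtain f where f: "f \<in> hom G S" "f \<noteq> zr G S" using gen by blast
    then have "arr f" "dom f = G" "cod f = S" by simp_all
    then show ?thesis using Fs[rule_format, of f] that f(2) by simp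
  qed
  have "rank_le (length Fs)" unfolding rank_le_def
  proof (intro allI impI)
    fix X :: "nat \<Rightarrow> 'a" assume X: "\<forall>i\<le>length Fs. X i \<in> Ob"
    have "\<forall>i. \<exists>m :: nat \<Rightarrow> int. i \<le> length Fs \<longrightarrow> (\<forall>\<phi>. additive \<phi> \<longrightarrow> \<phi> (X i) = (\<Sum>k<length Fs. m k * \<phi> (Fs ! k)))"
    proof
      fix i show "\<exists>m :: nat \<Rightarrow> int. i \<le> length Fs \<longrightarrow> (\<forall>\<phi>. additive \<phi> \<longrightarrow> \<phi> (X i) = (\<Sum>k<length Fs. m k * \<phi> (Fs ! k)))"
        using additive_via_factors[OF F, of "X i"] X by (cases "i \<le> length Fs") simp_all
    qed
    from choice[OF this] obtain m :: "nat \<Rightarrow> nat \<Rightarrow> int" where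
      m0: "\<forall>i. i \<le> length Fs \<longrightarrow> (\<forall>\<phi>. additive \<phi> \<longrightarrow> \<phi> (X i) = (\<Sum>k<length Fs. m i k * \<phi> (Fs ! k)))" by (elim exE)
    have m: "\<phi> (X i) = (\<Sum>k<length Fs. m i k * \<phi> (Fs ! k))" if "i \<le> length Fs" "additive \<phi>" for i \<phi>
      using m0 that by blast
    obtain c where c: "\<exists>j\<in>{..length Fs}. c j \<noteq> 0" "\<forall>i<length Fs. (\<Sum>j\<le>length Fs. c j * m j i) = 0"
      using integer_dependency[of "{..length Fs}" "length Fs" m] by (simp del: bex_simps, elim exE conjE)
    have "(\<Sum>i\<le>length Fs. c i * \<phi> (X i)) = 0" if \<phi>: "additive \<phi>" for \<phi>
    proof -
      have "(\<Sum>i\<le>length Fs. c i * \<phi> (X i)) = (\<Sum>i\<le>length Fs. \<Sum>k<length Fs. c i * m i k * \<phi> (Fs ! k))"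
      proof (rule sum.cong[OF refl])
        fix i assume "i \<in> {..length Fs}"
        then have "\<phi> (X i) = (\<Sum>k<length Fs. m i k * \<phi> (Fs ! k))" using m[OF _ \<phi>, of i] by simp
        then show "c i * \<phi> (X i) = (\<Sum>k<length Fs. c i * m i k * \<phi> (Fs ! k))"
          by (simp only: sum_distrib_left mult.assoc)
      qed
      also have "\<dots> = (\<Sum>k<length Fs. \<Sum>i\<le>length Fs. c i * m i k * \<phi> (Fs ! k))" by (rule sum.swap)
      also have "\<dots> = (\<Sum>k<length Fs. (\<Sum>i\<le>length Fs. c i * m i k) * \<phi> (Fs ! k))" by (simp add: sum_distrib_right)
      also have "\<dots> = 0" using c(2) by simp
      finally show ?thesis .
    qed
    moreover obtain j where "j \<le> length Fs" "c j \<noteq> 0" using c(1) by auto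
    ultimately show "\<exists>c :: nat \<Rightarrow> int. (\<exists>i\<le>length Fs. c i \<noteq> 0) \<and> (\<forall>\<phi>. additive \<phi> \<longrightarrow> (\<Sum>i\<le>length Fs. c i * \<phi> (X i)) = 0)"
      by (intro exI[of _ c] conjI exI[of _ j] allI impI)
  qed
  then show ?thesis by blast
qed

end


section \<open>The left and the right part\<close>

context length_abelian_cat
begin

definition left :: "'a set" where
  "left = {X. indec X \<and> (\<forall>W s. (W, X) \<in> step ^^ s \<longrightarrow> pd1 W)}"

definition right :: "'a set" where
  "right = {X. indec X \<and> (\<forall>W s. (X, W) \<in> step ^^ s \<longrightarrow> id1 W)}"

lemma iso_inverse:
  assumes "iso f" obtains g where "iso g" "dom g = cod f" "cod g = dom f" "g \<cdot> f = idn (dom f)" "f \<cdot> g = idn (cod f)"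
proof -
  obtain g where g: "arr g" "dom g = cod f" "cod g = dom f" "g \<cdot> f = idn (dom f)" "f \<cdot> g = idn (cod f)"
    using assms by (rule isoE)
  have "iso g" unfolding iso_def using g iso_arr[OF assms] by (auto intro!: bexI[of _ f])
  then show ?thesis using g that by blast
qed

lemma pd1_iso: assumes "iso f" "pd1 (dom f)" shows "pd1 (cod f)"
  using assms(2) ses_iso_right[OF _ assms(1)] unfolding pd1_def by blast

lemma step_iso:
  assumes s: "(Z, Y) \<in> step" and f: "iso f" "dom f = Y" "cod f = X" and X: "indec X" shows "(Z, X) \<in> step"
proof -
  obtain g where g: "indec Z" "arr g" "dom g = Z" "cod g = Y" "g \<noteq> zr Z Y" "\<not> iso g"
    using s unfolding step_def by auto
  obtain f' where f': "iso f'" "dom f' = X" "cod f' = Y" "f' \<cdot> f = idn Y" using iso_inverse[OF f(1)] f by metis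
  note a = iso_arr[OF f(1)] iso_arr[OF f'(1)]
  have eq: "f' \<cdot> (f \<cdot> g) = g" using g by (simp add: reassoc[OF f'(4)] idn_left)
  have fg: "arr (f \<cdot> g)" "dom (f \<cdot> g) = Z" "cod (f \<cdot> g) = X" using g f a by auto
  have "f \<cdot> g \<noteq> zr Z X"
  proof
    assume "f \<cdot> g = zr Z X"
    then have "g = f' \<cdot> zr Z X" using eq by simp
    then show False using g a f' indecD(1)[OF g(1)] by simp
  qed
  moreover have "\<not> iso (f \<cdot> g)" using iso_comp[of "f \<cdot> g" f'] eq g f' fg by auto
  ultimately show ?thesis using step_or_iso[OF g(1) X, of "f \<cdot> g"] fg by simp
qed

text \<open>
  A single nonzero map to a member is either a path of length one, or an isomorphism, which can be absorbed
  into the last arrow of any path to its source.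
\<close>

lemma left_closed:
  assumes X: "X \<in> left" and Y: "indec Y" and f: "f \<in> hom Y X" "f \<noteq> zr Y X" shows "Y \<in> left"
proof -
  have X': "indec X" "\<And>W s. (W, X) \<in> step ^^ s \<Longrightarrow> pd1 W" using X by (auto simp: left_def)
  have "pd1 W" if p: "(W, Y) \<in> step ^^ s" for W s
    using step_or_iso[OF Y X'(1) f]
  proof
    assume "(Y, X) \<in> step"
    then have "(W, X) \<in> step ^^ Suc s" using p by auto
    then show ?thesis by (rule X'(2))
  next
    assume i: "iso f"
    show ?thesis
    proof (cases s)
      case 0
      obtain g where "iso g" "dom g = X" "cod g = Y" using iso_inverse[OF i] f by auto
      moreover have "pd1 X" by (rule X'(2)[of _ 0]) simp
      ultimately show ?thesis using pd1_iso[of g] 0 p by simp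
    next
      case (Suc r)
      then obtain Z where Z: "(W, Z) \<in> step ^^ r" "(Z, Y) \<in> step" using p by auto
      have "(Z, X) \<in> step" using step_iso[OF Z(2) i] f X'(1) by simp
      then have "(W, X) \<in> step ^^ Suc r" using Z(1) by auto
      then show ?thesis by (rule X'(2))
    qed
  qed
  then show ?thesis using Y unfolding left_def by blast
qed

lemma left_part_path_bound:
  assumes "rank_le n" "injective I" "(I, Y) \<in> step ^^ s" "Y \<in> left" shows "s < n"
proof (rule left_path_bound[of n "\<lambda>X. X \<in> left"])
  show "indec X \<and> pd1 X" if "X \<in> left" for X
    using that relpow_0_I[of X step] unfolding left_def by blast
qed (use assms left_closed in auto)

lemma step_indec: "(X, Y) \<in> step \<Longrightarrow> indec X \<and> indec Y"
  unfolding step_def by blast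

lemma step_relpow_indec: "(X, Y) \<in> step ^^ s \<Longrightarrow> indec X \<Longrightarrow> indec Y"
  by (cases s) (auto dest: step_indec)

lemma step_relpow_indec': "(X, Y) \<in> step ^^ s \<Longrightarrow> indec Y \<Longrightarrow> indec X"
  by (cases s) (auto simp del: relpow.simps(2) dest!: relpow_Suc_D2 dest: step_indec)

lemma not_left_path_from_injective:
  assumes X: "indec X" "X \<notin> left" shows "\<exists>I s. indec I \<and> injective I \<and> (I, X) \<in> step ^^ s"
proof -
  obtain W s where W: "(W, X) \<in> step ^^ s" "\<not> pd1 W" using X by (auto simp: left_def)
  obtain I r where I: "indec I" "injective I" "(I, W) \<in> step ^^ r"
    using not_pd1_path_from_injective[OF step_relpow_indec'[OF W(1) X(1)] W(2)] by blast
  have "(I, X) \<in> step ^^ (r + s)" using I(3) W(1) unfolding relpow_add by blast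
  then show ?thesis using I by blast
qed

end

context length_abelian_cat
begin

interpretation D: length_abelian_cat Ob arr cod dom "\<lambda>f g. g \<cdot> f" "(\<^bold>+)" neg "\<lambda>X Y. zr Y X" idn d "\<lambda>X Y. h Y X"
  by (rule dual_length)

lemma dual_left: "D.left = right"
  unfolding D.left_def right_def dual_simps by (simp add: relpow_converse)

lemma id1_iso: assumes "iso f" "id1 (cod f)" shows "id1 (dom f)"
  using D.pd1_iso[of f] assms unfolding dual_simps by blast

lemma right_part_path_bound:
  assumes "rank_le n" "projective P" "(Y, P) \<in> step ^^ s" "Y \<in> right" shows "s < n"
  using D.left_part_path_bound[of n P Y s] assms unfolding dual_rank dual_simps dual_left by (simp add: relpow_converse)

lemma not_right_path_to_projective:
  assumes X: "indec X" "X \<notin> right" shows "\<exists>P s. indec P \<and> projective P \<and> (X, P) \<in> step ^^ s"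
  using D.not_left_path_from_injective[of X] assms unfolding dual_simps dual_left by (simp add: relpow_converse)

end


section \<open>Vector spaces of finite length\<close>

text \<open>
  The dimension of a vector space is measured by the lengths of chains of subspaces.  This length is additive on
  short exact sequences without any choice of bases.
\<close>

definition subspace :: "('k, 'u) ring_scheme \<Rightarrow> ('k, 'v, 'w) module_scheme \<Rightarrow> 'v set \<Rightarrow> bool" where
  "subspace K V U \<longleftrightarrow> U \<subseteq> carrier V \<and> \<zero>\<^bsub>V\<^esub> \<in> U \<and> (\<forall>x\<in>U. \<forall>y\<in>U. x \<oplus>\<^bsub>V\<^esub> y \<in> U) \<and>
     (\<forall>c\<in>carrier K. \<forall>x\<in>U. c \<odot>\<^bsub>V\<^esub> x \<in> U)"

definition subspace_chain :: "('k, 'u) ring_scheme \<Rightarrow> ('k, 'v, 'w) module_scheme \<Rightarrow> nat \<Rightarrow> bool" where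
  "subspace_chain K V n \<longleftrightarrow> (\<exists>U. (\<forall>i\<le>n. subspace K V (U i)) \<and> (\<forall>i<n. U i \<subset> U (Suc i)))"

definition vlen :: "('k, 'u) ring_scheme \<Rightarrow> ('k, 'v, 'w) module_scheme \<Rightarrow> enat" where
  "vlen K V = (SUP n \<in> {n. subspace_chain K V n}. enat n)"

definition linear :: "('k, 'u) ring_scheme \<Rightarrow> ('k, 'v, 'w) module_scheme \<Rightarrow> ('k, 'x, 'y) module_scheme \<Rightarrow> ('v \<Rightarrow> 'x) \<Rightarrow> bool" where
  "linear K V W T \<longleftrightarrow> T \<in> carrier V \<rightarrow> carrier W \<and>
     (\<forall>x\<in>carrier V. \<forall>y\<in>carrier V. T (x \<oplus>\<^bsub>V\<^esub> y) = T x \<oplus>\<^bsub>W\<^esub> T y) \<and>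
     (\<forall>c\<in>carrier K. \<forall>x\<in>carrier V. T (c \<odot>\<^bsub>V\<^esub> x) = c \<odot>\<^bsub>W\<^esub> T x)"

lemma chain_le_vlen: "subspace_chain K V n \<Longrightarrow> enat n \<le> vlen K V"
  unfolding vlen_def by (rule SUP_upper) simp

lemma vlen_le: "(\<And>n. subspace_chain K V n \<Longrightarrow> enat n \<le> b) \<Longrightarrow> vlen K V \<le> b"
  unfolding vlen_def by (rule SUP_least) simp

lemma subspaceD:
  assumes "subspace K V U"
  shows "U \<subseteq> carrier V" "\<zero>\<^bsub>V\<^esub> \<in> U" "\<And>x y. x \<in> U \<Longrightarrow> y \<in> U \<Longrightarrow> x \<oplus>\<^bsub>V\<^esub> y \<in> U"
    "\<And>c x. c \<in> carrier K \<Longrightarrow> x \<in> U \<Longrightarrow> c \<odot>\<^bsub>V\<^esub> x \<in> U"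
  using assms unfolding subspace_def by blast+

lemma subspace_minus:
  assumes V: "Module.module K V" and U: "subspace K V U" "x \<in> U" shows "\<ominus>\<^bsub>V\<^esub> x \<in> U"
proof -
  interpret V: Module.module K V by (rule V)
  have x: "x \<in> carrier V" using subspaceD(1)[OF U(1)] U(2) by auto
  have "(\<ominus>\<^bsub>K\<^esub> \<one>\<^bsub>K\<^esub>) \<odot>\<^bsub>V\<^esub> x \<in> U" using U by (intro subspaceD(4)[OF U(1)]) auto
  then show ?thesis using x by (simp add: V.smult_l_minus)
qed

lemma subspace_diff_mem:
  assumes V: "Module.module K V" and U: "subspace K V U" "x \<in> U" "y \<in> carrier V" "y \<oplus>\<^bsub>V\<^esub> x \<in> U"
  shows "y \<in> U"
proof -
  interpret V: Module.module K V by (rule V)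
  have x: "x \<in> carrier V" using subspaceD(1)[OF U(1)] U(2) by auto
  have "y = (y \<oplus>\<^bsub>V\<^esub> x) \<oplus>\<^bsub>V\<^esub> \<ominus>\<^bsub>V\<^esub> x" using x U(3) by (simp add: V.a_assoc V.r_neg)
  then show ?thesis using subspaceD(3)[OF U(1,4) subspace_minus[OF V U(1,2)]] by simp
qed

text \<open>
  Repetitions in a weakly increasing chain can be removed, so the number of strict steps is bounded by the
  length.
\<close>

lemma weak_chain:
  fixes U :: "nat \<Rightarrow> 'v set"
  assumes "\<And>i. i \<le> n \<Longrightarrow> subspace K V (U i)" "\<And>i. i < n \<Longrightarrow> U i \<subseteq> U (Suc i)"
  shows "\<exists>W. (\<forall>i\<le>card {i. i < n \<and> U i \<noteq> U (Suc i)}. subspace K V (W i)) \<and>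
    (\<forall>i<card {i. i < n \<and> U i \<noteq> U (Suc i)}. W i \<subset> W (Suc i)) \<and>
    W (card {i. i < n \<and> U i \<noteq> U (Suc i)}) = U n"
  using assms
proof (induction n)
  case 0
  then show ?case by (intro exI[of _ U]) auto
next
  case (Suc n)
  let ?k = "card {i. i < n \<and> U i \<noteq> U (Suc i)}"
  have "\<exists>W. (\<forall>i\<le>?k. subspace K V (W i)) \<and> (\<forall>i<?k. W i \<subset> W (Suc i)) \<and> W ?k = U n"
  proof (rule Suc.IH)
    show "subspace K V (U i)" if "i \<le> n" for i using Suc.prems(1)[of i] that by simp
    show "U i \<subseteq> U (Suc i)" if "i < n" for i using Suc.prems(2)[of i] that by simp
  qed
  then obtain W where W: "\<forall>i\<le>?k. subspace K V (W i)" "\<forall>i<?k. W i \<subset> W (Suc i)" "W ?k = U n"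
    by (elim exE conjE)
  show ?case
  proof (cases "U n = U (Suc n)")
    case True
    then have "{i. i < Suc n \<and> U i \<noteq> U (Suc i)} = {i. i < n \<and> U i \<noteq> U (Suc i)}" by (auto simp: less_Suc_eq)
    then show ?thesis using W True by (intro exI[of _ W]) simp
  next
    case False
    then have "{i. i < Suc n \<and> U i \<noteq> U (Suc i)} = insert n {i. i < n \<and> U i \<noteq> U (Suc i)}" by (auto simp: less_Suc_eq)
    then have k: "card {i. i < Suc n \<and> U i \<noteq> U (Suc i)} = Suc ?k" by simp
    have "U n \<subset> U (Suc n)" using Suc.prems(2)[of n] False by auto
    then show ?thesis unfolding k using W Suc.prems(1)[of "Suc n"]
      by (intro exI[of _ "W(Suc ?k := U (Suc n))"]) (auto simp: less_Suc_eq le_Suc_eq)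
  qed
qed

lemma chain_strict_steps:
  assumes "\<And>i. i \<le> n \<Longrightarrow> subspace K V (U i)" "\<And>i. i < n \<Longrightarrow> U i \<subseteq> U (Suc i)"
  shows "enat (card {i. i < n \<and> U i \<noteq> U (Suc i)}) \<le> vlen K V"
  using weak_chain[of n K V U] assms by (intro chain_le_vlen) (unfold subspace_chain_def, blast)

lemma linearD:
  assumes "linear K V W T"
  shows "\<And>x. x \<in> carrier V \<Longrightarrow> T x \<in> carrier W"
    "\<And>x y. x \<in> carrier V \<Longrightarrow> y \<in> carrier V \<Longrightarrow> T (x \<oplus>\<^bsub>V\<^esub> y) = T x \<oplus>\<^bsub>W\<^esub> T y"
    "\<And>c x. c \<in> carrier K \<Longrightarrow> x \<in> carrier V \<Longrightarrow> T (c \<odot>\<^bsub>V\<^esub> x) = c \<odot>\<^bsub>W\<^esub> T x"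
  using assms unfolding linear_def by auto

lemma linear_zero:
  assumes V: "Module.module K V" and W: "Module.module K W" and T: "linear K V W T"
  shows "T \<zero>\<^bsub>V\<^esub> = \<zero>\<^bsub>W\<^esub>"
proof -
  interpret V: Module.module K V by (rule V)
  interpret W: Module.module K W by (rule W)
  have "T \<zero>\<^bsub>V\<^esub> \<oplus>\<^bsub>W\<^esub> T \<zero>\<^bsub>V\<^esub> = T \<zero>\<^bsub>V\<^esub>" using linearD(2)[OF T, of "\<zero>\<^bsub>V\<^esub>" "\<zero>\<^bsub>V\<^esub>"] by simp
  then show ?thesis using linearD(1)[OF T V.zero_closed] by simp
qed

lemma linear_minus:
  assumes V: "Module.module K V" and W: "Module.module K W" and T: "linear K V W T" and x: "x \<in> carrier V"
  shows "T (\<ominus>\<^bsub>V\<^esub> x) = \<ominus>\<^bsub>W\<^esub> T x"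
proof -
  interpret V: Module.module K V by (rule V)
  interpret W: Module.module K W by (rule W)
  have "T (\<ominus>\<^bsub>V\<^esub> x) \<oplus>\<^bsub>W\<^esub> T x = \<zero>\<^bsub>W\<^esub>"
    using linearD(2)[OF T, of "\<ominus>\<^bsub>V\<^esub> x" x] x linear_zero[OF V W T] by (simp add: V.l_neg)
  then show ?thesis using W.minus_equality linearD(1)[OF T] x by (metis V.a_inv_closed)
qed

lemma subspace_image:
  assumes V: "Module.module K V" and W: "Module.module K W" and T: "linear K V W T" and U: "subspace K V U"
  shows "subspace K W (T ` U)"
  unfolding subspace_def
proof (intro conjI ballI)
  note U' = subspaceD[OF U] and T' = linearD[OF T]
  have c: "x \<in> carrier V" if "x \<in> U" for x using U'(1) that by auto
  show "T ` U \<subseteq> carrier W" using c T'(1) by auto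
  show "\<zero>\<^bsub>W\<^esub> \<in> T ` U" using linear_zero[OF V W T] U'(2) by (metis image_eqI)
  fix x assume "x \<in> T ` U"
  then obtain x' where x: "x = T x'" "x' \<in> U" by auto
  show "x \<oplus>\<^bsub>W\<^esub> y \<in> T ` U" if "y \<in> T ` U" for y
  proof -
    from that obtain y' where y: "y = T y'" "y' \<in> U" by auto
    show ?thesis using T'(2)[OF c[OF x(2)] c[OF y(2)]] U'(3)[OF x(2) y(2)] unfolding x(1) y(1) by (metis image_eqI)
  qed
  show "k \<odot>\<^bsub>W\<^esub> x \<in> T ` U" if "k \<in> carrier K" for k
    using T'(3)[OF that c[OF x(2)]] U'(4)[OF that x(2)] unfolding x(1) by (metis image_eqI)
qed

lemma subspace_preimage:
  assumes V: "Module.module K V" and W: "Module.module K W" and T: "linear K V W T" and U: "subspace K W U"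
  shows "subspace K V {x \<in> carrier V. T x \<in> U}"
proof -
  interpret V: Module.module K V by (rule V)
  interpret W: Module.module K W by (rule W)
  show ?thesis unfolding subspace_def using subspaceD[OF U] linearD[OF T] linear_zero[OF V W T] by auto
qed

text \<open>
  A chain of subspaces induces weak chains of preimages in \<open>V'\<close> and of images in \<open>W\<close>.  By the modular law, at each
  strict step at least one of the two is strict.
\<close>

lemma vlen_le_kernel:
  assumes V: "Module.module K V" and V': "Module.module K V'" and W: "Module.module K W"
    and S: "linear K V' V S" and T: "linear K V W T"
    and ker: "\<And>x. x \<in> carrier V \<Longrightarrow> T x = \<zero>\<^bsub>W\<^esub> \<Longrightarrow> x \<in> S ` carrier V'"
  shows "vlen K V \<le> vlen K V' + vlen K W"
proof (rule vlen_le)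
  interpret V: Module.module K V by (rule V)
  interpret W: Module.module K W by (rule W)
  fix n assume "subspace_chain K V n"
  then obtain U where U: "\<And>i. i \<le> n \<Longrightarrow> subspace K V (U i)" "\<And>i. i < n \<Longrightarrow> U i \<subset> U (Suc i)"
    unfolding subspace_chain_def by blast
  define P where "P i = {x \<in> carrier V'. S x \<in> U i}" for i
  define Q where "Q i = T ` U i" for i
  have P: "subspace K V' (P i)" "subspace K W (Q i)" if "i \<le> n" for i
    unfolding P_def Q_def using subspace_preimage[OF V' V S U(1)[OF that]] subspace_image[OF V W T U(1)[OF that]] .
  have PQ: "P i \<subseteq> P (Suc i)" "Q i \<subseteq> Q (Suc i)" if "i < n" for i
    unfolding P_def Q_def using U(2)[OF that] by auto
  have strict: "P i \<noteq> P (Suc i) \<or> Q i \<noteq> Q (Suc i)" if i: "i < n" for i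
  proof (rule ccontr)
    assume "\<not> ?thesis"
    then have eq: "P i = P (Suc i)" "Q i = Q (Suc i)" by auto
    note Ui = U(1)[of i] and Us = U(1)[of "Suc i"]
    have ci: "U i \<subseteq> carrier V" "U (Suc i) \<subseteq> carrier V" using Ui Us i subspaceD(1) by auto
    have "U (Suc i) \<subseteq> U i"
    proof
      fix x assume x: "x \<in> U (Suc i)"
      then have "T x \<in> Q (Suc i)" unfolding Q_def by (rule imageI)
      then have "T x \<in> Q i" unfolding eq(2) .
      then obtain y where y: "y \<in> U i" "T x = T y" unfolding Q_def by (elim imageE)
      have xy: "x \<in> carrier V" "y \<in> carrier V" using x y ci by auto
      have y': "\<ominus>\<^bsub>V\<^esub> y \<in> U i" using subspace_minus[OF V _ y(1)] Ui i by simp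
      then have m: "x \<oplus>\<^bsub>V\<^esub> \<ominus>\<^bsub>V\<^esub> y \<in> U (Suc i)" using subspaceD(3)[OF Us] x U(2)[OF i] i by auto
      have "T (x \<oplus>\<^bsub>V\<^esub> \<ominus>\<^bsub>V\<^esub> y) = \<zero>\<^bsub>W\<^esub>"
        using linearD(2)[OF T, of x "\<ominus>\<^bsub>V\<^esub> y"] linear_minus[OF V W T xy(2)] xy y(2) linearD(1)[OF T xy(2)]
        by (simp add: W.r_neg)
      then have "x \<oplus>\<^bsub>V\<^esub> \<ominus>\<^bsub>V\<^esub> y \<in> S ` carrier V'" using xy by (intro ker) simp_all
      then obtain z where z: "z \<in> carrier V'" "x \<oplus>\<^bsub>V\<^esub> \<ominus>\<^bsub>V\<^esub> y = S z" by (elim imageE)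
      have "z \<in> P (Suc i)" using m z(1) unfolding P_def z(2) by simp
      then have "z \<in> P i" unfolding eq(1) .
      then have "x \<oplus>\<^bsub>V\<^esub> \<ominus>\<^bsub>V\<^esub> y \<in> U i" unfolding P_def z(2) by simp
      then show "x \<in> U i" using subspace_diff_mem[OF V _ y' xy(1)] Ui i by simp
    qed
    then show False using U(2)[OF i] by auto
  qed
  have "{i. i < n} \<subseteq> {i. i < n \<and> P i \<noteq> P (Suc i)} \<union> {i. i < n \<and> Q i \<noteq> Q (Suc i)}" using strict by auto
  then have "card {i. i < n} \<le> card ({i. i < n \<and> P i \<noteq> P (Suc i)} \<union> {i. i < n \<and> Q i \<noteq> Q (Suc i)})"
    by (intro card_mono) auto
  also have "\<dots> \<le> card {i. i < n \<and> P i \<noteq> P (Suc i)} + card {i. i < n \<and> Q i \<noteq> Q (Suc i)}" by (rule card_Un_le)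
  finally have "enat n \<le> enat (card {i. i < n \<and> P i \<noteq> P (Suc i)}) + enat (card {i. i < n \<and> Q i \<noteq> Q (Suc i)})"
    by simp
  also have "\<dots> \<le> vlen K V' + vlen K W" using P PQ by (intro add_mono chain_strict_steps) auto
  finally show "enat n \<le> vlen K V' + vlen K W" .
qed

lemma vlen_attained:
  assumes "subspace_chain K V 0" and bd: "\<And>n. subspace_chain K V n \<Longrightarrow> n \<le> N"
  shows "\<exists>n. subspace_chain K V n \<and> vlen K V = enat n"
proof -
  define m where "m = Max {n. subspace_chain K V n}"
  have fin: "finite {n. subspace_chain K V n}"
    by (rule finite_subset[OF _ finite_atMost[of N]]) (use bd in auto)
  have "m \<in> {n. subspace_chain K V n}" unfolding m_def using assms(1) by (intro Max_in[OF fin]) auto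
  then have m: "subspace_chain K V m" by simp
  have "vlen K V \<le> enat m" unfolding m_def using Max_ge[OF fin] by (intro vlen_le) simp
  then show ?thesis using m chain_le_vlen[OF m] by (intro exI[of _ m] conjI antisym)
qed

text \<open>
  For the reverse inequality, a maximal chain of \<open>V'\<close> is continued by the preimages of one of \<open>W\<close>.
\<close>

lemma vlen_exact:
  assumes V: "Module.module K V" and V': "Module.module K V'" and W: "Module.module K W"
    and S: "linear K V' V S" "inj_on S (carrier V')" and T: "linear K V W T" "T ` carrier V = carrier W"
    and ker: "\<And>x. x \<in> carrier V \<Longrightarrow> T x = \<zero>\<^bsub>W\<^esub> \<longleftrightarrow> x \<in> S ` carrier V'"
    and fin: "vlen K V \<noteq> \<infinity>"
  shows "vlen K V = vlen K V' + vlen K W"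
proof (rule antisym)
  show "vlen K V \<le> vlen K V' + vlen K W" using vlen_le_kernel[OF V V' W S(1) T(1)] ker by blast
  have cat: "subspace_chain K V (a + b)" if ab: "subspace_chain K V' a" "subspace_chain K W b" for a b
  proof -
    obtain P where P: "\<And>i. i \<le> a \<Longrightarrow> subspace K V' (P i)" "\<And>i. i < a \<Longrightarrow> P i \<subset> P (Suc i)"
      using ab(1) unfolding subspace_chain_def by blast
    obtain Q where Q: "\<And>i. i \<le> b \<Longrightarrow> subspace K W (Q i)" "\<And>i. i < b \<Longrightarrow> Q i \<subset> Q (Suc i)"
      using ab(2) unfolding subspace_chain_def by blast
    define R where "R i = {x \<in> carrier V. T x \<in> Q i}" for i
    define U where "U i = (if i < a then S ` P i else R (i - a))" for i
    have "subspace K V (U i)" if "i \<le> a + b" for i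
      unfolding U_def R_def using subspace_image[OF V' V S(1) P(1)] subspace_preimage[OF V W T(1) Q(1)] that by auto
    moreover have "U i \<subset> U (Suc i)" if i: "i < a + b" for i
    proof -
      have SP: "S ` P i \<subset> S ` P (Suc i)" if "i < a"
      proof -
        have c: "P i \<subseteq> carrier V'" "P (Suc i) \<subseteq> carrier V'" using subspaceD(1)[OF P(1)] that by auto
        have "S ` P i \<noteq> S ` P (Suc i)" using inj_on_image_eq_iff[OF S(2) c] P(2)[OF that] by auto
        then show ?thesis using P(2)[OF that] by auto
      qed
      have kR: "S ` P a \<subseteq> R 0"
      proof
        fix x assume "x \<in> S ` P a"
        then have x: "x \<in> S ` carrier V'" using subspaceD(1)[OF P(1), of a] by auto
        then have xc: "x \<in> carrier V" using linearD(1)[OF S(1)] by auto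
        then have "T x = \<zero>\<^bsub>W\<^esub>" using x by (rule ker[THEN iffD2])
        then show "x \<in> R 0" using xc subspaceD(2)[OF Q(1), of 0] unfolding R_def by simp
      qed
      have RR: "R j \<subset> R (Suc j)" if j: "j < b" for j
      proof -
        obtain y where y: "y \<in> Q (Suc j)" "y \<notin> Q j" using Q(2)[OF j] by auto
        then have "y \<in> carrier W" using subspaceD(1)[OF Q(1), of "Suc j"] j by auto
        then have "y \<in> T ` carrier V" unfolding T(2) .
        then obtain x where "y = T x" "x \<in> carrier V" by (rule imageE)
        then show ?thesis using y Q(2)[OF j] unfolding R_def by auto
      qed
      consider "Suc i < a" | "Suc i = a" | "a \<le> i" by linarith
      then show ?thesis
      proof cases
        case 1 then show ?thesis using SP unfolding U_def by simp
      next
        case 2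
        then have "U i = S ` P i" "U (Suc i) = R 0" unfolding U_def by auto
        then show ?thesis using SP kR 2 by auto
      next
        case 3
        then show ?thesis using RR[of "i - a"] i unfolding U_def by (simp add: Suc_diff_le)
      qed
    qed
    ultimately show ?thesis unfolding subspace_chain_def by blast
  qed
  obtain N where N: "vlen K V = enat N" using fin by auto
  have bd: "a + b \<le> N" if "subspace_chain K V' a" "subspace_chain K W b" for a b
    using chain_le_vlen[OF cat[OF that]] N by simp
  interpret V': Module.module K V' by (rule V')
  interpret W: Module.module K W by (rule W)
  have c0: "subspace_chain K V' 0" "subspace_chain K W 0"
    unfolding subspace_chain_def subspace_def by (auto intro!: exI[of _ "\<lambda>_. carrier V'"] exI[of _ "\<lambda>_. carrier W"])
  obtain a where a: "subspace_chain K V' a" "vlen K V' = enat a"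
    using vlen_attained[OF c0(1), of N] bd[OF _ c0(2)] by auto
  obtain b where b: "subspace_chain K W b" "vlen K W = enat b"
    using vlen_attained[OF c0(2), of N] bd[OF c0(1)] by auto
  show "vlen K V' + vlen K W \<le> vlen K V" unfolding a(2) b(2) N using bd[OF a(1) b(1)] by simp
qed

lemma vlen_eq_0:
  assumes V: "Module.module K V" shows "vlen K V = 0 \<longleftrightarrow> carrier V = {\<zero>\<^bsub>V\<^esub>}"
proof
  interpret V: Module.module K V by (rule V)
  assume 0: "vlen K V = 0"
  show "carrier V = {\<zero>\<^bsub>V\<^esub>}"
  proof (rule ccontr)
    assume n: "carrier V \<noteq> {\<zero>\<^bsub>V\<^esub>}"
    have "subspace_chain K V 1" unfolding subspace_chain_def
      using n by (intro exI[of _ "\<lambda>i. if i = 0 then {\<zero>\<^bsub>V\<^esub>} else carrier V"])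
        (auto simp: subspace_def V.smult_r_null)
    then show False using chain_le_vlen[of K V 1] 0 by (simp add: zero_enat_def)
  qed
next
  assume z: "carrier V = {\<zero>\<^bsub>V\<^esub>}"
  have "n = 0" if c: "subspace_chain K V n" for n
  proof (rule ccontr)
    assume n: "n \<noteq> 0"
    obtain U where U: "\<And>i. i \<le> n \<Longrightarrow> subspace K V (U i)" "\<And>i. i < n \<Longrightarrow> U i \<subset> U (Suc i)"
      using c unfolding subspace_chain_def by blast
    have "U i = {\<zero>\<^bsub>V\<^esub>}" if "i \<le> n" for i using subspaceD(1,2)[OF U(1)[OF that]] z by auto
    then show False using U(2)[of 0] n by simp
  qed
  then have "vlen K V \<le> 0" by (intro vlen_le) (simp add: zero_enat_def)
  then show "vlen K V = 0" by simp
qed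

primrec kspan :: "('k, 'u) ring_scheme \<Rightarrow> ('k, 'v, 'w) module_scheme \<Rightarrow> (nat \<Rightarrow> 'v) \<Rightarrow> nat \<Rightarrow> 'v set" where
  "kspan K V z 0 = {\<zero>\<^bsub>V\<^esub>}"
| "kspan K V z (Suc j) = {u \<oplus>\<^bsub>V\<^esub> c \<odot>\<^bsub>V\<^esub> z j | u c. u \<in> kspan K V z j \<and> c \<in> carrier K}"

lemma kspan_subspace:
  assumes V: "Module.module K V" and z: "\<And>i. i < j \<Longrightarrow> z i \<in> carrier V"
  shows "subspace K V (kspan K V z j)"
proof -
  interpret V: Module.module K V by (rule V)
  show ?thesis using z
  proof (induction j)
    case 0
    then show ?case by (auto simp: subspace_def V.smult_r_null)
  next
    case (Suc j)
    then have IH: "subspace K V (kspan K V z j)" and zj: "z j \<in> carrier V" by auto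
    note IH' = subspaceD[OF IH]
    have c: "u \<in> carrier V" if "u \<in> kspan K V z j" for u using that IH'(1) by auto
    show ?case unfolding subspace_def kspan.simps
    proof (intro conjI ballI)
      show "{u \<oplus>\<^bsub>V\<^esub> c \<odot>\<^bsub>V\<^esub> z j |u c. u \<in> kspan K V z j \<and> c \<in> carrier K} \<subseteq> carrier V" using c zj by auto
      have "\<zero>\<^bsub>V\<^esub> = \<zero>\<^bsub>V\<^esub> \<oplus>\<^bsub>V\<^esub> \<zero>\<^bsub>K\<^esub> \<odot>\<^bsub>V\<^esub> z j" using zj by (simp add: V.smult_l_null)
      then show "\<zero>\<^bsub>V\<^esub> \<in> {u \<oplus>\<^bsub>V\<^esub> c \<odot>\<^bsub>V\<^esub> z j |u c. u \<in> kspan K V z j \<and> c \<in> carrier K}" using IH'(2) by blast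
      fix x assume "x \<in> {u \<oplus>\<^bsub>V\<^esub> c \<odot>\<^bsub>V\<^esub> z j |u c. u \<in> kspan K V z j \<and> c \<in> carrier K}"
      then obtain u a where x: "x = u \<oplus>\<^bsub>V\<^esub> a \<odot>\<^bsub>V\<^esub> z j" "u \<in> kspan K V z j" "a \<in> carrier K" by blast
      show "x \<oplus>\<^bsub>V\<^esub> y \<in> {u \<oplus>\<^bsub>V\<^esub> c \<odot>\<^bsub>V\<^esub> z j |u c. u \<in> kspan K V z j \<and> c \<in> carrier K}"
        if "y \<in> {u \<oplus>\<^bsub>V\<^esub> c \<odot>\<^bsub>V\<^esub> z j |u c. u \<in> kspan K V z j \<and> c \<in> carrier K}" for y
      proof -
        from that obtain v b where y: "y = v \<oplus>\<^bsub>V\<^esub> b \<odot>\<^bsub>V\<^esub> z j" "v \<in> kspan K V z j" "b \<in> carrier K" by blast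
        have "x \<oplus>\<^bsub>V\<^esub> y = (u \<oplus>\<^bsub>V\<^esub> v) \<oplus>\<^bsub>V\<^esub> (a \<oplus>\<^bsub>K\<^esub> b) \<odot>\<^bsub>V\<^esub> z j"
          unfolding x y using c[OF x(2)] c[OF y(2)] zj x(3) y(3) by (simp add: V.smult_l_distr V.a_ac)
        then show ?thesis using IH'(3)[OF x(2) y(2)] x(3) y(3) by blast
      qed
      show "k \<odot>\<^bsub>V\<^esub> x \<in> {u \<oplus>\<^bsub>V\<^esub> c \<odot>\<^bsub>V\<^esub> z j |u c. u \<in> kspan K V z j \<and> c \<in> carrier K}" if k: "k \<in> carrier K" for k
      proof -
        have "k \<odot>\<^bsub>V\<^esub> x = k \<odot>\<^bsub>V\<^esub> u \<oplus>\<^bsub>V\<^esub> (k \<otimes>\<^bsub>K\<^esub> a) \<odot>\<^bsub>V\<^esub> z j"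
          unfolding x using c[OF x(2)] zj x(3) k by (simp add: V.smult_r_distr V.smult_assoc1)
        then show ?thesis using IH'(4)[OF k x(2)] x(3) k by blast
      qed
    qed
  qed
qed

lemma kspan_mono:
  assumes V: "Module.module K V" and z: "\<And>i. i < j \<Longrightarrow> z i \<in> carrier V" and "i \<le> j"
  shows "kspan K V z i \<subseteq> kspan K V z j"
  using assms(3,2)
proof (induction rule: dec_induct)
  case (step j)
  interpret V: Module.module K V by (rule V)
  have "x \<in> kspan K V z (Suc j)" if x: "x \<in> kspan K V z j" for x
  proof -
    have "x \<in> carrier V" using subspaceD(1)[OF kspan_subspace[OF V, of j z]] x step(4) by auto
    then have "x = x \<oplus>\<^bsub>V\<^esub> \<zero>\<^bsub>K\<^esub> \<odot>\<^bsub>V\<^esub> z j" using step(4)[of j] by (simp add: V.smult_l_null)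
    then show ?thesis using x by auto
  qed
  then show ?case using step by auto
qed simp

lemma kspan_mem:
  assumes V: "Module.module K V" and z: "\<And>i. i < j \<Longrightarrow> z i \<in> carrier V" and i: "i < j"
  shows "z i \<in> kspan K V z j"
proof -
  interpret V: Module.module K V by (rule V)
  have zi: "z i \<in> carrier V" using z i by auto
  have "\<zero>\<^bsub>V\<^esub> \<in> kspan K V z i" using subspaceD(2)[OF kspan_subspace[OF V, of i z]] z i by auto
  moreover have "z i = \<zero>\<^bsub>V\<^esub> \<oplus>\<^bsub>V\<^esub> \<one>\<^bsub>K\<^esub> \<odot>\<^bsub>V\<^esub> z i" using zi by simp
  ultimately have "z i \<in> kspan K V z (Suc i)" unfolding kspan.simps by blast
  then show ?thesis using kspan_mono[OF V, of j z "Suc i"] z i by auto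
qed

lemma kspan_least:
  assumes U: "subspace K V U" and z: "\<And>i. i < j \<Longrightarrow> z i \<in> U"
  shows "kspan K V z j \<subseteq> U"
  using z
proof (induction j)
  case (Suc j)
  then have "kspan K V z j \<subseteq> U" "z j \<in> U" by auto
  then show ?case using subspaceD(3,4)[OF U] by auto
qed (use subspaceD(2)[OF U] in simp)

text \<open>
  An echelon argument: \<open>L i\<close> is the set of leading positions of \<open>U i\<close> with respect to the spanning family, and each
  step of a chain of subspaces gains a new one.
\<close>

lemma vlen_spanned:
  assumes K: "field K" and V: "Module.module K V" and z: "\<And>i. i < r \<Longrightarrow> z i \<in> carrier V"
    and sp: "carrier V \<subseteq> kspan K V z r"
  shows "vlen K V \<le> enat r"
proof (rule vlen_le)
  interpret K: field K by (rule K)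
  interpret V: Module.module K V by (rule V)
  fix n assume "subspace_chain K V n"
  then obtain U where U: "\<And>i. i \<le> n \<Longrightarrow> subspace K V (U i)" "\<And>i. i < n \<Longrightarrow> U i \<subset> U (Suc i)"
    unfolding subspace_chain_def by blast
  define L where "L i = {j. j < r \<and> (\<exists>u\<in>kspan K V z j. u \<oplus>\<^bsub>V\<^esub> z j \<in> U i)}" for i
  have kc: "kspan K V z j \<subseteq> carrier V" if "j \<le> r" for j
    using subspaceD(1)[OF kspan_subspace[OF V, of j z]] z that by auto
  have "L i \<subset> L (Suc i)" if i: "i < n" for i
  proof -
    have Ui: "subspace K V (U i)" "subspace K V (U (Suc i))" using U(1) i by auto
    obtain x where x: "x \<in> U (Suc i)" "x \<notin> U i" using U(2)[OF i] by auto
    have xc: "x \<in> carrier V" using x subspaceD(1)[OF Ui(2)] by auto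
    let ?P = "\<lambda>j. \<exists>x\<in>kspan K V z j. x \<in> U (Suc i) \<and> x \<notin> U i"
    have P0: "?P r" using x xc sp by auto
    define j where "j = (LEAST j. ?P j)"
    have j: "?P j" "j \<le> r" unfolding j_def by (rule LeastI[of ?P, OF P0], rule Least_le[of ?P, OF P0])
    have jmin: "\<not> ?P k" if "k < j" for k using that unfolding j_def by (rule not_less_Least)
    obtain y where y: "y \<in> kspan K V z j" "y \<in> U (Suc i)" "y \<notin> U i" using j(1) by blast
    have "j \<noteq> 0" using y subspaceD(2)[OF Ui(1)] by (metis kspan.simps(1) singletonD)
    then obtain j' where j': "j = Suc j'" using not0_implies_Suc by blast
    have zj: "z j' \<in> carrier V" using z j(2) j' by auto
    obtain u c where uc: "y = u \<oplus>\<^bsub>V\<^esub> c \<odot>\<^bsub>V\<^esub> z j'" "u \<in> kspan K V z j'" "c \<in> carrier K"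
      using y(1) unfolding j' by auto
    have sj: "subspace K V (kspan K V z j')" using kspan_subspace[OF V, of j' z] z j(2) j' by auto
    have ucar: "u \<in> carrier V" using uc(2) subspaceD(1)[OF sj] by auto
    have c0: "c \<noteq> \<zero>\<^bsub>K\<^esub>"
    proof
      assume "c = \<zero>\<^bsub>K\<^esub>"
      then have "y = u" using uc ucar zj by (simp add: V.smult_l_null)
      then show False using jmin[of j'] j' y uc(2) by auto
    qed
    define ci where "ci = inv\<^bsub>K\<^esub> c"
    have ci: "ci \<in> carrier K" "ci \<otimes>\<^bsub>K\<^esub> c = \<one>\<^bsub>K\<^esub>" "c \<otimes>\<^bsub>K\<^esub> ci = \<one>\<^bsub>K\<^esub>"
      unfolding ci_def using K.field_Units uc(3) c0 by auto
    have "ci \<odot>\<^bsub>V\<^esub> y = ci \<odot>\<^bsub>V\<^esub> u \<oplus>\<^bsub>V\<^esub> z j'"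
      unfolding uc(1) using ucar zj uc(3) ci by (simp add: V.smult_r_distr V.smult_assoc1[symmetric])
    then have "j' \<in> L (Suc i)" unfolding L_def
      using subspaceD(4)[OF Ui(2) ci(1) y(2)] subspaceD(4)[OF sj ci(1) uc(2)] j(2) j' by auto
    moreover have "j' \<notin> L i"
    proof
      assume "j' \<in> L i"
      then obtain v where v: "v \<in> kspan K V z j'" "v \<oplus>\<^bsub>V\<^esub> z j' \<in> U i" unfolding L_def by auto
      have vcar: "v \<in> carrier V" using v(1) subspaceD(1)[OF sj] by auto
      define w where "w = \<ominus>\<^bsub>V\<^esub> (c \<odot>\<^bsub>V\<^esub> (v \<oplus>\<^bsub>V\<^esub> z j'))"
      have w: "w \<in> U i" unfolding w_def using subspace_minus[OF V Ui(1)] subspaceD(4)[OF Ui(1) uc(3) v(2)] .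
      have car: "c \<odot>\<^bsub>V\<^esub> z j' \<in> carrier V" "c \<odot>\<^bsub>V\<^esub> v \<in> carrier V" using uc(3) vcar zj by auto
      have "w = \<ominus>\<^bsub>V\<^esub> (c \<odot>\<^bsub>V\<^esub> v) \<oplus>\<^bsub>V\<^esub> \<ominus>\<^bsub>V\<^esub> (c \<odot>\<^bsub>V\<^esub> z j')"
        unfolding w_def using vcar zj uc(3) car by (simp add: V.smult_r_distr V.minus_add)
      then have "y \<oplus>\<^bsub>V\<^esub> w = (u \<oplus>\<^bsub>V\<^esub> \<ominus>\<^bsub>V\<^esub> (c \<odot>\<^bsub>V\<^esub> v)) \<oplus>\<^bsub>V\<^esub> (c \<odot>\<^bsub>V\<^esub> z j' \<oplus>\<^bsub>V\<^esub> \<ominus>\<^bsub>V\<^esub> (c \<odot>\<^bsub>V\<^esub> z j'))"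
        unfolding uc(1) using ucar car by (simp add: V.a_ac)
      also have "\<dots> = u \<oplus>\<^bsub>V\<^esub> \<ominus>\<^bsub>V\<^esub> (c \<odot>\<^bsub>V\<^esub> v)" using ucar car by (simp add: V.r_neg)
      also have "\<dots> \<in> kspan K V z j'"
        using subspaceD(3)[OF sj uc(2) subspace_minus[OF V sj subspaceD(4)[OF sj uc(3) v(1)]]] .
      finally have k: "y \<oplus>\<^bsub>V\<^esub> w \<in> kspan K V z j'" .
      have "y \<oplus>\<^bsub>V\<^esub> w \<in> U (Suc i)" using subspaceD(3)[OF Ui(2) y(2)] w U(2)[OF i] by auto
      then have "y \<oplus>\<^bsub>V\<^esub> w \<in> U i" using jmin[of j'] j' k by auto
      then have "y \<in> U i" using subspace_diff_mem[OF V Ui(1) w] y(2) subspaceD(1)[OF Ui(2)] by auto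
      then show False using y by simp
    qed
    moreover have "L i \<subseteq> L (Suc i)" unfolding L_def using U(2)[OF i] by auto
    ultimately show ?thesis by auto
  qed
  then have lt: "card (L i) < card (L (Suc i))" if "i < n" for i
    using that by (intro psubset_card_mono) (auto simp: L_def)
  have "i \<le> card (L i)" if "i \<le> n" for i
    using that
  proof (induction i)
    case (Suc i)
    then show ?case using lt[of i] by simp
  qed simp
  then have "n \<le> card (L n)" by simp
  also have "\<dots> \<le> card {..<r}" by (rule card_mono) (auto simp: L_def)
  finally show "enat n \<le> enat r" by simp
qed

text \<open>Choosing elements outside the span of the previous ones makes a chain, which has to stop.\<close>

lemma finite_vlen_spanned:
  assumes V: "Module.module K V" and fin: "vlen K V \<noteq> \<infinity>" and U: "subspace K V U"
  shows "\<exists>r z. (\<forall>i<r. z i \<in> U) \<and> kspan K V z r = U"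
proof (rule ccontr)
  assume no: "\<not> ?thesis"
  obtain N where N: "vlen K V = enat N" using fin by auto
  have Uc: "U \<subseteq> carrier V" using subspaceD(1)[OF U] .
  have "\<exists>z. (\<forall>i<n. z i \<in> U \<and> z i \<notin> kspan K V z i)" for n
  proof (induction n)
    case (Suc n)
    then obtain z where z: "\<forall>i<n. z i \<in> U \<and> z i \<notin> kspan K V z i" by blast
    have "kspan K V z n \<subseteq> U" using z by (intro kspan_least[OF U]) auto
    then obtain x where x: "x \<in> U" "x \<notin> kspan K V z n" using no z by blast
    define z' where "z' i = (if i = n then x else z i)" for i
    have z': "z' n = x" "\<And>i. i < n \<Longrightarrow> z' i = z i" by (simp_all add: z'_def)
    have eq: "kspan K V z' i = kspan K V z i" if "i \<le> n" for i
      using that by (induction i) (simp_all add: z')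
    have "z' i \<in> U \<and> z' i \<notin> kspan K V z' i" if "i < Suc n" for i
      using that z x eq[of i] z' by (cases "i = n") auto
    then show ?case by blast
  qed simp
  then obtain z where z: "\<And>i. i < Suc N \<Longrightarrow> z i \<in> U \<and> z i \<notin> kspan K V z i" by blast
  have "subspace_chain K V (Suc N)" unfolding subspace_chain_def
  proof (intro exI[of _ "kspan K V z"] conjI allI impI)
    fix i assume i: "i \<le> Suc N"
    show "subspace K V (kspan K V z i)" using z i Uc by (intro kspan_subspace[OF V]) force
  next
    fix i assume i: "i < Suc N"
    have zc: "\<And>k. k < Suc i \<Longrightarrow> z k \<in> carrier V" using z i Uc by force
    have "kspan K V z i \<subseteq> kspan K V z (Suc i)" by (rule kspan_mono[OF V]) (use zc in auto)
    moreover have "z i \<in> kspan K V z (Suc i)" by (rule kspan_mem[OF V]) (use zc in auto)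
    ultimately show "kspan K V z i \<subset> kspan K V z (Suc i)" using z[OF i] by auto
  qed
  then show False using chain_le_vlen[of K V "Suc N"] N by simp
qed

lemma subspace_module:
  assumes V: "Module.module K V" and U: "subspace K V U"
  shows "Module.module K (V\<lparr>carrier := U\<rparr>)"
proof -
  interpret V: Module.module K V by (rule V)
  note U' = subspaceD[OF U]
  have c: "x \<in> carrier V" if "x \<in> U" for x using U'(1) that by auto
  have "\<exists>y\<in>U. y \<oplus>\<^bsub>V\<^esub> x = \<zero>\<^bsub>V\<^esub>" if "x \<in> U" for x
    using subspace_minus[OF V U that] c[OF that] by (intro bexI[of _ "\<ominus>\<^bsub>V\<^esub> x"]) (simp_all add: V.l_neg)
  then have "abelian_group (V\<lparr>carrier := U\<rparr>)"
    by (intro abelian_groupI) (simp_all add: U' c V.a_ac)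
  then show ?thesis
    by (intro Module.moduleI V.is_cring) (simp_all add: U' c V.smult_l_distr V.smult_r_distr V.smult_assoc1)
qed

lemma vlen_subspace:
  assumes "subspace K V U" shows "vlen K (V\<lparr>carrier := U\<rparr>) \<le> vlen K V"
proof (rule vlen_le)
  fix n assume "subspace_chain K (V\<lparr>carrier := U\<rparr>) n"
  then obtain W where W: "\<forall>i\<le>n. subspace K (V\<lparr>carrier := U\<rparr>) (W i)" "\<forall>i<n. W i \<subset> W (Suc i)"
    unfolding subspace_chain_def by (elim exE conjE)
  have "subspace K V (W i)" if "i \<le> n" for i
  proof -
    have "subspace K (V\<lparr>carrier := U\<rparr>) (W i)" using W(1) that by simp
    then show ?thesis using subspaceD(1)[OF assms] unfolding subspace_def by auto
  qed
  then have "subspace_chain K V n" unfolding subspace_chain_def using W(2) by (intro exI[of _ W]) simp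
  then show "enat n \<le> vlen K V" by (rule chain_le_vlen)
qed

text \<open>Imposing the conditions \<open>E i x = 0\<close> one after the other cuts out a descending sequence with quotients inside \<open>W\<close>.\<close>

lemma finite_vlen_jointly_injective:
  fixes V :: "('k, 'v, 'w) module_scheme" and n :: nat
  assumes V: "Module.module K V" and W: "Module.module K W" and fin: "vlen K W \<noteq> \<infinity>"
    and E: "\<And>i. i < n \<Longrightarrow> linear K V W (E i)"
    and inj: "\<And>x. x \<in> carrier V \<Longrightarrow> (\<And>i. i < n \<Longrightarrow> E i x = \<zero>\<^bsub>W\<^esub>) \<Longrightarrow> x = \<zero>\<^bsub>V\<^esub>"
  shows "vlen K V \<noteq> \<infinity>"
proof -
  interpret V: Module.module K V by (rule V)
  interpret W: Module.module K W by (rule W)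
  define U where "U j = {x \<in> carrier V. \<forall>i<j. E i x = \<zero>\<^bsub>W\<^esub>}" for j
  have U: "subspace K V (U j)" if "j \<le> n" for j
  proof -
    have l: "linear K V W (E i)" if "i < j" for i using E \<open>j \<le> n\<close> that by simp
    show ?thesis unfolding subspace_def U_def
      using linearD[OF l] linear_zero[OF V W l] by auto
  qed
  have m: "Module.module K (V\<lparr>carrier := U j\<rparr>)" if "j \<le> n" for j using subspace_module[OF V U[OF that]] .
  have st: "vlen K (V\<lparr>carrier := U j\<rparr>) \<le> vlen K (V\<lparr>carrier := U (Suc j)\<rparr>) + vlen K W" if j: "j < n" for j
  proof (rule vlen_le_kernel[OF m m W])
    show "linear K (V\<lparr>carrier := U (Suc j)\<rparr>) (V\<lparr>carrier := U j\<rparr>) (\<lambda>x. x)"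
      unfolding linear_def U_def by auto
    show "linear K (V\<lparr>carrier := U j\<rparr>) W (E j)"
      using E[OF j] unfolding linear_def U_def by auto
    fix x assume "x \<in> carrier (V\<lparr>carrier := U j\<rparr>)" "E j x = \<zero>\<^bsub>W\<^esub>"
    then show "x \<in> (\<lambda>x. x) ` carrier (V\<lparr>carrier := U (Suc j)\<rparr>)" unfolding U_def by (auto simp: less_Suc_eq)
  qed (use j in auto)
  have "vlen K (V\<lparr>carrier := U j\<rparr>) \<noteq> \<infinity>" if "j \<le> n" for j
    using that
  proof (induction rule: inc_induct)
    case base
    have "carrier (V\<lparr>carrier := U n\<rparr>) = {\<zero>\<^bsub>V\<lparr>carrier := U n\<rparr>\<^esub>}"
      using inj subspaceD(2)[OF U[of n]] unfolding U_def by auto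
    then have "vlen K (V\<lparr>carrier := U n\<rparr>) = 0" using vlen_eq_0[OF m[of n]] by simp
    then show ?case by simp
  next
    case (step j)
    have "vlen K (V\<lparr>carrier := U (Suc j)\<rparr>) + vlen K W \<noteq> \<infinity>" using step(3) fin by (simp add: plus_eq_infty_iff_enat)
    then show ?case using st[of j] step(2) by (metis enat_ord_simps(5))
  qed
  from this[of 0] show ?thesis unfolding U_def by simp
qed

text \<open>
  Extension by one dimension: a vector outside the subspace may be sent to zero.  In a finitely spanned space
  finitely many such extensions exhaust the space.
\<close>

lemma linear_extension_step:
  assumes K: "field K" and V: "Module.module K V" and W: "Module.module K W"
    and U: "subspace K V U" and \<phi>: "linear K (V\<lparr>carrier := U\<rparr>) W \<phi>" and z: "z \<in> carrier V"
  shows "\<exists>U' \<psi>. subspace K V U' \<and> U \<subseteq> U' \<and> z \<in> U' \<and> linear K (V\<lparr>carrier := U'\<rparr>) W \<psi> \<and> (\<forall>x\<in>U. \<psi> x = \<phi> x)"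
proof (cases "z \<in> U")
  case True
  then show ?thesis using U \<phi> by (intro exI[of _ U] exI[of _ \<phi>]) simp
next
  case False
  interpret K: field K by (rule K)
  interpret V: Module.module K V by (rule V)
  interpret W: Module.module K W by (rule W)
  note U' = subspaceD[OF U]
  have c: "x \<in> carrier V" if "x \<in> U" for x using U'(1) that by auto
  have uniq: "a = b \<and> u = v" if e: "u \<oplus>\<^bsub>V\<^esub> a \<odot>\<^bsub>V\<^esub> z = v \<oplus>\<^bsub>V\<^esub> b \<odot>\<^bsub>V\<^esub> z" and m: "u \<in> U" "v \<in> U" "a \<in> carrier K" "b \<in> carrier K" for a b u v
  proof -
    define t where "t = a \<oplus>\<^bsub>K\<^esub> \<ominus>\<^bsub>K\<^esub> b"
    have t: "t \<in> carrier K" unfolding t_def using m by simp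
    have uv: "u \<in> carrier V" "v \<in> carrier V" "a \<odot>\<^bsub>V\<^esub> z \<in> carrier V" "b \<odot>\<^bsub>V\<^esub> z \<in> carrier V" using m c z by auto
    have "t \<odot>\<^bsub>V\<^esub> z = a \<odot>\<^bsub>V\<^esub> z \<oplus>\<^bsub>V\<^esub> \<ominus>\<^bsub>V\<^esub> (b \<odot>\<^bsub>V\<^esub> z)"
      unfolding t_def using m z by (simp add: V.smult_l_distr V.smult_l_minus)
    also have "\<dots> = (u \<oplus>\<^bsub>V\<^esub> a \<odot>\<^bsub>V\<^esub> z) \<oplus>\<^bsub>V\<^esub> (\<ominus>\<^bsub>V\<^esub> u \<oplus>\<^bsub>V\<^esub> \<ominus>\<^bsub>V\<^esub> (b \<odot>\<^bsub>V\<^esub> z))"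
      using uv by (simp add: V.a_assoc V.a_lcomm[of u] V.r_neg1 V.r_neg2)
    also have "\<dots> = (v \<oplus>\<^bsub>V\<^esub> b \<odot>\<^bsub>V\<^esub> z) \<oplus>\<^bsub>V\<^esub> (\<ominus>\<^bsub>V\<^esub> u \<oplus>\<^bsub>V\<^esub> \<ominus>\<^bsub>V\<^esub> (b \<odot>\<^bsub>V\<^esub> z))" unfolding e ..
    also have "\<dots> = (v \<oplus>\<^bsub>V\<^esub> \<ominus>\<^bsub>V\<^esub> u) \<oplus>\<^bsub>V\<^esub> (b \<odot>\<^bsub>V\<^esub> z \<oplus>\<^bsub>V\<^esub> \<ominus>\<^bsub>V\<^esub> (b \<odot>\<^bsub>V\<^esub> z))"
      using uv by (simp add: V.a_ac)
    also have "\<dots> = v \<oplus>\<^bsub>V\<^esub> \<ominus>\<^bsub>V\<^esub> u" using uv by (simp add: V.r_neg)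
    finally have tz: "t \<odot>\<^bsub>V\<^esub> z \<in> U" using U'(3)[OF m(2) subspace_minus[OF V U m(1)]] by simp
    have "t = \<zero>\<^bsub>K\<^esub>"
    proof (rule ccontr)
      assume "t \<noteq> \<zero>\<^bsub>K\<^esub>"
      then have "t \<in> Units K" using t K.field_Units by simp
      then have i: "inv\<^bsub>K\<^esub> t \<in> carrier K" "inv\<^bsub>K\<^esub> t \<otimes>\<^bsub>K\<^esub> t = \<one>\<^bsub>K\<^esub>" by auto
      have "inv\<^bsub>K\<^esub> t \<odot>\<^bsub>V\<^esub> (t \<odot>\<^bsub>V\<^esub> z) = z" using i t z by (simp add: V.smult_assoc1[symmetric])
      then have "z \<in> U" using U'(4)[OF i(1) tz] by simp
      then show False using False by simp
    qed
    then have "a \<oplus>\<^bsub>K\<^esub> \<ominus>\<^bsub>K\<^esub> b = \<zero>\<^bsub>K\<^esub>" unfolding t_def .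
    then have ab: "a = b" using m K.minus_equality[of a "\<ominus>\<^bsub>K\<^esub> b"] by simp
    then have "u = v" using e uv V.a_comm by (metis V.add.right_cancel)
    then show ?thesis using ab by simp
  qed
  define U2 where "U2 = {u \<oplus>\<^bsub>V\<^esub> a \<odot>\<^bsub>V\<^esub> z | u a. u \<in> U \<and> a \<in> carrier K}"
  define p where "p y = (THE u. u \<in> U \<and> (\<exists>a\<in>carrier K. y = u \<oplus>\<^bsub>V\<^esub> a \<odot>\<^bsub>V\<^esub> z))" for y
  have p: "p (u \<oplus>\<^bsub>V\<^esub> a \<odot>\<^bsub>V\<^esub> z) = u" if m: "u \<in> U" "a \<in> carrier K" for u a
    unfolding p_def
  proof (rule the_equality)
    show "u \<in> U \<and> (\<exists>b\<in>carrier K. u \<oplus>\<^bsub>V\<^esub> a \<odot>\<^bsub>V\<^esub> z = u \<oplus>\<^bsub>V\<^esub> b \<odot>\<^bsub>V\<^esub> z)" using m by blast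
    show "v = u" if v: "v \<in> U \<and> (\<exists>b\<in>carrier K. u \<oplus>\<^bsub>V\<^esub> a \<odot>\<^bsub>V\<^esub> z = v \<oplus>\<^bsub>V\<^esub> b \<odot>\<^bsub>V\<^esub> z)" for v
    proof -
      obtain b where b: "b \<in> carrier K" "u \<oplus>\<^bsub>V\<^esub> a \<odot>\<^bsub>V\<^esub> z = v \<oplus>\<^bsub>V\<^esub> b \<odot>\<^bsub>V\<^esub> z" using v by (elim conjE bexE)
      have "v \<in> U" using v by (elim conjE)
      then show ?thesis using uniq[OF b(2) m(1) _ m(2) b(1)] by simp
    qed
  qed
  have add: "(u \<oplus>\<^bsub>V\<^esub> a \<odot>\<^bsub>V\<^esub> z) \<oplus>\<^bsub>V\<^esub> (v \<oplus>\<^bsub>V\<^esub> b \<odot>\<^bsub>V\<^esub> z) = (u \<oplus>\<^bsub>V\<^esub> v) \<oplus>\<^bsub>V\<^esub> (a \<oplus>\<^bsub>K\<^esub> b) \<odot>\<^bsub>V\<^esub> z"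
    if "u \<in> U" "v \<in> U" "a \<in> carrier K" "b \<in> carrier K" for u v a b
    using that c z by (simp add: V.smult_l_distr V.a_ac)
  have sm: "k \<odot>\<^bsub>V\<^esub> (u \<oplus>\<^bsub>V\<^esub> a \<odot>\<^bsub>V\<^esub> z) = k \<odot>\<^bsub>V\<^esub> u \<oplus>\<^bsub>V\<^esub> (k \<otimes>\<^bsub>K\<^esub> a) \<odot>\<^bsub>V\<^esub> z"
    if "u \<in> U" "a \<in> carrier K" "k \<in> carrier K" for u a k
    using that c z by (simp add: V.smult_r_distr V.smult_assoc1)
  have UU2: "u \<in> U2" "p u = u" if u: "u \<in> U" for u
  proof -
    have e: "u = u \<oplus>\<^bsub>V\<^esub> \<zero>\<^bsub>K\<^esub> \<odot>\<^bsub>V\<^esub> z" using c[OF u] z by (simp add: V.smult_l_null)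
    show "u \<in> U2" unfolding U2_def using e u K.zero_closed by blast
    show "p u = u" using p[OF u K.zero_closed] e by simp
  qed
  have "z = \<zero>\<^bsub>V\<^esub> \<oplus>\<^bsub>V\<^esub> \<one>\<^bsub>K\<^esub> \<odot>\<^bsub>V\<^esub> z" using z by simp
  then have zU2: "z \<in> U2" unfolding U2_def using U'(2) K.one_closed by blast
  have U2E: "\<exists>u a. u \<in> U \<and> a \<in> carrier K \<and> x = u \<oplus>\<^bsub>V\<^esub> a \<odot>\<^bsub>V\<^esub> z" if "x \<in> U2" for x using that unfolding U2_def by blast
  have U2I: "u \<oplus>\<^bsub>V\<^esub> a \<odot>\<^bsub>V\<^esub> z \<in> U2" if "u \<in> U" "a \<in> carrier K" for u a using that unfolding U2_def by blast
  have sub: "subspace K V U2" unfolding subspace_def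
  proof (intro conjI ballI)
    show "U2 \<subseteq> carrier V" unfolding U2_def using c z by auto
    show "\<zero>\<^bsub>V\<^esub> \<in> U2" using UU2(1)[OF U'(2)] .
    fix x assume xU: "x \<in> U2"
    obtain u a where x: "u \<in> U" "a \<in> carrier K" "x = u \<oplus>\<^bsub>V\<^esub> a \<odot>\<^bsub>V\<^esub> z" using U2E[OF xU] by (elim exE conjE)
    show "x \<oplus>\<^bsub>V\<^esub> y \<in> U2" if yU: "y \<in> U2" for y
    proof -
      obtain v b where y: "v \<in> U" "b \<in> carrier K" "y = v \<oplus>\<^bsub>V\<^esub> b \<odot>\<^bsub>V\<^esub> z" using U2E[OF yU] by (elim exE conjE)
      show ?thesis unfolding x(3) y(3) add[OF x(1) y(1) x(2) y(2)] using U2I[OF U'(3)[OF x(1) y(1)]] x(2) y(2) by simp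
    qed
    show "k \<odot>\<^bsub>V\<^esub> x \<in> U2" if k: "k \<in> carrier K" for k
      unfolding x(3) sm[OF x(1,2) k] using U2I[OF U'(4)[OF k x(1)]] x(2) k by simp
  qed
  have \<phi>': "\<phi> u \<in> carrier W" "\<phi> (u \<oplus>\<^bsub>V\<^esub> v) = \<phi> u \<oplus>\<^bsub>W\<^esub> \<phi> v" "k \<in> carrier K \<Longrightarrow> \<phi> (k \<odot>\<^bsub>V\<^esub> u) = k \<odot>\<^bsub>W\<^esub> \<phi> u"
    if "u \<in> U" "v \<in> U" for u v k using linearD[OF \<phi>] that by simp_all
  have "linear K (V\<lparr>carrier := U2\<rparr>) W (\<lambda>y. \<phi> (p y))" unfolding linear_def
  proof (intro conjI ballI funcsetI)
    fix x assume "x \<in> carrier (V\<lparr>carrier := U2\<rparr>)"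
    then have xU: "x \<in> U2" by simp
    obtain u a where x: "u \<in> U" "a \<in> carrier K" "x = u \<oplus>\<^bsub>V\<^esub> a \<odot>\<^bsub>V\<^esub> z" using U2E[OF xU] by (elim exE conjE)
    show "\<phi> (p x) \<in> carrier W" unfolding x(3) p[OF x(1,2)] by (rule \<phi>'(1)[OF x(1,1)])
    show "\<phi> (p (x \<oplus>\<^bsub>V\<lparr>carrier := U2\<rparr>\<^esub> y)) = \<phi> (p x) \<oplus>\<^bsub>W\<^esub> \<phi> (p y)" if "y \<in> carrier (V\<lparr>carrier := U2\<rparr>)" for y
    proof -
      have yU: "y \<in> U2" using that by simp
      obtain v b where y: "v \<in> U" "b \<in> carrier K" "y = v \<oplus>\<^bsub>V\<^esub> b \<odot>\<^bsub>V\<^esub> z" using U2E[OF yU] by (elim exE conjE)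
      have "p (x \<oplus>\<^bsub>V\<^esub> y) = u \<oplus>\<^bsub>V\<^esub> v" unfolding x(3) y(3) add[OF x(1) y(1) x(2) y(2)]
        using p[OF U'(3)[OF x(1) y(1)]] x(2) y(2) by simp
      then show ?thesis using p[OF x(1,2)] p[OF y(1,2)] \<phi>'(2)[OF x(1) y(1)] x(3) y(3) by simp
    qed
    show "\<phi> (p (k \<odot>\<^bsub>V\<lparr>carrier := U2\<rparr>\<^esub> x)) = k \<odot>\<^bsub>W\<^esub> \<phi> (p x)" if k: "k \<in> carrier K" for k
    proof -
      have "p (k \<odot>\<^bsub>V\<^esub> x) = k \<odot>\<^bsub>V\<^esub> u" unfolding x(3) sm[OF x(1,2) k]
        using p[OF U'(4)[OF k x(1)]] x(2) k by simp
      then show ?thesis using p[OF x(1,2)] \<phi>'(3)[OF x(1,1) k] x(3) by simp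
    qed
  qed
  then show ?thesis using sub UU2 zU2 by (intro exI[of _ U2] exI[of _ "\<lambda>y. \<phi> (p y)"]) auto
qed

lemma linear_extension:
  assumes K: "field K" and V: "Module.module K V" and W: "Module.module K W"
    and fin: "vlen K V \<noteq> \<infinity>"
    and U: "subspace K V U" and \<phi>: "linear K (V\<lparr>carrier := U\<rparr>) W \<phi>"
  shows "\<exists>\<psi>. linear K V W \<psi> \<and> (\<forall>x\<in>U. \<psi> x = \<phi> x)"
proof -
  interpret V: Module.module K V by (rule V)
  have "subspace K V (carrier V)" unfolding subspace_def by auto
  then obtain r z where z0: "\<forall>i<r. z i \<in> carrier V" "kspan K V z r = carrier V"
    using finite_vlen_spanned[OF V fin] by blast
  have z: "\<And>i. i < r \<Longrightarrow> z i \<in> carrier V" using z0(1) by simp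
  have ex: "\<exists>U' \<psi>. subspace K V U' \<and> U \<subseteq> U' \<and> (\<forall>i<j. z i \<in> U') \<and> linear K (V\<lparr>carrier := U'\<rparr>) W \<psi> \<and> (\<forall>x\<in>U. \<psi> x = \<phi> x)"
    if "j \<le> r" for j
    using that
  proof (induction j)
    case 0
    then show ?case using U \<phi> by (intro exI[of _ U] exI[of _ \<phi>]) simp
  next
    case (Suc j)
    then obtain U' \<psi> where h: "subspace K V U'" "U \<subseteq> U'" "\<forall>i<j. z i \<in> U'" "linear K (V\<lparr>carrier := U'\<rparr>) W \<psi>" "\<forall>x\<in>U. \<psi> x = \<phi> x"
      by auto
    obtain U2 \<psi>2 where h2: "subspace K V U2" "U' \<subseteq> U2" "z j \<in> U2" "linear K (V\<lparr>carrier := U2\<rparr>) W \<psi>2" "\<forall>x\<in>U'. \<psi>2 x = \<psi> x"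
      using linear_extension_step[OF K V W h(1,4), of "z j"] z[of j] Suc.prems by auto
    show ?case using h h2 by (intro exI[of _ U2] exI[of _ \<psi>2]) (auto simp: less_Suc_eq)
  qed
  obtain U' \<psi> where h: "subspace K V U'" "\<forall>i<r. z i \<in> U'" "linear K (V\<lparr>carrier := U'\<rparr>) W \<psi>" "\<forall>x\<in>U. \<psi> x = \<phi> x"
    using ex[OF le_refl] by (elim exE conjE)
  have "carrier V \<subseteq> U'" using kspan_least[OF h(1), of r z] h(2) z0(2) by simp
  then have "U' = carrier V" using subspaceD(1)[OF h(1)] by auto
  then show ?thesis using h by (intro exI[of _ \<psi>]) (simp add: linear_def)
qed


section \<open>Constructions of right modules\<close>

text \<open>
  Specialises the record types to those for which \<open>fgmod\<close> is defined.
\<close>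

locale fd_alg = fd_algebra K A for K :: "'k ring" and A :: "('k, 'a) module"

lemma enat_le_finite: "x \<le> (y::enat) \<Longrightarrow> y \<noteq> \<infinity> \<Longrightarrow> x \<noteq> \<infinity>"
  by (cases x; cases y) auto

lemma (in abelian_monoid) finsum_lessThan_mem:
  assumes "S \<subseteq> carrier G" "\<zero> \<in> S" "\<And>x y. x \<in> S \<Longrightarrow> y \<in> S \<Longrightarrow> x \<oplus> y \<in> S" "\<And>i. i < (n::nat) \<Longrightarrow> f i \<in> S"
  shows "(\<Oplus>i\<in>{..<n}. f i) \<in> S"
  using assms(4)
proof (induction n)
  case (Suc n)
  have "f \<in> {..<n} \<rightarrow> carrier G" "f n \<in> carrier G" using Suc(2) assms(1) by (auto simp: Pi_iff less_Suc_eq)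
  then show ?case using Suc assms(3) by (simp add: lessThan_Suc)
qed (simp add: assms(2))

context right_module
begin

lemma ract_zero: assumes x: "x \<in> carrier M" shows "x \<triangleleft>\<^bsub>M\<^esub> \<zero>\<^bsub>A\<^esub> = \<zero>\<^bsub>M\<^esub>"
proof -
  have c: "x \<triangleleft>\<^bsub>M\<^esub> \<zero>\<^bsub>A\<^esub> \<in> carrier M" using x ract_closed by simp
  have "x \<triangleleft>\<^bsub>M\<^esub> \<zero>\<^bsub>A\<^esub> \<oplus>\<^bsub>M\<^esub> x \<triangleleft>\<^bsub>M\<^esub> \<zero>\<^bsub>A\<^esub> = x \<triangleleft>\<^bsub>M\<^esub> \<zero>\<^bsub>A\<^esub>" using add_ract[OF x A.zero_closed A.zero_closed] by simp
  then show ?thesis using c by simp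
qed

lemma zero_ract: assumes a: "a \<in> carrier A" shows "\<zero>\<^bsub>M\<^esub> \<triangleleft>\<^bsub>M\<^esub> a = \<zero>\<^bsub>M\<^esub>"
proof -
  have c: "\<zero>\<^bsub>M\<^esub> \<triangleleft>\<^bsub>M\<^esub> a \<in> carrier M" using a ract_closed by simp
  have "\<zero>\<^bsub>M\<^esub> \<triangleleft>\<^bsub>M\<^esub> a \<oplus>\<^bsub>M\<^esub> \<zero>\<^bsub>M\<^esub> \<triangleleft>\<^bsub>M\<^esub> a = \<zero>\<^bsub>M\<^esub> \<triangleleft>\<^bsub>M\<^esub> a" using ract_add[OF M.zero_closed M.zero_closed a] by simp
  then show ?thesis using c by simp
qed

lemma ract_minus_one: assumes x: "x \<in> carrier M" shows "x \<triangleleft>\<^bsub>M\<^esub> (\<ominus>\<^bsub>A\<^esub> \<one>\<^bsub>A\<^esub>) = \<ominus>\<^bsub>M\<^esub> x"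
proof -
  have c: "x \<triangleleft>\<^bsub>M\<^esub> (\<ominus>\<^bsub>A\<^esub> \<one>\<^bsub>A\<^esub>) \<in> carrier M" using x ract_closed by simp
  have "x \<triangleleft>\<^bsub>M\<^esub> (\<ominus>\<^bsub>A\<^esub> \<one>\<^bsub>A\<^esub> \<oplus>\<^bsub>A\<^esub> \<one>\<^bsub>A\<^esub>) = \<zero>\<^bsub>M\<^esub>" using ract_zero[OF x] by (simp add: A.l_neg)
  then have "x \<triangleleft>\<^bsub>M\<^esub> (\<ominus>\<^bsub>A\<^esub> \<one>\<^bsub>A\<^esub>) \<oplus>\<^bsub>M\<^esub> x = \<zero>\<^bsub>M\<^esub>" using add_ract[OF x, of "\<ominus>\<^bsub>A\<^esub> \<one>\<^bsub>A\<^esub>" "\<one>\<^bsub>A\<^esub>"] x ract_one by simp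
  then show ?thesis using M.minus_equality[OF _ x c] by simp
qed

lemma minus_ract: assumes x: "x \<in> carrier M" and a: "a \<in> carrier A" shows "(\<ominus>\<^bsub>M\<^esub> x) \<triangleleft>\<^bsub>M\<^esub> a = \<ominus>\<^bsub>M\<^esub> (x \<triangleleft>\<^bsub>M\<^esub> a)"
proof -
  have "(\<ominus>\<^bsub>M\<^esub> x \<oplus>\<^bsub>M\<^esub> x) \<triangleleft>\<^bsub>M\<^esub> a = \<zero>\<^bsub>M\<^esub>" using x zero_ract[OF a] by (simp add: M.l_neg)
  then have "(\<ominus>\<^bsub>M\<^esub> x) \<triangleleft>\<^bsub>M\<^esub> a \<oplus>\<^bsub>M\<^esub> x \<triangleleft>\<^bsub>M\<^esub> a = \<zero>\<^bsub>M\<^esub>" using ract_add[of "\<ominus>\<^bsub>M\<^esub> x" x a] x a by simp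
  then show ?thesis using M.minus_equality[of "(\<ominus>\<^bsub>M\<^esub> x) \<triangleleft>\<^bsub>M\<^esub> a" "x \<triangleleft>\<^bsub>M\<^esub> a"] x a ract_closed by simp
qed

end

lemma submodI:
  assumes M: "right_module A M" and U: "U \<subseteq> carrier M" "\<zero>\<^bsub>M\<^esub> \<in> U" "\<And>x y. x \<in> U \<Longrightarrow> y \<in> U \<Longrightarrow> x \<oplus>\<^bsub>M\<^esub> y \<in> U"
    "\<And>x a. x \<in> U \<Longrightarrow> a \<in> carrier A \<Longrightarrow> x \<triangleleft>\<^bsub>M\<^esub> a \<in> U"
  shows "submod A U M"
proof -
  interpret right_module A M by (rule M)
  have "\<ominus>\<^bsub>M\<^esub> x \<in> U" if "x \<in> U" for x
  proof -
    have x: "x \<in> carrier M" using U(1) that by auto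
    then show ?thesis using U(4)[OF that, of "\<ominus>\<^bsub>A\<^esub> \<one>\<^bsub>A\<^esub>"] ract_minus_one[OF x] by simp
  qed
  then have "subgroup U (add_monoid M)"
    using U by (intro subgroup.intro) (auto simp: a_inv_def)
  then show ?thesis unfolding submod_def using U(4) by (simp add: additive_subgroup.intro)
qed

lemma submodD:
  assumes M: "right_module A M" and U: "submod A U M"
  shows "U \<subseteq> carrier M" "\<zero>\<^bsub>M\<^esub> \<in> U" "\<And>x y. x \<in> U \<Longrightarrow> y \<in> U \<Longrightarrow> x \<oplus>\<^bsub>M\<^esub> y \<in> U"
    "\<And>x a. x \<in> U \<Longrightarrow> a \<in> carrier A \<Longrightarrow> x \<triangleleft>\<^bsub>M\<^esub> a \<in> U" "\<And>x. x \<in> U \<Longrightarrow> \<ominus>\<^bsub>M\<^esub> x \<in> U"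
proof -
  interpret right_module A M by (rule M)
  interpret U: additive_subgroup U M using U unfolding submod_def by simp
  show "U \<subseteq> carrier M" by (rule U.a_subset)
  show "\<zero>\<^bsub>M\<^esub> \<in> U" by (rule U.zero_closed)
  show "x \<oplus>\<^bsub>M\<^esub> y \<in> U" if "x \<in> U" "y \<in> U" for x y using that by (rule U.a_closed)
  show "x \<triangleleft>\<^bsub>M\<^esub> a \<in> U" if "x \<in> U" "a \<in> carrier A" for x a using U that unfolding submod_def by simp
  show "\<ominus>\<^bsub>M\<^esub> x \<in> U" if "x \<in> U" for x
  proof -
    have "inv\<^bsub>add_monoid M\<^esub> x \<in> U" by (rule subgroup.m_inv_closed[OF U.a_subgroup that])
    then show ?thesis by (simp add: a_inv_def)
  qed
qed

lemma rmod_homD: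
  assumes "f \<in> rmod_hom A M N"
  shows "\<And>x. x \<in> carrier M \<Longrightarrow> f x \<in> carrier N"
    "\<And>x y. x \<in> carrier M \<Longrightarrow> y \<in> carrier M \<Longrightarrow> f (x \<oplus>\<^bsub>M\<^esub> y) = f x \<oplus>\<^bsub>N\<^esub> f y"
    "\<And>x a. x \<in> carrier M \<Longrightarrow> a \<in> carrier A \<Longrightarrow> f (x \<triangleleft>\<^bsub>M\<^esub> a) = f x \<triangleleft>\<^bsub>N\<^esub> a"
  using assms unfolding rmod_hom_def by auto

lemma rmod_homI:
  assumes "\<And>x. x \<in> carrier M \<Longrightarrow> f x \<in> carrier N"
    "\<And>x y. x \<in> carrier M \<Longrightarrow> y \<in> carrier M \<Longrightarrow> f (x \<oplus>\<^bsub>M\<^esub> y) = f x \<oplus>\<^bsub>N\<^esub> f y"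
    "\<And>x a. x \<in> carrier M \<Longrightarrow> a \<in> carrier A \<Longrightarrow> f (x \<triangleleft>\<^bsub>M\<^esub> a) = f x \<triangleleft>\<^bsub>N\<^esub> a"
  shows "f \<in> rmod_hom A M N"
  using assms unfolding rmod_hom_def by auto

lemma rmod_hom_zero:
  assumes M: "right_module A M" and N: "right_module A N" and f: "f \<in> rmod_hom A M N"
  shows "f \<zero>\<^bsub>M\<^esub> = \<zero>\<^bsub>N\<^esub>"
proof -
  interpret M: right_module A M by (rule M)
  interpret N: right_module A N by (rule N)
  have "f \<zero>\<^bsub>M\<^esub> \<oplus>\<^bsub>N\<^esub> f \<zero>\<^bsub>M\<^esub> = f \<zero>\<^bsub>M\<^esub>" using rmod_homD(2)[OF f, of "\<zero>\<^bsub>M\<^esub>" "\<zero>\<^bsub>M\<^esub>"] by simp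
  then show ?thesis using rmod_homD(1)[OF f, of "\<zero>\<^bsub>M\<^esub>"] by simp
qed

lemma rmod_hom_minus:
  assumes M: "right_module A M" and N: "right_module A N" and f: "f \<in> rmod_hom A M N" and x: "x \<in> carrier M"
  shows "f (\<ominus>\<^bsub>M\<^esub> x) = \<ominus>\<^bsub>N\<^esub> f x"
proof -
  interpret M: right_module A M by (rule M)
  interpret N: right_module A N by (rule N)
  have "f (\<ominus>\<^bsub>M\<^esub> x) \<oplus>\<^bsub>N\<^esub> f x = \<zero>\<^bsub>N\<^esub>"
    using rmod_homD(2)[OF f, of "\<ominus>\<^bsub>M\<^esub> x" x] x rmod_hom_zero[OF M N f] by (simp add: M.M.l_neg)
  then show ?thesis using N.M.minus_equality[of "f (\<ominus>\<^bsub>M\<^esub> x)" "f x"] rmod_homD(1)[OF f] x by simp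
qed

lemma rmod_hom_inj_iff:
  assumes M: "right_module A M" and N: "right_module A N" and f: "f \<in> rmod_hom A M N"
  shows "inj_on f (carrier M) \<longleftrightarrow> (\<forall>x\<in>carrier M. f x = \<zero>\<^bsub>N\<^esub> \<longrightarrow> x = \<zero>\<^bsub>M\<^esub>)"
proof
  interpret M: right_module A M by (rule M)
  interpret N: right_module A N by (rule N)
  show "\<forall>x\<in>carrier M. f x = \<zero>\<^bsub>N\<^esub> \<longrightarrow> x = \<zero>\<^bsub>M\<^esub>" if "inj_on f (carrier M)"
    using that rmod_hom_zero[OF M N f] by (metis M.M.zero_closed inj_onD)
  assume z: "\<forall>x\<in>carrier M. f x = \<zero>\<^bsub>N\<^esub> \<longrightarrow> x = \<zero>\<^bsub>M\<^esub>"
  show "inj_on f (carrier M)"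
  proof (rule inj_onI)
    fix x y assume xy: "x \<in> carrier M" "y \<in> carrier M" "f x = f y"
    have "f (x \<oplus>\<^bsub>M\<^esub> \<ominus>\<^bsub>M\<^esub> y) = f x \<oplus>\<^bsub>N\<^esub> \<ominus>\<^bsub>N\<^esub> f y"
      using rmod_homD(2)[OF f, of x "\<ominus>\<^bsub>M\<^esub> y"] rmod_hom_minus[OF M N f xy(2)] xy by simp
    also have "\<dots> = \<zero>\<^bsub>N\<^esub>" using xy rmod_homD(1)[OF f xy(2)] by (simp add: N.M.r_neg)
    finally have "x \<oplus>\<^bsub>M\<^esub> \<ominus>\<^bsub>M\<^esub> y = \<zero>\<^bsub>M\<^esub>" using z xy by simp
    then show "x = y" using M.M.minus_equality[of x "\<ominus>\<^bsub>M\<^esub> y"] xy by simp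
  qed
qed

lemma rmod_hom_finsum:
  assumes M: "right_module A M" and N: "right_module A N" and f: "f \<in> rmod_hom A M N"
    and g: "\<And>i. i < (n::nat) \<Longrightarrow> g i \<in> carrier M"
  shows "f (\<Oplus>\<^bsub>M\<^esub>i\<in>{..<n}. g i) = (\<Oplus>\<^bsub>N\<^esub>i\<in>{..<n}. f (g i))"
  using g
proof (induction n)
  interpret M: right_module A M by (rule M)
  interpret N: right_module A N by (rule N)
  case 0
  then show ?case using rmod_hom_zero[OF M N f] by simp
next
  interpret M: right_module A M by (rule M)
  interpret N: right_module A N by (rule N)
  case (Suc n)
  have g: "g \<in> {..<n} \<rightarrow> carrier M" "g n \<in> carrier M" using Suc(2) by auto
  have fg: "(\<lambda>i. f (g i)) \<in> {..<n} \<rightarrow> carrier N" "f (g n) \<in> carrier N" using g rmod_homD(1)[OF f] by auto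
  show ?case using g fg Suc rmod_homD(2)[OF f] by (simp add: lessThan_Suc)
qed

lemma fin_gen_surj:
  assumes M: "right_module A M" and N: "right_module A N" and f: "f \<in> rmod_hom A M N" "f ` carrier M = carrier N"
    and fg: "fin_gen A M"
  shows "fin_gen A N"
proof -
  interpret M: right_module A M by (rule M)
  interpret N: right_module A N by (rule N)
  obtain n :: nat and x where x: "x \<in> {..<n} \<rightarrow> carrier M"
    "\<forall>m\<in>carrier M. \<exists>a\<in>{..<n} \<rightarrow> carrier A. m = (\<Oplus>\<^bsub>M\<^esub>i\<in>{..<n}. x i \<triangleleft>\<^bsub>M\<^esub> a i)"
    using fg unfolding fin_gen_def by blast
  show ?thesis unfolding fin_gen_def
  proof (intro exI conjI ballI)
    show "(\<lambda>i. f (x i)) \<in> {..<n} \<rightarrow> carrier N" using x(1) rmod_homD(1)[OF f(1)] by auto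
    fix m assume "m \<in> carrier N"
    then have "m \<in> f ` carrier M" unfolding f(2) .
    then obtain m' where m': "m = f m'" "m' \<in> carrier M" by (rule imageE)
    obtain a where a: "a \<in> {..<n} \<rightarrow> carrier A" "m' = (\<Oplus>\<^bsub>M\<^esub>i\<in>{..<n}. x i \<triangleleft>\<^bsub>M\<^esub> a i)" using x(2) m'(2) by blast
    have xa: "x i \<in> carrier M" "a i \<in> carrier A" if "i < n" for i using x(1) a(1) that by auto
    have "f m' = (\<Oplus>\<^bsub>N\<^esub>i\<in>{..<n}. f (x i \<triangleleft>\<^bsub>M\<^esub> a i))"
      unfolding a(2) using xa M.ract_closed by (intro rmod_hom_finsum[OF M N f(1)]) simp
    also have "\<dots> = (\<Oplus>\<^bsub>N\<^esub>i\<in>{..<n}. f (x i) \<triangleleft>\<^bsub>N\<^esub> a i)"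
      by (intro N.M.finsum_cong') (auto simp: xa rmod_homD[OF f(1)] intro!: N.ract_closed)
    finally show "\<exists>a\<in>{..<n} \<rightarrow> carrier A. m = (\<Oplus>\<^bsub>N\<^esub>i\<in>{..<n}. f (x i) \<triangleleft>\<^bsub>N\<^esub> a i)"
      unfolding m'(1) using a(1) by blast
  qed
qed

context fd_alg
begin

abbreviation sc :: "'k \<Rightarrow> 'a" where "sc c \<equiv> c \<odot>\<^bsub>A\<^esub> \<one>\<^bsub>A\<^esub>"

lemma sc_closed: "c \<in> carrier K \<Longrightarrow> sc c \<in> carrier A" by simp

lemma sc_central: "c \<in> carrier K \<Longrightarrow> a \<in> carrier A \<Longrightarrow> a \<otimes>\<^bsub>A\<^esub> sc c = c \<odot>\<^bsub>A\<^esub> a"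
  "c \<in> carrier K \<Longrightarrow> a \<in> carrier A \<Longrightarrow> sc c \<otimes>\<^bsub>A\<^esub> a = c \<odot>\<^bsub>A\<^esub> a"
  using smult_mult_left[of c "\<one>\<^bsub>A\<^esub>" a] smult_mult_right[of c a "\<one>\<^bsub>A\<^esub>"] by simp_all

text \<open>
  A right module over \<open>A\<close> is a vector space through the central elements \<open>c \<odot> \<one>\<close>.
\<close>

definition kmod :: "('a, 'm) rmodule \<Rightarrow> ('k, 'm) module" where
  "kmod M = \<lparr>carrier = carrier M, mult = mult M, one = one M, zero = zero M, add = add M,
     smult = (\<lambda>c m. m \<triangleleft>\<^bsub>M\<^esub> sc c)\<rparr>"

lemma kmod_simps [simp]: "carrier (kmod M) = carrier M" "\<zero>\<^bsub>kmod M\<^esub> = \<zero>\<^bsub>M\<^esub>" "x \<oplus>\<^bsub>kmod M\<^esub> y = x \<oplus>\<^bsub>M\<^esub> y"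
  "c \<odot>\<^bsub>kmod M\<^esub> x = x \<triangleleft>\<^bsub>M\<^esub> sc c"
  by (simp_all add: kmod_def)

lemma kmod_module: assumes M: "right_module A M" shows "Module.module K (kmod M)"
proof -
  interpret M: right_module A M by (rule M)
  have "abelian_group (kmod M)"
  proof (rule abelian_groupI)
    fix x assume "x \<in> carrier (kmod M)"
    then show "\<exists>y\<in>carrier (kmod M). y \<oplus>\<^bsub>kmod M\<^esub> x = \<zero>\<^bsub>kmod M\<^esub>"
      by (intro bexI[of _ "\<ominus>\<^bsub>M\<^esub> x"]) (simp_all add: M.M.l_neg)
  qed (simp_all add: M.M.a_ac)
  then show ?thesis
  proof (rule Module.moduleI[OF K.is_cring])
    fix a b x assume ab: "a \<in> carrier K" "b \<in> carrier K" and x: "x \<in> carrier (kmod M)"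
    show "(a \<oplus>\<^bsub>K\<^esub> b) \<odot>\<^bsub>kmod M\<^esub> x = a \<odot>\<^bsub>kmod M\<^esub> x \<oplus>\<^bsub>kmod M\<^esub> b \<odot>\<^bsub>kmod M\<^esub> x"
      using ab x by (simp add: smult_l_distr M.add_ract)
    have "sc b \<otimes>\<^bsub>A\<^esub> sc a = (a \<otimes>\<^bsub>K\<^esub> b) \<odot>\<^bsub>A\<^esub> \<one>\<^bsub>A\<^esub>" using ab by (simp add: sc_central(1) smult_assoc1)
    then show "(a \<otimes>\<^bsub>K\<^esub> b) \<odot>\<^bsub>kmod M\<^esub> x = a \<odot>\<^bsub>kmod M\<^esub> (b \<odot>\<^bsub>kmod M\<^esub> x)"
      using ab x M.ract_mult[of x "sc b" "sc a"] by simp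
  qed (simp_all add: M.ract_closed M.ract_add M.ract_one)
qed

lemma submod_subspace:
  assumes M: "right_module A M" and U: "submod A U M" shows "subspace K (kmod M) U"
  unfolding subspace_def using submodD[OF M U] by simp

text \<open>
  Together with its converse below: a module is finitely generated if and only if it is finite-dimensional.  This
  is how submodules are seen to be finitely generated.
\<close>

lemma fin_gen_finite_vlen:
  assumes M: "right_module A M" and fg: "fin_gen A M" shows "vlen K (kmod M) \<noteq> \<infinity>"
proof -
  interpret M: right_module A M by (rule M)
  note km = kmod_module[OF M]
  obtain n :: nat and x where x: "x \<in> {..<n} \<rightarrow> carrier M"
    "\<forall>m\<in>carrier M. \<exists>a\<in>{..<n} \<rightarrow> carrier A. m = (\<Oplus>\<^bsub>M\<^esub>i\<in>{..<n}. x i \<triangleleft>\<^bsub>M\<^esub> a i)"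
    using fg unfolding fin_gen_def by blast
  obtain r :: nat and b where b: "b \<in> {..<r} \<rightarrow> carrier A"
    "\<forall>y\<in>carrier A. \<exists>c\<in>{..<r} \<rightarrow> carrier K. y = (\<Oplus>\<^bsub>A\<^esub>i\<in>{..<r}. c i \<odot>\<^bsub>A\<^esub> b i)"
    using finite_dim by blast
  have xc: "x i \<in> carrier M" if "i < n" for i using x(1) that by auto
  have bc: "b i \<in> carrier A" if "i < r" for i using b(1) that by auto
  define z where "z k = x (k div r) \<triangleleft>\<^bsub>M\<^esub> b (k mod r)" for k
  have kd: "k div r < n \<and> k mod r < r" if "k < n * r" for k
    using that by (metis less_mult_imp_div_less mod_less_divisor mult_0_right not_less_zero gr0I)
  have zc: "z k \<in> carrier (kmod M)" if "k < n * r" for k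
    unfolding z_def using kd[OF that] xc bc M.ract_closed by simp
  define U where "U = kspan K (kmod M) z (n * r)"
  have U: "subspace K (kmod M) U" unfolding U_def by (rule kspan_subspace[OF km]) (rule zc)
  note U' = subspaceD[OF U, simplified]
  have xb: "x i \<triangleleft>\<^bsub>M\<^esub> b j \<in> U" if ij: "i < n" "j < r" for i j
  proof -
    have "i * r + j < Suc i * r" using ij by simp
    also have "\<dots> \<le> n * r" using ij by (intro mult_le_mono1) simp
    finally have k: "i * r + j < n * r" .
    have "z (i * r + j) = x i \<triangleleft>\<^bsub>M\<^esub> b j" unfolding z_def using ij by simp
    moreover have "z (i * r + j) \<in> kspan K (kmod M) z (n * r)" by (rule kspan_mem[OF km _ k]) (rule zc)
    ultimately show ?thesis unfolding U_def by simp
  qed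
  have xa: "x i \<triangleleft>\<^bsub>M\<^esub> a \<in> U" if i: "i < n" and a: "a \<in> carrier A" for i a
  proof -
    obtain c where c: "c \<in> {..<r} \<rightarrow> carrier K" "a = (\<Oplus>\<^bsub>A\<^esub>j\<in>{..<r}. c j \<odot>\<^bsub>A\<^esub> b j)" using b(2) a by blast
    have cc: "c j \<in> carrier K" if "j < r" for j using c(1) that by auto
    have "a \<in> {a \<in> carrier A. x i \<triangleleft>\<^bsub>M\<^esub> a \<in> U}" unfolding c(2)
    proof (rule A.finsum_lessThan_mem)
      show "\<zero>\<^bsub>A\<^esub> \<in> {a \<in> carrier A. x i \<triangleleft>\<^bsub>M\<^esub> a \<in> U}" using M.ract_zero[OF xc[OF i]] U'(2) by simp
      show "y \<oplus>\<^bsub>A\<^esub> w \<in> {a \<in> carrier A. x i \<triangleleft>\<^bsub>M\<^esub> a \<in> U}"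
        if "y \<in> {a \<in> carrier A. x i \<triangleleft>\<^bsub>M\<^esub> a \<in> U}" "w \<in> {a \<in> carrier A. x i \<triangleleft>\<^bsub>M\<^esub> a \<in> U}" for y w
        using that U'(3) M.add_ract[OF xc[OF i]] by simp
      fix j assume j: "j < r"
      have "c j \<odot>\<^bsub>A\<^esub> b j = b j \<otimes>\<^bsub>A\<^esub> sc (c j)" using sc_central(1)[OF cc[OF j] bc[OF j]] by simp
      then have "x i \<triangleleft>\<^bsub>M\<^esub> (c j \<odot>\<^bsub>A\<^esub> b j) = (x i \<triangleleft>\<^bsub>M\<^esub> b j) \<triangleleft>\<^bsub>M\<^esub> sc (c j)"
        using M.ract_mult[OF xc[OF i] bc[OF j] sc_closed[OF cc[OF j]]] by simp
      then show "c j \<odot>\<^bsub>A\<^esub> b j \<in> {a \<in> carrier A. x i \<triangleleft>\<^bsub>M\<^esub> a \<in> U}"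
        using U'(4)[OF cc[OF j] xb[OF i j]] cc[OF j] bc[OF j] by simp
    qed auto
    then show ?thesis by simp
  qed
  have "carrier M \<subseteq> U"
  proof
    fix m assume "m \<in> carrier M"
    then obtain a where a: "a \<in> {..<n} \<rightarrow> carrier A" "m = (\<Oplus>\<^bsub>M\<^esub>i\<in>{..<n}. x i \<triangleleft>\<^bsub>M\<^esub> a i)" using x(2) by blast
    have "x i \<triangleleft>\<^bsub>M\<^esub> a i \<in> U" if "i < n" for i using xa[OF that, of "a i"] a(1) that by auto
    then show "m \<in> U" unfolding a(2) using U' by (intro M.M.finsum_lessThan_mem) auto
  qed
  then have "vlen K (kmod M) \<le> enat (n * r)"
    by (intro vlen_spanned[OF K.field_axioms km zc]) (simp_all add: U_def)
  then show ?thesis by (cases "vlen K (kmod M)") simp_all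
qed

lemma kspan_generated:
  assumes M: "right_module A M" and z: "\<And>i. i < r \<Longrightarrow> z i \<in> carrier M"
  shows "u \<in> kspan K (kmod M) z r \<Longrightarrow> \<exists>a\<in>{..<r} \<rightarrow> carrier A. u = (\<Oplus>\<^bsub>M\<^esub>i\<in>{..<r}. z i \<triangleleft>\<^bsub>M\<^esub> a i)"
  using z
proof (induction r arbitrary: u)
  interpret M: right_module A M by (rule M)
  case 0
  then show ?case by simp
next
  interpret M: right_module A M by (rule M)
  case (Suc r)
  then obtain v c where v: "v \<in> kspan K (kmod M) z r" "c \<in> carrier K" "u = v \<oplus>\<^bsub>M\<^esub> z r \<triangleleft>\<^bsub>M\<^esub> sc c" by auto
  then obtain a where a: "a \<in> {..<r} \<rightarrow> carrier A" "v = (\<Oplus>\<^bsub>M\<^esub>i\<in>{..<r}. z i \<triangleleft>\<^bsub>M\<^esub> a i)" using Suc by auto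
  define a' where "a' i = (if i = r then sc c else a i)" for i
  have za: "z i \<in> carrier M" "a' i \<in> carrier A" if "i \<le> r" for i using Suc(3)[of i] that a(1) v(2) by (auto simp: a'_def)
  have eq: "(\<Oplus>\<^bsub>M\<^esub>i\<in>{..<r}. z i \<triangleleft>\<^bsub>M\<^esub> a i) = (\<Oplus>\<^bsub>M\<^esub>i\<in>{..<r}. z i \<triangleleft>\<^bsub>M\<^esub> a' i)"
  proof (rule M.M.finsum_cong'[OF refl])
    show "(\<lambda>i. z i \<triangleleft>\<^bsub>M\<^esub> a' i) \<in> {..<r} \<rightarrow> carrier M" using za M.ract_closed by auto
  qed (simp add: a'_def)
  have "(\<Oplus>\<^bsub>M\<^esub>i\<in>{..<Suc r}. z i \<triangleleft>\<^bsub>M\<^esub> a' i) = z r \<triangleleft>\<^bsub>M\<^esub> sc c \<oplus>\<^bsub>M\<^esub> (\<Oplus>\<^bsub>M\<^esub>i\<in>{..<r}. z i \<triangleleft>\<^bsub>M\<^esub> a' i)"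
  proof -
    have "(\<lambda>i. z i \<triangleleft>\<^bsub>M\<^esub> a' i) \<in> {..<r} \<rightarrow> carrier M" using za M.ract_closed by auto
    moreover have "a' r = sc c" by (simp add: a'_def)
    ultimately show ?thesis using za[of r] M.ract_closed[of "z r" "sc c"] v(2) by (simp add: lessThan_Suc)
  qed
  also have "\<dots> = u"
  proof -
    have "(\<Oplus>\<^bsub>M\<^esub>i\<in>{..<r}. z i \<triangleleft>\<^bsub>M\<^esub> a' i) \<in> carrier M" using za M.ract_closed by (intro M.M.finsum_closed) auto
    then show ?thesis unfolding v(3) a(2) eq using za[of r] M.ract_closed[of "z r" "sc c"] v(2) M.M.a_comm by simp
  qed
  finally have "u = (\<Oplus>\<^bsub>M\<^esub>i\<in>{..<Suc r}. z i \<triangleleft>\<^bsub>M\<^esub> a' i)" by simp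
  moreover have "a' \<in> {..<Suc r} \<rightarrow> carrier A" using za by auto
  ultimately show ?case by blast
qed

lemma finite_vlen_fin_gen:
  assumes M: "right_module A M" and fin: "vlen K (kmod M) \<noteq> \<infinity>" shows "fin_gen A M"
proof -
  interpret M: right_module A M by (rule M)
  have "subspace K (kmod M) (carrier (kmod M))" unfolding subspace_def using M.ract_closed by simp
  then obtain r z where "\<forall>i<r. z i \<in> carrier (kmod M)" and sp: "kspan K (kmod M) z r = carrier (kmod M)"
    using finite_vlen_spanned[OF kmod_module[OF M] fin] by blast
  then have z: "\<And>i. i < r \<Longrightarrow> z i \<in> carrier M" by simp
  show ?thesis unfolding fin_gen_def
    using z kspan_generated[OF M z] sp by (intro exI[of _ r] exI[of _ z]) auto
qed

lemma fgmodD: "M \<in> fgmod A \<Longrightarrow> right_module A M" "M \<in> fgmod A \<Longrightarrow> fin_gen A M"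
  by (simp_all add: fgmod_def)

lemma sub_right_module:
  assumes M: "right_module A M" and U: "submod A U M" shows "right_module A (M\<lparr>carrier := U\<rparr>)"
proof -
  interpret M: right_module A M by (rule M)
  note U' = submodD[OF M U]
  have c: "x \<in> carrier M" if "x \<in> U" for x using U'(1) that by auto
  have "\<exists>y\<in>U. y \<oplus>\<^bsub>M\<^esub> x = \<zero>\<^bsub>M\<^esub>" if "x \<in> U" for x
    using U'(5)[OF that] c[OF that] by (intro bexI[of _ "\<ominus>\<^bsub>M\<^esub> x"]) (simp_all add: M.M.l_neg)
  then have "abelian_group (M\<lparr>carrier := U\<rparr>)"
    by (intro abelian_groupI) (simp_all add: U' c M.M.a_ac)
  then interpret U: abelian_group "M\<lparr>carrier := U\<rparr>" .
  show ?thesis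
    by unfold_locales (simp_all add: U' c M.ract_add M.add_ract M.ract_mult M.ract_one)
qed

lemma sub_fgmod:
  assumes M: "M \<in> fgmod A" and U: "submod A U M" shows "M\<lparr>carrier := U\<rparr> \<in> fgmod A"
proof -
  note r = sub_right_module[OF fgmodD(1)[OF M] U]
  have e: "kmod (M\<lparr>carrier := U\<rparr>) = (kmod M)\<lparr>carrier := U\<rparr>" by (simp add: kmod_def)
  have "vlen K (kmod (M\<lparr>carrier := U\<rparr>)) \<le> vlen K (kmod M)"
    unfolding e by (rule vlen_subspace[OF submod_subspace[OF fgmodD(1)[OF M] U]])
  then have "vlen K (kmod (M\<lparr>carrier := U\<rparr>)) \<noteq> \<infinity>" using fin_gen_finite_vlen[OF fgmodD[OF M]] by (rule enat_le_finite)
  then show ?thesis using finite_vlen_fin_gen[OF r] r by (simp add: fgmod_def)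
qed

text \<open>
  The cosets themselves would live in a different type; a set of representatives keeps quotients in the type of
  the given module, and so in the category under consideration.
\<close>

definition qrep :: "('a, 'm) rmodule \<Rightarrow> 'm set \<Rightarrow> 'm \<Rightarrow> 'm" where
  "qrep M U x = (SOME y. y \<in> carrier M \<and> x \<oplus>\<^bsub>M\<^esub> \<ominus>\<^bsub>M\<^esub> y \<in> U)"

definition qmod :: "('a, 'm) rmodule \<Rightarrow> 'm set \<Rightarrow> ('a, 'm) rmodule" where
  "qmod M U = \<lparr>carrier = qrep M U ` carrier M, mult = undefined, one = undefined, zero = qrep M U \<zero>\<^bsub>M\<^esub>,
     add = (\<lambda>x y. qrep M U (x \<oplus>\<^bsub>M\<^esub> y)), ract = (\<lambda>x a. qrep M U (x \<triangleleft>\<^bsub>M\<^esub> a))\<rparr>"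

lemma qmod_simps [simp]: "carrier (qmod M U) = qrep M U ` carrier M" "\<zero>\<^bsub>qmod M U\<^esub> = qrep M U \<zero>\<^bsub>M\<^esub>"
  "x \<oplus>\<^bsub>qmod M U\<^esub> y = qrep M U (x \<oplus>\<^bsub>M\<^esub> y)" "x \<triangleleft>\<^bsub>qmod M U\<^esub> a = qrep M U (x \<triangleleft>\<^bsub>M\<^esub> a)"
  by (simp_all add: qmod_def)

lemma
  assumes M: "right_module A M" and U: "submod A U M"
  shows qrep_closed: "x \<in> carrier M \<Longrightarrow> qrep M U x \<in> carrier M"
    and qrep_diff: "x \<in> carrier M \<Longrightarrow> x \<oplus>\<^bsub>M\<^esub> \<ominus>\<^bsub>M\<^esub> qrep M U x \<in> U"
    and qrep_eq: "x \<in> carrier M \<Longrightarrow> y \<in> carrier M \<Longrightarrow> qrep M U x = qrep M U y \<longleftrightarrow> x \<oplus>\<^bsub>M\<^esub> \<ominus>\<^bsub>M\<^esub> y \<in> U"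
proof -
  interpret M: right_module A M by (rule M)
  note U' = submodD[OF M U]
  have e: "qrep M U x \<in> carrier M \<and> x \<oplus>\<^bsub>M\<^esub> \<ominus>\<^bsub>M\<^esub> qrep M U x \<in> U" if "x \<in> carrier M" for x
  proof -
    have "\<exists>y. y \<in> carrier M \<and> x \<oplus>\<^bsub>M\<^esub> \<ominus>\<^bsub>M\<^esub> y \<in> U" using that U'(2) by (intro exI[of _ x]) (simp add: M.M.r_neg)
    from someI_ex[OF this] show ?thesis unfolding qrep_def .
  qed
  show "x \<in> carrier M \<Longrightarrow> qrep M U x \<in> carrier M" "x \<in> carrier M \<Longrightarrow> x \<oplus>\<^bsub>M\<^esub> \<ominus>\<^bsub>M\<^esub> qrep M U x \<in> U" using e by auto
  assume xy: "x \<in> carrier M" "y \<in> carrier M"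
  have tr: "a \<oplus>\<^bsub>M\<^esub> \<ominus>\<^bsub>M\<^esub> c \<in> U" if "a \<oplus>\<^bsub>M\<^esub> \<ominus>\<^bsub>M\<^esub> b \<in> U" "b \<oplus>\<^bsub>M\<^esub> \<ominus>\<^bsub>M\<^esub> c \<in> U" "a \<in> carrier M" "b \<in> carrier M" "c \<in> carrier M" for a b c
  proof -
    have "(a \<oplus>\<^bsub>M\<^esub> \<ominus>\<^bsub>M\<^esub> b) \<oplus>\<^bsub>M\<^esub> (b \<oplus>\<^bsub>M\<^esub> \<ominus>\<^bsub>M\<^esub> c) = a \<oplus>\<^bsub>M\<^esub> \<ominus>\<^bsub>M\<^esub> c" using that(3-5) by (simp add: M.M.a_assoc M.M.r_neg1)
    then show ?thesis using U'(3)[OF that(1,2)] by simp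
  qed
  have sy: "b \<oplus>\<^bsub>M\<^esub> \<ominus>\<^bsub>M\<^esub> a \<in> U" if "a \<oplus>\<^bsub>M\<^esub> \<ominus>\<^bsub>M\<^esub> b \<in> U" "a \<in> carrier M" "b \<in> carrier M" for a b
    using U'(5)[OF that(1)] that(2,3) by (simp add: M.M.minus_add M.M.a_comm)
  show "qrep M U x = qrep M U y \<longleftrightarrow> x \<oplus>\<^bsub>M\<^esub> \<ominus>\<^bsub>M\<^esub> y \<in> U"
  proof
    assume q: "qrep M U x = qrep M U y"
    have "x \<oplus>\<^bsub>M\<^esub> \<ominus>\<^bsub>M\<^esub> qrep M U y \<in> U" using e[OF xy(1)] unfolding q by simp
    then show "x \<oplus>\<^bsub>M\<^esub> \<ominus>\<^bsub>M\<^esub> y \<in> U" using tr[OF _ sy, of x "qrep M U y" y] e[OF xy(2)] xy by simp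
  next
    assume d: "x \<oplus>\<^bsub>M\<^esub> \<ominus>\<^bsub>M\<^esub> y \<in> U"
    have "(z \<in> carrier M \<and> x \<oplus>\<^bsub>M\<^esub> \<ominus>\<^bsub>M\<^esub> z \<in> U) = (z \<in> carrier M \<and> y \<oplus>\<^bsub>M\<^esub> \<ominus>\<^bsub>M\<^esub> z \<in> U)" for z
      using tr[OF d, of z] tr[OF sy[OF d], of z] xy by blast
    then show "qrep M U x = qrep M U y" unfolding qrep_def by simp
  qed
qed

lemma quotient_module:
  assumes M: "right_module A M" and U: "submod A U M"
  shows "right_module A (qmod M U)" and "qrep M U \<in> rmod_hom A M (qmod M U)"
    and "x \<in> carrier M \<Longrightarrow> qrep M U x = \<zero>\<^bsub>qmod M U\<^esub> \<longleftrightarrow> x \<in> U"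
proof -
  interpret M: right_module A M by (rule M)
  note U' = submodD[OF M U]
  let ?q = "qrep M U"
  have qc: "?q x \<in> carrier M" if "x \<in> carrier M" for x using qrep_closed[OF M U that] .
  have q_add: "?q (?q x \<oplus>\<^bsub>M\<^esub> ?q y) = ?q (x \<oplus>\<^bsub>M\<^esub> y)" if xy: "x \<in> carrier M" "y \<in> carrier M" for x y
  proof -
    have "(x \<oplus>\<^bsub>M\<^esub> y) \<oplus>\<^bsub>M\<^esub> \<ominus>\<^bsub>M\<^esub> (?q x \<oplus>\<^bsub>M\<^esub> ?q y) = (x \<oplus>\<^bsub>M\<^esub> \<ominus>\<^bsub>M\<^esub> ?q x) \<oplus>\<^bsub>M\<^esub> (y \<oplus>\<^bsub>M\<^esub> \<ominus>\<^bsub>M\<^esub> ?q y)"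
      using xy qc by (simp add: M.M.minus_add M.M.a_ac)
    then have "(x \<oplus>\<^bsub>M\<^esub> y) \<oplus>\<^bsub>M\<^esub> \<ominus>\<^bsub>M\<^esub> (?q x \<oplus>\<^bsub>M\<^esub> ?q y) \<in> U"
      using U'(3)[OF qrep_diff[OF M U xy(1)] qrep_diff[OF M U xy(2)]] by simp
    then show ?thesis using qrep_eq[OF M U, of "x \<oplus>\<^bsub>M\<^esub> y" "?q x \<oplus>\<^bsub>M\<^esub> ?q y"] xy qc by simp
  qed
  have q_act: "?q (?q x \<triangleleft>\<^bsub>M\<^esub> a) = ?q (x \<triangleleft>\<^bsub>M\<^esub> a)" if xa: "x \<in> carrier M" "a \<in> carrier A" for x a
  proof -
    have "x \<triangleleft>\<^bsub>M\<^esub> a \<oplus>\<^bsub>M\<^esub> \<ominus>\<^bsub>M\<^esub> (?q x \<triangleleft>\<^bsub>M\<^esub> a) = (x \<oplus>\<^bsub>M\<^esub> \<ominus>\<^bsub>M\<^esub> ?q x) \<triangleleft>\<^bsub>M\<^esub> a"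
      using xa qc by (simp add: M.ract_add M.minus_ract)
    then have "x \<triangleleft>\<^bsub>M\<^esub> a \<oplus>\<^bsub>M\<^esub> \<ominus>\<^bsub>M\<^esub> (?q x \<triangleleft>\<^bsub>M\<^esub> a) \<in> U" using U'(4)[OF qrep_diff[OF M U xa(1)] xa(2)] by simp
    then show ?thesis using qrep_eq[OF M U, of "x \<triangleleft>\<^bsub>M\<^esub> a" "?q x \<triangleleft>\<^bsub>M\<^esub> a"] xa qc M.ract_closed by simp
  qed
  have ab: "abelian_group (qmod M U)"
  proof (rule abelian_groupI)
    show "\<zero>\<^bsub>qmod M U\<^esub> \<in> carrier (qmod M U)" by simp
    fix x assume "x \<in> carrier (qmod M U)"
    then obtain m where m: "m \<in> carrier M" "x = ?q m" by auto
    show "\<exists>y\<in>carrier (qmod M U). y \<oplus>\<^bsub>qmod M U\<^esub> x = \<zero>\<^bsub>qmod M U\<^esub>"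
      using m by (intro bexI[of _ "?q (\<ominus>\<^bsub>M\<^esub> m)"]) (simp_all add: q_add M.M.l_neg)
    show "\<zero>\<^bsub>qmod M U\<^esub> \<oplus>\<^bsub>qmod M U\<^esub> x = x" using m by (simp add: q_add)
    fix y assume "y \<in> carrier (qmod M U)"
    then obtain n where n: "n \<in> carrier M" "y = ?q n" by auto
    show "x \<oplus>\<^bsub>qmod M U\<^esub> y \<in> carrier (qmod M U)" using m n by (simp add: q_add)
    show "x \<oplus>\<^bsub>qmod M U\<^esub> y = y \<oplus>\<^bsub>qmod M U\<^esub> x" using m n by (simp add: q_add M.M.a_comm)
    fix z assume "z \<in> carrier (qmod M U)"
    then obtain l where l: "l \<in> carrier M" "z = ?q l" by auto
    show "x \<oplus>\<^bsub>qmod M U\<^esub> y \<oplus>\<^bsub>qmod M U\<^esub> z = x \<oplus>\<^bsub>qmod M U\<^esub> (y \<oplus>\<^bsub>qmod M U\<^esub> z)"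
      using m n l by (simp add: q_add M.M.a_assoc)
  qed
  interpret Q: abelian_group "qmod M U" by (rule ab)
  show "right_module A (qmod M U)"
    by unfold_locales
      (auto simp: q_add q_act M.ract_closed M.ract_add M.add_ract M.ract_mult M.ract_one)
  show "?q \<in> rmod_hom A M (qmod M U)" by (rule rmod_homI) (simp_all add: q_add q_act)
  show "?q x = \<zero>\<^bsub>qmod M U\<^esub> \<longleftrightarrow> x \<in> U" if x: "x \<in> carrier M"
  proof -
    have z: "\<ominus>\<^bsub>M\<^esub> \<zero>\<^bsub>M\<^esub> = \<zero>\<^bsub>M\<^esub>" using M.M.minus_equality[of "\<zero>\<^bsub>M\<^esub>" "\<zero>\<^bsub>M\<^esub>"] by simp
    have "x \<oplus>\<^bsub>M\<^esub> \<ominus>\<^bsub>M\<^esub> \<zero>\<^bsub>M\<^esub> = x" unfolding z by (rule M.M.r_zero[OF x])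
    then show ?thesis unfolding qmod_simps qrep_eq[OF M U x M.M.zero_closed] by (rule arg_cong)
  qed
qed

lemma quotient_fgmod:
  assumes M: "M \<in> fgmod A" and U: "submod A U M" shows "qmod M U \<in> fgmod A"
  using fin_gen_surj[OF fgmodD(1)[OF M] quotient_module(1,2)[OF fgmodD(1)[OF M] U]] quotient_module(1)[OF fgmodD(1)[OF M] U]
    fgmodD(2)[OF M] by (simp add: fgmod_def)

definition dsum :: "('a, 'm) rmodule \<Rightarrow> ('a, 'n) rmodule \<Rightarrow> ('a, 'm \<times> 'n) rmodule" where
  "dsum M N = \<lparr>carrier = carrier M \<times> carrier N, mult = undefined, one = undefined, zero = (\<zero>\<^bsub>M\<^esub>, \<zero>\<^bsub>N\<^esub>),
     add = (\<lambda>(x, y) (x', y'). (x \<oplus>\<^bsub>M\<^esub> x', y \<oplus>\<^bsub>N\<^esub> y')), ract = (\<lambda>(x, y) a. (x \<triangleleft>\<^bsub>M\<^esub> a, y \<triangleleft>\<^bsub>N\<^esub> a))\<rparr>"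

lemma dsum_simps [simp]: "carrier (dsum M N) = carrier M \<times> carrier N" "\<zero>\<^bsub>dsum M N\<^esub> = (\<zero>\<^bsub>M\<^esub>, \<zero>\<^bsub>N\<^esub>)"
  "(x, y) \<oplus>\<^bsub>dsum M N\<^esub> (x', y') = (x \<oplus>\<^bsub>M\<^esub> x', y \<oplus>\<^bsub>N\<^esub> y')" "(x, y) \<triangleleft>\<^bsub>dsum M N\<^esub> a = (x \<triangleleft>\<^bsub>M\<^esub> a, y \<triangleleft>\<^bsub>N\<^esub> a)"
  by (simp_all add: dsum_def)

lemma dsum_right_module:
  assumes M: "right_module A M" and N: "right_module A N" shows "right_module A (dsum M N)"
proof -
  interpret M: right_module A M by (rule M)
  interpret N: right_module A N by (rule N)
  have "abelian_group (dsum M N)"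
  proof (rule abelian_groupI)
    fix x assume "x \<in> carrier (dsum M N)"
    then show "\<exists>y\<in>carrier (dsum M N). y \<oplus>\<^bsub>dsum M N\<^esub> x = \<zero>\<^bsub>dsum M N\<^esub>"
      by (intro bexI[of _ "(\<ominus>\<^bsub>M\<^esub> fst x, \<ominus>\<^bsub>N\<^esub> snd x)"]) (auto simp: M.M.l_neg N.M.l_neg)
  qed (auto simp: M.M.a_ac N.M.a_ac)
  then interpret S: abelian_group "dsum M N" .
  show ?thesis
    by unfold_locales (auto simp: M.ract_closed M.ract_add M.add_ract M.ract_mult M.ract_one
      N.ract_closed N.ract_add N.add_ract N.ract_mult N.ract_one)
qed

lemma dsum_fin_gen:
  assumes M: "right_module A M" "fin_gen A M" and N: "right_module A N" "fin_gen A N" shows "fin_gen A (dsum M N)"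
proof -
  interpret M: right_module A M by (rule M)
  interpret N: right_module A N by (rule N)
  note S = dsum_right_module[OF M(1) N(1)]
  have "vlen K (kmod (dsum M N)) \<le> vlen K (kmod M) + vlen K (kmod N)"
  proof (rule vlen_le_kernel[OF kmod_module[OF S] kmod_module[OF M(1)] kmod_module[OF N(1)]])
    show "linear K (kmod M) (kmod (dsum M N)) (\<lambda>x. (x, \<zero>\<^bsub>N\<^esub>))" unfolding linear_def by (auto simp: N.zero_ract)
    show "linear K (kmod (dsum M N)) (kmod N) snd" unfolding linear_def by auto
    show "x \<in> (\<lambda>x. (x, \<zero>\<^bsub>N\<^esub>)) ` carrier (kmod M)" if "x \<in> carrier (kmod (dsum M N))" "snd x = \<zero>\<^bsub>kmod N\<^esub>" for x
      using that by auto
  qed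
  moreover have "vlen K (kmod M) + vlen K (kmod N) \<noteq> \<infinity>"
    using fin_gen_finite_vlen[OF M] fin_gen_finite_vlen[OF N] by (simp add: plus_eq_infty_iff_enat)
  ultimately have "vlen K (kmod (dsum M N)) \<noteq> \<infinity>" by (rule enat_le_finite)
  then show ?thesis by (rule finite_vlen_fin_gen[OF S])
qed

definition regm :: "('a, 'a) rmodule" where
  "regm = \<lparr>carrier = carrier A, mult = undefined, one = undefined, zero = \<zero>\<^bsub>A\<^esub>, add = add A, ract = mult A\<rparr>"

lemma regm_simps [simp]: "carrier regm = carrier A" "\<zero>\<^bsub>regm\<^esub> = \<zero>\<^bsub>A\<^esub>" "x \<oplus>\<^bsub>regm\<^esub> y = x \<oplus>\<^bsub>A\<^esub> y" "x \<triangleleft>\<^bsub>regm\<^esub> a = x \<otimes>\<^bsub>A\<^esub> a"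
  by (simp_all add: regm_def)

lemma regm_right_module: "right_module A regm"
proof -
  have "abelian_group regm"
  proof (rule abelian_groupI)
    fix x assume "x \<in> carrier regm"
    then show "\<exists>y\<in>carrier regm. y \<oplus>\<^bsub>regm\<^esub> x = \<zero>\<^bsub>regm\<^esub>"
      by (intro bexI[of _ "\<ominus>\<^bsub>A\<^esub> x"]) (simp_all add: A.l_neg)
  qed (simp_all add: A.a_ac)
  then interpret R: abelian_group regm .
  show ?thesis by unfold_locales (simp_all add: A.l_distr A.r_distr A.m_assoc)
qed

lemma regm_fin_gen: "fin_gen A regm"
proof -
  interpret R: right_module A regm by (rule regm_right_module)
  show ?thesis unfolding fin_gen_def
  proof (intro exI conjI ballI)
    show "(\<lambda>_. \<one>\<^bsub>A\<^esub>) \<in> {..<Suc 0} \<rightarrow> carrier regm" by simp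
    fix m assume "m \<in> carrier regm"
    then show "\<exists>a\<in>{..<Suc 0} \<rightarrow> carrier A. m = (\<Oplus>\<^bsub>regm\<^esub>i\<in>{..<Suc 0}. \<one>\<^bsub>A\<^esub> \<triangleleft>\<^bsub>regm\<^esub> a i)"
      by (intro bexI[of _ "\<lambda>_. m"]) (simp_all add: lessThan_Suc)
  qed
qed

text \<open>
  The \<open>K\<close>-linear maps from \<open>A\<close> to \<open>M\<close>, with \<open>A\<close> acting through left multiplication on the argument.  They supply
  the injective modules: homomorphisms into them correspond to linear maps into \<open>M\<close>.  Maps are made extensional
  so that equality of elements is pointwise.
\<close>

definition coind :: "('a, 'm) rmodule \<Rightarrow> ('a, 'a \<Rightarrow> 'm) rmodule" where
  "coind M = \<lparr>carrier = {f \<in> extensional (carrier A). f \<in> carrier A \<rightarrow> carrier M \<and>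
       (\<forall>a\<in>carrier A. \<forall>b\<in>carrier A. f (a \<oplus>\<^bsub>A\<^esub> b) = f a \<oplus>\<^bsub>M\<^esub> f b) \<and>
       (\<forall>c\<in>carrier K. \<forall>a\<in>carrier A. f (c \<odot>\<^bsub>A\<^esub> a) = f a \<triangleleft>\<^bsub>M\<^esub> sc c)},
     mult = undefined, one = undefined, zero = (\<lambda>a\<in>carrier A. \<zero>\<^bsub>M\<^esub>),
     add = (\<lambda>f g. \<lambda>a\<in>carrier A. f a \<oplus>\<^bsub>M\<^esub> g a), ract = (\<lambda>f b. \<lambda>a\<in>carrier A. f (b \<otimes>\<^bsub>A\<^esub> a))\<rparr>"

lemma coind_carrierD:
  assumes "f \<in> carrier (coind M)"
  shows "f \<in> extensional (carrier A)" "\<And>a. a \<in> carrier A \<Longrightarrow> f a \<in> carrier M"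
    "\<And>a b. a \<in> carrier A \<Longrightarrow> b \<in> carrier A \<Longrightarrow> f (a \<oplus>\<^bsub>A\<^esub> b) = f a \<oplus>\<^bsub>M\<^esub> f b"
    "\<And>c a. c \<in> carrier K \<Longrightarrow> a \<in> carrier A \<Longrightarrow> f (c \<odot>\<^bsub>A\<^esub> a) = f a \<triangleleft>\<^bsub>M\<^esub> sc c"
  using assms unfolding coind_def by auto

lemma coind_carrierI:
  assumes "f \<in> extensional (carrier A)" "\<And>a. a \<in> carrier A \<Longrightarrow> f a \<in> carrier M"
    "\<And>a b. a \<in> carrier A \<Longrightarrow> b \<in> carrier A \<Longrightarrow> f (a \<oplus>\<^bsub>A\<^esub> b) = f a \<oplus>\<^bsub>M\<^esub> f b"
    "\<And>c a. c \<in> carrier K \<Longrightarrow> a \<in> carrier A \<Longrightarrow> f (c \<odot>\<^bsub>A\<^esub> a) = f a \<triangleleft>\<^bsub>M\<^esub> sc c"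
  shows "f \<in> carrier (coind M)"
  using assms unfolding coind_def by auto

lemma coind_simps: "\<zero>\<^bsub>coind M\<^esub> = (\<lambda>a\<in>carrier A. \<zero>\<^bsub>M\<^esub>)" "f \<oplus>\<^bsub>coind M\<^esub> g = (\<lambda>a\<in>carrier A. f a \<oplus>\<^bsub>M\<^esub> g a)"
  "f \<triangleleft>\<^bsub>coind M\<^esub> b = (\<lambda>a\<in>carrier A. f (b \<otimes>\<^bsub>A\<^esub> a))"
  by (simp_all add: coind_def)

lemma coind_eqI:
  "f \<in> carrier (coind M) \<Longrightarrow> g \<in> carrier (coind M) \<Longrightarrow> (\<And>a. a \<in> carrier A \<Longrightarrow> f a = g a) \<Longrightarrow> f = g"
  by (rule extensionalityI[of f "carrier A"]) (auto dest: coind_carrierD(1))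

lemma coind_right_module:
  assumes M: "right_module A M" shows "right_module A (coind M)"
proof -
  interpret M: right_module A M by (rule M)
  note D = coind_carrierD
  have cl_add: "f \<oplus>\<^bsub>coind M\<^esub> g \<in> carrier (coind M)" if "f \<in> carrier (coind M)" "g \<in> carrier (coind M)" for f g
    unfolding coind_simps
    by (rule coind_carrierI) (simp_all add: D[OF that(1)] D[OF that(2)] M.M.a_ac M.ract_add)
  have cl_zero: "\<zero>\<^bsub>coind M\<^esub> \<in> carrier (coind M)"
    unfolding coind_simps by (rule coind_carrierI) (simp_all add: M.zero_ract)
  have cl_act: "f \<triangleleft>\<^bsub>coind M\<^esub> b \<in> carrier (coind M)" if "f \<in> carrier (coind M)" "b \<in> carrier A" for f b
    unfolding coind_simps
    by (rule coind_carrierI) (simp_all add: D[OF that(1)] that(2) A.r_distr smult_mult_right)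
  have cl_neg: "(\<lambda>a\<in>carrier A. \<ominus>\<^bsub>M\<^esub> f a) \<in> carrier (coind M)" if "f \<in> carrier (coind M)" for f
    by (rule coind_carrierI) (simp_all add: D[OF that] M.M.minus_add M.minus_ract)
  have ab: "abelian_group (coind M)"
  proof (rule abelian_groupI)
    fix f assume f: "f \<in> carrier (coind M)"
    show "\<exists>g\<in>carrier (coind M). g \<oplus>\<^bsub>coind M\<^esub> f = \<zero>\<^bsub>coind M\<^esub>"
      using cl_neg[OF f] by (intro bexI[of _ "\<lambda>a\<in>carrier A. \<ominus>\<^bsub>M\<^esub> f a"])
        (auto simp: coind_simps D[OF f] M.M.l_neg intro!: restrict_ext)
    show "\<zero>\<^bsub>coind M\<^esub> \<oplus>\<^bsub>coind M\<^esub> f = f"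
      by (rule coind_eqI[OF cl_add[OF cl_zero f] f]) (simp add: coind_simps D[OF f])
    fix g assume g: "g \<in> carrier (coind M)"
    show "f \<oplus>\<^bsub>coind M\<^esub> g = g \<oplus>\<^bsub>coind M\<^esub> f"
      by (rule coind_eqI[OF cl_add[OF f g] cl_add[OF g f]]) (simp add: coind_simps D[OF f] D[OF g] M.M.a_comm)
    fix h assume h: "h \<in> carrier (coind M)"
    show "f \<oplus>\<^bsub>coind M\<^esub> g \<oplus>\<^bsub>coind M\<^esub> h = f \<oplus>\<^bsub>coind M\<^esub> (g \<oplus>\<^bsub>coind M\<^esub> h)"
      by (rule coind_eqI[OF cl_add[OF cl_add[OF f g] h] cl_add[OF f cl_add[OF g h]]])
        (simp add: coind_simps D[OF f] D[OF g] D[OF h] M.M.a_assoc)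
  qed (use cl_add cl_zero in auto)
  interpret C: abelian_group "coind M" by (rule ab)
  show ?thesis
  proof unfold_locales
    fix f a assume f: "f \<in> carrier (coind M)" and a: "a \<in> carrier A"
    show "f \<triangleleft>\<^bsub>coind M\<^esub> a \<in> carrier (coind M)" using cl_act f a .
    fix b assume b: "b \<in> carrier A"
    show "f \<triangleleft>\<^bsub>coind M\<^esub> (a \<oplus>\<^bsub>A\<^esub> b) = f \<triangleleft>\<^bsub>coind M\<^esub> a \<oplus>\<^bsub>coind M\<^esub> f \<triangleleft>\<^bsub>coind M\<^esub> b"
      using a b by (intro coind_eqI[where M = M] cl_add cl_act f) (simp_all add: coind_simps D[OF f] A.l_distr)
    show "f \<triangleleft>\<^bsub>coind M\<^esub> (a \<otimes>\<^bsub>A\<^esub> b) = f \<triangleleft>\<^bsub>coind M\<^esub> a \<triangleleft>\<^bsub>coind M\<^esub> b"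
      using a b by (intro coind_eqI[where M = M] cl_act f) (simp_all add: coind_simps D[OF f] A.m_assoc)
  next
    fix f g a assume f: "f \<in> carrier (coind M)" and g: "g \<in> carrier (coind M)" and a: "a \<in> carrier A"
    show "(f \<oplus>\<^bsub>coind M\<^esub> g) \<triangleleft>\<^bsub>coind M\<^esub> a = f \<triangleleft>\<^bsub>coind M\<^esub> a \<oplus>\<^bsub>coind M\<^esub> g \<triangleleft>\<^bsub>coind M\<^esub> a"
      using a by (intro coind_eqI[where M = M] cl_add cl_act f g) (simp_all add: coind_simps)
  next
    fix f assume f: "f \<in> carrier (coind M)"
    show "f \<triangleleft>\<^bsub>coind M\<^esub> \<one>\<^bsub>A\<^esub> = f"
      by (intro coind_eqI[where M = M] cl_act f) (simp_all add: coind_simps)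
  qed
qed

text \<open>
  A linear map is determined by its values on a finite spanning set of the algebra.
\<close>

lemma coind_fin_gen:
  assumes M: "right_module A M" "fin_gen A M" shows "fin_gen A (coind M)"
proof -
  interpret M: right_module A M by (rule M)
  note C = coind_right_module[OF M(1)] and D = coind_carrierD
  interpret C: right_module A "coind M" by (rule C)
  obtain r :: nat and b where b: "b \<in> {..<r} \<rightarrow> carrier A"
    "\<forall>y\<in>carrier A. \<exists>c\<in>{..<r} \<rightarrow> carrier K. y = (\<Oplus>\<^bsub>A\<^esub>i\<in>{..<r}. c i \<odot>\<^bsub>A\<^esub> b i)"
    using finite_dim by blast
  have bc: "b i \<in> carrier A" if "i < r" for i using b(1) that by auto
  have "vlen K (kmod (coind M)) \<noteq> \<infinity>"
  proof (rule finite_vlen_jointly_injective[OF kmod_module[OF C] kmod_module[OF M(1)] fin_gen_finite_vlen[OF M]])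
    fix i assume i: "i < r"
    have "f (c \<odot>\<^bsub>A\<^esub> \<one>\<^bsub>A\<^esub> \<otimes>\<^bsub>A\<^esub> b i) = f (b i) \<triangleleft>\<^bsub>M\<^esub> sc c" if "f \<in> carrier (coind M)" "c \<in> carrier K" for f c
      using D(4)[OF that bc[OF i]] sc_central(2)[OF that(2) bc[OF i]] by simp
    then show "linear K (kmod (coind M)) (kmod M) (\<lambda>f. f (b i))"
      unfolding linear_def using D(2)[OF _ bc[OF i]] bc[OF i] by (auto simp: coind_simps)
  next
    fix f assume f: "f \<in> carrier (kmod (coind M))" and z: "\<And>i. i < r \<Longrightarrow> f (b i) = \<zero>\<^bsub>kmod M\<^esub>"
    have f': "f \<in> carrier (coind M)" using f by simp
    have "f a = \<zero>\<^bsub>M\<^esub>" if a: "a \<in> carrier A" for a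
    proof -
      obtain c where c: "c \<in> {..<r} \<rightarrow> carrier K" "a = (\<Oplus>\<^bsub>A\<^esub>j\<in>{..<r}. c j \<odot>\<^bsub>A\<^esub> b j)" using b(2) a by blast
      have cc: "c j \<in> carrier K" if "j < r" for j using c(1) that by auto
      have f0: "f \<zero>\<^bsub>A\<^esub> = \<zero>\<^bsub>M\<^esub>" using D(3)[OF f', of "\<zero>\<^bsub>A\<^esub>" "\<zero>\<^bsub>A\<^esub>"] D(2)[OF f', of "\<zero>\<^bsub>A\<^esub>"] by simp
      have "a \<in> {a \<in> carrier A. f a = \<zero>\<^bsub>M\<^esub>}" unfolding c(2)
      proof (rule A.finsum_lessThan_mem)
        show "c j \<odot>\<^bsub>A\<^esub> b j \<in> {a \<in> carrier A. f a = \<zero>\<^bsub>M\<^esub>}" if j: "j < r" for j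
          using D(4)[OF f' cc[OF j] bc[OF j]] z[OF j] cc[OF j] bc[OF j] M.zero_ract by simp
      qed (use f0 D(3)[OF f'] in auto)
      then show ?thesis by simp
    qed
    then have "f = \<zero>\<^bsub>coind M\<^esub>" by (intro coind_eqI[OF f' C.M.zero_closed]) (simp add: coind_simps)
    then show "f = \<zero>\<^bsub>kmod (coind M)\<^esub>" by simp
  qed
  then show ?thesis by (rule finite_vlen_fin_gen[OF C])
qed

end


section \<open>The category of finitely generated modules\<close>

lemma factor_through_surj:
  assumes M: "right_module A M" and Z: "right_module A Z" and L: "right_module A L"
    and p: "p \<in> rmod_hom A M Z" "p ` carrier M = carrier Z" and f: "f \<in> rmod_hom A M L"
    and k: "\<And>x. x \<in> carrier M \<Longrightarrow> p x = \<zero>\<^bsub>Z\<^esub> \<Longrightarrow> f x = \<zero>\<^bsub>L\<^esub>"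
  shows "\<exists>h\<in>rmod_hom A Z L. \<forall>x\<in>carrier M. h (p x) = f x"
proof -
  interpret M: right_module A M by (rule M)
  interpret Z: right_module A Z by (rule Z)
  interpret L: right_module A L by (rule L)
  note p' = rmod_homD[OF p(1)] and f' = rmod_homD[OF f]
  define s where "s = inv_into (carrier M) p"
  have s: "s z \<in> carrier M" "p (s z) = z" if "z \<in> carrier Z" for z
    using that inv_into_into[of z p "carrier M"] f_inv_into_f[of z p "carrier M"] unfolding s_def p(2) by auto
  have eq: "f x = f y" if xy: "x \<in> carrier M" "y \<in> carrier M" "p x = p y" for x y
  proof -
    have "p (x \<oplus>\<^bsub>M\<^esub> \<ominus>\<^bsub>M\<^esub> y) = \<zero>\<^bsub>Z\<^esub>"
      using p'(2)[of x "\<ominus>\<^bsub>M\<^esub> y"] rmod_hom_minus[OF M Z p(1) xy(2)] xy p'(1)[OF xy(2)] by (simp add: Z.M.r_neg)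
    then have "f (x \<oplus>\<^bsub>M\<^esub> \<ominus>\<^bsub>M\<^esub> y) = \<zero>\<^bsub>L\<^esub>" using k xy by simp
    then have "f x \<oplus>\<^bsub>L\<^esub> \<ominus>\<^bsub>L\<^esub> f y = \<zero>\<^bsub>L\<^esub>" using f'(2)[of x "\<ominus>\<^bsub>M\<^esub> y"] rmod_hom_minus[OF M L f xy(2)] xy by simp
    then show ?thesis using L.M.minus_equality[of "f x" "\<ominus>\<^bsub>L\<^esub> f y"] f'(1) xy by simp
  qed
  have hp: "f (s (p x)) = f x" if "x \<in> carrier M" for x
    using eq[of "s (p x)" x] s[OF p'(1)[OF that]] that by simp
  have "(\<lambda>z. f (s z)) \<in> rmod_hom A Z L"
  proof (rule rmod_homI)
    show "f (s z) \<in> carrier L" if "z \<in> carrier Z" for z using f'(1) s(1)[OF that] .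
    show "f (s (z \<oplus>\<^bsub>Z\<^esub> w)) = f (s z) \<oplus>\<^bsub>L\<^esub> f (s w)" if zw: "z \<in> carrier Z" "w \<in> carrier Z" for z w
    proof -
      have "f (s (z \<oplus>\<^bsub>Z\<^esub> w)) = f (s z \<oplus>\<^bsub>M\<^esub> s w)"
        using s[OF zw(1)] s[OF zw(2)] s[of "z \<oplus>\<^bsub>Z\<^esub> w"] zw by (intro eq) (simp_all add: p'(2))
      then show ?thesis using f'(2)[OF s(1)[OF zw(1)] s(1)[OF zw(2)]] by simp
    qed
    show "f (s (z \<triangleleft>\<^bsub>Z\<^esub> a)) = f (s z) \<triangleleft>\<^bsub>L\<^esub> a" if za: "z \<in> carrier Z" "a \<in> carrier A" for z a
    proof -
      have "f (s (z \<triangleleft>\<^bsub>Z\<^esub> a)) = f (s z \<triangleleft>\<^bsub>M\<^esub> a)"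
        using s[OF za(1)] s[OF Z.ract_closed[OF za]] M.ract_closed za by (intro eq) (simp_all add: p'(3))
      then show ?thesis using f'(3)[OF s(1)[OF za(1)] za(2)] by simp
    qed
  qed
  then show ?thesis using hp by (intro bexI[of _ "\<lambda>z. f (s z)"]) simp_all
qed

lemma factor_through_inj:
  assumes N: "right_module A N" and W: "right_module A W" and M: "right_module A M"
    and i: "i \<in> rmod_hom A N M" "inj_on i (carrier N)" and g: "g \<in> rmod_hom A W M" "g ` carrier W \<subseteq> i ` carrier N"
  shows "\<exists>h\<in>rmod_hom A W N. \<forall>x\<in>carrier W. i (h x) = g x"
proof -
  interpret N: right_module A N by (rule N)
  interpret W: right_module A W by (rule W)
  note i' = rmod_homD[OF i(1)] and g' = rmod_homD[OF g(1)]
  define h where "h x = inv_into (carrier N) i (g x)" for x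
  have h: "h x \<in> carrier N" "i (h x) = g x" if "x \<in> carrier W" for x
    using g(2) that inv_into_into[of "g x" i "carrier N"] f_inv_into_f[of "g x" i "carrier N"] unfolding h_def by auto
  have eq: "y = z" if "y \<in> carrier N" "z \<in> carrier N" "i y = i z" for y z using i(2) that by (auto dest: inj_onD)
  have "h \<in> rmod_hom A W N"
  proof (rule rmod_homI)
    show "h x \<in> carrier N" if "x \<in> carrier W" for x using h(1)[OF that] .
    show "h (x \<oplus>\<^bsub>W\<^esub> y) = h x \<oplus>\<^bsub>N\<^esub> h y" if "x \<in> carrier W" "y \<in> carrier W" for x y
      using that h by (intro eq) (simp_all add: i'(2) g'(2))
    show "h (x \<triangleleft>\<^bsub>W\<^esub> a) = h x \<triangleleft>\<^bsub>N\<^esub> a" if "x \<in> carrier W" "a \<in> carrier A" for x a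
      using that h W.ract_closed N.ract_closed by (intro eq) (simp_all add: i'(3) g'(3))
  qed
  then show ?thesis using h(2) by blast
qed

lemma rmod_hom_comp: "f \<in> rmod_hom A M N \<Longrightarrow> g \<in> rmod_hom A N L \<Longrightarrow> (\<lambda>x. g (f x)) \<in> rmod_hom A M L"
  by (rule rmod_homI) (simp_all add: rmod_homD)

lemma kernel_submod:
  assumes M: "right_module A M" and N: "right_module A N" and f: "f \<in> rmod_hom A M N"
  shows "submod A {x \<in> carrier M. f x = \<zero>\<^bsub>N\<^esub>} M"
proof -
  interpret M: right_module A M by (rule M)
  interpret N: right_module A N by (rule N)
  show ?thesis by (rule submodI[OF M]) (auto simp: rmod_homD[OF f] rmod_hom_zero[OF M N f] M.ract_closed N.zero_ract)
qed

lemma image_submod: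
  assumes M: "right_module A M" and N: "right_module A N" and f: "f \<in> rmod_hom A M N"
  shows "submod A (f ` carrier M) N"
proof -
  interpret M: right_module A M by (rule M)
  note f' = rmod_homD[OF f]
  show ?thesis
  proof (rule submodI[OF N])
    show "f ` carrier M \<subseteq> carrier N" using f'(1) by auto
    show "\<zero>\<^bsub>N\<^esub> \<in> f ` carrier M" using rmod_hom_zero[OF M N f] by (metis M.M.zero_closed image_eqI)
    fix x assume "x \<in> f ` carrier M"
    then obtain m where m: "x = f m" "m \<in> carrier M" by (rule imageE)
    show "x \<triangleleft>\<^bsub>N\<^esub> a \<in> f ` carrier M" if "a \<in> carrier A" for a
      unfolding m(1) f'(3)[OF m(2) that, symmetric] using M.ract_closed[OF m(2) that] by (rule imageI)
    fix y assume "y \<in> f ` carrier M"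
    then obtain n where n: "y = f n" "n \<in> carrier M" by (rule imageE)
    show "x \<oplus>\<^bsub>N\<^esub> y \<in> f ` carrier M"
      unfolding m(1) n(1) f'(2)[OF m(2) n(2), symmetric] using M.M.a_closed[OF m(2) n(2)] by (rule imageI)
  qed
qed

text \<open>
  The value \<open>None\<close> is the result of ill-typed operations, which makes the laws of the category unconditional.
\<close>

type_synonym ('k, 'a) arrow = "(('a, nat \<Rightarrow> 'k) rmodule \<times> ((nat \<Rightarrow> 'k) \<Rightarrow> nat \<Rightarrow> 'k) \<times> ('a, nat \<Rightarrow> 'k) rmodule) option"

context fd_alg
begin

text \<open>
  Restriction to the carrier identifies functions that are the same homomorphism.
\<close>

definition mk :: "('a, nat \<Rightarrow> 'k) rmodule \<Rightarrow> ((nat \<Rightarrow> 'k) \<Rightarrow> nat \<Rightarrow> 'k) \<Rightarrow> ('a, nat \<Rightarrow> 'k) rmodule \<Rightarrow> ('k, 'a) arrow" where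
  "mk M f N = Some (M, restrict f (carrier M), N)"

definition adom :: "('k, 'a) arrow \<Rightarrow> ('a, nat \<Rightarrow> 'k) rmodule" where "adom a = fst (the a)"
definition acod :: "('k, 'a) arrow \<Rightarrow> ('a, nat \<Rightarrow> 'k) rmodule" where "acod a = snd (snd (the a))"
definition afun :: "('k, 'a) arrow \<Rightarrow> (nat \<Rightarrow> 'k) \<Rightarrow> nat \<Rightarrow> 'k" where "afun a = fst (snd (the a))"

definition aarr :: "('k, 'a) arrow \<Rightarrow> bool" where
  "aarr a \<longleftrightarrow> (\<exists>M f N. a = mk M f N \<and> M \<in> fgmod A \<and> N \<in> fgmod A \<and> f \<in> rmod_hom A M N)"

definition acomp :: "('k, 'a) arrow \<Rightarrow> ('k, 'a) arrow \<Rightarrow> ('k, 'a) arrow" where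
  "acomp g f = (if aarr f \<and> aarr g \<and> acod f = adom g then mk (adom f) (\<lambda>x. afun g (afun f x)) (acod g) else None)"

definition aadd :: "('k, 'a) arrow \<Rightarrow> ('k, 'a) arrow \<Rightarrow> ('k, 'a) arrow" where
  "aadd f g = (if aarr f \<and> aarr g \<and> adom f = adom g \<and> acod f = acod g
     then mk (adom f) (\<lambda>x. afun f x \<oplus>\<^bsub>acod f\<^esub> afun g x) (acod f) else None)"

definition aneg :: "('k, 'a) arrow \<Rightarrow> ('k, 'a) arrow" where
  "aneg f = mk (adom f) (\<lambda>x. \<ominus>\<^bsub>acod f\<^esub> afun f x) (acod f)"

definition azr :: "('a, nat \<Rightarrow> 'k) rmodule \<Rightarrow> ('a, nat \<Rightarrow> 'k) rmodule \<Rightarrow> ('k, 'a) arrow" where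
  "azr M N = mk M (\<lambda>_. \<zero>\<^bsub>N\<^esub>) N"

definition aid :: "('a, nat \<Rightarrow> 'k) rmodule \<Rightarrow> ('k, 'a) arrow" where "aid M = mk M (\<lambda>x. x) M"

lemma mk_simps [simp]: "adom (mk M f N) = M" "acod (mk M f N) = N" "x \<in> carrier M \<Longrightarrow> afun (mk M f N) x = f x"
  by (simp_all add: mk_def adom_def acod_def afun_def)

lemma mk_arr: "M \<in> fgmod A \<Longrightarrow> N \<in> fgmod A \<Longrightarrow> f \<in> rmod_hom A M N \<Longrightarrow> aarr (mk M f N)"
  unfolding aarr_def by blast

lemma None_arr [simp]: "\<not> aarr None"
  by (simp add: aarr_def mk_def)

lemma restrict_hom:
  assumes M: "right_module A M" and f: "f \<in> rmod_hom A M N" shows "restrict f (carrier M) \<in> rmod_hom A M N"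
proof -
  interpret M: right_module A M by (rule M)
  show ?thesis by (rule rmod_homI) (simp_all add: rmod_homD[OF f] M.ract_closed)
qed

lemma arrD:
  assumes "aarr a"
  shows "adom a \<in> fgmod A" "acod a \<in> fgmod A" "afun a \<in> rmod_hom A (adom a) (acod a)"
    "right_module A (adom a)" "right_module A (acod a)" "a = mk (adom a) (afun a) (acod a)"
proof -
  obtain M f N where a: "a = mk M f N" "M \<in> fgmod A" "N \<in> fgmod A" "f \<in> rmod_hom A M N"
    using assms unfolding aarr_def by blast
  show "adom a \<in> fgmod A" "acod a \<in> fgmod A" "right_module A (adom a)" "right_module A (acod a)"
    using a fgmodD(1) by simp_all
  show "afun a \<in> rmod_hom A (adom a) (acod a)"
    using restrict_hom[OF fgmodD(1)[OF a(2)] a(4)] unfolding a(1) by (simp add: mk_def afun_def adom_def acod_def)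
  show "a = mk (adom a) (afun a) (acod a)" unfolding a(1) by (simp add: mk_def afun_def adom_def acod_def)
qed

lemma arr_eqI:
  assumes "aarr a" "aarr b" "adom a = adom b" "acod a = acod b" "\<And>x. x \<in> carrier (adom b) \<Longrightarrow> afun a x = afun b x"
  shows "a = b"
proof -
  have "a = mk (adom a) (afun a) (acod a)" using arrD(6)[OF assms(1)] .
  also have "\<dots> = mk (adom b) (afun b) (acod b)"
    unfolding mk_def assms(3,4) using assms(5) by (auto intro!: restrict_ext)
  also have "\<dots> = b" using arrD(6)[OF assms(2)] by simp
  finally show ?thesis .
qed

lemma afun_closed: "aarr a \<Longrightarrow> x \<in> carrier (adom a) \<Longrightarrow> afun a x \<in> carrier (acod a)"
  using rmod_homD(1)[OF arrD(3)] .

lemma acomp_arr: "aarr f \<Longrightarrow> aarr g \<Longrightarrow> acod f = adom g \<Longrightarrow> aarr (acomp g f)"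
  unfolding acomp_def using arrD(1-3)[of f] arrD(1-3)[of g] by (simp add: mk_arr rmod_hom_comp)

lemma acomp_arr_iff: "aarr (acomp g f) \<longleftrightarrow> aarr f \<and> aarr g \<and> acod f = adom g"
  using acomp_arr by (auto simp: acomp_def split: if_splits)

lemma acomp_dom: "aarr f \<Longrightarrow> aarr g \<Longrightarrow> acod f = adom g \<Longrightarrow> adom (acomp g f) = adom f"
  and acomp_cod: "aarr f \<Longrightarrow> aarr g \<Longrightarrow> acod f = adom g \<Longrightarrow> acod (acomp g f) = acod g"
  and acomp_fun: "aarr f \<Longrightarrow> aarr g \<Longrightarrow> acod f = adom g \<Longrightarrow> x \<in> carrier (adom f) \<Longrightarrow> afun (acomp g f) x = afun g (afun f x)"
  by (simp_all add: acomp_def)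

lemma acomp_None: "\<not> aarr (acomp g f) \<Longrightarrow> acomp g f = None"
  using acomp_arr by (auto simp: acomp_def)

lemma aadd_arr: assumes "aarr f" "aarr g" "adom f = adom g" "acod f = acod g" shows "aarr (aadd f g)"
proof -
  interpret N: right_module A "acod f" by (rule arrD[OF assms(1)])
  note f = rmod_homD[OF arrD(3)[OF assms(1)]] and g = rmod_homD[OF arrD(3)[OF assms(2)], folded assms(3,4)]
  have "(\<lambda>x. afun f x \<oplus>\<^bsub>acod f\<^esub> afun g x) \<in> rmod_hom A (adom f) (acod f)"
    by (rule rmod_homI) (simp_all add: f g N.M.a_ac N.ract_add)
  then show ?thesis unfolding aadd_def using assms arrD(1,2)[OF assms(1)] by (simp add: mk_arr)
qed

lemma aadd_arr_iff: "aarr (aadd f g) \<longleftrightarrow> aarr f \<and> aarr g \<and> adom f = adom g \<and> acod f = acod g"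
  using aadd_arr by (auto simp: aadd_def split: if_splits)

lemma aadd_dom: "aarr f \<Longrightarrow> aarr g \<Longrightarrow> adom f = adom g \<Longrightarrow> acod f = acod g \<Longrightarrow> adom (aadd f g) = adom f"
  and aadd_cod: "aarr f \<Longrightarrow> aarr g \<Longrightarrow> adom f = adom g \<Longrightarrow> acod f = acod g \<Longrightarrow> acod (aadd f g) = acod f"
  and aadd_fun: "aarr f \<Longrightarrow> aarr g \<Longrightarrow> adom f = adom g \<Longrightarrow> acod f = acod g \<Longrightarrow> x \<in> carrier (adom f) \<Longrightarrow>
    afun (aadd f g) x = afun f x \<oplus>\<^bsub>acod f\<^esub> afun g x"
  by (simp_all add: aadd_def)

lemma aadd_None: "\<not> aarr (aadd g f) \<Longrightarrow> aadd g f = None"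
  using aadd_arr by (auto simp: aadd_def)

lemma aneg_arr: assumes "aarr f" shows "aarr (aneg f)"
proof -
  interpret N: right_module A "acod f" by (rule arrD[OF assms(1)])
  note f = rmod_homD[OF arrD(3)[OF assms(1)]]
  have "(\<lambda>x. \<ominus>\<^bsub>acod f\<^esub> afun f x) \<in> rmod_hom A (adom f) (acod f)"
    by (rule rmod_homI) (simp_all add: f N.M.minus_add N.minus_ract)
  then show ?thesis unfolding aneg_def using arrD(1,2)[OF assms(1)] by (simp add: mk_arr)
qed

lemma azr_arr: assumes "M \<in> fgmod A" "N \<in> fgmod A" shows "aarr (azr M N)"
proof -
  interpret N: right_module A N by (rule fgmodD(1)[OF assms(2)])
  have "(\<lambda>x. \<zero>\<^bsub>N\<^esub>) \<in> rmod_hom A M N" by (rule rmod_homI) (simp_all add: N.zero_ract)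
  then show ?thesis unfolding azr_def using assms by (simp add: mk_arr)
qed

lemma aid_arr: "M \<in> fgmod A \<Longrightarrow> aarr (aid M)"
  unfolding aid_def by (simp add: mk_arr rmod_homI)

lemma aneg_fun: "aarr f \<Longrightarrow> x \<in> carrier (adom f) \<Longrightarrow> afun (aneg f) x = \<ominus>\<^bsub>acod f\<^esub> afun f x"
  and azr_fun: "x \<in> carrier M \<Longrightarrow> afun (azr M N) x = \<zero>\<^bsub>N\<^esub>"
  and aid_fun: "x \<in> carrier M \<Longrightarrow> afun (aid M) x = x"
  and aneg_dom [simp]: "adom (aneg f) = adom f" and aneg_cod [simp]: "acod (aneg f) = acod f"
  and azr_dom [simp]: "adom (azr M N) = M" and azr_cod [simp]: "acod (azr M N) = N"
  and aid_dom [simp]: "adom (aid M) = M" and aid_cod [simp]: "acod (aid M) = M"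
  by (simp_all add: aneg_def azr_def aid_def)

lemma acomp_assoc: "acomp (acomp h g) f = acomp h (acomp g f)"
proof (cases "aarr f \<and> aarr g \<and> aarr h \<and> acod f = adom g \<and> acod g = adom h")
  case True
  have c: "afun f x \<in> carrier (adom g)" if "x \<in> carrier (adom f)" for x using afun_closed[of f x] True that by simp
  show ?thesis using True
    by (intro arr_eqI) (simp_all add: acomp_arr acomp_dom acomp_cod acomp_fun c)
next
  case False
  then have "\<not> aarr (acomp (acomp h g) f)" "\<not> aarr (acomp h (acomp g f))"
    by (auto simp: acomp_arr_iff acomp_dom acomp_cod)
  then show ?thesis using acomp_None by metis
qed

lemma aadd_assoc: "aadd (aadd f g) h = aadd f (aadd g h)"
proof (cases "aarr f \<and> aarr g \<and> aarr h \<and> adom f = adom g \<and> adom g = adom h \<and> acod f = acod g \<and> acod g = acod h")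
  case True
  then interpret N: right_module A "acod h" using arrD(5) by blast
  have c: "afun f x \<in> carrier (acod h)" "afun g x \<in> carrier (acod h)" "afun h x \<in> carrier (acod h)" if "x \<in> carrier (adom h)" for x
    using True that afun_closed by metis+
  show ?thesis using True
    by (intro arr_eqI) (simp_all add: aadd_arr aadd_dom aadd_cod aadd_fun c N.M.a_assoc)
next
  case False
  then have "\<not> aarr (aadd (aadd f g) h)" "\<not> aarr (aadd f (aadd g h))"
    by (auto simp: aadd_arr_iff aadd_dom aadd_cod)
  then show ?thesis using aadd_None by metis
qed

lemma aadd_comm: "aadd f g = aadd g f"
proof (cases "aarr f \<and> aarr g \<and> adom f = adom g \<and> acod f = acod g")
  case True
  then interpret N: right_module A "acod g" using arrD(5) by blast
  have c: "afun f x \<in> carrier (acod g)" "afun g x \<in> carrier (acod g)" if "x \<in> carrier (adom g)" for x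
    using True that afun_closed by metis+
  show ?thesis using True by (intro arr_eqI) (simp_all add: aadd_arr aadd_dom aadd_cod aadd_fun c N.M.a_comm)
next
  case False
  then have "\<not> aarr (aadd f g)" "\<not> aarr (aadd g f)" by (auto simp: aadd_arr_iff)
  then show ?thesis using aadd_None by metis
qed

lemma acomp_aadd: "acomp h (aadd f g) = aadd (acomp h f) (acomp h g)"
proof (cases "aarr f \<and> aarr g \<and> aarr h \<and> adom f = adom g \<and> acod f = acod g \<and> acod g = adom h")
  case True
  have c: "afun f x \<in> carrier (adom h)" "afun g x \<in> carrier (adom h)" if "x \<in> carrier (adom g)" for x
    using True that afun_closed by metis+
  have h: "afun h (u \<oplus>\<^bsub>adom h\<^esub> v) = afun h u \<oplus>\<^bsub>acod h\<^esub> afun h v" if "u \<in> carrier (adom h)" "v \<in> carrier (adom h)" for u v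
    using rmod_homD(2)[OF arrD(3)] True that by blast
  show ?thesis using True
    by (intro arr_eqI) (simp_all add: aadd_arr aadd_dom aadd_cod aadd_fun acomp_arr acomp_dom acomp_cod acomp_fun c h)
next
  case False
  then have "\<not> aarr (acomp h (aadd f g))" "\<not> aarr (aadd (acomp h f) (acomp h g))"
    by (auto simp: aadd_arr_iff acomp_arr_iff aadd_dom aadd_cod acomp_dom acomp_cod)
  then show ?thesis using aadd_None acomp_None by metis
qed

lemma aadd_acomp: "acomp (aadd f g) h = aadd (acomp f h) (acomp g h)"
proof (cases "aarr f \<and> aarr g \<and> aarr h \<and> adom f = adom g \<and> acod f = acod g \<and> acod h = adom g")
  case True
  have c: "afun h x \<in> carrier (adom g)" if "x \<in> carrier (adom h)" for x using True that afun_closed by metis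
  show ?thesis using True
    by (intro arr_eqI) (simp_all add: aadd_arr aadd_dom aadd_cod aadd_fun acomp_arr acomp_dom acomp_cod acomp_fun c)
next
  case False
  then have "\<not> aarr (acomp (aadd f g) h)" "\<not> aarr (aadd (acomp f h) (acomp g h))"
    by (auto simp: aadd_arr_iff acomp_arr_iff aadd_dom aadd_cod acomp_dom acomp_cod)
  then show ?thesis using aadd_None acomp_None by metis
qed

lemma category: "preadditive_cat (fgmod A) aarr adom acod acomp aadd aneg azr aid"
proof
  fix f g :: "('k, 'a) arrow"
  show "acomp (aid X) f = f" if f: "aarr f" "acod f = X" for X
  proof -
    have c: "afun f x \<in> carrier X" if "x \<in> carrier (adom f)" for x using afun_closed[of f x] f that by simp
    show ?thesis using f arrD(1,2)[OF f(1)]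
      by (intro arr_eqI) (simp_all add: acomp_arr acomp_dom acomp_cod acomp_fun aid_arr aid_fun c)
  qed
  show "acomp f (aid X) = f" if "aarr f" "adom f = X" for X
    using that arrD(1,2)[of f] by (intro arr_eqI) (simp_all add: acomp_arr acomp_dom acomp_cod acomp_fun aid_arr aid_fun afun_closed)
  show "aadd f (azr X Y) = f" if f: "aarr f" "adom f = X" "acod f = Y" for X Y
  proof -
    interpret N: right_module A "acod f" by (rule arrD[OF f(1)])
    show ?thesis using f arrD(1,2)[OF f(1)]
      by (intro arr_eqI) (auto simp: aadd_arr aadd_dom aadd_cod aadd_fun azr_arr azr_fun afun_closed)
  qed
  show "aadd f (aneg f) = azr (adom f) (acod f)" if f: "aarr f"
  proof -
    interpret N: right_module A "acod f" by (rule arrD[OF f(1)])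
    show ?thesis using f arrD(1,2)[OF f(1)]
      by (intro arr_eqI) (simp_all add: aadd_arr aadd_dom aadd_cod aadd_fun azr_arr azr_fun afun_closed aneg_arr aneg_fun N.M.r_neg)
  qed
qed (simp_all add: arrD(1,2) acomp_arr acomp_dom acomp_cod acomp_assoc aid_arr aadd_arr aadd_dom aadd_cod aadd_assoc
  acomp_aadd aadd_acomp azr_arr aneg_arr, rule aadd_comm)

end

sublocale fd_alg \<subseteq> C: preadditive_cat "fgmod A" aarr adom acod acomp aadd aneg azr aid
  by (rule category)

context fd_alg
begin

lemma zero_iff: "aarr f \<Longrightarrow> f = azr (adom f) (acod f) \<longleftrightarrow> (\<forall>x\<in>carrier (adom f). afun f x = \<zero>\<^bsub>acod f\<^esub>)"
  using arr_eqI[of f "azr (adom f) (acod f)"] azr_arr arrD(1,2) azr_fun by (metis azr_cod azr_dom)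

lemma inclusion_arr:
  assumes M: "M \<in> fgmod A" and U: "submod A U M"
  shows "aarr (mk (M\<lparr>carrier := U\<rparr>) (\<lambda>x. x) M)"
  using submodD(1)[OF fgmodD(1)[OF M] U] by (intro mk_arr sub_fgmod[OF M U] M rmod_homI) auto

lemma projection_arr:
  assumes M: "M \<in> fgmod A" and U: "submod A U M"
  shows "aarr (mk M (qrep M U) (qmod M U))"
  by (intro mk_arr quotient_fgmod[OF M U] M quotient_module(2)[OF fgmodD(1)[OF M] U])

text \<open>
  In one direction a mono is tested on the inclusion of its kernel.
\<close>

lemma mono_iff:
  assumes m: "aarr m" shows "C.mono m \<longleftrightarrow> inj_on (afun m) (carrier (adom m))"
proof
  note m' = arrD[OF m]
  assume mo: "C.mono m"
  let ?U = "{x \<in> carrier (adom m). afun m x = \<zero>\<^bsub>acod m\<^esub>}"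
  have U: "submod A ?U (adom m)" by (rule kernel_submod[OF m'(4,5,3)])
  define k where "k = mk ((adom m)\<lparr>carrier := ?U\<rparr>) (\<lambda>x. x) (adom m)"
  have k: "aarr k" "acod k = adom m" "carrier (adom k) = ?U" "\<And>x. x \<in> ?U \<Longrightarrow> afun k x = x"
    unfolding k_def using inclusion_arr[OF m'(1) U] by simp_all
  have "acomp m k = azr (adom k) (acod m)"
    using k m arrD(1)[OF k(1)] m'(2) by (intro arr_eqI) (simp_all add: acomp_arr acomp_dom acomp_cod acomp_fun azr_arr azr_fun)
  then have "k = azr (adom k) (adom m)" using C.monoD[OF mo k(1,2)] by simp
  then have "\<forall>x\<in>?U. x = \<zero>\<^bsub>adom m\<^esub>" using zero_iff[OF k(1)] k by simp
  then show "inj_on (afun m) (carrier (adom m))" unfolding rmod_hom_inj_iff[OF m'(4,5,3)] by blast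
next
  note m' = arrD[OF m]
  assume i: "inj_on (afun m) (carrier (adom m))"
  show "C.mono m" unfolding C.mono_def
  proof (intro conjI allI impI m)
    fix g assume g: "aarr g \<and> acod g = adom m \<and> acomp m g = azr (adom g) (acod m)"
    then have g': "aarr g" "acod g = adom m" by auto
    have "afun g x = \<zero>\<^bsub>adom m\<^esub>" if x: "x \<in> carrier (adom g)" for x
    proof -
      have "afun m (afun g x) = \<zero>\<^bsub>acod m\<^esub>" using acomp_fun[OF g'(1) m g'(2) x] g azr_fun[OF x] by simp
      then show ?thesis using i afun_closed[OF g'(1) x] g'(2) unfolding rmod_hom_inj_iff[OF m'(4,5,3)] by simp
    qed
    then show "g = azr (adom g) (adom m)" using zero_iff[OF g'(1)] g'(2) by simp
  qed
qed

text \<open>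
  In one direction an epi is tested on the projection onto its cokernel.
\<close>

lemma epi_iff:
  assumes p: "aarr p" shows "C.epi p \<longleftrightarrow> afun p ` carrier (adom p) = carrier (acod p)"
proof
  note p' = arrD[OF p]
  assume ep: "C.epi p"
  let ?U = "afun p ` carrier (adom p)"
  have U: "submod A ?U (acod p)" by (rule image_submod[OF p'(4,5,3)])
  define q where "q = mk (acod p) (qrep (acod p) ?U) (qmod (acod p) ?U)"
  have q: "aarr q" "adom q = acod p" "acod q = qmod (acod p) ?U" "\<And>x. x \<in> carrier (acod p) \<Longrightarrow> afun q x = qrep (acod p) ?U x"
    unfolding q_def using projection_arr[OF p'(2) U] by simp_all
  note qz = quotient_module(3)[OF p'(5) U]
  have "acomp q p = azr (adom p) (acod q)"
    using q p arrD(2)[OF q(1)] p'(1) afun_closed[OF p]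
    by (intro arr_eqI) (simp_all add: acomp_arr acomp_dom acomp_cod acomp_fun azr_arr azr_fun qz del: qmod_simps)
  then have "q = azr (acod p) (acod q)" using C.epiD[OF ep q(1,2)] by simp
  then have "\<forall>x\<in>carrier (acod p). x \<in> ?U" using zero_iff[OF q(1)] q qz by (simp del: qmod_simps)
  then show "?U = carrier (acod p)" using afun_closed[OF p] by auto
next
  note p' = arrD[OF p]
  assume s: "afun p ` carrier (adom p) = carrier (acod p)"
  show "C.epi p" unfolding C.epi_def
  proof (intro conjI allI impI p)
    fix g assume g: "aarr g \<and> adom g = acod p \<and> acomp g p = azr (adom p) (acod g)"
    then have g': "aarr g" "adom g = acod p" by auto
    have "afun g y = \<zero>\<^bsub>acod g\<^esub>" if y: "y \<in> carrier (acod p)" for y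
    proof -
      have "y \<in> afun p ` carrier (adom p)" using y s by simp
      then obtain x where x: "y = afun p x" "x \<in> carrier (adom p)" by (rule imageE)
      show ?thesis using acomp_fun[OF p g'(1) g'(2)[symmetric] x(2)] g azr_fun[OF x(2)] x(1) by simp
    qed
    then show "g = azr (acod p) (acod g)" using zero_iff[OF g'(1)] g'(2) by simp
  qed
qed

lemma exact_imp_ses:
  assumes i: "aarr i" "adom i = N" "acod i = M" "inj_on (afun i) (carrier N)"
    and p: "aarr p" "adom p = M" "acod p = Z" "afun p ` carrier M = carrier Z"
    and e: "\<And>x. x \<in> carrier M \<Longrightarrow> afun p x = \<zero>\<^bsub>Z\<^esub> \<longleftrightarrow> x \<in> afun i ` carrier N"
  shows "C.ses N i M p Z"
proof -
  note i' = arrD(1-5)[OF i(1), unfolded i(2,3)] and p' = arrD(1-5)[OF p(1), unfolded p(2,3)]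
  have "\<exists>h\<in>C.hom (adom g) N. acomp i h = g" if g: "aarr g \<and> acod g = M \<and> acomp p g = azr (adom g) Z" for g
  proof -
    have g': "aarr g" "acod g = M" using g by auto
    note gd = arrD[OF g'(1), unfolded g'(2)]
    have "afun g ` carrier (adom g) \<subseteq> afun i ` carrier N"
    proof (rule image_subsetI)
      fix x assume x: "x \<in> carrier (adom g)"
      have "afun p (afun g x) = \<zero>\<^bsub>Z\<^esub>" using acomp_fun[OF g'(1) p(1) _ x] g'(2) p(2) g azr_fun[OF x] by simp
      then show "afun g x \<in> afun i ` carrier N" using e[of "afun g x"] afun_closed[OF g'(1) x] g'(2) by simp
    qed
    then obtain h where h: "h \<in> rmod_hom A (adom g) N" "\<forall>x\<in>carrier (adom g). afun i (h x) = afun g x"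
      using factor_through_inj[OF i'(4) gd(4) i'(5) i'(3) i(4) gd(3)] by blast
    have a: "aarr (mk (adom g) h N)" using mk_arr[OF gd(1) i'(1) h(1)] .
    have "acomp i (mk (adom g) h N) = g" using a i g' h(2)
      by (intro arr_eqI) (simp_all add: acomp_arr acomp_dom acomp_cod acomp_fun)
    then show ?thesis using a by (intro bexI[of _ "mk (adom g) h N"]) simp_all
  qed
  moreover have "\<exists>h\<in>C.hom Z (acod g). acomp h p = g" if g: "aarr g \<and> adom g = M \<and> acomp g i = azr N (acod g)" for g
  proof -
    have g': "aarr g" "adom g = M" using g by auto
    note gd = arrD[OF g'(1), unfolded g'(2)]
    have k: "afun g x = \<zero>\<^bsub>acod g\<^esub>" if x: "x \<in> carrier M" "afun p x = \<zero>\<^bsub>Z\<^esub>" for x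
    proof -
      have "x \<in> afun i ` carrier N" using e[OF x(1)] x(2) by simp
      then obtain y where y: "x = afun i y" "y \<in> carrier N" by (rule imageE)
      have yi: "y \<in> carrier (adom i)" using y(2) i(2) by simp
      show ?thesis using acomp_fun[OF i(1) g'(1) _ yi] g'(2) i(3) g azr_fun[OF y(2)] y(1) by simp
    qed
    obtain h where h: "h \<in> rmod_hom A Z (acod g)" "\<forall>x\<in>carrier M. h (afun p x) = afun g x"
      using factor_through_surj[OF p'(4,5) gd(5) p'(3) p(4) gd(3)] k by blast
    have a: "aarr (mk Z h (acod g))" using mk_arr[OF p'(2) gd(2) h(1)] .
    have "acomp (mk Z h (acod g)) p = g" using a p g' h(2) afun_closed[OF p(1)]
      by (intro arr_eqI) (simp_all add: acomp_arr acomp_dom acomp_cod acomp_fun)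
    then show ?thesis using a by (intro bexI[of _ "mk Z h (acod g)"]) simp_all
  qed
  moreover have "acomp p i = azr N Z"
  proof (rule arr_eqI)
    fix x assume x: "x \<in> carrier (adom (azr N Z))"
    then have "afun i x \<in> carrier M" using afun_closed[OF i(1)] i by simp
    then show "afun (acomp p i) x = afun (azr N Z) x" using x e[of "afun i x"] i p by (simp add: acomp_fun azr_fun)
  qed (use i p i' p' in \<open>simp_all add: acomp_arr acomp_dom acomp_cod azr_arr\<close>)
  moreover have "C.mono i" "C.epi p" using mono_iff[OF i(1)] epi_iff[OF p(1)] i p by simp_all
  ultimately show ?thesis unfolding C.ses_def using i p by simp
qed

lemma ses_imp_exact:
  assumes s: "C.ses N i M p Z"
  shows "inj_on (afun i) (carrier N)" "afun p ` carrier M = carrier Z"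
    "x \<in> carrier M \<Longrightarrow> afun p x = \<zero>\<^bsub>Z\<^esub> \<longleftrightarrow> x \<in> afun i ` carrier N"
proof -
  note s' = C.sesD[OF s]
  show "inj_on (afun i) (carrier N)" using s'(7) mono_iff[OF s'(1)] s' by simp
  show "afun p ` carrier M = carrier Z" using s'(8) epi_iff[OF s'(4)] s' by simp
  assume x: "x \<in> carrier M"
  show "afun p x = \<zero>\<^bsub>Z\<^esub> \<longleftrightarrow> x \<in> afun i ` carrier N"
  proof
    assume "x \<in> afun i ` carrier N"
    then obtain y where y: "x = afun i y" "y \<in> carrier N" by (rule imageE)
    have yi: "y \<in> carrier (adom i)" using y(2) s' by simp
    have "afun p x = afun (acomp p i) y" unfolding y(1) using acomp_fun[OF s'(1,4) _ yi] s'(3,5) by simp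
    then show "afun p x = \<zero>\<^bsub>Z\<^esub>" unfolding s'(9) azr_fun[OF y(2)] .
  next
    assume px: "afun p x = \<zero>\<^bsub>Z\<^esub>"
    let ?U = "{x \<in> carrier M. afun p x = \<zero>\<^bsub>Z\<^esub>}"
    have U: "submod A ?U M" using kernel_submod[OF arrD(4,5,3)[OF s'(4)]] s' by simp
    define k where "k = mk (M\<lparr>carrier := ?U\<rparr>) (\<lambda>x. x) M"
    have k: "aarr k" "acod k = M" "carrier (adom k) = ?U" "\<And>x. x \<in> ?U \<Longrightarrow> afun k x = x"
      unfolding k_def using inclusion_arr[OF s'(11) U] by simp_all
    have "acomp p k = azr (adom k) Z"
      using k s'(1-6) arrD(1)[OF k(1)] s'(12) by (intro arr_eqI) (simp_all add: acomp_arr acomp_dom acomp_cod acomp_fun azr_arr azr_fun)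
    then obtain h where h: "aarr h" "adom h = adom k" "acod h = N" "acomp i h = k" using C.ses_ker[OF s k(1,2)] by blast
    have xk: "x \<in> carrier (adom h)" using x px h(2) k(3) by simp
    have "afun i (afun h x) = x" using acomp_fun[OF h(1) s'(1) _ xk] h s' k(4)[of x] x px by simp
    then show "x \<in> afun i ` carrier N" using afun_closed[OF h(1) xk] h(3) by (metis image_eqI)
  qed
qed

lemma iso_iff:
  assumes f: "aarr f" shows "C.iso f \<longleftrightarrow> bij_betw (afun f) (carrier (adom f)) (carrier (acod f))"
proof
  assume "C.iso f"
  then show "bij_betw (afun f) (carrier (adom f)) (carrier (acod f))"
    using C.iso_mono C.iso_epi mono_iff[OF f] epi_iff[OF f] by (simp add: bij_betw_def)
next
  assume b: "bij_betw (afun f) (carrier (adom f)) (carrier (acod f))"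
  note f' = arrD[OF f]
  have bi: "inj_on (afun f) (carrier (adom f))" "afun f ` carrier (adom f) = carrier (acod f)" using b by (auto simp: bij_betw_def)
  have ii: "(\<lambda>x. x) \<in> rmod_hom A (acod f) (acod f)" by (rule rmod_homI) simp_all
  obtain h where h: "h \<in> rmod_hom A (acod f) (adom f)" "\<forall>x\<in>carrier (acod f). afun f (h x) = x"
    using factor_through_inj[OF f'(4,5,5,3) bi(1) ii] bi(2) by auto
  have a: "aarr (mk (acod f) h (adom f))" using mk_arr[OF f'(2,1) h(1)] .
  have "acomp f (mk (acod f) h (adom f)) = aid (acod f)"
    using a f h(2) f'(2) by (intro arr_eqI) (simp_all add: acomp_arr acomp_dom acomp_cod acomp_fun aid_arr aid_fun)
  moreover have "C.mono f" using mono_iff[OF f] bi by simp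
  ultimately show "C.iso f" using C.split_epi_mono_iso[of "mk (acod f) h (adom f)" "acod f" "adom f" f] a f by simp
qed

end


section \<open>Enough projectives and injectives, dimensions of spaces of homomorphisms\<close>

lemma rmod_iso_inverse:
  assumes M: "right_module A M" and N: "right_module A N" and f: "f \<in> rmod_iso A M N"
  obtains g where "g \<in> rmod_hom A N M" "\<And>y. y \<in> carrier N \<Longrightarrow> f (g y) = y" "\<And>x. x \<in> carrier M \<Longrightarrow> g (f x) = x"
proof -
  have f': "f \<in> rmod_hom A M N" "inj_on f (carrier M)" "f ` carrier M = carrier N"
    using f unfolding rmod_iso_def bij_betw_def by auto
  have ii: "(\<lambda>x. x) \<in> rmod_hom A N N" by (rule rmod_homI) simp_all
  obtain g where g: "g \<in> rmod_hom A N M" "\<forall>y\<in>carrier N. f (g y) = y"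
    using factor_through_inj[OF M N N f'(1,2) ii] f'(3) by auto
  have "g (f x) = x" if x: "x \<in> carrier M" for x
  proof -
    have fx: "f x \<in> carrier N" using rmod_homD(1)[OF f'(1) x] .
    show ?thesis using inj_onD[OF f'(2), of "g (f x)" x] g(2) fx rmod_homD(1)[OF g(1) fx] x by simp
  qed
  then show ?thesis using that g by blast
qed

context fd_alg
begin

text \<open>
  The image with the induced maps; as quotients and submodules stay in the type, all terms are objects.
\<close>

lemma factor_arr:
  assumes f: "aarr f"
  shows "\<exists>K k e J m C c. C.ses K k (adom f) e J \<and> C.ses J m (acod f) c C \<and> acomp m e = f"
proof -
  note f' = arrD[OF f]
  let ?U = "{x \<in> carrier (adom f). afun f x = \<zero>\<^bsub>acod f\<^esub>}" and ?I = "afun f ` carrier (adom f)"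
  have U: "submod A ?U (adom f)" by (rule kernel_submod[OF f'(4,5,3)])
  have I: "submod A ?I (acod f)" by (rule image_submod[OF f'(4,5,3)])
  define J where "J = (acod f)\<lparr>carrier := ?I\<rparr>"
  have J: "J \<in> fgmod A" unfolding J_def by (rule sub_fgmod[OF f'(2) I])
  define k where "k = mk ((adom f)\<lparr>carrier := ?U\<rparr>) (\<lambda>x. x) (adom f)"
  define m where "m = mk J (\<lambda>x. x) (acod f)"
  define c where "c = mk (acod f) (qrep (acod f) ?I) (qmod (acod f) ?I)"
  define e where "e = mk (adom f) (afun f) J"
  have k: "aarr k" unfolding k_def by (rule inclusion_arr[OF f'(1) U])
  have m: "aarr m" unfolding m_def J_def by (rule inclusion_arr[OF f'(2) I])
  have c: "aarr c" unfolding c_def by (rule projection_arr[OF f'(2) I])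
  have "afun f \<in> rmod_hom A (adom f) J" unfolding J_def by (rule rmod_homI) (simp_all add: rmod_homD[OF f'(3)])
  then have e: "aarr e" unfolding e_def by (rule mk_arr[OF f'(1) J])
  have Jc: "carrier J = ?I" "\<zero>\<^bsub>J\<^esub> = \<zero>\<^bsub>acod f\<^esub>" by (simp_all add: J_def)
  have 1: "C.ses ((adom f)\<lparr>carrier := ?U\<rparr>) k (adom f) e J"
  proof (rule exact_imp_ses[OF k _ _ _ e])
    show "inj_on (afun k) (carrier ((adom f)\<lparr>carrier := ?U\<rparr>))" by (rule inj_onI) (simp add: k_def)
    show "afun e ` carrier (adom f) = carrier J" unfolding Jc e_def by simp
    show "afun e x = \<zero>\<^bsub>J\<^esub> \<longleftrightarrow> x \<in> afun k ` carrier ((adom f)\<lparr>carrier := ?U\<rparr>)" if "x \<in> carrier (adom f)" for x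
    proof -
      have "afun k ` ?U = ?U" unfolding k_def by (auto simp: image_iff)
      then show ?thesis using that by (simp add: e_def Jc)
    qed
  qed (simp_all add: k_def e_def)
  have 2: "C.ses J m (acod f) c (qmod (acod f) ?I)"
  proof (rule exact_imp_ses[OF m _ _ _ c])
    show "inj_on (afun m) (carrier J)" by (rule inj_onI) (simp add: m_def)
    show "afun c ` carrier (acod f) = carrier (qmod (acod f) ?I)" unfolding c_def by simp
    show "afun c x = \<zero>\<^bsub>qmod (acod f) ?I\<^esub> \<longleftrightarrow> x \<in> afun m ` carrier J" if x: "x \<in> carrier (acod f)" for x
    proof -
      have "afun m ` carrier J = ?I" unfolding m_def Jc by (auto simp: image_iff Jc)
      then show ?thesis using x quotient_module(3)[OF f'(5) I x] by (simp add: c_def del: qmod_simps)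
    qed
  qed (simp_all add: m_def c_def)
  have "acomp m e = f" using m e f
    by (intro arr_eqI) (simp_all add: acomp_arr acomp_dom acomp_cod acomp_fun, simp_all add: m_def e_def Jc acomp_arr acomp_dom acomp_cod acomp_fun imageI)
  then show ?thesis using 1 2 by blast
qed

text \<open>
  The direct sum of the carriers has pairs as elements; \<open>fgmod_universal\<close> moves it back into the category.
\<close>

lemma biprod_arr:
  assumes X: "X \<in> fgmod A" and Y: "Y \<in> fgmod A" shows "\<exists>S i j p q. C.biprod S X Y i j p q"
proof -
  note X' = fgmodD[OF X] and Y' = fgmodD[OF Y]
  interpret X: right_module A X by (rule X')
  interpret Y: right_module A Y by (rule Y')
  note D = dsum_right_module[OF X'(1) Y'(1)]
  obtain S \<phi> where S: "S \<in> fgmod A" and \<phi>: "\<phi> \<in> rmod_iso A (dsum X Y) S"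
    using fgmod_universal[OF fd_algebra_axioms D dsum_fin_gen[OF X' Y']] by blast
  note S' = fgmodD[OF S]
  interpret S: right_module A S by (rule S')
  obtain \<psi> where \<psi>: "\<psi> \<in> rmod_hom A S (dsum X Y)" "\<And>y. y \<in> carrier S \<Longrightarrow> \<phi> (\<psi> y) = y"
    "\<And>x. x \<in> carrier (dsum X Y) \<Longrightarrow> \<psi> (\<phi> x) = x"
    using rmod_iso_inverse[OF D S'(1) \<phi>] by blast
  have \<phi>h: "\<phi> \<in> rmod_hom A (dsum X Y) S" using \<phi> by (simp add: rmod_iso_def)
  note \<phi>' = rmod_homD[OF \<phi>h] and \<psi>' = rmod_homD[OF \<psi>(1)]
  have fs: "fst (\<psi> s) \<in> carrier X" "snd (\<psi> s) \<in> carrier Y" if "s \<in> carrier S" for s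
    using \<psi>'(1)[OF that] by (auto simp: mem_Times_iff)
  have h1: "(\<lambda>x. (x, \<zero>\<^bsub>Y\<^esub>)) \<in> rmod_hom A X (dsum X Y)" by (rule rmod_homI) (simp_all add: Y.zero_ract)
  have h2: "(\<lambda>y. (\<zero>\<^bsub>X\<^esub>, y)) \<in> rmod_hom A Y (dsum X Y)" by (rule rmod_homI) (simp_all add: X.zero_ract)
  have g1: "fst \<in> rmod_hom A (dsum X Y) X" by (rule rmod_homI) auto
  have g2: "snd \<in> rmod_hom A (dsum X Y) Y" by (rule rmod_homI) auto
  define i where "i = mk X (\<lambda>x. \<phi> (x, \<zero>\<^bsub>Y\<^esub>)) S"
  define j where "j = mk Y (\<lambda>y. \<phi> (\<zero>\<^bsub>X\<^esub>, y)) S"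
  define p where "p = mk S (\<lambda>s. fst (\<psi> s)) X"
  define q where "q = mk S (\<lambda>s. snd (\<psi> s)) Y"
  have arr: "aarr i" "aarr j" "aarr p" "aarr q"
    unfolding i_def j_def p_def q_def
    using mk_arr[OF X S rmod_hom_comp[OF h1 \<phi>h]] mk_arr[OF Y S rmod_hom_comp[OF h2 \<phi>h]]
      mk_arr[OF S X rmod_hom_comp[OF \<psi>(1) g1]] mk_arr[OF S Y rmod_hom_comp[OF \<psi>(1) g2]] by simp_all
  have dc: "adom i = X" "acod i = S" "adom j = Y" "acod j = S" "adom p = S" "acod p = X" "adom q = S" "acod q = Y"
    unfolding i_def j_def p_def q_def by simp_all
  have fn: "\<And>x. x \<in> carrier X \<Longrightarrow> afun i x = \<phi> (x, \<zero>\<^bsub>Y\<^esub>)" "\<And>y. y \<in> carrier Y \<Longrightarrow> afun j y = \<phi> (\<zero>\<^bsub>X\<^esub>, y)"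
    "\<And>s. s \<in> carrier S \<Longrightarrow> afun p s = fst (\<psi> s)" "\<And>s. s \<in> carrier S \<Longrightarrow> afun q s = snd (\<psi> s)"
    unfolding i_def j_def p_def q_def by simp_all
  have cl: "\<And>x y. x \<in> carrier X \<Longrightarrow> y \<in> carrier Y \<Longrightarrow> \<phi> (x, y) \<in> carrier S" using \<phi>'(1) by simp
  note rules = acomp_arr acomp_dom acomp_cod acomp_fun aid_arr aid_fun azr_arr azr_fun aadd_arr aadd_dom aadd_cod aadd_fun
  have 1: "acomp p i = aid X" by (rule arr_eqI) (simp_all add: rules arr dc fn cl \<psi>(3) X)
  have 2: "acomp q j = aid Y" by (rule arr_eqI) (simp_all add: rules arr dc fn cl \<psi>(3) Y)
  have 3: "acomp q i = azr X Y" by (rule arr_eqI) (simp_all add: rules arr dc fn cl \<psi>(3) X Y)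
  have 4: "acomp p j = azr Y X" by (rule arr_eqI) (simp_all add: rules arr dc fn cl \<psi>(3) X Y)
  have sum: "\<phi> (fst (\<psi> s), \<zero>\<^bsub>Y\<^esub>) \<oplus>\<^bsub>S\<^esub> \<phi> (\<zero>\<^bsub>X\<^esub>, snd (\<psi> s)) = s" if s: "s \<in> carrier S" for s
    using \<phi>'(2)[of "(fst (\<psi> s), \<zero>\<^bsub>Y\<^esub>)" "(\<zero>\<^bsub>X\<^esub>, snd (\<psi> s))"] fs[OF s] \<psi>(2)[OF s] by simp
  have 5: "aadd (acomp i p) (acomp j q) = aid S"
    by (rule arr_eqI) (simp_all add: rules arr dc fn fs sum S)
  show ?thesis unfolding C.biprod_def using arr dc 1 2 3 4 5 by (intro exI[of _ S] exI[of _ i] exI[of _ j] exI[of _ p] exI[of _ q]) simp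
qed

text \<open>A copy of the regular module inside the category; it is a projective generator.\<close>

definition Gm :: "('a, nat \<Rightarrow> 'k) rmodule" where
  "Gm = (SOME N. N \<in> fgmod A \<and> rmod_iso A regm N \<noteq> {})"

lemma Gm_iso: "Gm \<in> fgmod A" "rmod_iso A regm Gm \<noteq> {}"
proof -
  have "\<exists>N. N \<in> fgmod A \<and> rmod_iso A regm N \<noteq> {}"
    using fgmod_universal[OF fd_algebra_axioms regm_right_module regm_fin_gen] by blast
  from someI_ex[OF this] show "Gm \<in> fgmod A" "rmod_iso A regm Gm \<noteq> {}" unfolding Gm_def by auto
qed

text \<open>
  Homomorphisms from the free module of rank one are choices of elements.
\<close>

lemma Gm_generator:
  obtains g where "g \<in> carrier Gm" "\<And>y. y \<in> carrier Gm \<Longrightarrow> \<exists>a\<in>carrier A. y = g \<triangleleft>\<^bsub>Gm\<^esub> a"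
    "\<And>M :: ('a, nat \<Rightarrow> 'k) rmodule. \<And>m. right_module A M \<Longrightarrow> m \<in> carrier M \<Longrightarrow> \<exists>f\<in>rmod_hom A Gm M. f g = m"
proof -
  obtain \<phi> where \<phi>: "\<phi> \<in> rmod_iso A regm Gm" using Gm_iso(2) by blast
  have \<phi>h: "\<phi> \<in> rmod_hom A regm Gm" using \<phi> by (simp add: rmod_iso_def)
  obtain \<psi> where \<psi>: "\<psi> \<in> rmod_hom A Gm regm" "\<And>y. y \<in> carrier Gm \<Longrightarrow> \<phi> (\<psi> y) = y"
    "\<And>x. x \<in> carrier regm \<Longrightarrow> \<psi> (\<phi> x) = x"
    using rmod_iso_inverse[OF regm_right_module fgmodD(1)[OF Gm_iso(1)] \<phi>] by blast
  note \<phi>' = rmod_homD[OF \<phi>h, simplified] and \<psi>' = rmod_homD[OF \<psi>(1), simplified]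
  show ?thesis
  proof (rule that[of "\<phi> \<one>\<^bsub>A\<^esub>"])
    show "\<phi> \<one>\<^bsub>A\<^esub> \<in> carrier Gm" using \<phi>'(1) by simp
    show "\<exists>a\<in>carrier A. y = \<phi> \<one>\<^bsub>A\<^esub> \<triangleleft>\<^bsub>Gm\<^esub> a" if y: "y \<in> carrier Gm" for y
      using \<phi>'(3)[of "\<one>\<^bsub>A\<^esub>" "\<psi> y"] \<psi>'(1)[OF y] \<psi>(2)[OF y] by (intro bexI[of _ "\<psi> y"]) simp_all
    fix M :: "('a, nat \<Rightarrow> 'k) rmodule" and m assume M: "right_module A M" and m: "m \<in> carrier M"
    interpret M: right_module A M by (rule M)
    have "(\<lambda>a. m \<triangleleft>\<^bsub>M\<^esub> a) \<in> rmod_hom A regm M"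
      by (rule rmod_homI) (simp_all add: m M.ract_closed M.add_ract M.ract_mult)
    then have "(\<lambda>y. m \<triangleleft>\<^bsub>M\<^esub> \<psi> y) \<in> rmod_hom A Gm M" using rmod_hom_comp[OF \<psi>(1)] by blast
    moreover have "m \<triangleleft>\<^bsub>M\<^esub> \<psi> (\<phi> \<one>\<^bsub>A\<^esub>) = m" using \<psi>(3)[of "\<one>\<^bsub>A\<^esub>"] m M.ract_one by simp
    ultimately show "\<exists>f\<in>rmod_hom A Gm M. f (\<phi> \<one>\<^bsub>A\<^esub>) = m" by (intro bexI[of _ "\<lambda>y. m \<triangleleft>\<^bsub>M\<^esub> \<psi> y"]) simp_all
  qed
qed

lemma projective_iff: "C.projective P \<longleftrightarrow> projective A P"
proof
  assume P: "C.projective P"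
  have PO: "P \<in> fgmod A" using P by (simp add: C.projective_def)
  show "projective A P" unfolding projective_def
  proof (intro conjI ballI impI PO)
    fix M N g f assume MN: "M \<in> fgmod A" "N \<in> fgmod A" and g: "g \<in> rmod_hom A M N" and f: "f \<in> rmod_hom A P N"
      and s: "g ` carrier M = carrier N"
    have ga: "aarr (mk M g N)" and fa: "aarr (mk P f N)" using mk_arr MN PO g f by auto
    have "C.epi (mk M g N)" using epi_iff[OF ga] s by simp
    then obtain h where h: "aarr h" "adom h = P" "acod h = M" "acomp (mk M g N) h = mk P f N"
      using C.projectiveD[OF P _ fa, of "mk M g N"] by auto
    have "g (afun h x) = f x" if x: "x \<in> carrier P" for x
      using acomp_fun[OF h(1) ga, of x] h x afun_closed[OF h(1), of x] by simp
    then show "\<exists>h\<in>rmod_hom A P M. \<forall>x\<in>carrier P. g (h x) = f x" using arrD(3)[OF h(1)] h(2,3) by auto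
  qed
next
  assume P: "projective A P"
  have PO: "P \<in> fgmod A" using P by (simp add: projective_def)
  show "C.projective P" unfolding C.projective_def
  proof (intro conjI allI impI PO)
    fix g f assume gf: "C.epi g \<and> aarr f \<and> adom f = P \<and> acod f = acod g"
    then have g: "aarr g" and f: "aarr f" "adom f = P" "acod f = acod g" using C.epi_arr by auto
    note g' = arrD[OF g] and f' = arrD[OF f(1), unfolded f(2,3)]
    have "afun g ` carrier (adom g) = carrier (acod g)" using gf epi_iff[OF g] by simp
    then obtain h where h: "h \<in> rmod_hom A P (adom g)" "\<forall>x\<in>carrier P. afun g (h x) = afun f x"
      using P g' f'(3) unfolding projective_def by blast
    have a: "aarr (mk P h (adom g))" using mk_arr[OF PO g'(1) h(1)] .
    have "acomp g (mk P h (adom g)) = f" using a g f h(2)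
      by (intro arr_eqI) (simp_all add: acomp_arr acomp_dom acomp_cod acomp_fun)
    then show "\<exists>h\<in>C.hom P (adom g). acomp g h = f" using a by (intro bexI[of _ "mk P h (adom g)"]) simp_all
  qed
qed

lemma injective_iff: "C.injective I \<longleftrightarrow> injective A I"
proof
  assume I: "C.injective I"
  have IO: "I \<in> fgmod A" using I by (simp add: C.injective_def)
  show "injective A I" unfolding injective_def
  proof (intro conjI ballI impI IO)
    fix M N g f assume MN: "M \<in> fgmod A" "N \<in> fgmod A" and g: "g \<in> rmod_hom A M N" and f: "f \<in> rmod_hom A M I"
      and s: "inj_on g (carrier M)"
    have ga: "aarr (mk M g N)" and fa: "aarr (mk M f I)" using mk_arr MN IO g f by auto
    have "inj_on (afun (mk M g N)) (carrier M)" using s by (auto simp: inj_on_def)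
    then have "C.mono (mk M g N)" using mono_iff[OF ga] by simp
    then obtain h where h: "aarr h" "adom h = N" "acod h = I" "acomp h (mk M g N) = mk M f I"
      using C.injectiveD[OF I _ fa, of "mk M g N"] by auto
    have "afun h (g x) = f x" if x: "x \<in> carrier M" for x
      using acomp_fun[OF ga h(1), of x] h x by simp
    then show "\<exists>h\<in>rmod_hom A N I. \<forall>x\<in>carrier M. h (g x) = f x" using arrD(3)[OF h(1)] h(2,3) by auto
  qed
next
  assume I: "injective A I"
  have IO: "I \<in> fgmod A" using I by (simp add: injective_def)
  show "C.injective I" unfolding C.injective_def
  proof (intro conjI allI impI IO)
    fix g f assume gf: "C.mono g \<and> aarr f \<and> acod f = I \<and> adom f = adom g"
    then have g: "aarr g" and f: "aarr f" "acod f = I" "adom f = adom g" using C.mono_arr by auto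
    note g' = arrD[OF g] and f' = arrD[OF f(1), unfolded f(2,3)]
    have "inj_on (afun g) (carrier (adom g))" using gf mono_iff[OF g] by simp
    then obtain h where h: "h \<in> rmod_hom A (acod g) I" "\<forall>x\<in>carrier (adom g). h (afun g x) = afun f x"
      using I g' f'(3) unfolding injective_def by blast
    have a: "aarr (mk (acod g) h I)" using mk_arr[OF g'(2) IO h(1)] .
    have "acomp (mk (acod g) h I) g = f" using a g f h(2) afun_closed[OF g]
      by (intro arr_eqI) (simp_all add: acomp_arr acomp_dom acomp_cod acomp_fun)
    then show "\<exists>h\<in>C.hom (acod g) I. acomp h g = f" using a by (intro bexI[of _ "mk (acod g) h I"]) simp_all
  qed
qed

lemma Gm_projective: "C.projective Gm"
  unfolding projective_iff projective_def
proof (intro conjI ballI impI Gm_iso(1))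
  fix M N :: "('a, nat \<Rightarrow> 'k) rmodule" and g f
  assume MN: "M \<in> fgmod A" "N \<in> fgmod A" and g: "g \<in> rmod_hom A M N" and f: "f \<in> rmod_hom A Gm N"
    and s: "g ` carrier M = carrier N"
  obtain u where u: "u \<in> carrier Gm" "\<And>y. y \<in> carrier Gm \<Longrightarrow> \<exists>a\<in>carrier A. y = u \<triangleleft>\<^bsub>Gm\<^esub> a"
    "\<And>M :: ('a, nat \<Rightarrow> 'k) rmodule. \<And>m. right_module A M \<Longrightarrow> m \<in> carrier M \<Longrightarrow> \<exists>f\<in>rmod_hom A Gm M. f u = m"
    by (rule Gm_generator) blast
  have "f u \<in> g ` carrier M" unfolding s using rmod_homD(1)[OF f u(1)] .
  then obtain m where m: "f u = g m" "m \<in> carrier M" by (rule imageE)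
  obtain h where h: "h \<in> rmod_hom A Gm M" "h u = m" using u(3)[OF fgmodD(1)[OF MN(1)] m(2)] by blast
  have "g (h y) = f y" if y: "y \<in> carrier Gm" for y
  proof -
    obtain a where a: "a \<in> carrier A" "y = u \<triangleleft>\<^bsub>Gm\<^esub> a" using u(2)[OF y] by blast
    show ?thesis unfolding a(2) using rmod_homD(3)[OF h(1) u(1) a(1)] rmod_homD(3)[OF g m(2) a(1)]
      rmod_homD(3)[OF f u(1) a(1)] h(2) m(1) by simp
  qed
  then show "\<exists>h\<in>rmod_hom A Gm M. \<forall>x\<in>carrier Gm. g (h x) = f x" using h(1) by blast
qed

lemma nonzero_iff: "M \<in> fgmod A \<Longrightarrow> C.nonzero M \<longleftrightarrow> (\<exists>x\<in>carrier M. x \<noteq> \<zero>\<^bsub>M\<^esub>)"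
  unfolding C.nonzero_def using zero_iff[OF aid_arr, of M] by (auto simp: aid_fun)

lemma Gm_generates: assumes "C.nonzero X" shows "\<exists>f\<in>C.hom Gm X. f \<noteq> azr Gm X"
proof -
  have X: "X \<in> fgmod A" using assms by (simp add: C.nonzero_def)
  obtain x where x: "x \<in> carrier X" "x \<noteq> \<zero>\<^bsub>X\<^esub>" using assms nonzero_iff[OF X] by blast
  obtain u f where f: "u \<in> carrier Gm" "f \<in> rmod_hom A Gm X" "f u = x"
    using fgmodD(1)[OF X] x(1) by (metis Gm_generator)
  have a: "aarr (mk Gm f X)" using mk_arr[OF Gm_iso(1) X f(2)] .
  have "mk Gm f X \<noteq> azr Gm X"
  proof
    assume "mk Gm f X = azr Gm X"
    then have "afun (mk Gm f X) u = afun (azr Gm X) u" by simp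
    then show False using f x azr_fun[OF f(1)] by simp
  qed
  then show ?thesis using a by (intro bexI[of _ "mk Gm f X"]) simp_all
qed

text \<open>
  One copy of the regular module for each generator, added by induction on the number of generators.
\<close>

lemma enough_projectives: assumes X: "X \<in> fgmod A" shows "\<exists>P p. C.projective P \<and> p \<in> C.hom P X \<and> C.epi p"
proof -
  note X' = fgmodD[OF X]
  interpret X: right_module A X by (rule X')
  obtain n :: nat and x where x: "x \<in> {..<n} \<rightarrow> carrier X"
    "\<forall>m\<in>carrier X. \<exists>a\<in>{..<n} \<rightarrow> carrier A. m = (\<Oplus>\<^bsub>X\<^esub>i\<in>{..<n}. x i \<triangleleft>\<^bsub>X\<^esub> a i)"
    using X'(2) unfolding fin_gen_def by blast
  have xc: "x i \<in> carrier X" if "i < n" for i using x(1) that by auto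
  have "\<exists>P f. C.projective P \<and> aarr f \<and> adom f = P \<and> acod f = X \<and> (\<forall>i<j. x i \<in> afun f ` carrier P)" if "j \<le> n" for j
    using that
  proof (induction j)
    case 0
    then show ?case using Gm_projective azr_arr[OF Gm_iso(1) X] by (intro exI[of _ Gm] exI[of _ "azr Gm X"]) simp
  next
    case (Suc j)
    then obtain P f where f: "C.projective P" "aarr f" "adom f = P" "acod f = X" "\<forall>i<j. x i \<in> afun f ` carrier P" by auto
    have PO: "P \<in> fgmod A" using f(1) by (simp add: C.projective_def)
    obtain u g where g: "u \<in> carrier Gm" "g \<in> rmod_hom A Gm X" "g u = x j"
      using X'(1) xc[of j] Suc.prems by (metis Gm_generator Suc_le_lessD)
    have ga: "aarr (mk Gm g X)" using mk_arr[OF Gm_iso(1) X g(2)] .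
    obtain S i1 i2 p1 p2 where b0: "C.biprod S P Gm i1 i2 p1 p2" using biprod_arr[OF PO Gm_iso(1)] by blast
    note b = C.biprodD[OF b0]
    have S: "C.projective S" using C.biprod_projective[OF b0 f(1) Gm_projective] .
    define F where "F = aadd (acomp f p1) (acomp (mk Gm g X) p2)"
    have F: "aarr F" "adom F = S" "acod F = X" unfolding F_def using f ga b by simp_all
    have F1: "acomp F i1 = f" unfolding F_def
      using f(2-4) ga b(1-16,18-20) X by (simp add: C.distr C.comp_assoc C.idn_right C.add_zr)
    have F2: "acomp F i2 = mk Gm g X" unfolding F_def
      using f(2-4) ga b(1-16,18-20) X by (simp add: C.distr C.comp_assoc C.idn_right C.zr_add)
    have im: "afun (acomp F i) y \<in> afun F ` carrier S" if "aarr i" "acod i = S" "y \<in> carrier (adom i)" for i y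
      using acomp_fun[OF that(1) F(1) _ that(3)] afun_closed[OF that(1,3)] that(2) F(2) by simp
    have "x i \<in> afun F ` carrier S" if "i < Suc j" for i
    proof (cases "i = j")
      case True
      then show ?thesis using im[of i2 u] F2 b g by simp
    next
      case False
      then have "x i \<in> afun f ` carrier P" using f(5) that by simp
      then obtain y where "x i = afun f y" "y \<in> carrier P" by (rule imageE)
      then show ?thesis using im[of i1 y] F1 b by simp
    qed
    then show ?case using S F by blast
  qed
  from this[of n] obtain P f where f: "C.projective P" "aarr f" "adom f = P" "acod f = X" "\<forall>i<n. x i \<in> afun f ` carrier P" by auto
  have sub: "submod A (afun f ` carrier P) X" using image_submod[OF arrD(4,5,3)[OF f(2)]] f by simp
  note sub' = submodD[OF X'(1) sub]
  have "m \<in> afun f ` carrier P" if m: "m \<in> carrier X" for m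
  proof -
    obtain a where a: "a \<in> {..<n} \<rightarrow> carrier A" "m = (\<Oplus>\<^bsub>X\<^esub>i\<in>{..<n}. x i \<triangleleft>\<^bsub>X\<^esub> a i)" using x(2) m by blast
    have "x i \<triangleleft>\<^bsub>X\<^esub> a i \<in> afun f ` carrier P" if "i < n" for i using f(5) a(1) that by (intro sub'(4)) auto
    then show ?thesis unfolding a(2) using sub' by (intro X.M.finsum_lessThan_mem) auto
  qed
  then have "afun f ` carrier P = carrier X" using sub'(1) by auto
  then have "C.epi f" using epi_iff[OF f(2)] f by simp
  then show ?thesis using f by (intro exI[of _ P] exI[of _ f]) simp
qed

text \<open>
  \<open>X\<close> embeds into its coinduced module by sending \<open>x\<close> to \<open>a \<mapsto> x a\<close>.  To extend a homomorphism into the coinduced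
  module, evaluate it at \<open>1\<close>, extend the resulting linear map, and coinduce again.
\<close>

lemma enough_injectives: assumes X: "X \<in> fgmod A" shows "\<exists>Q i. C.injective Q \<and> i \<in> C.hom X Q \<and> C.mono i"
proof -
  note X' = fgmodD[OF X]
  interpret X: right_module A X by (rule X')
  note C = coind_right_module[OF X'(1)] and D = coind_carrierD
  interpret Co: right_module A "coind X" by (rule C)
  obtain Q \<psi> where Q: "Q \<in> fgmod A" and \<psi>: "\<psi> \<in> rmod_iso A (coind X) Q"
    using fgmod_universal[OF fd_algebra_axioms C coind_fin_gen[OF X']] by blast
  obtain h where h: "h \<in> rmod_hom A Q (coind X)" "\<And>y. y \<in> carrier Q \<Longrightarrow> \<psi> (h y) = y"
    "\<And>x. x \<in> carrier (coind X) \<Longrightarrow> h (\<psi> x) = x"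
    using rmod_iso_inverse[OF C fgmodD(1)[OF Q] \<psi>] by blast
  have \<psi>h: "\<psi> \<in> rmod_hom A (coind X) Q" "inj_on \<psi> (carrier (coind X))" using \<psi> by (auto simp: rmod_iso_def bij_betw_def)
  have scA: "(x \<triangleleft>\<^bsub>M\<^esub> (c \<odot>\<^bsub>A\<^esub> a)) = (x \<triangleleft>\<^bsub>M\<^esub> a) \<triangleleft>\<^bsub>M\<^esub> sc c"
    if "right_module A M" "x \<in> carrier M" "c \<in> carrier K" "a \<in> carrier A" for M :: "('a, nat \<Rightarrow> 'k) rmodule" and x c a
    using right_module.ract_mult[OF that(1,2,4) sc_closed[OF that(3)]] sc_central(1)[OF that(3,4)] by simp
  have ex: "(\<lambda>a\<in>carrier A. F (m \<triangleleft>\<^bsub>M\<^esub> a)) \<in> carrier (coind X)"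
    if M: "right_module A M" and F: "linear K (kmod M) (kmod X) F" and m: "m \<in> carrier M" for M :: "('a, nat \<Rightarrow> 'k) rmodule" and F m
  proof -
    interpret M: right_module A M by (rule M)
    note F' = linearD[OF F, simplified]
    show ?thesis
      by (rule coind_carrierI) (simp_all add: m M.ract_closed F' M.add_ract scA[OF M m])
  qed
  have exh: "(\<lambda>m. \<lambda>a\<in>carrier A. F (m \<triangleleft>\<^bsub>M\<^esub> a)) \<in> rmod_hom A M (coind X)"
    if M: "right_module A M" and F: "linear K (kmod M) (kmod X) F" for M :: "('a, nat \<Rightarrow> 'k) rmodule" and F
  proof -
    interpret M: right_module A M by (rule M)
    note F' = linearD[OF F, simplified] and e = ex[OF M F]
    show ?thesis
    proof (rule rmod_homI[OF e])
      show "(\<lambda>a\<in>carrier A. F ((x \<oplus>\<^bsub>M\<^esub> y) \<triangleleft>\<^bsub>M\<^esub> a)) = (\<lambda>a\<in>carrier A. F (x \<triangleleft>\<^bsub>M\<^esub> a)) \<oplus>\<^bsub>coind X\<^esub> (\<lambda>a\<in>carrier A. F (y \<triangleleft>\<^bsub>M\<^esub> a))"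
        if xy: "x \<in> carrier M" "y \<in> carrier M" for x y
        using xy by (intro coind_eqI[OF e[OF M.M.a_closed[OF xy]] Co.M.a_closed[OF e[OF xy(1)] e[OF xy(2)]]])
          (simp add: coind_simps M.ract_closed F' M.ract_add)
      show "(\<lambda>a\<in>carrier A. F ((x \<triangleleft>\<^bsub>M\<^esub> b) \<triangleleft>\<^bsub>M\<^esub> a)) = (\<lambda>a\<in>carrier A. F (x \<triangleleft>\<^bsub>M\<^esub> a)) \<triangleleft>\<^bsub>coind X\<^esub> b"
        if xb: "x \<in> carrier M" "b \<in> carrier A" for x b
        using xb by (intro coind_eqI[OF e[OF M.ract_closed[OF xb]] Co.ract_closed[OF e[OF xb(1)] xb(2)]])
          (simp add: coind_simps M.ract_mult)
    qed
  qed
  have idl: "linear K (kmod X) (kmod X) (\<lambda>x. x)" unfolding linear_def by simp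
  define i where "i = mk X (\<lambda>m. \<psi> (\<lambda>a\<in>carrier A. m \<triangleleft>\<^bsub>X\<^esub> a)) Q"
  have i: "aarr i" unfolding i_def using mk_arr[OF X Q rmod_hom_comp[OF exh[OF X'(1) idl] \<psi>h(1)]] by simp
  have "C.mono i" unfolding mono_iff[OF i]
  proof (rule inj_onI)
    fix x y assume "x \<in> carrier (adom i)" "y \<in> carrier (adom i)" and eq: "afun i x = afun i y"
    then have xy: "x \<in> carrier X" "y \<in> carrier X" by (simp_all add: i_def)
    have "\<psi> (\<lambda>a\<in>carrier A. x \<triangleleft>\<^bsub>X\<^esub> a) = \<psi> (\<lambda>a\<in>carrier A. y \<triangleleft>\<^bsub>X\<^esub> a)" using eq xy by (simp add: i_def)
    then have "(\<lambda>a\<in>carrier A. x \<triangleleft>\<^bsub>X\<^esub> a) = (\<lambda>a\<in>carrier A. y \<triangleleft>\<^bsub>X\<^esub> a)"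
      using inj_onD[OF \<psi>h(2)] ex[OF X'(1) idl xy(1)] ex[OF X'(1) idl xy(2)] by blast
    from fun_cong[OF this, of "\<one>\<^bsub>A\<^esub>"] show "x = y" using xy X.ract_one by simp
  qed
  moreover have "C.injective Q" unfolding injective_iff injective_def
  proof (intro conjI ballI impI Q)
    fix N M g f assume NM: "N \<in> fgmod A" "M \<in> fgmod A" and g: "g \<in> rmod_hom A N M" and f: "f \<in> rmod_hom A N Q"
      and inj: "inj_on g (carrier N)"
    note N' = fgmodD[OF NM(1)] and M' = fgmodD[OF NM(2)]
    interpret N: right_module A N by (rule N')
    interpret M: right_module A M by (rule M')
    note g' = rmod_homD[OF g] and f' = rmod_homD[OF f] and h' = rmod_homD[OF h(1)]
    have hf: "h (f n) \<in> carrier (coind X)" if "n \<in> carrier N" for n using h'(1)[OF f'(1)[OF that]] .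
    define f0 where "f0 n = h (f n) \<one>\<^bsub>A\<^esub>" for n
    define \<phi> where "\<phi> y = f0 (inv_into (carrier N) g y)" for y
    have \<phi>g: "\<phi> (g n) = f0 n" if "n \<in> carrier N" for n unfolding \<phi>_def using inv_into_f_f[OF inj that] by simp
    have f0act: "f0 (n \<triangleleft>\<^bsub>N\<^esub> a) = h (f n) a" if "n \<in> carrier N" "a \<in> carrier A" for n a
      unfolding f0_def using that by (simp add: f'(3) h'(3) f'(1) coind_simps)
    have f0c: "f0 n \<in> carrier X" if "n \<in> carrier N" for n unfolding f0_def using D(2)[OF hf[OF that]] by simp
    have f0add: "f0 (n \<oplus>\<^bsub>N\<^esub> n') = f0 n \<oplus>\<^bsub>X\<^esub> f0 n'" if "n \<in> carrier N" "n' \<in> carrier N" for n n'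
      unfolding f0_def using that by (simp add: f'(2) h'(2) f'(1) coind_simps)
    have f0sc: "f0 (n \<triangleleft>\<^bsub>N\<^esub> sc c) = f0 n \<triangleleft>\<^bsub>X\<^esub> sc c" if "n \<in> carrier N" "c \<in> carrier K" for n c
      using f0act[OF that(1) sc_closed[OF that(2)]] D(4)[OF hf[OF that(1)] that(2) A.one_closed] unfolding f0_def by simp
    have U: "subspace K (kmod M) (g ` carrier N)" using submod_subspace[OF M'(1) image_submod[OF N'(1) M'(1) g]] .
    have "linear K ((kmod M)\<lparr>carrier := g ` carrier N\<rparr>) (kmod X) \<phi>" unfolding linear_def
    proof (intro conjI ballI funcsetI)
      fix x assume "x \<in> carrier ((kmod M)\<lparr>carrier := g ` carrier N\<rparr>)"
      then have "x \<in> g ` carrier N" by simp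
      then obtain n where n: "x = g n" "n \<in> carrier N" by (rule imageE)
      show "\<phi> x \<in> carrier (kmod X)" unfolding n(1) \<phi>g[OF n(2)] using f0c[OF n(2)] by simp
      show "\<phi> (c \<odot>\<^bsub>(kmod M)\<lparr>carrier := g ` carrier N\<rparr>\<^esub> x) = c \<odot>\<^bsub>kmod X\<^esub> \<phi> x" if c: "c \<in> carrier K" for c
        using \<phi>g[OF N.ract_closed[OF n(2) sc_closed[OF c]]] g'(3)[OF n(2) sc_closed[OF c]] f0sc[OF n(2) c] \<phi>g[OF n(2)] n(1) by simp
      fix y assume "y \<in> carrier ((kmod M)\<lparr>carrier := g ` carrier N\<rparr>)"
      then have "y \<in> g ` carrier N" by simp
      then obtain n' where n': "y = g n'" "n' \<in> carrier N" by (rule imageE)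
      show "\<phi> (x \<oplus>\<^bsub>(kmod M)\<lparr>carrier := g ` carrier N\<rparr>\<^esub> y) = \<phi> x \<oplus>\<^bsub>kmod X\<^esub> \<phi> y"
        using \<phi>g[OF N.M.a_closed[OF n(2) n'(2)]] g'(2)[OF n(2) n'(2)] f0add[OF n(2) n'(2)] \<phi>g[OF n(2)] \<phi>g[OF n'(2)] n(1) n'(1) by simp
    qed
    then obtain F where F: "linear K (kmod M) (kmod X) F" "\<forall>x\<in>g ` carrier N. F x = \<phi> x"
      using linear_extension[OF K.field_axioms kmod_module[OF M'(1)] kmod_module[OF X'(1)] fin_gen_finite_vlen[OF M'] U] by blast
    have "(\<lambda>a\<in>carrier A. F (g n \<triangleleft>\<^bsub>M\<^esub> a)) = h (f n)" if n: "n \<in> carrier N" for n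
    proof (rule coind_eqI[OF ex[OF M'(1) F(1) g'(1)[OF n]] hf[OF n]])
      fix a assume a: "a \<in> carrier A"
      have "F (g n \<triangleleft>\<^bsub>M\<^esub> a) = \<phi> (g (n \<triangleleft>\<^bsub>N\<^esub> a))" using F(2) g'(3)[OF n a] N.ract_closed[OF n a] by (metis image_eqI)
      then show "(\<lambda>a\<in>carrier A. F (g n \<triangleleft>\<^bsub>M\<^esub> a)) a = h (f n) a" using \<phi>g[OF N.ract_closed[OF n a]] f0act[OF n a] a by simp
    qed
    then have "\<psi> (\<lambda>a\<in>carrier A. F (g n \<triangleleft>\<^bsub>M\<^esub> a)) = f n" if "n \<in> carrier N" for n using h(2)[OF f'(1)[OF that]] that by simp
    then show "\<exists>k\<in>rmod_hom A M Q. \<forall>x\<in>carrier N. k (g x) = f x"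
      by (intro bexI[OF _ rmod_hom_comp[OF exh[OF M'(1) F(1)] \<psi>h(1)]]) simp
  qed
  ultimately show ?thesis using i by (intro exI[of _ Q] exI[of _ i]) (simp add: i_def)
qed

definition hom_space :: "('a, nat \<Rightarrow> 'k) rmodule \<Rightarrow> ('a, nat \<Rightarrow> 'k) rmodule \<Rightarrow> ('k, ('k, 'a) arrow) module" where
  "hom_space X Y = \<lparr>carrier = C.hom X Y, mult = undefined, one = undefined, zero = azr X Y, add = aadd,
     smult = (\<lambda>c a. mk (adom a) (\<lambda>x. afun a x \<triangleleft>\<^bsub>acod a\<^esub> sc c) (acod a))\<rparr>"

lemma hom_space_simps [simp]: "carrier (hom_space X Y) = C.hom X Y" "\<zero>\<^bsub>hom_space X Y\<^esub> = azr X Y" "a \<oplus>\<^bsub>hom_space X Y\<^esub> b = aadd a b"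
  by (simp_all add: hom_space_def)

lemma hom_space_smult:
  assumes c: "c \<in> carrier K" and a: "aarr a"
  shows "aarr (c \<odot>\<^bsub>hom_space X Y\<^esub> a)" "adom (c \<odot>\<^bsub>hom_space X Y\<^esub> a) = adom a" "acod (c \<odot>\<^bsub>hom_space X Y\<^esub> a) = acod a"
    "x \<in> carrier (adom a) \<Longrightarrow> afun (c \<odot>\<^bsub>hom_space X Y\<^esub> a) x = afun a x \<triangleleft>\<^bsub>acod a\<^esub> sc c"
proof -
  note a' = arrD[OF a] and ah = rmod_homD[OF arrD(3)[OF a]]
  interpret N: right_module A "acod a" by (rule a')
  have "(\<lambda>x. afun a x \<triangleleft>\<^bsub>acod a\<^esub> sc c) \<in> rmod_hom A (adom a) (acod a)"
  proof (rule rmod_homI)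
    show "afun a (x \<triangleleft>\<^bsub>adom a\<^esub> b) \<triangleleft>\<^bsub>acod a\<^esub> sc c = afun a x \<triangleleft>\<^bsub>acod a\<^esub> sc c \<triangleleft>\<^bsub>acod a\<^esub> b"
      if xb: "x \<in> carrier (adom a)" "b \<in> carrier A" for x b
      using N.ract_mult[OF ah(1)[OF xb(1)] xb(2) sc_closed[OF c]] N.ract_mult[OF ah(1)[OF xb(1)] sc_closed[OF c] xb(2)]
        ah(3)[OF xb] sc_central[OF c xb(2)] by simp
  qed (simp_all add: ah c N.ract_closed N.ract_add)
  then show "aarr (c \<odot>\<^bsub>hom_space X Y\<^esub> a)" unfolding hom_space_def using mk_arr a' by simp
qed (simp_all add: hom_space_def)

lemma hom_space_module:
  assumes X: "X \<in> fgmod A" and Y: "Y \<in> fgmod A" shows "Module.module K (hom_space X Y)"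
proof -
  interpret Y: right_module A Y by (rule fgmodD(1)[OF Y])
  have "abelian_group (hom_space X Y)"
  proof (rule abelian_groupI)
    fix a assume "a \<in> carrier (hom_space X Y)"
    then show "\<exists>b\<in>carrier (hom_space X Y). b \<oplus>\<^bsub>hom_space X Y\<^esub> a = \<zero>\<^bsub>hom_space X Y\<^esub>"
      by (intro bexI[of _ "aneg a"]) (auto simp: C.neg_add)
  qed (auto simp: X Y C.add_assoc C.zr_add intro: aadd_comm)
  then show ?thesis
  proof (rule Module.moduleI[OF K.is_cring])
    note rules = hom_space_smult aadd_arr aadd_dom aadd_cod aadd_fun
    fix a b x assume ab: "a \<in> carrier K" "b \<in> carrier K" and "x \<in> carrier (hom_space X Y)"
    then have x: "aarr x" "adom x = X" "acod x = Y" by auto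
    have xf: "afun x u \<in> carrier Y" if "u \<in> carrier X" for u using afun_closed[OF x(1), of u] x that by simp
    show "a \<odot>\<^bsub>hom_space X Y\<^esub> x \<in> carrier (hom_space X Y)" using hom_space_smult(1-3)[OF ab(1) x(1)] x by simp
    have abK: "a \<oplus>\<^bsub>K\<^esub> b \<in> carrier K" "a \<otimes>\<^bsub>K\<^esub> b \<in> carrier K" using ab by auto
    show "(a \<oplus>\<^bsub>K\<^esub> b) \<odot>\<^bsub>hom_space X Y\<^esub> x = a \<odot>\<^bsub>hom_space X Y\<^esub> x \<oplus>\<^bsub>hom_space X Y\<^esub> b \<odot>\<^bsub>hom_space X Y\<^esub> x"
      unfolding hom_space_simps using ab abK x
      by (intro arr_eqI) (simp_all add: rules xf smult_l_distr Y.add_ract)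
    have "sc b \<otimes>\<^bsub>A\<^esub> sc a = (a \<otimes>\<^bsub>K\<^esub> b) \<odot>\<^bsub>A\<^esub> \<one>\<^bsub>A\<^esub>" using ab by (simp add: sc_central(1) smult_assoc1)
    then have "u \<triangleleft>\<^bsub>Y\<^esub> ((a \<otimes>\<^bsub>K\<^esub> b) \<odot>\<^bsub>A\<^esub> \<one>\<^bsub>A\<^esub>) = u \<triangleleft>\<^bsub>Y\<^esub> sc b \<triangleleft>\<^bsub>Y\<^esub> sc a" if "u \<in> carrier Y" for u
      using Y.ract_mult[OF that, of "sc b" "sc a"] ab by simp
    then show "(a \<otimes>\<^bsub>K\<^esub> b) \<odot>\<^bsub>hom_space X Y\<^esub> x = a \<odot>\<^bsub>hom_space X Y\<^esub> (b \<odot>\<^bsub>hom_space X Y\<^esub> x)"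
      using ab abK x by (intro arr_eqI) (simp_all add: rules xf)
    fix y assume "y \<in> carrier (hom_space X Y)"
    then have y: "aarr y" "adom y = X" "acod y = Y" by auto
    have yf: "afun y u \<in> carrier Y" if "u \<in> carrier X" for u using afun_closed[OF y(1), of u] y that by simp
    show "a \<odot>\<^bsub>hom_space X Y\<^esub> (x \<oplus>\<^bsub>hom_space X Y\<^esub> y) = a \<odot>\<^bsub>hom_space X Y\<^esub> x \<oplus>\<^bsub>hom_space X Y\<^esub> a \<odot>\<^bsub>hom_space X Y\<^esub> y"
      unfolding hom_space_simps using ab x y
      by (intro arr_eqI) (simp_all add: rules xf yf Y.ract_add)
  next
    fix x assume "x \<in> carrier (hom_space X Y)"
    then have x: "aarr x" "adom x = X" "acod x = Y" by auto
    have xf: "afun x u \<in> carrier Y" if "u \<in> carrier X" for u using afun_closed[OF x(1), of u] x that by simp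
    show "\<one>\<^bsub>K\<^esub> \<odot>\<^bsub>hom_space X Y\<^esub> x = x" using x by (intro arr_eqI) (simp_all add: hom_space_smult xf Y.ract_one)
  qed
qed

text \<open>
  A homomorphism is determined by its values at finitely many generators.
\<close>

lemma hom_space_finite: assumes X: "X \<in> fgmod A" and Y: "Y \<in> fgmod A" shows "vlen K (hom_space X Y) \<noteq> \<infinity>"
proof -
  note X' = fgmodD[OF X] and Y' = fgmodD[OF Y]
  interpret X: right_module A X by (rule X')
  interpret Y: right_module A Y by (rule Y')
  obtain n :: nat and x where x: "x \<in> {..<n} \<rightarrow> carrier X"
    "\<forall>m\<in>carrier X. \<exists>a\<in>{..<n} \<rightarrow> carrier A. m = (\<Oplus>\<^bsub>X\<^esub>i\<in>{..<n}. x i \<triangleleft>\<^bsub>X\<^esub> a i)"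
    using X'(2) unfolding fin_gen_def by blast
  have xc: "x i \<in> carrier X" if "i < n" for i using x(1) that by auto
  show ?thesis
  proof (rule finite_vlen_jointly_injective[OF hom_space_module[OF X Y] kmod_module[OF Y'(1)] fin_gen_finite_vlen[OF Y']])
    fix i assume i: "i < n"
    show "linear K (hom_space X Y) (kmod Y) (\<lambda>a. afun a (x i))" unfolding linear_def
    proof (intro conjI ballI funcsetI)
      fix a assume "a \<in> carrier (hom_space X Y)"
      then have a: "aarr a" "adom a = X" "acod a = Y" by auto
      show "afun a (x i) \<in> carrier (kmod Y)" using afun_closed[OF a(1), of "x i"] a xc[OF i] by simp
      show "afun (c \<odot>\<^bsub>hom_space X Y\<^esub> a) (x i) = c \<odot>\<^bsub>kmod Y\<^esub> afun a (x i)" if "c \<in> carrier K" for c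
        using hom_space_smult(4)[OF that a(1), of "x i"] a xc[OF i] by simp
      fix b assume "b \<in> carrier (hom_space X Y)"
      then have b: "aarr b" "adom b = X" "acod b = Y" by auto
      show "afun (a \<oplus>\<^bsub>hom_space X Y\<^esub> b) (x i) = afun a (x i) \<oplus>\<^bsub>kmod Y\<^esub> afun b (x i)"
        using aadd_fun[OF a(1) b(1), of "x i"] a b xc[OF i] by simp
    qed
  next
    fix a assume "a \<in> carrier (hom_space X Y)" and z: "\<And>i. i < n \<Longrightarrow> afun a (x i) = \<zero>\<^bsub>kmod Y\<^esub>"
    then have a: "aarr a" "adom a = X" "acod a = Y" by auto
    let ?U = "{x \<in> carrier X. afun a x = \<zero>\<^bsub>Y\<^esub>}"
    have U: "submod A ?U X" using kernel_submod[OF arrD(4,5,3)[OF a(1)]] a by simp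
    note U' = submodD[OF X'(1) U]
    have "m \<in> ?U" if m: "m \<in> carrier X" for m
    proof -
      obtain b where b: "b \<in> {..<n} \<rightarrow> carrier A" "m = (\<Oplus>\<^bsub>X\<^esub>i\<in>{..<n}. x i \<triangleleft>\<^bsub>X\<^esub> b i)" using x(2) m by blast
      have "x i \<triangleleft>\<^bsub>X\<^esub> b i \<in> ?U" if "i < n" for i using z[OF that] xc[OF that] b(1) that by (intro U'(4)) auto
      then show ?thesis unfolding b(2) using U'(1-3) by (intro X.M.finsum_lessThan_mem) blast+
    qed
    then show "a = \<zero>\<^bsub>hom_space X Y\<^esub>" using zero_iff[OF a(1)] a by simp
  qed
qed

definition hdim :: "('a, nat \<Rightarrow> 'k) rmodule \<Rightarrow> ('a, nat \<Rightarrow> 'k) rmodule \<Rightarrow> nat" where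
  "hdim X Y = the_enat (vlen K (hom_space X Y))"

lemma hdim_zero:
  assumes X: "X \<in> fgmod A" and Y: "Y \<in> fgmod A" shows "hdim X Y = 0 \<longleftrightarrow> C.hom X Y = {azr X Y}"
proof -
  obtain n where n: "vlen K (hom_space X Y) = enat n" using hom_space_finite[OF X Y] by auto
  show ?thesis using vlen_eq_0[OF hom_space_module[OF X Y]] n by (simp add: hdim_def zero_enat_def)
qed

lemma hdim_exact:
  assumes S: "linear K (hom_space X' Y') (hom_space X Y) S" "inj_on S (C.hom X' Y')" and T: "linear K (hom_space X Y) (hom_space X'' Y'') T" "T ` C.hom X Y = C.hom X'' Y''"
    and ker: "\<And>a. a \<in> C.hom X Y \<Longrightarrow> T a = azr X'' Y'' \<longleftrightarrow> a \<in> S ` C.hom X' Y'"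
    and O: "X \<in> fgmod A" "Y \<in> fgmod A" "X' \<in> fgmod A" "Y' \<in> fgmod A" "X'' \<in> fgmod A" "Y'' \<in> fgmod A"
  shows "hdim X Y = hdim X' Y' + hdim X'' Y''"
proof -
  have "vlen K (hom_space X Y) = vlen K (hom_space X' Y') + vlen K (hom_space X'' Y'')"
    using vlen_exact[OF hom_space_module[OF O(1,2)] hom_space_module[OF O(3,4)] hom_space_module[OF O(5,6)] S(1) _ T(1)] S(2) T(2) ker hom_space_finite[OF O(1,2)]
    by (simp del: C.mem_hom)
  moreover obtain n n' n'' where "vlen K (hom_space X Y) = enat n" "vlen K (hom_space X' Y') = enat n'" "vlen K (hom_space X'' Y'') = enat n''"
    using hom_space_finite[OF O(1,2)] hom_space_finite[OF O(3,4)] hom_space_finite[OF O(5,6)] by auto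
  ultimately show ?thesis by (simp add: hdim_def)
qed

lemma precomp_linear:
  assumes p: "aarr p" "adom p = M" "acod p = Z" and Y: "Y \<in> fgmod A"
  shows "linear K (hom_space Z Y) (hom_space M Y) (\<lambda>a. acomp a p)"
  unfolding linear_def
proof (intro conjI ballI funcsetI)
  fix a assume "a \<in> carrier (hom_space Z Y)"
  then have a: "aarr a" "adom a = Z" "acod a = Y" by auto
  show "acomp a p \<in> carrier (hom_space M Y)" using a p by simp
  show "acomp (a \<oplus>\<^bsub>hom_space Z Y\<^esub> b) p = acomp a p \<oplus>\<^bsub>hom_space M Y\<^esub> acomp b p" for b by (simp add: aadd_acomp)
  have pf: "afun p x \<in> carrier Z" if "x \<in> carrier M" for x using afun_closed[OF p(1), of x] p that by simp
  show "acomp (c \<odot>\<^bsub>hom_space Z Y\<^esub> a) p = c \<odot>\<^bsub>hom_space M Y\<^esub> acomp a p" if c: "c \<in> carrier K" for c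
    using a p c by (intro arr_eqI) (simp_all add: hom_space_smult acomp_arr acomp_dom acomp_cod acomp_fun pf)
qed

lemma postcomp_linear:
  assumes p: "aarr p" "adom p = M" "acod p = Z" and Y: "Y \<in> fgmod A"
  shows "linear K (hom_space Y M) (hom_space Y Z) (\<lambda>a. acomp p a)"
  unfolding linear_def
proof (intro conjI ballI funcsetI)
  fix a assume "a \<in> carrier (hom_space Y M)"
  then have a: "aarr a" "adom a = Y" "acod a = M" by auto
  show "acomp p a \<in> carrier (hom_space Y Z)" using a p by simp
  show "acomp p (a \<oplus>\<^bsub>hom_space Y M\<^esub> b) = acomp p a \<oplus>\<^bsub>hom_space Y Z\<^esub> acomp p b" for b by (simp add: acomp_aadd)
  have af: "afun a x \<in> carrier M" if "x \<in> carrier Y" for x using afun_closed[OF a(1), of x] a that by simp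
  have ph: "afun p (y \<triangleleft>\<^bsub>M\<^esub> sc c) = afun p y \<triangleleft>\<^bsub>Z\<^esub> sc c" if "y \<in> carrier M" "c \<in> carrier K" for y c
    using rmod_homD(3)[OF arrD(3)[OF p(1)]] p sc_closed[OF that(2)] that(1) by simp
  interpret M: right_module A M using arrD(4)[OF p(1)] p by simp
  show "acomp p (c \<odot>\<^bsub>hom_space Y M\<^esub> a) = c \<odot>\<^bsub>hom_space Y Z\<^esub> acomp p a" if c: "c \<in> carrier K" for c
    using a p c by (intro arr_eqI) (simp_all add: hom_space_smult acomp_arr acomp_dom acomp_cod acomp_fun af ph)
qed

lemma hdim_left:
  assumes s: "C.ses N i M p Z" and Y: "Y \<in> fgmod A" and ext: "\<And>f. f \<in> C.hom N Y \<Longrightarrow> \<exists>g\<in>C.hom M Y. acomp g i = f"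
  shows "hdim M Y = hdim N Y + hdim Z Y"
proof -
  note s' = C.sesD[OF s]
  have "hdim M Y = hdim Z Y + hdim N Y"
  proof (rule hdim_exact[OF precomp_linear[OF s'(4-6) Y] _ precomp_linear[OF s'(1-3) Y]])
    show "inj_on (\<lambda>a. acomp a p) (C.hom Z Y)"
      using C.epi_cancel[OF s'(8)] s'(6) by (intro inj_onI) simp
    show "(\<lambda>a. acomp a i) ` C.hom M Y = C.hom N Y"
    proof
      show "(\<lambda>a. acomp a i) ` C.hom M Y \<subseteq> C.hom N Y" using s' by auto
      show "C.hom N Y \<subseteq> (\<lambda>a. acomp a i) ` C.hom M Y"
      proof
        fix f assume "f \<in> C.hom N Y"
        from ext[OF this] obtain g where "g \<in> C.hom M Y" "acomp g i = f" by (elim bexE)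
        then show "f \<in> (\<lambda>a. acomp a i) ` C.hom M Y" by (intro image_eqI[of _ _ g]) simp_all
      qed
    qed
    fix a assume "a \<in> C.hom M Y"
    then have a: "aarr a" "adom a = M" "acod a = Y" by auto
    show "acomp a i = azr N Y \<longleftrightarrow> a \<in> (\<lambda>a. acomp a p) ` C.hom Z Y"
    proof
      assume "acomp a i = azr N Y"
      then obtain h where "aarr h" "adom h = Z" "acod h = Y" "acomp h p = a" using C.ses_coker[OF s a(1,2)] a(3) by auto
      then show "a \<in> (\<lambda>a. acomp a p) ` C.hom Z Y" by (intro image_eqI[of _ _ h]) simp_all
    next
      assume "a \<in> (\<lambda>a. acomp a p) ` C.hom Z Y"
      then obtain h where h: "a = acomp h p" "h \<in> C.hom Z Y" by (rule imageE)
      show "acomp a i = azr N Y" unfolding h(1) using h(2) s' by (simp add: C.comp_assoc)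
    qed
  qed (use s' Y in auto)
  then show ?thesis by simp
qed

lemma hdim_right:
  assumes s: "C.ses N i M p Z" and Y: "Y \<in> fgmod A" and lft: "\<And>f. f \<in> C.hom Y Z \<Longrightarrow> \<exists>g\<in>C.hom Y M. acomp p g = f"
  shows "hdim Y M = hdim Y N + hdim Y Z"
proof -
  note s' = C.sesD[OF s]
  show ?thesis
  proof (rule hdim_exact[OF postcomp_linear[OF s'(1-3) Y] _ postcomp_linear[OF s'(4-6) Y]])
    show "inj_on (\<lambda>a. acomp i a) (C.hom Y N)"
      using C.mono_cancel[OF s'(7)] s'(2) by (intro inj_onI) simp
    show "(\<lambda>a. acomp p a) ` C.hom Y M = C.hom Y Z"
    proof
      show "(\<lambda>a. acomp p a) ` C.hom Y M \<subseteq> C.hom Y Z" using s' by auto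
      show "C.hom Y Z \<subseteq> (\<lambda>a. acomp p a) ` C.hom Y M"
      proof
        fix f assume "f \<in> C.hom Y Z"
        from lft[OF this] obtain g where "g \<in> C.hom Y M" "acomp p g = f" by (elim bexE)
        then show "f \<in> (\<lambda>a. acomp p a) ` C.hom Y M" by (intro image_eqI[of _ _ g]) simp_all
      qed
    qed
    fix a assume "a \<in> C.hom Y M"
    then have a: "aarr a" "adom a = Y" "acod a = M" by auto
    show "acomp p a = azr Y Z \<longleftrightarrow> a \<in> (\<lambda>a. acomp i a) ` C.hom Y N"
    proof
      assume "acomp p a = azr Y Z"
      then obtain h where "aarr h" "adom h = Y" "acod h = N" "acomp i h = a" using C.ses_ker[OF s a(1,3)] a(2) by auto
      then show "a \<in> (\<lambda>a. acomp i a) ` C.hom Y N" by (intro image_eqI[of _ _ h]) simp_all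
    next
      assume "a \<in> (\<lambda>a. acomp i a) ` C.hom Y N"
      then obtain h where h: "a = acomp i h" "h \<in> C.hom Y N" by (rule imageE)
      show "acomp p a = azr Y Z" unfolding h(1) using h(2) s' by (simp add: C.reassoc[OF s'(9)])
    qed
  qed (use s' Y in auto)
qed

text \<open>
  The length function of the category is \<open>hdim Gm\<close>: homomorphisms from the regular module to \<open>M\<close> form a space
  of the dimension of \<open>M\<close>, and \<open>hdim Gm\<close> is additive because \<open>Gm\<close> is projective.
\<close>

lemma length_category: "length_abelian_cat (fgmod A) aarr adom acod acomp aadd aneg azr aid (hdim Gm) hdim"
proof unfold_locales
  show "hdim Gm M = hdim Gm N + hdim Gm Z" if s: "C.ses N i M p Z" for N i M p Z
  proof (rule hdim_right[OF s Gm_iso(1)])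
    fix f assume f: "f \<in> C.hom Gm Z"
    then have f': "aarr f" "adom f = Gm" "acod f = acod p" using C.sesD(6)[OF s] by auto
    obtain h where "aarr h" "adom h = Gm" "acod h = adom p" "acomp p h = f"
      using C.projectiveD[OF Gm_projective C.sesD(8)[OF s] f'] by blast
    then show "\<exists>g\<in>C.hom Gm M. acomp p g = f" using C.sesD(5)[OF s] by (intro bexI[of _ h]) simp_all
  qed
  show "0 < hdim Gm X" if X: "C.nonzero X" for X
  proof -
    have XO: "X \<in> fgmod A" using X by (simp add: C.nonzero_def)
    have "C.hom Gm X \<noteq> {azr Gm X}" using Gm_generates[OF X] by blast
    then show ?thesis using hdim_zero[OF Gm_iso(1) XO] by simp
  qed
qed (rule factor_arr biprod_arr hdim_zero hdim_left hdim_right enough_projectives enough_injectives; assumption)+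

end

sublocale fd_alg \<subseteq> C: length_abelian_cat "fgmod A" aarr adom acod acomp aadd aneg azr aid "hdim Gm" hdim
  by (rule length_category)

context fd_alg
begin

lemma rank_finite: "\<exists>n. C.rank_le n"
  by (rule C.generator_rank[OF Gm_iso(1) Gm_generates])

end


section \<open>Paths and homological dimensions in the category of modules\<close>

lemma Inf_enat_le_1: "Inf {enat n | n. Q n} \<le> 1 \<longleftrightarrow> Q 0 \<or> Q 1"
proof
  assume "Inf {enat n | n. Q n} \<le> 1"
  also have "(1::enat) < 2" by (simp add: one_enat_def numeral_eq_enat)
  finally obtain n where n: "Q n" "enat n < 2" unfolding Inf_less_iff by auto
  then have "n < 2" by (simp add: numeral_eq_enat)
  then have "n = 0 \<or> n = 1" by auto
  then show "Q 0 \<or> Q 1" using n(1) by auto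
next
  assume "Q 0 \<or> Q 1"
  then obtain n where "Q n" "enat n \<le> 1" by (auto simp: one_enat_def)
  then show "Inf {enat n | n. Q n} \<le> 1" by (intro Inf_lower2[of "enat n"]) auto
qed

context fd_alg
begin

text \<open>
  Complementary submodules correspond to idempotent endomorphisms: the projection along one summand here, the
  image and the kernel of the idempotent in the next lemma.
\<close>

lemma indec_imp_indecomposable:
  assumes i: "C.indec M" shows "indecomposable A M"
proof -
  have M: "M \<in> fgmod A" using C.indecD(1)[OF i] .
  note M' = fgmodD[OF M]
  interpret M: right_module A M by (rule M')
  have nz: "carrier M \<noteq> {\<zero>\<^bsub>M\<^esub>}" using i nonzero_iff[OF M] unfolding C.indec_def by auto
  have "U = {\<zero>\<^bsub>M\<^esub>} \<or> V = {\<zero>\<^bsub>M\<^esub>}"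
    if U: "submod A U M" and V: "submod A V M" and UV: "U <+>\<^bsub>M\<^esub> V = carrier M" "U \<inter> V = {\<zero>\<^bsub>M\<^esub>}" for U V
  proof -
    note U' = submodD[OF M'(1) U] and V' = submodD[OF M'(1) V]
    have mem: "u \<in> carrier M" "v \<in> carrier M" if "u \<in> U" "v \<in> V" for u v using U'(1) V'(1) that by auto
    have uniq: "u = u' \<and> v = v'" if a: "u \<in> U" "v \<in> V" "u' \<in> U" "v' \<in> V" and e: "u \<oplus>\<^bsub>M\<^esub> v = u' \<oplus>\<^bsub>M\<^esub> v'" for u v u' v'
    proof -
      note c = mem[OF a(1,2)] mem[OF a(3,4)]
      have "\<ominus>\<^bsub>M\<^esub> u' \<oplus>\<^bsub>M\<^esub> u \<oplus>\<^bsub>M\<^esub> v = \<ominus>\<^bsub>M\<^esub> u' \<oplus>\<^bsub>M\<^esub> u' \<oplus>\<^bsub>M\<^esub> v'" using c e by (simp add: M.M.a_assoc)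
      then have "\<ominus>\<^bsub>M\<^esub> u' \<oplus>\<^bsub>M\<^esub> u \<oplus>\<^bsub>M\<^esub> v = v'" using c by (simp add: M.M.l_neg)
      then have "v' \<oplus>\<^bsub>M\<^esub> \<ominus>\<^bsub>M\<^esub> v = \<ominus>\<^bsub>M\<^esub> u' \<oplus>\<^bsub>M\<^esub> u" using c by (auto simp: M.M.a_assoc M.M.r_neg)
      moreover have "v' \<oplus>\<^bsub>M\<^esub> \<ominus>\<^bsub>M\<^esub> v \<in> V" using V'(3)[OF a(4) V'(5)[OF a(2)]] .
      moreover have "\<ominus>\<^bsub>M\<^esub> u' \<oplus>\<^bsub>M\<^esub> u \<in> U" using U'(3)[OF U'(5)[OF a(3)] a(1)] .
      ultimately have z: "\<ominus>\<^bsub>M\<^esub> u' \<oplus>\<^bsub>M\<^esub> u = \<zero>\<^bsub>M\<^esub>" using UV(2) by auto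
      then have "\<ominus>\<^bsub>M\<^esub> u = \<ominus>\<^bsub>M\<^esub> u'" using c by (intro M.M.minus_equality) simp_all
      then have uu: "u = u'" by (metis M.M.minus_minus c(1) c(3))
      then have "\<ominus>\<^bsub>M\<^esub> u' \<oplus>\<^bsub>M\<^esub> (u' \<oplus>\<^bsub>M\<^esub> v) = \<ominus>\<^bsub>M\<^esub> u' \<oplus>\<^bsub>M\<^esub> (u' \<oplus>\<^bsub>M\<^esub> v')" using e by (simp only:)
      then have "v = v'" using c(2-4) by (simp add: M.M.r_neg1)
      then show ?thesis using uu by blast
    qed
    have "\<exists>u. u \<in> U \<and> (\<exists>v\<in>V. x = u \<oplus>\<^bsub>M\<^esub> v)" if "x \<in> carrier M" for x
      using that unfolding UV(1)[symmetric] by (auto simp: set_add_defs)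
    then obtain t where t: "\<And>x. x \<in> carrier M \<Longrightarrow> t x \<in> U \<and> (\<exists>v\<in>V. x = t x \<oplus>\<^bsub>M\<^esub> v)" by metis
    have teq: "t x = u" if "u \<in> U" "v \<in> V" "x = u \<oplus>\<^bsub>M\<^esub> v" for x u v
    proof -
      have x: "x \<in> carrier M" using mem[OF that(1,2)] that(3) by simp
      obtain w where "w \<in> V" "x = t x \<oplus>\<^bsub>M\<^esub> w" using t[OF x] by blast
      then show ?thesis using uniq[of "t x" w u v] t[OF x] that by simp
    qed
    have tc: "t x \<in> carrier M" if "x \<in> carrier M" for x using t[OF that] U'(1) by auto
    have tU: "t u = u" if "u \<in> U" for u using teq[OF that V'(2), of u] mem[OF that V'(2)] by simp
    have tV: "t v = \<zero>\<^bsub>M\<^esub>" if "v \<in> V" for v using teq[OF U'(2) that, of v] mem[OF U'(2) that] by simp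
    have th: "t \<in> rmod_hom A M M"
    proof (rule rmod_homI[OF tc])
      fix x assume x: "x \<in> carrier M"
      obtain v where v: "v \<in> V" "x = t x \<oplus>\<^bsub>M\<^esub> v" using t[OF x] by blast
      note c = mem[OF conjunct1[OF t[OF x]] v(1)]
      show "t (x \<triangleleft>\<^bsub>M\<^esub> a) = t x \<triangleleft>\<^bsub>M\<^esub> a" if a: "a \<in> carrier A" for a
      proof (rule teq[OF U'(4)[OF _ a] V'(4)[OF v(1) a]])
        show "t x \<in> U" using t[OF x] by blast
        show "x \<triangleleft>\<^bsub>M\<^esub> a = t x \<triangleleft>\<^bsub>M\<^esub> a \<oplus>\<^bsub>M\<^esub> v \<triangleleft>\<^bsub>M\<^esub> a" using arg_cong[OF v(2), of "\<lambda>z. z \<triangleleft>\<^bsub>M\<^esub> a"] c a by (simp add: M.ract_add)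
      qed
      fix y assume y: "y \<in> carrier M"
      obtain w where w: "w \<in> V" "y = t y \<oplus>\<^bsub>M\<^esub> w" using t[OF y] by blast
      note d = mem[OF conjunct1[OF t[OF y]] w(1)]
      show "t (x \<oplus>\<^bsub>M\<^esub> y) = t x \<oplus>\<^bsub>M\<^esub> t y"
      proof (rule teq[OF U'(3) V'(3)[OF v(1) w(1)]])
        show "t x \<in> U" "t y \<in> U" using t x y by auto
        have "x \<oplus>\<^bsub>M\<^esub> y = (t x \<oplus>\<^bsub>M\<^esub> v) \<oplus>\<^bsub>M\<^esub> (t y \<oplus>\<^bsub>M\<^esub> w)" using v(2) w(2) by simp
        also have "\<dots> = (t x \<oplus>\<^bsub>M\<^esub> t y) \<oplus>\<^bsub>M\<^esub> (v \<oplus>\<^bsub>M\<^esub> w)" using c d by (simp add: M.M.a_ac)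
        finally show "x \<oplus>\<^bsub>M\<^esub> y = (t x \<oplus>\<^bsub>M\<^esub> t y) \<oplus>\<^bsub>M\<^esub> (v \<oplus>\<^bsub>M\<^esub> w)" .
      qed
    qed
    define a where "a = mk M t M"
    have a: "aarr a" "adom a = M" "acod a = M" "\<And>x. x \<in> carrier M \<Longrightarrow> afun a x = t x"
      unfolding a_def using mk_arr[OF M M th] by simp_all
    have "acomp a a = a"
      using a tc t tU by (intro arr_eqI) (simp_all add: acomp_arr acomp_dom acomp_cod acomp_fun)
    then have "a = azr M M \<or> a = aid M" using i a unfolding C.indec_def by simp
    then show ?thesis
    proof
      assume z: "a = azr M M"
      have "u = \<zero>\<^bsub>M\<^esub>" if "u \<in> U" for u
        using a(4)[of u] tU[OF that] U'(1) that azr_fun[of u M M] unfolding z by auto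
      then show ?thesis using U'(2) by blast
    next
      assume z: "a = aid M"
      have "v = \<zero>\<^bsub>M\<^esub>" if "v \<in> V" for v
        using a(4)[of v] tV[OF that] V'(1) that aid_fun[of v M] unfolding z by auto
      then show ?thesis using V'(2) by blast
    qed
  qed
  then show ?thesis unfolding indecomposable_def using nz by blast
qed

lemma indecomposable_imp_indec:
  assumes M: "M \<in> fgmod A" and i: "indecomposable A M" shows "C.indec M"
proof -
  note M' = fgmodD[OF M]
  interpret M: right_module A M by (rule M')
  have nz: "C.nonzero M" using i M.M.zero_closed unfolding nonzero_iff[OF M] indecomposable_def by blast
  have "t = azr M M \<or> t = aid M" if t: "aarr t" "adom t = M" "acod t = M" "acomp t t = t" for t
  proof -
    note th = arrD(3)[OF t(1), unfolded t(2,3)]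
    note th' = rmod_homD[OF th]
    have tt: "afun t (afun t x) = afun t x" if "x \<in> carrier M" for x
      using acomp_fun[OF t(1) t(1), of x] t that by simp
    let ?U = "afun t ` carrier M" and ?V = "{x \<in> carrier M. afun t x = \<zero>\<^bsub>M\<^esub>}"
    have U: "submod A ?U M" and V: "submod A ?V M"
      using image_submod[OF M'(1) M'(1) th] kernel_submod[OF M'(1) M'(1) th] .
    have "?U <+>\<^bsub>M\<^esub> ?V = carrier M"
    proof
      show "?U <+>\<^bsub>M\<^esub> ?V \<subseteq> carrier M" using th'(1) by (auto simp: set_add_defs)
      show "carrier M \<subseteq> ?U <+>\<^bsub>M\<^esub> ?V"
      proof
        fix x assume x: "x \<in> carrier M"
        let ?v = "\<ominus>\<^bsub>M\<^esub> afun t x \<oplus>\<^bsub>M\<^esub> x"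
        have "afun t ?v = \<zero>\<^bsub>M\<^esub>"
          using x th'(1)[OF x] th'(2)[of "\<ominus>\<^bsub>M\<^esub> afun t x" x] rmod_hom_minus[OF M'(1) M'(1) th, of "afun t x"] tt[OF x]
          by (simp add: M.M.l_neg)
        then have v: "?v \<in> ?V" using x th'(1)[OF x] by simp
        have eq: "afun t x \<oplus>\<^bsub>M\<^esub> ?v = x" using x th'(1)[OF x] by (simp add: M.M.a_assoc[symmetric] M.M.r_neg)
        have "afun t x \<oplus>\<^bsub>M\<^esub> ?v \<in> ?U <+>\<^bsub>M\<^esub> ?V" unfolding set_add_defs by (rule UN_I[where a="afun t x"], rule imageI[OF x], rule UN_I[OF v], simp)
        then show "x \<in> ?U <+>\<^bsub>M\<^esub> ?V" unfolding eq .
      qed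
    qed
    moreover have "?U \<inter> ?V = {\<zero>\<^bsub>M\<^esub>}"
    proof
      show "?U \<inter> ?V \<subseteq> {\<zero>\<^bsub>M\<^esub>}" using tt by auto
      show "{\<zero>\<^bsub>M\<^esub>} \<subseteq> ?U \<inter> ?V" using submodD(2)[OF M'(1) U] submodD(2)[OF M'(1) V] by auto
    qed
    ultimately have "?U = {\<zero>\<^bsub>M\<^esub>} \<or> ?V = {\<zero>\<^bsub>M\<^esub>}" using i U V unfolding indecomposable_def by blast
    then show ?thesis
    proof
      assume "?U = {\<zero>\<^bsub>M\<^esub>}"
      then have "\<forall>x\<in>carrier M. afun t x = \<zero>\<^bsub>M\<^esub>" by blast
      then show ?thesis using zero_iff[OF t(1)] t by simp
    next
      assume v: "?V = {\<zero>\<^bsub>M\<^esub>}"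
      then have "\<forall>x\<in>carrier M. afun t x = \<zero>\<^bsub>M\<^esub> \<longrightarrow> x = \<zero>\<^bsub>M\<^esub>" by blast
      then have "inj_on (afun t) (carrier M)" using rmod_hom_inj_iff[OF M'(1) M'(1) th] by simp
      then have "afun t x = x" if "x \<in> carrier M" for x using tt[OF that] th'(1)[OF that] that by (auto dest: inj_onD)
      then have "t = aid M" using t M by (intro arr_eqI) (simp_all add: aid_arr aid_fun)
      then show ?thesis by simp
    qed
  qed
  then show ?thesis unfolding C.indec_def using nz by auto
qed

lemma ind_iff: "M \<in> ind A \<longleftrightarrow> C.indec M"
  using indec_imp_indecomposable indecomposable_imp_indec C.indecD(1) unfolding ind_def by blast

lemma step_iff:
  "(M, N) \<in> C.step \<longleftrightarrow> M \<in> ind A \<and> N \<in> ind A \<and>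
     (\<exists>f. f \<in> rmod_hom A M N \<and> (\<exists>x\<in>carrier M. f x \<noteq> \<zero>\<^bsub>N\<^esub>) \<and> f \<notin> rmod_iso A M N)"
proof
  assume "(M, N) \<in> C.step"
  then obtain f where MN: "M \<in> ind A" "N \<in> ind A" and f: "aarr f" "adom f = M" "acod f = N" "f \<noteq> azr M N" "\<not> C.iso f"
    unfolding C.step_def ind_iff by auto
  have "afun f \<in> rmod_hom A M N" using arrD(3)[OF f(1)] f by simp
  moreover have "\<exists>x\<in>carrier M. afun f x \<noteq> \<zero>\<^bsub>N\<^esub>" using zero_iff[OF f(1)] f by simp
  moreover have "afun f \<notin> rmod_iso A M N" using iso_iff[OF f(1)] f by (simp add: rmod_iso_def)
  ultimately show "M \<in> ind A \<and> N \<in> ind A \<and>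
     (\<exists>f. f \<in> rmod_hom A M N \<and> (\<exists>x\<in>carrier M. f x \<noteq> \<zero>\<^bsub>N\<^esub>) \<and> f \<notin> rmod_iso A M N)" using MN by blast
next
  assume "M \<in> ind A \<and> N \<in> ind A \<and>
     (\<exists>f. f \<in> rmod_hom A M N \<and> (\<exists>x\<in>carrier M. f x \<noteq> \<zero>\<^bsub>N\<^esub>) \<and> f \<notin> rmod_iso A M N)"
  then obtain f where MN: "M \<in> ind A" "N \<in> ind A" and f: "f \<in> rmod_hom A M N" "\<exists>x\<in>carrier M. f x \<noteq> \<zero>\<^bsub>N\<^esub>" "f \<notin> rmod_iso A M N"
    by blast
  have a: "aarr (mk M f N)" using MN f(1) by (intro mk_arr) (auto simp: ind_def)
  have "mk M f N \<noteq> azr M N" using zero_iff[OF a] f(2) by simp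
  moreover have "\<not> C.iso (mk M f N)"
  proof
    assume "C.iso (mk M f N)"
    then have "bij_betw (afun (mk M f N)) (carrier M) (carrier N)" using iso_iff[OF a] by simp
    then have "bij_betw f (carrier M) (carrier N)" using bij_betw_cong[of "carrier M" "afun (mk M f N)" f] by simp
    then show False using f(1,3) by (simp add: rmod_iso_def)
  qed
  ultimately show "(M, N) \<in> C.step" unfolding C.step_def using a MN[unfolded ind_iff] by (auto intro!: bexI[of _ "mk M f N"])
qed

lemma ind_path_iff: "ind_path A M N s \<longleftrightarrow> M \<in> ind A \<and> (M, N) \<in> C.step ^^ s"
proof
  assume "ind_path A M N s"
  then obtain X f where X: "X 0 = M" "X s = N" "\<forall>i\<le>s. X i \<in> ind A"
    and f: "\<forall>i<s. f i \<in> rmod_hom A (X i) (X (Suc i)) \<and>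
        (\<exists>x\<in>carrier (X i). f i x \<noteq> \<zero>\<^bsub>X (Suc i)\<^esub>) \<and> f i \<notin> rmod_iso A (X i) (X (Suc i))"
    unfolding ind_path_def by blast
  have "(X i, X (Suc i)) \<in> C.step" if "i < s" for i
    using f that X(3) by (intro iffD2[OF step_iff] conjI exI[of _ "f i"]) auto
  then have "(M, N) \<in> C.step ^^ s" unfolding relpow_fun_conv using X by blast
  then show "M \<in> ind A \<and> (M, N) \<in> C.step ^^ s" using X by auto
next
  assume M: "M \<in> ind A \<and> (M, N) \<in> C.step ^^ s"
  then obtain X where X: "X 0 = M" "X s = N" "\<forall>i<s. (X i, X (Suc i)) \<in> C.step" unfolding relpow_fun_conv by blast
  have "X i \<in> ind A" if "i \<le> s" for i
    using that M X step_iff[of "X (i - 1)" "X i"] by (cases i) auto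
  moreover have "\<forall>i. \<exists>f. i < s \<longrightarrow> f \<in> rmod_hom A (X i) (X (Suc i)) \<and>
        (\<exists>x\<in>carrier (X i). f x \<noteq> \<zero>\<^bsub>X (Suc i)\<^esub>) \<and> f \<notin> rmod_iso A (X i) (X (Suc i))"
    using X(3) step_iff by blast
  from choice[OF this] obtain f where "\<forall>i<s. f i \<in> rmod_hom A (X i) (X (Suc i)) \<and>
        (\<exists>x\<in>carrier (X i). f i x \<noteq> \<zero>\<^bsub>X (Suc i)\<^esub>) \<and> f i \<notin> rmod_iso A (X i) (X (Suc i))" by blast
  ultimately show "ind_path A M N s" unfolding ind_path_def using X by blast
qed

lemma mk_exact_ses:
  assumes O: "N \<in> fgmod A" "M \<in> fgmod A" "Z \<in> fgmod A"
    and i: "i \<in> rmod_hom A N M" "inj_on i (carrier N)" and p: "p \<in> rmod_hom A M Z" "p ` carrier M = carrier Z"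
    and e: "\<And>x. x \<in> carrier M \<Longrightarrow> p x = \<zero>\<^bsub>Z\<^esub> \<longleftrightarrow> x \<in> i ` carrier N"
  shows "C.ses N (mk N i M) M (mk M p Z) Z"
proof (rule exact_imp_ses)
  show "inj_on (afun (mk N i M)) (carrier N)" using i(2) by (auto simp: inj_on_def)
  have "afun (mk M p Z) ` carrier M = p ` carrier M" by (rule image_cong) simp_all
  then show "afun (mk M p Z) ` carrier M = carrier Z" using p(2) by simp
  have "afun (mk N i M) ` carrier N = i ` carrier N" by (rule image_cong) simp_all
  then show "afun (mk M p Z) x = \<zero>\<^bsub>Z\<^esub> \<longleftrightarrow> x \<in> afun (mk N i M) ` carrier N" if "x \<in> carrier M" for x
    using e[OF that] that by simp
qed (simp_all add: mk_arr O i(1) p(1))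

lemma pd1_iff:
  "C.pd1 M \<longleftrightarrow> M \<in> fgmod A \<and> (\<exists>P1 i P0 p. projective A P1 \<and> projective A P0 \<and> i \<in> rmod_hom A P1 P0 \<and> inj_on i (carrier P1) \<and>
     p \<in> rmod_hom A P0 M \<and> p ` carrier P0 = carrier M \<and> (\<forall>x\<in>carrier P0. p x = \<zero>\<^bsub>M\<^esub> \<longleftrightarrow> x \<in> i ` carrier P1))"
  (is "_ \<longleftrightarrow> _ \<and> (\<exists>P1 i P0 p. ?E P1 i P0 p)")
proof
  assume "C.pd1 M"
  then obtain P1 i P0 p where s: "C.ses P1 i P0 p M" and P: "projective A P1" "projective A P0"
    unfolding C.pd1_def projective_iff by blast
  note s' = C.sesD[OF s] and e = ses_imp_exact[OF s]
  have "afun i \<in> rmod_hom A P1 P0" "afun p \<in> rmod_hom A P0 M" using arrD(3)[OF s'(1)] arrD(3)[OF s'(4)] s' by auto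
  then have "?E P1 (afun i) P0 (afun p)" using P e by blast
  then show "M \<in> fgmod A \<and> (\<exists>P1 i P0 p. ?E P1 i P0 p)" using s'(12) by blast
next
  assume "M \<in> fgmod A \<and> (\<exists>P1 i P0 p. ?E P1 i P0 p)"
  then obtain P1 i P0 p where M: "M \<in> fgmod A" and E: "?E P1 i P0 p" by blast
  have O: "P1 \<in> fgmod A" "P0 \<in> fgmod A" using E unfolding projective_def by blast+
  have "C.ses P1 (mk P1 i P0) P0 (mk P0 p M) M" by (rule mk_exact_ses[OF O M]) (use E in blast)+
  then show "C.pd1 M" unfolding C.pd1_def projective_iff using E by blast
qed

lemma id1_iff:
  "C.id1 M \<longleftrightarrow> M \<in> fgmod A \<and> (\<exists>J0 i J1 p. injective A J0 \<and> injective A J1 \<and> i \<in> rmod_hom A M J0 \<and> inj_on i (carrier M) \<and>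
     p \<in> rmod_hom A J0 J1 \<and> p ` carrier J0 = carrier J1 \<and> (\<forall>x\<in>carrier J0. p x = \<zero>\<^bsub>J1\<^esub> \<longleftrightarrow> x \<in> i ` carrier M))"
  (is "_ \<longleftrightarrow> _ \<and> (\<exists>J0 i J1 p. ?E J0 i J1 p)")
proof
  assume "C.id1 M"
  then obtain J0 i J1 p where s: "C.ses M i J0 p J1" and P: "injective A J0" "injective A J1"
    unfolding C.id1_def injective_iff by blast
  note s' = C.sesD[OF s] and e = ses_imp_exact[OF s]
  have "afun i \<in> rmod_hom A M J0" "afun p \<in> rmod_hom A J0 J1" using arrD(3)[OF s'(1)] arrD(3)[OF s'(4)] s' by auto
  then have "?E J0 (afun i) J1 (afun p)" using P e by blast
  then show "M \<in> fgmod A \<and> (\<exists>J0 i J1 p. ?E J0 i J1 p)" using s'(10) by blast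
next
  assume "M \<in> fgmod A \<and> (\<exists>J0 i J1 p. ?E J0 i J1 p)"
  then obtain J0 i J1 p where M: "M \<in> fgmod A" and E: "?E J0 i J1 p" by blast
  have O: "J0 \<in> fgmod A" "J1 \<in> fgmod A" using E unfolding injective_def by blast+
  have "C.ses M (mk M i J0) J0 (mk J0 p J1) J1" by (rule mk_exact_ses[OF M O]) (use E in blast)+
  then show "C.id1 M" unfolding C.id1_def injective_iff using E by blast
qed

text \<open>
  A resolution of length zero is an isomorphism with a projective module, which has a resolution of length one
  with zero end term.
\<close>

lemma pd_le_1_iff: assumes M: "M \<in> fgmod A" shows "pd A M \<le> 1 \<longleftrightarrow> C.pd1 M"
proof -
  have "C.pd1 M" if r: "projective_resolution A M 0 P d" for P d
  proof -
    have P: "projective A (P 0)" and d: "d 0 \<in> rmod_hom A (P 0) M" "inj_on (d 0) (carrier (P 0))" "d 0 ` carrier (P 0) = carrier M"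
      using r unfolding projective_resolution_def by auto
    have a: "aarr (mk (P 0) (d 0) M)" using P d M by (intro mk_arr) (auto simp: projective_def)
    have "bij_betw (d 0) (carrier (P 0)) (carrier M)" using d by (simp add: bij_betw_def)
    then have "C.iso (mk (P 0) (d 0) M)"
      using iso_iff[OF a] bij_betw_cong[of "carrier (P 0)" "afun (mk (P 0) (d 0) M)" "d 0"] by simp
    moreover have "C.pd1 (P 0)" using C.projective_pd1 P projective_iff by blast
    ultimately show ?thesis using C.pd1_iso[of "mk (P 0) (d 0) M"] by simp
  qed
  moreover have "C.pd1 M" if r: "projective_resolution A M 1 P d" for P d
  proof -
    have P: "projective A (P 0)" "projective A (P (Suc 0))" using r unfolding projective_resolution_def by auto
    have d: "d 0 \<in> rmod_hom A (P 0) M" "d (Suc 0) \<in> rmod_hom A (P (Suc 0)) (P 0)" "d 0 ` carrier (P 0) = carrier M"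
      "d (Suc 0) ` carrier (P (Suc 0)) = {x \<in> carrier (P 0). d 0 x = \<zero>\<^bsub>M\<^esub>}" "inj_on (d (Suc 0)) (carrier (P (Suc 0)))"
      using r unfolding projective_resolution_def by (auto simp: a_kernel_def')
    show ?thesis unfolding pd1_iff using M P d(1,2,3,5)
      by (intro conjI exI[of _ "P (Suc 0)"] exI[of _ "d (Suc 0)"] exI[of _ "P 0"] exI[of _ "d 0"]) (simp_all add: d(4))
  qed
  moreover have "\<exists>P d. projective_resolution A M 1 P d" if "C.pd1 M"
  proof -
    from that obtain P1 i P0 p where e: "projective A P1" "projective A P0" "i \<in> rmod_hom A P1 P0" "inj_on i (carrier P1)"
      "p \<in> rmod_hom A P0 M" "p ` carrier P0 = carrier M" "\<forall>x\<in>carrier P0. p x = \<zero>\<^bsub>M\<^esub> \<longleftrightarrow> x \<in> i ` carrier P1"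
      unfolding pd1_iff by blast
    have "i ` carrier P1 = {x \<in> carrier P0. p x = \<zero>\<^bsub>M\<^esub>}" using e(7) rmod_homD(1)[OF e(3)] by blast
    then have "projective_resolution A M 1 (\<lambda>j. if j = 0 then P0 else P1) (\<lambda>j. if j = 0 then p else i)"
      unfolding projective_resolution_def using e(1-6) by (simp add: a_kernel_def')
    then show ?thesis by blast
  qed
  ultimately show ?thesis unfolding pd_def Inf_enat_le_1 by blast
qed

lemma inj_dim_le_1_iff: assumes M: "M \<in> fgmod A" shows "inj_dim A M \<le> 1 \<longleftrightarrow> C.id1 M"
proof -
  have "C.id1 M" if r: "injective_resolution A M 0 J d" for J d
  proof -
    have J: "injective A (J 0)" and d: "d 0 \<in> rmod_hom A M (J 0)" "inj_on (d 0) (carrier M)" "d 0 ` carrier M = carrier (J 0)"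
      using r unfolding injective_resolution_def by auto
    have a: "aarr (mk M (d 0) (J 0))" using J d M by (intro mk_arr) (auto simp: injective_def)
    have "bij_betw (d 0) (carrier M) (carrier (J 0))" using d by (simp add: bij_betw_def)
    then have "C.iso (mk M (d 0) (J 0))"
      using iso_iff[OF a] bij_betw_cong[of "carrier M" "afun (mk M (d 0) (J 0))" "d 0"] by simp
    moreover have "C.id1 (J 0)" using C.injective_id1 J injective_iff by blast
    ultimately show ?thesis using C.id1_iso[of "mk M (d 0) (J 0)"] by simp
  qed
  moreover have "C.id1 M" if r: "injective_resolution A M 1 J d" for J d
  proof -
    have J: "injective A (J 0)" "injective A (J (Suc 0))" using r unfolding injective_resolution_def by auto
    have d: "d 0 \<in> rmod_hom A M (J 0)" "d (Suc 0) \<in> rmod_hom A (J 0) (J (Suc 0))" "d (Suc 0) ` carrier (J 0) = carrier (J (Suc 0))"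
      "d 0 ` carrier M = {x \<in> carrier (J 0). d (Suc 0) x = \<zero>\<^bsub>J (Suc 0)\<^esub>}" "inj_on (d 0) (carrier M)"
      using r unfolding injective_resolution_def by (auto simp: a_kernel_def')
    show ?thesis unfolding id1_iff using M J d(1,2,3,5)
      by (intro conjI exI[of _ "J 0"] exI[of _ "d 0"] exI[of _ "J (Suc 0)"] exI[of _ "d (Suc 0)"]) (simp_all add: d(4))
  qed
  moreover have "\<exists>J d. injective_resolution A M 1 J d" if "C.id1 M"
  proof -
    from that obtain J0 i J1 p where e: "injective A J0" "injective A J1" "i \<in> rmod_hom A M J0" "inj_on i (carrier M)"
      "p \<in> rmod_hom A J0 J1" "p ` carrier J0 = carrier J1" "\<forall>x\<in>carrier J0. p x = \<zero>\<^bsub>J1\<^esub> \<longleftrightarrow> x \<in> i ` carrier M"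
      unfolding id1_iff by blast
    have "i ` carrier M = {x \<in> carrier J0. p x = \<zero>\<^bsub>J1\<^esub>}" using e(7) rmod_homD(1)[OF e(3)] by blast
    then have "injective_resolution A M 1 (\<lambda>j. if j = 0 then J0 else J1) (\<lambda>j. if j = 0 then i else p)"
      unfolding injective_resolution_def using e(1-6) by (simp add: a_kernel_def')
    then show ?thesis by blast
  qed
  ultimately show ?thesis unfolding inj_dim_def Inf_enat_le_1 by blast
qed

lemma L_part_eq: "L_part A = C.left"
proof -
  have "pd A W \<le> 1 \<longleftrightarrow> C.pd1 W" if "W \<in> ind A" for W using pd_le_1_iff that by (simp add: ind_def)
  then show ?thesis unfolding L_part_def C.left_def ind_path_iff ind_iff
    using C.step_relpow_indec' by blast
qed

lemma R_part_eq: "R_part A = C.right"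
proof -
  have "inj_dim A W \<le> 1 \<longleftrightarrow> C.id1 W" if "W \<in> ind A" for W using inj_dim_le_1_iff that by (simp add: ind_def)
  then show ?thesis unfolding R_part_def C.right_def ind_path_iff ind_iff
    using C.step_relpow_indec by blast
qed

end


section \<open>The quotient by the ideal of an idempotent\<close>

locale idempotent_quotient = fd_alg K A for K :: "'k ring" and A :: "('k, 'a) module" +
  fixes e :: 'a
  assumes e_closed: "e \<in> carrier A" and e_idem: "e \<otimes>\<^bsub>A\<^esub> e = e"
begin

abbreviation I :: "'a set" where "I \<equiv> AeA A e"
abbreviation B :: "('k, 'a set) module" where "B \<equiv> quot_algebra A I"
abbreviation cs :: "'a \<Rightarrow> 'a set" where "cs a \<equiv> I +>\<^bsub>A\<^esub> a"

lemma I_ideal: "ideal I A" by (rule A.AeA_ideal[OF e_closed])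

end

sublocale idempotent_quotient \<subseteq> I: ideal "AeA A e" A
  by (rule I_ideal)

sublocale idempotent_quotient \<subseteq> B: fd_alg K "quot_algebra A (AeA A e)"
  by (intro fd_alg.intro AeA_quot_fd_algebra e_closed)

context idempotent_quotient
begin

lemma I_subset: "a \<in> I \<Longrightarrow> a \<in> carrier A" using I.a_subset by blast

lemma B_carrier: "carrier B = cs ` carrier A"
  by (auto simp: FactRing_def A_RCOSETS_def')

lemma cs_closed: "a \<in> carrier A \<Longrightarrow> cs a \<in> carrier B"
  unfolding B_carrier by (rule imageI)

lemma cs_add: "a \<in> carrier A \<Longrightarrow> b \<in> carrier A \<Longrightarrow> cs a \<oplus>\<^bsub>B\<^esub> cs b = cs (a \<oplus>\<^bsub>A\<^esub> b)"
  by (simp add: FactRing_def I.a_rcos_sum)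

lemma cs_mult: "a \<in> carrier A \<Longrightarrow> b \<in> carrier A \<Longrightarrow> cs a \<otimes>\<^bsub>B\<^esub> cs b = cs (a \<otimes>\<^bsub>A\<^esub> b)"
  by (simp add: FactRing_def I.rcoset_mult_add)

lemma cs_one: "\<one>\<^bsub>B\<^esub> = cs \<one>\<^bsub>A\<^esub>"
  by (simp add: FactRing_def)

lemma cs_I: "a \<in> I \<Longrightarrow> cs a = \<zero>\<^bsub>B\<^esub>"
  using I.a_rcos_const by (simp add: FactRing_def)

lemma cs_eqD:
  assumes "a \<in> carrier A" "b \<in> carrier A" "cs a = cs b" obtains c where "c \<in> I" "a = c \<oplus>\<^bsub>A\<^esub> b"
proof -
  have "a \<in> cs b" using I.a_rcos_self[OF assms(1)] assms(3) by simp
  then show ?thesis using that by (auto simp: a_r_coset_def r_coset_def)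
qed

definition killed :: "('a, 'm) rmodule \<Rightarrow> bool" where
  "killed M \<longleftrightarrow> (\<forall>x\<in>carrier M. \<forall>a\<in>I. x \<triangleleft>\<^bsub>M\<^esub> a = \<zero>\<^bsub>M\<^esub>)"

lemma killedD: "killed M \<Longrightarrow> x \<in> carrier M \<Longrightarrow> a \<in> I \<Longrightarrow> x \<triangleleft>\<^bsub>M\<^esub> a = \<zero>\<^bsub>M\<^esub>"
  by (simp add: killed_def)

text \<open>
  An \<open>A\<close>-module and a \<open>B\<close>-module on the same abelian group, with actions that correspond under \<open>A \<rightarrow> B\<close>.  Working
  with this relation instead of a pair of mutually inverse functors makes homomorphisms, submodules and
  indecomposability literally coincide.
\<close>

definition agree :: "('a, 'm) rmodule \<Rightarrow> ('a set, 'm) rmodule \<Rightarrow> bool" where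
  "agree M X \<longleftrightarrow> carrier M = carrier X \<and> zero M = zero X \<and> add M = add X \<and>
     (\<forall>x\<in>carrier X. \<forall>a\<in>carrier A. x \<triangleleft>\<^bsub>M\<^esub> a = x \<triangleleft>\<^bsub>X\<^esub> cs a)"

lemma agreeD:
  assumes "agree M X"
  shows "carrier M = carrier X" "\<zero>\<^bsub>M\<^esub> = \<zero>\<^bsub>X\<^esub>" "add M = add X"
    "\<And>x a. x \<in> carrier X \<Longrightarrow> a \<in> carrier A \<Longrightarrow> x \<triangleleft>\<^bsub>M\<^esub> a = x \<triangleleft>\<^bsub>X\<^esub> cs a"
  using assms unfolding agree_def by auto

lemma agree_hom: assumes M: "agree M X" and N: "agree N Y" shows "rmod_hom A M N = rmod_hom B X Y"
proof -
  have "(\<forall>a\<in>carrier A. f (x \<triangleleft>\<^bsub>M\<^esub> a) = f x \<triangleleft>\<^bsub>N\<^esub> a) \<longleftrightarrow> (\<forall>b\<in>carrier B. f (x \<triangleleft>\<^bsub>X\<^esub> b) = f x \<triangleleft>\<^bsub>Y\<^esub> b)"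
    if "x \<in> carrier X" "f x \<in> carrier Y" for f x
    unfolding B_carrier using that by (simp add: agreeD(4)[OF M] agreeD(4)[OF N])
  then show ?thesis unfolding rmod_hom_def agreeD(1-3)[OF M] agreeD(1-3)[OF N] by blast
qed

lemma agree_iso: "agree M X \<Longrightarrow> agree N Y \<Longrightarrow> rmod_iso A M N = rmod_iso B X Y"
  unfolding rmod_iso_def by (simp only: agree_hom agreeD(1))

lemma agree_submod: assumes M: "agree M X" shows "submod A U M \<longleftrightarrow> submod B U X"
proof -
  have "additive_subgroup U M \<longleftrightarrow> additive_subgroup U X"
    by (simp add: additive_subgroup_def subgroup_def m_inv_def agreeD(1-3)[OF M])
  moreover have "(\<forall>u\<in>U. \<forall>a\<in>carrier A. u \<triangleleft>\<^bsub>M\<^esub> a \<in> U) \<longleftrightarrow> (\<forall>u\<in>U. \<forall>b\<in>carrier B. u \<triangleleft>\<^bsub>X\<^esub> b \<in> U)"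
    if "additive_subgroup U X"
  proof -
    have "U \<subseteq> carrier X" using additive_subgroup.a_subset[OF that] .
    then show ?thesis unfolding B_carrier using agreeD(4)[OF M] by (auto simp: subset_iff)
  qed
  ultimately show ?thesis unfolding submod_def by blast
qed

lemma agree_indecomposable: assumes M: "agree M X" shows "indecomposable A M \<longleftrightarrow> indecomposable B X"
  by (simp add: indecomposable_def agree_submod[OF M] set_add_defs agreeD(1-3)[OF M])

lemma agree_fin_gen:
  assumes M: "agree M X" and X: "right_module B X" shows "fin_gen A M \<longleftrightarrow> fin_gen B X"
proof -
  interpret X: right_module B X by (rule X)
  have fs: "finsum M = finsum X" by (intro ext) (simp add: finsum_def finprod_def agreeD(1-3)[OF M])
  have eq: "(\<Oplus>\<^bsub>M\<^esub>i\<in>{..<n}. x i \<triangleleft>\<^bsub>M\<^esub> a i) = (\<Oplus>\<^bsub>X\<^esub>i\<in>{..<n}. x i \<triangleleft>\<^bsub>X\<^esub> cs (a i))"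
    if "x \<in> {..<n} \<rightarrow> carrier X" "a \<in> {..<n} \<rightarrow> carrier A" for n :: nat and x a
    unfolding fs using that by (intro X.M.finsum_cong') (auto simp: agreeD(4)[OF M] Pi_iff cs_closed intro!: X.ract_closed simp del: quot_algebra_simps)
  have main: "(\<exists>a\<in>{..<n} \<rightarrow> carrier A. m = (\<Oplus>\<^bsub>M\<^esub>i\<in>{..<n}. x i \<triangleleft>\<^bsub>M\<^esub> a i)) \<longleftrightarrow>
      (\<exists>b\<in>{..<n} \<rightarrow> carrier B. m = (\<Oplus>\<^bsub>X\<^esub>i\<in>{..<n}. x i \<triangleleft>\<^bsub>X\<^esub> b i))" (is "?l \<longleftrightarrow> ?r")
    if x: "x \<in> {..<n} \<rightarrow> carrier X" for n :: nat and x m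
  proof
    assume ?l
    then obtain a where a: "a \<in> {..<n} \<rightarrow> carrier A" "m = (\<Oplus>\<^bsub>M\<^esub>i\<in>{..<n}. x i \<triangleleft>\<^bsub>M\<^esub> a i)" by blast
    have "(\<lambda>i. cs (a i)) \<in> {..<n} \<rightarrow> carrier B" using a(1) cs_closed by blast
    then show ?r using a(2) unfolding eq[OF x a(1)] by (intro bexI[of _ "\<lambda>i. cs (a i)"])
  next
    assume ?r
    then obtain b where b: "b \<in> {..<n} \<rightarrow> carrier B" "m = (\<Oplus>\<^bsub>X\<^esub>i\<in>{..<n}. x i \<triangleleft>\<^bsub>X\<^esub> b i)" by blast
    have "\<forall>i\<in>{..<n}. \<exists>a. a \<in> carrier A \<and> cs a = b i" using b(1) unfolding B_carrier by blast
    then obtain a where a: "\<forall>i\<in>{..<n}. a i \<in> carrier A \<and> cs (a i) = b i" by (rule bchoice[THEN exE])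
    have a': "a \<in> {..<n} \<rightarrow> carrier A" using a by blast
    have "(\<Oplus>\<^bsub>X\<^esub>i\<in>{..<n}. x i \<triangleleft>\<^bsub>X\<^esub> b i) = (\<Oplus>\<^bsub>X\<^esub>i\<in>{..<n}. x i \<triangleleft>\<^bsub>X\<^esub> cs (a i))"
      using a x b(1) by (intro X.M.finsum_cong') (auto simp: Pi_iff cs_closed intro!: X.ract_closed simp del: quot_algebra_simps)
    then show ?l using b(2) eq[OF x a'] a' by (intro bexI[of _ a]) simp_all
  qed
  show ?thesis unfolding fin_gen_def agreeD(1)[OF M]
    by (intro arg_cong[where f = Ex] ext conj_cong ball_cong refl main)
qed

definition res :: "('a set, 'm) rmodule \<Rightarrow> ('a, 'm) rmodule" where
  "res X = \<lparr>carrier = carrier X, mult = undefined, one = undefined, zero = \<zero>\<^bsub>X\<^esub>, add = add X,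
     ract = (\<lambda>x a. x \<triangleleft>\<^bsub>X\<^esub> cs a)\<rparr>"

definition ext :: "('a, 'm) rmodule \<Rightarrow> ('a set, 'm) rmodule" where
  "ext M = \<lparr>carrier = carrier M, mult = undefined, one = undefined, zero = \<zero>\<^bsub>M\<^esub>, add = add M,
     ract = (\<lambda>x b. x \<triangleleft>\<^bsub>M\<^esub> (SOME a. a \<in> carrier A \<and> cs a = b))\<rparr>"

lemma agree_abelian_group: assumes M: "agree M X" shows "abelian_group M \<longleftrightarrow> abelian_group X"
  by (simp add: abelian_group_def abelian_monoid_def abelian_group_axioms_def comm_group_def group_def group_axioms_def
      comm_monoid_def comm_monoid_axioms_def Group.monoid_def Units_def agreeD(1-3)[OF M])

lemma agree_right_module:
  assumes M: "agree M X"
  shows "right_module B X \<Longrightarrow> right_module A M"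
    and "right_module A M \<Longrightarrow> right_module B X"
proof -
  note d = agreeD(4)[OF M]
  show "right_module A M" if X: "right_module B X"
  proof -
    interpret X: right_module B X by (rule X)
    have "abelian_group M" using agree_abelian_group[OF M] X.M.abelian_group_axioms by simp
    moreover have "right_module_axioms A M"
      unfolding right_module_axioms_def agreeD(1-3)[OF M]
      using X.ract_closed X.ract_add X.add_ract X.ract_mult X.ract_one
      by (simp add: d cs_closed cs_add[symmetric] cs_mult[symmetric] cs_one[symmetric] del: quot_algebra_simps)
    ultimately show ?thesis by (intro right_module.intro A.ring_axioms)
  qed
  show "right_module B X" if M': "right_module A M"
  proof -
    interpret M: right_module A M by (rule M')
    have im: "(\<forall>b. b \<in> cs ` carrier A \<longrightarrow> Q b) \<longleftrightarrow> (\<forall>a\<in>carrier A. Q (cs a))" for Q by blast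
    have "abelian_group X" using agree_abelian_group[OF M] M.M.abelian_group_axioms by simp
    moreover have "right_module_axioms B X"
      unfolding right_module_axioms_def agreeD(1-3)[OF M, symmetric] B_carrier
      using M.ract_closed M.ract_add M.add_ract M.ract_mult M.ract_one
      by (simp add: d[folded agreeD(1)[OF M], symmetric] cs_add cs_mult cs_one im del: quot_algebra_simps)
    ultimately show ?thesis by (intro right_module.intro B.A.ring_axioms)
  qed
qed

lemma agree_fgmod: "agree M X \<Longrightarrow> M \<in> fgmod A \<longleftrightarrow> X \<in> fgmod B"
  using agree_right_module agree_fin_gen unfolding fgmod_def by blast

lemma agree_ind: "agree M X \<Longrightarrow> M \<in> ind A \<longleftrightarrow> X \<in> ind B"
  using agree_fgmod agree_indecomposable unfolding ind_def by blast

lemma agree_killed: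
  assumes M: "agree M X" and X: "right_module B X" shows "killed M"
proof -
  interpret X: right_module B X by (rule X)
  show ?thesis unfolding killed_def agreeD(1,2)[OF M] using agreeD(4)[OF M] I_subset X.ract_zero by (simp add: cs_I del: quot_algebra_simps)
qed

lemma agree_res: "agree (res X) X"
  by (simp add: agree_def res_def)

lemma agree_ext:
  assumes M: "right_module A M" and k: "killed M" shows "agree M (ext M)"
proof -
  interpret M: right_module A M by (rule M)
  have "x \<triangleleft>\<^bsub>M\<^esub> a = x \<triangleleft>\<^bsub>M\<^esub> (SOME a'. a' \<in> carrier A \<and> cs a' = cs a)" if x: "x \<in> carrier M" and a: "a \<in> carrier A" for x a
  proof -
    define a' where "a' = (SOME a'. a' \<in> carrier A \<and> cs a' = cs a)"
    have "\<exists>a'. a' \<in> carrier A \<and> cs a' = cs a" using a by blast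
    from someI_ex[OF this] have a': "a' \<in> carrier A" "cs a = cs a'" unfolding a'_def by auto
    obtain c where c: "c \<in> I" "a = c \<oplus>\<^bsub>A\<^esub> a'" using cs_eqD[OF a a'] by blast
    have "x \<triangleleft>\<^bsub>M\<^esub> a = x \<triangleleft>\<^bsub>M\<^esub> a'"
      unfolding c(2) using killedD[OF k x c(1)] M.add_ract[OF x I_subset[OF c(1)] a'(1)] M.ract_closed[OF x a'(1)] by simp
    then show ?thesis unfolding a'_def .
  qed
  then show ?thesis by (simp add: agree_def ext_def)
qed

lemma res_killed: "X \<in> fgmod B \<Longrightarrow> killed (res X)"
  by (rule agree_killed[OF agree_res B.fgmodD(1)])

lemma res_fgmod: "X \<in> fgmod B \<Longrightarrow> res X \<in> fgmod A"
  using agree_fgmod[OF agree_res] by blast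

lemma step_res: assumes "(X, Y) \<in> B.C.step" shows "(res X, res Y) \<in> C.step"
  using assms unfolding B.step_iff step_iff agree_hom[OF agree_res agree_res] agree_iso[OF agree_res agree_res]
    agree_ind[OF agree_res] agreeD(1,2)[OF agree_res] .

lemma relpow_step_res: "(X, Y) \<in> B.C.step ^^ s \<Longrightarrow> (res X, res Y) \<in> C.step ^^ s"
proof (induction s arbitrary: Y)
  case (Suc s)
  then obtain Z where "(X, Z) \<in> B.C.step ^^ s" "(Z, Y) \<in> B.C.step" by auto
  then show ?case using Suc.IH step_res by auto
qed simp

text \<open>
  The ideal is generated by the products \<open>(a e) (e b)\<close>, so an additive condition on its elements may be checked on
  products of two of them.
\<close>

lemma idempotent_action:
  assumes M: "right_module A M" and U: "submod A U M" and x: "x \<in> carrier M"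
    and g: "\<And>a b. a \<in> I \<Longrightarrow> b \<in> I \<Longrightarrow> x \<triangleleft>\<^bsub>M\<^esub> (a \<otimes>\<^bsub>A\<^esub> b) \<in> U" and c: "c \<in> I"
  shows "x \<triangleleft>\<^bsub>M\<^esub> c \<in> U"
proof -
  interpret M: right_module A M by (rule M)
  note U' = submodD[OF M U]
  let ?H = "{c \<in> carrier A. x \<triangleleft>\<^bsub>M\<^esub> c \<in> U}"
  have m: "x \<triangleleft>\<^bsub>M\<^esub> (\<ominus>\<^bsub>A\<^esub> c) \<in> U" if "c \<in> carrier A" "x \<triangleleft>\<^bsub>M\<^esub> c \<in> U" for c
  proof -
    have "c \<otimes>\<^bsub>A\<^esub> (\<ominus>\<^bsub>A\<^esub> \<one>\<^bsub>A\<^esub>) = \<ominus>\<^bsub>A\<^esub> c" using A.r_minus[OF that(1) A.one_closed] that(1) by simp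
    then have "x \<triangleleft>\<^bsub>M\<^esub> (\<ominus>\<^bsub>A\<^esub> c) = (x \<triangleleft>\<^bsub>M\<^esub> c) \<triangleleft>\<^bsub>M\<^esub> (\<ominus>\<^bsub>A\<^esub> \<one>\<^bsub>A\<^esub>)" using M.ract_mult[OF x that(1), of "\<ominus>\<^bsub>A\<^esub> \<one>\<^bsub>A\<^esub>"] by simp
    then show ?thesis using U'(4)[OF that(2), of "\<ominus>\<^bsub>A\<^esub> \<one>\<^bsub>A\<^esub>"] by simp
  qed
  have "subgroup ?H (add_monoid A)"
    by (rule subgroup.intro) (use U'(2,3) m in \<open>auto simp: M.add_ract x M.ract_zero a_inv_def[symmetric]\<close>)
  moreover have "{a \<otimes>\<^bsub>A\<^esub> e \<otimes>\<^bsub>A\<^esub> b | a b. a \<in> carrier A \<and> b \<in> carrier A} \<subseteq> ?H"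
  proof
    fix y assume "y \<in> {a \<otimes>\<^bsub>A\<^esub> e \<otimes>\<^bsub>A\<^esub> b | a b. a \<in> carrier A \<and> b \<in> carrier A}"
    then obtain a b where y: "y = a \<otimes>\<^bsub>A\<^esub> e \<otimes>\<^bsub>A\<^esub> b" "a \<in> carrier A" "b \<in> carrier A" by blast
    have gen: "a \<otimes>\<^bsub>A\<^esub> e \<otimes>\<^bsub>A\<^esub> b \<in> I" if "a \<in> carrier A" "b \<in> carrier A" for a b
      unfolding AeA_def by (rule generate.incl) (use that in blast)
    have "a \<otimes>\<^bsub>A\<^esub> e \<in> I" "e \<otimes>\<^bsub>A\<^esub> b \<in> I"
      using gen[OF y(2) A.one_closed] gen[OF A.one_closed y(3)] y e_closed by simp_all
    moreover have "y = (a \<otimes>\<^bsub>A\<^esub> e) \<otimes>\<^bsub>A\<^esub> (e \<otimes>\<^bsub>A\<^esub> b)"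
    proof -
      have "(a \<otimes>\<^bsub>A\<^esub> e) \<otimes>\<^bsub>A\<^esub> (e \<otimes>\<^bsub>A\<^esub> b) = a \<otimes>\<^bsub>A\<^esub> (e \<otimes>\<^bsub>A\<^esub> e) \<otimes>\<^bsub>A\<^esub> b" using y e_closed by (simp add: A.m_assoc)
      then show ?thesis unfolding e_idem y(1) by simp
    qed
    ultimately show "y \<in> ?H" using g y e_closed by simp
  qed
  ultimately have "I \<subseteq> ?H" unfolding AeA_def by (intro A.add.generate_subgroup_incl)
  then show ?thesis using c by blast
qed

text \<open>
  The submodule \<open>M I\<close>, as the least submodule that contains all \<open>x a\<close> with \<open>a \<in> I\<close>.
\<close>

definition MI :: "('a, 'm) rmodule \<Rightarrow> 'm set" where
  "MI M = \<Inter>{U. submod A U M \<and> (\<forall>x\<in>carrier M. \<forall>a\<in>I. x \<triangleleft>\<^bsub>M\<^esub> a \<in> U)}"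

lemma MI_least: "submod A U M \<Longrightarrow> (\<And>x a. x \<in> carrier M \<Longrightarrow> a \<in> I \<Longrightarrow> x \<triangleleft>\<^bsub>M\<^esub> a \<in> U) \<Longrightarrow> MI M \<subseteq> U"
  unfolding MI_def by blast

lemma MI_mem: "x \<in> carrier M \<Longrightarrow> a \<in> I \<Longrightarrow> x \<triangleleft>\<^bsub>M\<^esub> a \<in> MI M"
  unfolding MI_def by blast

lemma MI_submod: assumes M: "right_module A M" shows "submod A (MI M) M"
proof -
  interpret M: right_module A M by (rule M)
  have "submod A (carrier M) M" by (rule submodI[OF M]) (auto simp: M.ract_closed)
  then have "MI M \<subseteq> carrier M" by (rule MI_least) (simp add: M.ract_closed I_subset)
  then show ?thesis
    by (rule submodI[OF M]) (auto simp: MI_def dest: submodD(2-4)[OF M])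
qed

lemma MI_hom:
  assumes M: "right_module A M" and N: "right_module A N" "killed N" and f: "f \<in> rmod_hom A M N" and x: "x \<in> MI M"
  shows "f x = \<zero>\<^bsub>N\<^esub>"
proof -
  interpret M: right_module A M by (rule M)
  have "MI M \<subseteq> {x \<in> carrier M. f x = \<zero>\<^bsub>N\<^esub>}"
    by (rule MI_least[OF kernel_submod[OF M N(1) f]])
      (simp add: M.ract_closed I_subset rmod_homD[OF f] killedD[OF N(2)])
  then show ?thesis using x by blast
qed

definition MI_quot :: "('a, 'm) rmodule \<Rightarrow> ('a, 'm) rmodule" where
  "MI_quot M = qmod M (MI M)"

lemma
  assumes M: "M \<in> fgmod A"
  shows MI_quot_fgmod: "MI_quot M \<in> fgmod A" and MI_quot_module: "right_module A (MI_quot M)" and MI_quot_killed: "killed (MI_quot M)"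
    and MI_quot_hom: "qrep M (MI M) \<in> rmod_hom A M (MI_quot M)" and MI_quot_surj: "qrep M (MI M) ` carrier M = carrier (MI_quot M)"
    and MI_quot_zero: "x \<in> carrier M \<Longrightarrow> qrep M (MI M) x = \<zero>\<^bsub>MI_quot M\<^esub> \<longleftrightarrow> x \<in> MI M"
proof -
  note M' = fgmodD(1)[OF M]
  interpret M: right_module A M by (rule M')
  note U = MI_submod[OF M'] and Q = quotient_module[OF M' MI_submod[OF M'], folded MI_quot_def]
  show "MI_quot M \<in> fgmod A" unfolding MI_quot_def by (rule quotient_fgmod[OF M U])
  show "right_module A (MI_quot M)" by (rule Q)
  show h: "qrep M (MI M) \<in> rmod_hom A M (MI_quot M)" by (rule Q)
  show s: "qrep M (MI M) ` carrier M = carrier (MI_quot M)" by (simp add: MI_quot_def)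
  show "x \<in> carrier M \<Longrightarrow> qrep M (MI M) x = \<zero>\<^bsub>MI_quot M\<^esub> \<longleftrightarrow> x \<in> MI M" by (rule Q)
  show "killed (MI_quot M)" unfolding killed_def s[symmetric]
  proof (intro ballI)
    fix y a assume y: "y \<in> qrep M (MI M) ` carrier M" and a: "a \<in> I"
    obtain x where x: "y = qrep M (MI M) x" "x \<in> carrier M" using y by (rule imageE)
    show "y \<triangleleft>\<^bsub>MI_quot M\<^esub> a = \<zero>\<^bsub>MI_quot M\<^esub>"
      using rmod_homD(3)[OF h x(2) I_subset[OF a]] Q(3)[OF M.ract_closed[OF x(2) I_subset[OF a]]] MI_mem[OF x(2) a] x(1) by simp
  qed
qed

lemma MI_quot_factor:
  assumes M: "M \<in> fgmod A" and N: "right_module A N" "killed N" and f: "f \<in> rmod_hom A M N"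
  obtains h where "h \<in> rmod_hom A (MI_quot M) N" "\<And>x. x \<in> carrier M \<Longrightarrow> h (qrep M (MI M) x) = f x"
proof -
  note M' = fgmodD(1)[OF M]
  have "\<exists>h\<in>rmod_hom A (MI_quot M) N. \<forall>x\<in>carrier M. h (qrep M (MI M) x) = f x"
    using MI_quot_zero[OF M] MI_hom[OF M' N f]
    by (intro factor_through_surj[OF M' MI_quot_module[OF M] N(1) MI_quot_hom[OF M] MI_quot_surj[OF M] f]) simp
  then show ?thesis using that by blast
qed

lemma agree_MI_quot: "M \<in> fgmod A \<Longrightarrow> agree (MI_quot M) (ext (MI_quot M))"
  by (rule agree_ext[OF MI_quot_module MI_quot_killed])

text \<open>
  The functor \<open>M \<mapsto> M/M I\<close> is left adjoint to the exact inclusion of \<open>mod B\<close>, so it preserves projectives.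
\<close>

lemma MI_quot_projective:
  assumes P: "projective A P" shows "projective B (ext (MI_quot P))"
  unfolding projective_def
proof (intro conjI ballI impI)
  have PO: "P \<in> fgmod A" using P by (simp add: projective_def)
  note ag = agree_MI_quot[OF PO]
  let ?q = "qrep P (MI P)"
  show "ext (MI_quot P) \<in> fgmod B" using agree_fgmod[OF ag] MI_quot_fgmod[OF PO] by simp
  fix M N g f assume M: "M \<in> fgmod B" and N: "N \<in> fgmod B" and g: "g \<in> rmod_hom B M N" and f: "f \<in> rmod_hom B (ext (MI_quot P)) N"
    and s: "g ` carrier M = carrier N"
  have g': "g \<in> rmod_hom A (res M) (res N)" and f': "f \<in> rmod_hom A (MI_quot P) (res N)"
    using g f unfolding agree_hom[OF agree_res agree_res] agree_hom[OF ag agree_res] .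
  have s': "g ` carrier (res M) = carrier (res N)" using s by (simp add: agreeD(1)[OF agree_res])
  obtain h where h: "h \<in> rmod_hom A P (res M)" "\<forall>x\<in>carrier P. g (h x) = f (?q x)"
    using P[unfolded projective_def, THEN conjunct2, rule_format, OF res_fgmod[OF M] res_fgmod[OF N] g'
        rmod_hom_comp[OF MI_quot_hom[OF PO] f'] s'] by blast
  obtain k where k: "k \<in> rmod_hom A (MI_quot P) (res M)" "\<And>x. x \<in> carrier P \<Longrightarrow> k (?q x) = h x"
    using MI_quot_factor[OF PO fgmodD(1)[OF res_fgmod[OF M]] res_killed[OF M] h(1)] by blast
  have "g (k y) = f y" if "y \<in> carrier (MI_quot P)" for y
  proof -
    have "y \<in> ?q ` carrier P" using that MI_quot_surj[OF PO] by simp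
    then obtain x where "y = ?q x" "x \<in> carrier P" by (rule imageE)
    then show ?thesis using k(2) h(2) by simp
  qed
  then show "\<exists>h\<in>rmod_hom B (ext (MI_quot P)) M. \<forall>x\<in>carrier (ext (MI_quot P)). g (h x) = f x"
    using k(1) unfolding agree_hom[OF ag agree_res] agreeD(1)[OF ag, symmetric] by blast
qed

text \<open>
  Applying \<open>M \<mapsto> M/M I\<close> to \<open>0 \<rightarrow> P1 \<rightarrow> P0 \<rightarrow> M \<rightarrow> 0\<close> could fail to be exact only on the left, where \<open>P0 I \<subseteq> P1 I\<close>
  saves it.
\<close>

lemma pd1_descends:
  assumes ag: "agree M X" and X: "X \<in> fgmod B" and pd: "C.pd1 M" shows "B.C.pd1 X"
proof -
  obtain P1 i P0 p where M: "M \<in> fgmod A" and P: "projective A P1" "projective A P0"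
    and i: "i \<in> rmod_hom A P1 P0" "inj_on i (carrier P1)" and p: "p \<in> rmod_hom A P0 M" "p ` carrier P0 = carrier M"
    and e': "\<forall>x\<in>carrier P0. p x = \<zero>\<^bsub>M\<^esub> \<longleftrightarrow> x \<in> i ` carrier P1"
    using pd unfolding pd1_iff by blast
  note e = bspec[OF e']
  have O: "P1 \<in> fgmod A" "P0 \<in> fgmod A" using P by (simp_all add: projective_def)
  note m = fgmodD(1)[OF O(1)] fgmodD(1)[OF O(2)] fgmodD(1)[OF M]
  interpret P0: right_module A P0 by (rule m(2))
  interpret P1: right_module A P1 by (rule m(1))
  have kM: "killed M" by (rule agree_killed[OF ag B.fgmodD(1)[OF X]])
  let ?q0 = "qrep P0 (MI P0)" and ?q1 = "qrep P1 (MI P1)"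
  obtain j where j: "j \<in> rmod_hom A (MI_quot P1) (MI_quot P0)" "\<And>x. x \<in> carrier P1 \<Longrightarrow> j (?q1 x) = ?q0 (i x)"
    using MI_quot_factor[OF O(1) MI_quot_module[OF O(2)] MI_quot_killed[OF O(2)] rmod_hom_comp[OF i(1) MI_quot_hom[OF O(2)]]] by blast
  obtain r where r: "r \<in> rmod_hom A (MI_quot P0) M" "\<And>x. x \<in> carrier P0 \<Longrightarrow> r (?q0 x) = p x"
    using MI_quot_factor[OF O(2) m(3) kM p(1)] by blast
  have q1: "\<exists>x. x \<in> carrier P1 \<and> y = ?q1 x" if "y \<in> carrier (MI_quot P1)" for y
    using that MI_quot_surj[OF O(1)] by blast
  have q0: "\<exists>x. x \<in> carrier P0 \<and> y = ?q0 x" if "y \<in> carrier (MI_quot P0)" for y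
    using that MI_quot_surj[OF O(2)] by blast
  \<comment> \<open>\<open>P0 I\<close> is contained in \<open>i P1\<close> because \<open>M I = 0\<close>; since \<open>I = I I\<close> it is even contained in \<open>i (P1 I)\<close>\<close>
  have sub: "MI P0 \<subseteq> i ` MI P1"
  proof (rule MI_least)
    note U = submodD[OF m(1) MI_submod[OF m(1)]]
    have "right_module A (P1\<lparr>carrier := MI P1\<rparr>)" using sub_right_module[OF m(1) MI_submod[OF m(1)]] .
    moreover have "i \<in> rmod_hom A (P1\<lparr>carrier := MI P1\<rparr>) P0"
      using U(1) by (intro rmod_homI) (auto simp: rmod_homD[OF i(1)] subset_iff)
    ultimately show sm: "submod A (i ` MI P1) P0" using image_submod[OF _ m(2)] by fastforce
    show "x \<triangleleft>\<^bsub>P0\<^esub> c \<in> i ` MI P1" if x: "x \<in> carrier P0" and c: "c \<in> I" for x c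
    proof (rule idempotent_action[OF m(2) sm x _ c])
      fix a b assume ab: "a \<in> I" "b \<in> I"
      have xa: "x \<triangleleft>\<^bsub>P0\<^esub> a \<in> carrier P0" using P0.ract_closed[OF x I_subset[OF ab(1)]] .
      have "p (x \<triangleleft>\<^bsub>P0\<^esub> a) = \<zero>\<^bsub>M\<^esub>"
        using rmod_homD(3)[OF p(1) x I_subset[OF ab(1)]] killedD[OF kM rmod_homD(1)[OF p(1) x] ab(1)] by simp
      then have "x \<triangleleft>\<^bsub>P0\<^esub> a \<in> i ` carrier P1" using e[OF xa] by simp
      then obtain y where y: "x \<triangleleft>\<^bsub>P0\<^esub> a = i y" "y \<in> carrier P1" by (rule imageE)
      have "x \<triangleleft>\<^bsub>P0\<^esub> (a \<otimes>\<^bsub>A\<^esub> b) = i (y \<triangleleft>\<^bsub>P1\<^esub> b)"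
        using P0.ract_mult[OF x I_subset[OF ab(1)] I_subset[OF ab(2)]] rmod_homD(3)[OF i(1) y(2) I_subset[OF ab(2)]] y(1) by simp
      then show "x \<triangleleft>\<^bsub>P0\<^esub> (a \<otimes>\<^bsub>A\<^esub> b) \<in> i ` MI P1" using MI_mem[OF y(2) ab(2)] by simp
    qed
  qed
  have "inj_on j (carrier (MI_quot P1))"
    unfolding rmod_hom_inj_iff[OF MI_quot_module[OF O(1)] MI_quot_module[OF O(2)] j(1)]
  proof (intro ballI impI)
    fix y assume y: "y \<in> carrier (MI_quot P1)" "j y = \<zero>\<^bsub>MI_quot P0\<^esub>"
    obtain x where x: "x \<in> carrier P1" "y = ?q1 x" using q1[OF y(1)] by blast
    have "?q0 (i x) = \<zero>\<^bsub>MI_quot P0\<^esub>" using j(2)[OF x(1)] y(2) x(2) by simp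
    then have "i x \<in> i ` MI P1" using MI_quot_zero[OF O(2) rmod_homD(1)[OF i(1) x(1)]] sub by blast
    then obtain x' where x': "i x = i x'" "x' \<in> MI P1" by (rule imageE)
    have "x' \<in> carrier P1" using x'(2) submodD(1)[OF m(1) MI_submod[OF m(1)]] by blast
    then have "x = x'" using i(2) x(1) x'(1) by (auto dest: inj_onD)
    then show "y = \<zero>\<^bsub>MI_quot P1\<^esub>" using MI_quot_zero[OF O(1) x(1)] x'(2) x(2) by simp
  qed
  moreover have "r ` carrier (MI_quot P0) = carrier M"
  proof -
    have "r ` ?q0 ` carrier P0 = p ` carrier P0" unfolding image_image by (rule image_cong) (simp_all add: r(2))
    then show ?thesis unfolding MI_quot_surj[OF O(2)] p(2) .
  qed
  moreover have "r y = \<zero>\<^bsub>M\<^esub> \<longleftrightarrow> y \<in> j ` carrier (MI_quot P1)" if y: "y \<in> carrier (MI_quot P0)" for y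
  proof
    obtain x where x: "x \<in> carrier P0" "y = ?q0 x" using q0[OF y] by blast
    assume "r y = \<zero>\<^bsub>M\<^esub>"
    then have "x \<in> i ` carrier P1" using e[OF x(1)] r(2)[OF x(1)] x(2) by simp
    then obtain z where z: "x = i z" "z \<in> carrier P1" by (rule imageE)
    have "y = j (?q1 z)" using j(2)[OF z(2)] x(2) z(1) by simp
    then show "y \<in> j ` carrier (MI_quot P1)" using rmod_homD(1)[OF MI_quot_hom[OF O(1)] z(2)] by (rule image_eqI)
  next
    assume "y \<in> j ` carrier (MI_quot P1)"
    then obtain w where w: "y = j w" "w \<in> carrier (MI_quot P1)" by (rule imageE)
    obtain z where z: "z \<in> carrier P1" "w = ?q1 z" using q1[OF w(2)] by blast
    have iz: "i z \<in> carrier P0" using rmod_homD(1)[OF i(1) z(1)] .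
    have "r y = p (i z)" using j(2)[OF z(1)] r(2)[OF iz] w(1) z(2) by simp
    then show "r y = \<zero>\<^bsub>M\<^esub>" using e[OF iz] z(1) by simp
  qed
  moreover note a0 = agree_MI_quot[OF O(2)] and a1 = agree_MI_quot[OF O(1)]
  ultimately show ?thesis
    unfolding B.pd1_iff using X MI_quot_projective[OF P(1)] MI_quot_projective[OF P(2)] j(1) r(1)
    unfolding agree_hom[OF a1 a0] agree_hom[OF a0 ag] agreeD(1,2)[OF a0] agreeD(1,2)[OF a1] agreeD(1,2)[OF ag]
    by (intro conjI exI[of _ "ext (MI_quot P1)"] exI[of _ j] exI[of _ "ext (MI_quot P0)"] exI[of _ r]) simp_all
qed

text \<open>
  The largest submodule that \<open>I\<close> annihilates; it is the right adjoint to the inclusion of \<open>mod B\<close>, so that it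
  preserves injectives.
\<close>

definition ann :: "('a, 'm) rmodule \<Rightarrow> 'm set" where
  "ann M = {x \<in> carrier M. \<forall>a\<in>I. x \<triangleleft>\<^bsub>M\<^esub> a = \<zero>\<^bsub>M\<^esub>}"

definition ann_sub :: "('a, 'm) rmodule \<Rightarrow> ('a, 'm) rmodule" where
  "ann_sub M = M\<lparr>carrier := ann M\<rparr>"

lemma ann_sub_simps [simp]: "carrier (ann_sub M) = ann M" "\<zero>\<^bsub>ann_sub M\<^esub> = \<zero>\<^bsub>M\<^esub>" "x \<oplus>\<^bsub>ann_sub M\<^esub> y = x \<oplus>\<^bsub>M\<^esub> y"
  "x \<triangleleft>\<^bsub>ann_sub M\<^esub> a = x \<triangleleft>\<^bsub>M\<^esub> a"
  by (simp_all add: ann_sub_def)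

lemma annD: "x \<in> ann M \<Longrightarrow> x \<in> carrier M" "x \<in> ann M \<Longrightarrow> a \<in> I \<Longrightarrow> x \<triangleleft>\<^bsub>M\<^esub> a = \<zero>\<^bsub>M\<^esub>"
  by (simp_all add: ann_def)

lemma ann_submod: assumes M: "right_module A M" shows "submod A (ann M) M"
proof -
  interpret M: right_module A M by (rule M)
  have "x \<triangleleft>\<^bsub>M\<^esub> a \<in> ann M" if x: "x \<in> ann M" and a: "a \<in> carrier A" for x a
  proof -
    have "(x \<triangleleft>\<^bsub>M\<^esub> a) \<triangleleft>\<^bsub>M\<^esub> b = \<zero>\<^bsub>M\<^esub>" if b: "b \<in> I" for b
      using M.ract_mult[OF annD(1)[OF x] a I_subset[OF b]] annD(2)[OF x I.I_l_closed[OF b a]] by simp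
    then show ?thesis using M.ract_closed[OF annD(1)[OF x] a] by (simp add: ann_def)
  qed
  then show ?thesis
    by (intro submodI[OF M]) (auto simp: ann_def I_subset M.zero_ract M.ract_add)
qed

lemma
  assumes M: "M \<in> fgmod A"
  shows ann_sub_fgmod: "ann_sub M \<in> fgmod A" and ann_sub_killed: "killed (ann_sub M)"
    and agree_ann_sub: "agree (ann_sub M) (ext (ann_sub M))"
proof -
  show f: "ann_sub M \<in> fgmod A" unfolding ann_sub_def by (rule sub_fgmod[OF M ann_submod[OF fgmodD(1)[OF M]]])
  show k: "killed (ann_sub M)" by (simp add: killed_def annD)
  show "agree (ann_sub M) (ext (ann_sub M))" by (rule agree_ext[OF fgmodD(1)[OF f] k])
qed

lemma ann_sub_corestrict:
  assumes M: "right_module A M" and N: "killed M" "right_module A N" and f: "f \<in> rmod_hom A M N" shows "f \<in> rmod_hom A M (ann_sub N)"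
proof (rule rmod_homI)
  fix x assume x: "x \<in> carrier M"
  have "f x \<triangleleft>\<^bsub>N\<^esub> a = \<zero>\<^bsub>N\<^esub>" if a: "a \<in> I" for a
    using rmod_homD(3)[OF f x I_subset[OF a]] killedD[OF N(1) x a] rmod_hom_zero[OF M N(2) f] by simp
  then show "f x \<in> carrier (ann_sub N)" using rmod_homD(1)[OF f x] by (simp add: ann_def)
qed (simp_all add: rmod_homD[OF f])

lemma ann_sub_incl: assumes f: "f \<in> rmod_hom A M (ann_sub N)" shows "f \<in> rmod_hom A M N"
proof (rule rmod_homI)
  show "f x \<in> carrier N" if "x \<in> carrier M" for x using annD(1) rmod_homD(1)[OF f that] by simp
qed (simp_all add: rmod_homD(2,3)[OF f])

lemma ann_sub_injective:
  assumes J: "injective A J" shows "injective B (ext (ann_sub J))"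
  unfolding injective_def
proof (intro conjI ballI impI)
  have JO: "J \<in> fgmod A" using J by (simp add: injective_def)
  note ag = agree_ann_sub[OF JO]
  show "ext (ann_sub J) \<in> fgmod B" using agree_fgmod[OF ag] ann_sub_fgmod[OF JO] by simp
  fix M N g f assume M: "M \<in> fgmod B" and N: "N \<in> fgmod B" and g: "g \<in> rmod_hom B M N" and f: "f \<in> rmod_hom B M (ext (ann_sub J))"
    and s: "inj_on g (carrier M)"
  have g': "g \<in> rmod_hom A (res M) (res N)" and f': "f \<in> rmod_hom A (res M) (ann_sub J)"
    using g f unfolding agree_hom[OF agree_res agree_res] agree_hom[OF agree_res ag] .
  have s': "inj_on g (carrier (res M))" using s by (simp add: agreeD(1)[OF agree_res])
  obtain h where h: "h \<in> rmod_hom A (res N) J" "\<forall>x\<in>carrier (res M). h (g x) = f x"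
    using J[unfolded injective_def, THEN conjunct2, rule_format, OF res_fgmod[OF M] res_fgmod[OF N] g'
        ann_sub_incl[OF f'] s'] by blast
  have "h \<in> rmod_hom A (res N) (ann_sub J)"
    by (rule ann_sub_corestrict[OF fgmodD(1)[OF res_fgmod[OF N]] res_killed[OF N] fgmodD(1)[OF JO] h(1)])
  then show "\<exists>h\<in>rmod_hom B N (ext (ann_sub J)). \<forall>x\<in>carrier M. h (g x) = f x"
    using h(2) unfolding agree_hom[OF agree_res ag] agreeD(1)[OF agree_res] by blast
qed

text \<open>
  Taking the annihilated submodule is left exact; surjectivity on the right comes from the idempotency of \<open>I\<close>.
\<close>

lemma id1_descends:
  assumes ag: "agree M X" and X: "X \<in> fgmod B" and idM: "C.id1 M" shows "B.C.id1 X"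
proof -
  obtain J0 i J1 p where M: "M \<in> fgmod A" and J: "injective A J0" "injective A J1"
    and i: "i \<in> rmod_hom A M J0" "inj_on i (carrier M)" and p: "p \<in> rmod_hom A J0 J1" "p ` carrier J0 = carrier J1"
    and e': "\<forall>x\<in>carrier J0. p x = \<zero>\<^bsub>J1\<^esub> \<longleftrightarrow> x \<in> i ` carrier M"
    using idM unfolding id1_iff by blast
  note e = bspec[OF e']
  have O: "J0 \<in> fgmod A" "J1 \<in> fgmod A" using J by (simp_all add: injective_def)
  note m = fgmodD(1)[OF O(1)] fgmodD(1)[OF O(2)] fgmodD(1)[OF M]
  interpret J0: right_module A J0 by (rule m(1))
  interpret M: right_module A M by (rule m(3))
  have kM: "killed M" by (rule agree_killed[OF ag B.fgmodD(1)[OF X]])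
  have i': "i \<in> rmod_hom A M (ann_sub J0)" by (rule ann_sub_corestrict[OF m(3) kM m(1) i(1)])
  have "p \<in> rmod_hom A (ann_sub J0) J1" by (rule rmod_homI) (simp_all add: rmod_homD[OF p(1)] annD)
  then have p': "p \<in> rmod_hom A (ann_sub J0) (ann_sub J1)"
    by (rule ann_sub_corestrict[OF fgmodD(1)[OF ann_sub_fgmod[OF O(1)]] ann_sub_killed[OF O(1)] m(2)])
  \<comment> \<open>if \<open>p x\<close> is annihilated by \<open>I\<close> then \<open>x I\<close> lies in the image of \<open>M\<close>, so \<open>x I I = 0\<close>, and \<open>I I = I\<close>\<close>
  have "p ` ann J0 = ann J1"
  proof
    show "p ` ann J0 \<subseteq> ann J1" using rmod_homD(1)[OF p'] by auto
    show "ann J1 \<subseteq> p ` ann J0"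
    proof
      fix y assume y: "y \<in> ann J1"
      then have "y \<in> p ` carrier J0" using annD(1) p(2) by simp
      then obtain x where x: "y = p x" "x \<in> carrier J0" by (rule imageE)
      have z: "submod A {\<zero>\<^bsub>J0\<^esub>} J0" by (rule submodI[OF m(1)]) (auto simp: J0.zero_ract)
      have "x \<triangleleft>\<^bsub>J0\<^esub> c \<in> {\<zero>\<^bsub>J0\<^esub>}" if c: "c \<in> I" for c
      proof (rule idempotent_action[OF m(1) z x(2) _ c])
        fix a b assume ab: "a \<in> I" "b \<in> I"
        have "p (x \<triangleleft>\<^bsub>J0\<^esub> a) = \<zero>\<^bsub>J1\<^esub>" using rmod_homD(3)[OF p(1) x(2) I_subset[OF ab(1)]] annD(2)[OF y ab(1)] x(1) by simp
        then have "x \<triangleleft>\<^bsub>J0\<^esub> a \<in> i ` carrier M" using e[OF J0.ract_closed[OF x(2) I_subset[OF ab(1)]]] by simp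
        then obtain w where w: "x \<triangleleft>\<^bsub>J0\<^esub> a = i w" "w \<in> carrier M" by (rule imageE)
        have "x \<triangleleft>\<^bsub>J0\<^esub> (a \<otimes>\<^bsub>A\<^esub> b) = i (w \<triangleleft>\<^bsub>M\<^esub> b)"
          using J0.ract_mult[OF x(2) I_subset[OF ab(1)] I_subset[OF ab(2)]] rmod_homD(3)[OF i(1) w(2) I_subset[OF ab(2)]] w(1) by simp
        then show "x \<triangleleft>\<^bsub>J0\<^esub> (a \<otimes>\<^bsub>A\<^esub> b) \<in> {\<zero>\<^bsub>J0\<^esub>}"
          using killedD[OF kM w(2) ab(2)] rmod_hom_zero[OF m(3) m(1) i(1)] by simp
      qed
      then have "x \<in> ann J0" using x(2) by (simp add: ann_def)
      then show "y \<in> p ` ann J0" unfolding x(1) by (rule imageI)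
    qed
  qed
  moreover have "p x = \<zero>\<^bsub>J1\<^esub> \<longleftrightarrow> x \<in> i ` carrier M" if "x \<in> ann J0" for x using e[OF annD(1)[OF that]] .
  moreover note a0 = agree_ann_sub[OF O(1)] and a1 = agree_ann_sub[OF O(2)]
  ultimately show ?thesis
    unfolding B.id1_iff using X ann_sub_injective[OF J(1)] ann_sub_injective[OF J(2)] i' i(2) p'
    unfolding agree_hom[OF a0 a1] agree_hom[OF ag a0] agreeD(1,2)[OF a0, symmetric] agreeD(1,2)[OF a1, symmetric] agreeD(1,2)[OF ag] ann_sub_simps
    by (intro conjI exI[of _ "ext (ann_sub J0)"] exI[of _ i] exI[of _ "ext (ann_sub J1)"] exI[of _ p]) (simp_all add: agreeD(1,2)[OF a0, symmetric] agreeD(1,2)[OF a1, symmetric])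
qed

lemma left_descends: assumes X: "X \<in> ind B" and r: "res X \<in> C.left" shows "X \<in> B.C.left"
  unfolding B.C.left_def
proof (intro CollectI conjI allI impI)
  show iX: "B.C.indec X" using X B.ind_iff by simp
  fix W s assume p: "(W, X) \<in> B.C.step ^^ s"
  have W: "W \<in> fgmod B" using B.C.indecD(1)[OF B.C.step_relpow_indec'[OF p iX]] .
  have "C.pd1 (res W)" using r relpow_step_res[OF p] unfolding C.left_def by blast
  then show "B.C.pd1 W" by (rule pd1_descends[OF agree_res W])
qed

lemma right_descends: assumes X: "X \<in> ind B" and r: "res X \<in> C.right" shows "X \<in> B.C.right"
  unfolding B.C.right_def
proof (intro CollectI conjI allI impI)
  show iX: "B.C.indec X" using X B.ind_iff by simp
  fix W s assume p: "(X, W) \<in> B.C.step ^^ s"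
  have W: "W \<in> fgmod B" using B.C.indecD(1)[OF B.C.step_relpow_indec[OF p iX]] .
  have "C.id1 (res W)" using r relpow_step_res[OF p] unfolding C.right_def by blast
  then show "B.C.id1 W" by (rule id1_descends[OF agree_res W])
qed

text \<open>
  Each class over \<open>B\<close> is the trace on \<open>ind B\<close> of the class over \<open>A\<close>, since isomorphisms are the same.
\<close>

lemma cofinite_descends:
  assumes S: "cofinite_in_ind A S" and ST: "\<And>X. X \<in> ind B \<Longrightarrow> res X \<in> S \<Longrightarrow> X \<in> T"
  shows "cofinite_in_ind B T"
proof -
  define G where "G D = {Y \<in> ind B. res Y \<in> D}" for D
  have "(ind B - T) // iso_rel B \<subseteq> G ` ((ind A - S) // iso_rel A)"
  proof
    fix D assume "D \<in> (ind B - T) // iso_rel B"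
    then obtain X where X: "X \<in> ind B" "X \<notin> T" "D = iso_rel B `` {X}" by (auto simp: quotient_def)
    have rX: "res X \<in> ind A - S" using X ST agree_ind[OF agree_res] by blast
    have "D = G (iso_rel A `` {res X})"
      unfolding X(3) G_def iso_rel_def agree_ind[OF agree_res] using X(1) agree_iso[OF agree_res agree_res]
      by (auto simp: agree_ind[OF agree_res])
    then show "D \<in> G ` ((ind A - S) // iso_rel A)" using quotientI[OF rX] by (rule image_eqI)
  qed
  then show ?thesis using S finite_surj unfolding cofinite_in_ind_def by blast
qed

lemma laura_descends: assumes "laura A" shows "laura B"
proof -
  have "X \<in> L_part B \<union> R_part B" if "X \<in> ind B" "res X \<in> L_part A \<union> R_part A" for X
    using that left_descends right_descends unfolding L_part_eq R_part_eq B.L_part_eq B.R_part_eq by blast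
  then show ?thesis using assms cofinite_descends unfolding laura_def by blast
qed

lemma right_glued_descends: assumes "right_glued A" shows "right_glued B"
  using assms cofinite_descends left_descends unfolding right_glued_def L_part_eq B.L_part_eq by blast

lemma left_glued_descends: assumes "left_glued A" shows "left_glued B"
  using assms cofinite_descends right_descends unfolding left_glued_def R_part_eq B.R_part_eq by blast

lemma shod_descends: assumes "shod A" shows "shod B"
  unfolding shod_def
proof
  fix X assume X: "X \<in> ind B"
  then have XO: "X \<in> fgmod B" by (simp add: ind_def)
  have "res X \<in> ind A" using X agree_ind[OF agree_res] by blast
  then have "C.pd1 (res X) \<or> C.id1 (res X)"
    using assms pd_le_1_iff[OF res_fgmod[OF XO]] inj_dim_le_1_iff[OF res_fgmod[OF XO]] unfolding shod_def by blast
  then show "pd B X \<le> 1 \<or> inj_dim B X \<le> 1"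
    using pd1_descends[OF agree_res XO] id1_descends[OF agree_res XO] B.pd_le_1_iff[OF XO] B.inj_dim_le_1_iff[OF XO] by blast
qed

text \<open>
  If \<open>b\<close> bounds the paths over \<open>A\<close> and \<open>n\<close> the rank of the Grothendieck group of \<open>B\<close>, then \<open>2 n + b\<close> bounds the
  paths over \<open>B\<close>: beyond the first \<open>n\<close> arrows a path has left the left part, before the last \<open>n\<close> arrows it is
  not yet in the right part, and the piece between extends over \<open>A\<close> to a path from an injective to a projective
  module.
\<close>

lemma weakly_shod_descends: assumes "weakly_shod A" shows "weakly_shod B"
proof -
  obtain b where b: "\<And>J Q s. J \<in> ind A \<Longrightarrow> Q \<in> ind A \<Longrightarrow> injective A J \<Longrightarrow> projective A Q \<Longrightarrow> (J, Q) \<in> C.step ^^ s \<Longrightarrow> s \<le> b"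
    using assms unfolding weakly_shod_def ind_path_iff by blast
  obtain n where n: "B.C.rank_le n" using B.rank_finite by blast
  have "s \<le> n + b + n"
    if J: "J \<in> ind B" "injective B J" and Q: "Q \<in> ind B" "projective B Q" and p: "(J, Q) \<in> B.C.step ^^ s" for J Q s
  proof (cases "n + n \<le> s")
    case True
    then have "s = n + ((s - n - n) + n)" by simp
    then have "(J, Q) \<in> B.C.step ^^ n O (B.C.step ^^ (s - n - n) O B.C.step ^^ n)" using p relpow_add by metis
    then obtain X Y where X: "(J, X) \<in> B.C.step ^^ n" and XY: "(X, Y) \<in> B.C.step ^^ (s - n - n)" and Y: "(Y, Q) \<in> B.C.step ^^ n"
      by blast
    have X': "X \<in> ind B" and Y': "Y \<in> ind B"
      using B.C.step_relpow_indec[OF X] B.C.step_relpow_indec'[OF Y] J(1) Q(1) unfolding B.ind_iff by auto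
    have "X \<notin> B.C.left" using B.C.left_part_path_bound[OF n _ X] J(2) B.injective_iff by blast
    then have "C.indec (res X)" "res X \<notin> C.left"
      using left_descends[OF X'] X' agree_ind[OF agree_res] ind_iff by blast+
    then obtain J' r where J': "C.indec J'" "C.injective J'" "(J', res X) \<in> C.step ^^ r"
      using C.not_left_path_from_injective by blast
    have "Y \<notin> B.C.right" using B.C.right_part_path_bound[OF n _ Y] Q(2) B.projective_iff by blast
    then have "C.indec (res Y)" "res Y \<notin> C.right"
      using right_descends[OF Y'] Y' agree_ind[OF agree_res] ind_iff by blast+
    then obtain Q' t where Q': "C.indec Q'" "C.projective Q'" "(res Y, Q') \<in> C.step ^^ t"
      using C.not_right_path_to_projective by blast
    have "(J', Q') \<in> C.step ^^ (r + ((s - n - n) + t))"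
      unfolding relpow_add using J'(3) relpow_step_res[OF XY] Q'(3) by blast
    then have "r + ((s - n - n) + t) \<le> b"
      using b J'(1,2) Q'(1,2) unfolding ind_iff projective_iff injective_iff by blast
    then show ?thesis by simp
  qed simp
  then show ?thesis unfolding weakly_shod_def B.ind_path_iff by blast
qed

end

theorem theorem1p3:
  fixes K :: "'k ring" and A :: "('k, 'a) module" and e :: 'a
  assumes "fd_algebra K A"
    and "e \<in> carrier A" and "e \<otimes>\<^bsub>A\<^esub> e = e"
  shows "(laura A \<longrightarrow> laura (quot_algebra A (AeA A e))) \<and>
    ((right_glued A \<longrightarrow> right_glued (quot_algebra A (AeA A e))) \<and>
     (left_glued A \<longrightarrow> left_glued (quot_algebra A (AeA A e)))) \<and>
    (weakly_shod A \<longrightarrow> weakly_shod (quot_algebra A (AeA A e))) \<and>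
    (shod A \<longrightarrow> shod (quot_algebra A (AeA A e)))"
proof -
  interpret idempotent_quotient K A e
    using assms by (intro idempotent_quotient.intro fd_alg.intro idempotent_quotient_axioms.intro)
  show ?thesis
    using laura_descends right_glued_descends left_glued_descends weakly_shod_descends shod_descends by blast
qed

end
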